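(* \textsc{Max-Min Fair Matching} and \textsc{MoV Fair Matching}, each with arbitrary size constraints, can be solved in $O^{\star}((|C|\cdot k)^{O(|C|\cdot k)})$ time, where $k=|V|$ and $C$ is the set of colors.
   Context: Let $G=(U\cup V,E)$ be a bipartite graph with left side $U$ and right side $V$ ($U\cap V=\emptyset$); $k=|V|$. For a vertex $w$ and $M\subseteq E$, let $M(w)=\{w' \mid \{w,w'\}\in M\}$. A many-to-one matching is a set $M\subseteq E$ with $|M(u)|\le 1$ for every $u\in U$; it is left-perfect if $|M(u)|=1$ for every $u\in U$. Let $C$ be a finite set of colors and $\mathrm{col}\colon U\to C$; for $U'\subseteq U$ and $c\in C$ let $U'_c=\{u\in U'\mid \mathrm{col}(u)=c\}$. Define $\mathrm{MaxMin}(U')=\max_{c\in C}|U'_c|-\min_{c\in C}|U'_c|$, and $\mathrm{MoV}(U')$ as the largest value minus the second largest value in the list $(|U'_c|)_{c\in C}$ (counted with multiplicity; absent colors count $0$). For $\Pi\in\{\mathrm{MaxMin},\mathrm{MoV}\}$ and integer $\ell\ge 0$, $U'$ is $\ell$-fair if $\Pi(U')\le\ell$, and $M$ is $\ell$-fair if $M(v)$ is $\ell$-fair for every $v\in V$. \textsc{$\Pi$ Fair Matching} with size constraints: given $G$, $C$, $\mathrm{col}$, $\ell\in\mathbb{N}$ and integers $p,q$, decide whether there is a left-perfect many-to-one matching $M$ in $G$ that is $\ell$-fair with respect to $\Pi$ and satisfies $p\le|M(v)|\le q$ for every $v\in V$. The notation $O^{\star}(\cdot)$ suppresses factors polynomial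 in the input size. *)

theory Defs
  imports Complex_Main "HOL-Library.Multiset" "HOL-Library.Log_Nat"
    "HOL-Computational_Algebra.Polynomial"
begin

section \<open>Fair matchings\<close>

type_synonym 'v edge = "'v set"

definition bipartite :: "'v set \<Rightarrow> 'v set \<Rightarrow> 'v edge set \<Rightarrow> bool" where
  "bipartite U V E \<longleftrightarrow> finite U \<and> finite V \<and> U \<inter> V = {} \<and> E \<subseteq> {{u, v} | u v. u \<in> U \<and> v \<in> V}"

definition nbs :: "'v edge set \<Rightarrow> 'v \<Rightarrow> 'v set" where
  "nbs M w = {w'. {w, w'} \<in> M}"

definition many_to_one_matching :: "'v set \<Rightarrow> 'v edge set \<Rightarrow> 'v edge set \<Rightarrow> bool" where
  "many_to_one_matching U E M \<longleftrightarrow> M \<subseteq> E \<and> (\<forall>u\<in>U. card (nbs M u) \<le> 1)"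

definition left_perfect :: "'v set \<Rightarrow> 'v edge set \<Rightarrow> bool" where
  "left_perfect U M \<longleftrightarrow> (\<forall>u\<in>U. card (nbs M u) = 1)"

definition color_class :: "('v \<Rightarrow> 'c) \<Rightarrow> 'v set \<Rightarrow> 'c \<Rightarrow> 'v set" where
  "color_class col U' c = {u \<in> U'. col u = c}"

text \<open>A fairness measure maps the coloring, the color set and a vertex set to a number.\<close>

type_synonym ('v, 'c) fairness_measure = "('v \<Rightarrow> 'c) \<Rightarrow> 'c set \<Rightarrow> 'v set \<Rightarrow> nat"

text \<open>The empty color set, for which maximum and minimum do not exist, is given the value 0.
  It can only occur together with an empty left side.\<close>

definition MaxMin :: "('v, 'c) fairness_measure" where
  "MaxMin col C U' =
     (if C = {} then 0
      else (MAX c\<in>C. card (color_class col U' c)) - (MIN c\<in>C. card (color_class col U' c)))"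

text \<open>The list of color counts is sorted in descending order, with multiplicity. An entry that does
  not exist because there are fewer than two colors counts as 0, like that of an absent color.\<close>

definition MoV :: "('v, 'c) fairness_measure" where
  "MoV col C U' =
     (case rev (sorted_list_of_multiset
                 (image_mset (\<lambda>c. card (color_class col U' c)) (mset_set C))) of
        [] \<Rightarrow> 0
      | [x] \<Rightarrow> x
      | x # y # _ \<Rightarrow> x - y)"

record ('v, 'c) fm_instance =
  left :: "'v set"
  right :: "'v set"
  edges :: "'v edge set"
  colors :: "'c set"
  col :: "'v \<Rightarrow> 'c"
  fairness :: nat
  lower :: int
  upper :: int

definition fm_wf :: "('v, 'c) fm_instance \<Rightarrow> bool" where
  "fm_wf I \<longleftrightarrow> bipartite (left I) (right I) (edges I) \<and> finite (colors I) \<and>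
     col I ` left I \<subseteq> colors I"

definition fair_matching ::
  "('v, 'c) fairness_measure \<Rightarrow> ('v, 'c) fm_instance \<Rightarrow> 'v edge set \<Rightarrow> bool" where
  "fair_matching \<Pi> I M \<longleftrightarrow> (\<forall>v\<in>right I. \<Pi> (col I) (colors I) (nbs M v) \<le> fairness I)"

definition Fair_Matching :: "('v, 'c) fairness_measure \<Rightarrow> ('v, 'c) fm_instance \<Rightarrow> bool" where
  "Fair_Matching \<Pi> I \<longleftrightarrow>
     (\<exists>M. many_to_one_matching (left I) (edges I) M \<and> left_perfect (left I) M \<and>
          fair_matching \<Pi> I M \<and>
          (\<forall>v\<in>right I. lower I \<le> int (card (nbs M v)) \<and> int (card (nbs M v)) \<le> upper I))"


section \<open>Random access machines\<close>

text \<open>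
  A RAM with integer registers and a read-only input, in which each instruction takes one step.
  There is no multiplication, so a step lengthens the longest number stored by at most one bit
  (apart from the numbers read from the input or from the program); hence this unit-cost measure is
  polynomially related to the running time of Turing machines. The size of an input is
  the number of bits needed to write it down, not the number of integers in it.
\<close>

datatype instr =
    Const nat int
  | Read nat nat
  | Load nat nat
  | Store nat nat
  | Add nat nat nat
  | Sub nat nat nat
  | Half nat nat
  | Jump nat
  | JPos nat nat

type_synonym config = "nat \<times> (nat \<Rightarrow> int)"

text \<open>Negative addresses are read as 0, and reading beyond the end of the input yields 0.\<close>

fun exec :: "int list \<Rightarrow> instr \<Rightarrow> config \<Rightarrow> config" where
  "exec w (Const i z) (pc, R) = (Suc pc, R(i := z))"
| "exec w (Read i j) (pc, R) =
     (Suc pc, R(i := (if nat (R j) < length w then w ! nat (R j) else 0)))"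
| "exec w (Load i j) (pc, R) = (Suc pc, R(i := R (nat (R j))))"
| "exec w (Store i j) (pc, R) = (Suc pc, R(nat (R i) := R j))"
| "exec w (Add i j k) (pc, R) = (Suc pc, R(i := R j + R k))"
| "exec w (Sub i j k) (pc, R) = (Suc pc, R(i := R j - R k))"
| "exec w (Half i j) (pc, R) = (Suc pc, R(i := R j div 2))"
| "exec w (Jump l) (pc, R) = (l, R)"
| "exec w (JPos i l) (pc, R) = (if R i > 0 then l else Suc pc, R)"

text \<open>A program halts when the program counter leaves it.\<close>

definition halted :: "instr list \<Rightarrow> config \<Rightarrow> bool" where
  "halted P s \<longleftrightarrow> length P \<le> fst s"

definition step :: "instr list \<Rightarrow> int list \<Rightarrow> config \<Rightarrow> config" where
  "step P w s = (if halted P s then s else exec w (P ! fst s) s)"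

definition run :: "instr list \<Rightarrow> int list \<Rightarrow> nat \<Rightarrow> config" where
  "run P w t = (step P w ^^ t) (0, \<lambda>_. 0)"

text \<open>The answer is found in register 0. Since a halted configuration is never left,
  it is immaterial that \<open>t\<close> need not be the first time at which the program has halted.\<close>

definition answers_within :: "instr list \<Rightarrow> int list \<Rightarrow> nat \<Rightarrow> bool \<Rightarrow> bool" where
  "answers_within P w T b \<longleftrightarrow>
     (\<exists>t\<le>T. halted P (run P w t) \<and> snd (run P w t) 0 = (if b then 1 else 0))"

definition bits :: "int \<Rightarrow> nat" where
  "bits z = Suc (floorlog 2 (nat \<bar>z\<bar>))"

definition input_size :: "int list \<Rightarrow> nat" where
  "input_size w = (\<Sum>z\<leftarrow>w. bits z)"


section \<open>Instances as inputs\<close>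

text \<open>For computations, vertices and colors are named by natural numbers. The vertices, edges and
  colors are listed in any order; every list is preceded by its length.\<close>

definition represents :: "int list \<Rightarrow> (nat, nat) fm_instance \<Rightarrow> bool" where
  "represents w I \<longleftrightarrow>
     (\<exists>us vs es cs.
        distinct us \<and> set us = left I \<and>
        distinct vs \<and> set vs = right I \<and>
        distinct es \<and> set es \<subseteq> left I \<times> right I \<and> edges I = (\<lambda>(u, v). {u, v}) ` set es \<and>
        distinct cs \<and> set cs = colors I \<and>
        w = [int (length us)] @ concat (map (\<lambda>u. [int u, int (col I u)]) us) @
            [int (length vs)] @ map int vs @
            [int (length es)] @ concat (map (\<lambda>(u, v). [int u, int v]) es) @
            [int (length cs)] @ map int cs @
            [int (fairness I), lower I, upper I])"

definition solves_within ::
  "instr list \<Rightarrow> ((nat, nat) fm_instance \<Rightarrow> bool) \<Rightarrow>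
   ((nat, nat) fm_instance \<Rightarrow> nat \<Rightarrow> nat) \<Rightarrow> bool" where
  "solves_within P Q T \<longleftrightarrow>
     (\<forall>I w. fm_wf I \<longrightarrow> represents w I \<longrightarrow> answers_within P w (T I (input_size w)) (Q I))"

text \<open>
  \<open>O\<^sup>\<star>(\<kappa> ^ O(\<kappa>))\<close> for a parameter \<open>\<kappa>\<close> of instances: the constant \<open>a\<close> is the one hidden by
  the inner \<open>O\<close>, and the polynomial \<open>f\<close> in the input size is the factor
  suppressed by \<open>O\<^sup>\<star>\<close>. If \<open>\<kappa> = 0\<close>, then \<open>\<kappa> ^ (a * \<kappa>) = 1\<close>.
\<close>

definition solvable_in_Ostar_self_power ::
  "((nat, nat) fm_instance \<Rightarrow> bool) \<Rightarrow> ((nat, nat) fm_instance \<Rightarrow> nat) \<Rightarrow> bool" where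
  "solvable_in_Ostar_self_power Q \<kappa> \<longleftrightarrow>
     (\<exists>P (a :: nat) (f :: nat poly). solves_within P Q (\<lambda>I N. \<kappa> I ^ (a * \<kappa> I) * poly f N))"

end

theory Submission
  imports Defs
begin

text \<open>
  Counting the partners of every right vertex by color turns a fair matching into an integer vector
  \<open>x\<close> indexed by \<open>right \<times> colors\<close>. By Hall's theorem \<open>x\<close> is realizable iff it sums up to \<open>|U|\<close> and
  \<open>x(S) \<ge> g(S)\<close> for all sets \<open>S\<close> of indices, where \<open>g(S)\<close> counts the left vertices that can only go
  to \<open>S\<close>; and fairness at \<open>v\<close> means that all counts are at most \<open>m + \<ell>\<close> for some \<open>m \<ge> 0\<close> such that
  \<open>m = 0\<close> or at least \<open>|C|\<close> (for \<open>MaxMin\<close>) or 2 (for \<open>MoV\<close>) of the counts are at least \<open>m\<close>.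

  Instead of an integer programming algorithm, the solution is searched digit by digit, from the
  most significant binary digits of \<open>x\<close> and \<open>m\<close> to the least significant ones. If \<open>D\<close> is the weight of
  the last digit fixed so far, then the digits to come change the slack of a constraint by less than
  \<open>(n + 1) D\<close>; so two prefixes whose slacks agree after clipping at this value are
  interchangeable, and prefixes that are too far from feasibility can be dropped. The number of
  prefixes kept is \<open>\<kappa>\<^bsup>O(\<kappa>)\<^esup>\<close>: there are only \<open>O(\<kappa>)\<close> constraints besides those of Hall, and as \<open>g\<close> is
  supermodular, the sets \<open>S\<close> whose slack is not clipped generate a lattice of sets of small slack,
  so that all these slacks are determined by the values on one maximal chain.

  All loops of the program run at most \<open>\<kappa>\<^bsup>O(\<kappa>)\<^esup> \<cdot> N\<close> times, hence its running time is bounded by a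
  constant power of this number.
\<close>

section \<open>A structured language and its compiler\<close>

text \<open>The obstacle is the number of Hall constraints, which is exponential in the number of
  indices: bounding the clipped slacks row by row would give a doubly exponential count. The count
  is saved by two bounds for a prefix that is not dropped: every Hall slack is at least -K, and
  since the total may not exceed |U|, the slack of the full index set is at most K. In the
  submodular inequality for two sets, the lower bound takes care of the union or of the
  intersection, so the other one remains small; as each set of the lattice is obtained in
  polynomially many such operations, its slack is a polynomial multiple of K. Since a prefix
  consists of multiples of D and K is (n + 1) D, a value on the chain, measured relative to g, has
  only polynomially many possibilities, no matter how long the numbers are.

  The alternative in the fairness condition is not linear, but it depends only on the signs of
  linear forms. These forms are carried along in the signatures without being required to be
  nonnegative, and they are evaluated after the last digit.\<close>

datatype aexp = Lit int | Var nat | Ar nat aexp | In aexp | Plus aexp aexp | Minus aexp aexp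
  | Hlf aexp | Pos aexp

datatype com = Skip | Assign nat aexp | AStore nat aexp aexp | Seq com com
  | IfPos aexp com com | For nat aexp com

type_synonym mem = "(nat \<Rightarrow> int) \<times> (nat \<Rightarrow> nat \<Rightarrow> int)"

definition setv :: "nat \<Rightarrow> int \<Rightarrow> mem \<Rightarrow> mem" where
  "setv x z s = ((fst s)(x := z), snd s)"

definition seta :: "nat \<Rightarrow> nat \<Rightarrow> int \<Rightarrow> mem \<Rightarrow> mem" where
  "seta a i z s = (fst s, (snd s)(a := (snd s a)(i := z)))"

definition incv :: "nat \<Rightarrow> mem \<Rightarrow> mem" where
  "incv x s = setv x (fst s x + 1) s"

fun aval :: "int list \<Rightarrow> aexp \<Rightarrow> mem \<Rightarrow> int" where
  "aval w (Lit z) s = z"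
| "aval w (Var x) s = fst s x"
| "aval w (Ar a e) s = snd s a (nat (aval w e s))"
| "aval w (In e) s = (let i = nat (aval w e s) in if i < length w then w ! i else 0)"
| "aval w (Plus e1 e2) s = aval w e1 s + aval w e2 s"
| "aval w (Minus e1 e2) s = aval w e1 s - aval w e2 s"
| "aval w (Hlf e) s = aval w e s div 2"
| "aval w (Pos e) s = (if aval w e s > 0 then 1 else 0)"

text \<open>A \<open>For\<close> loop evaluates its bound once and then runs that many times. So
  every program terminates, and \<open>sem\<close> is a total function by structural
  recursion.\<close>

primrec sem :: "int list \<Rightarrow> com \<Rightarrow> mem \<Rightarrow> mem" where
  "sem w Skip s = s"
| "sem w (Assign x e) s = setv x (aval w e s) s"
| "sem w (AStore a e1 e2) s = seta a (nat (aval w e1 s)) (aval w e2 s) s"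
| "sem w (Seq c1 c2) s = sem w c2 (sem w c1 s)"
| "sem w (IfPos e c1 c2) s = (if aval w e s > 0 then sem w c1 s else sem w c2 s)"
| "sem w (For x e c) s = ((\<lambda>s. incv x (sem w c s)) ^^ nat (aval w e s)) (setv x 0 s)"

text \<open>Code length and step count at once: the code of an expression jumps only forwards, so it
  is left after at most \<open>asz e\<close> steps.\<close>

primrec asz :: "aexp \<Rightarrow> nat" where
  "asz (Lit z) = 1"
| "asz (Var x) = 1"
| "asz (Ar a e) = asz e + 8"
| "asz (In e) = asz e + 1"
| "asz (Plus e1 e2) = asz e1 + asz e2 + 1"
| "asz (Minus e1 e2) = asz e1 + asz e2 + 1"
| "asz (Hlf e) = asz e + 1"
| "asz (Pos e) = asz e + 4"

text \<open>An upper bound on the steps of the compiled code. An iteration of \<open>For\<close>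
  costs 5 steps besides its body: one test and four instructions that update the counters and jump
  back. Entering and leaving the loop costs 4.\<close>

primrec tm :: "int list \<Rightarrow> com \<Rightarrow> mem \<Rightarrow> nat" where
  "tm w Skip s = 0"
| "tm w (Assign x e) s = asz e + 1"
| "tm w (AStore a e1 e2) s = asz e1 + asz e2 + 8"
| "tm w (Seq c1 c2) s = tm w c1 s + tm w c2 (sem w c1 s)"
| "tm w (IfPos e c1 c2) s = asz e + 2 + (if aval w e s > 0 then tm w c1 s else tm w c2 s)"
| "tm w (For x e c) s = asz e + 4 +
     (\<Sum>i<nat (aval w e s). tm w c (((\<lambda>s. incv x (sem w c s)) ^^ i) (setv x 0 s)) + 5)"

text \<open>Register layout of the compiled code: variables live below 64, temporaries in 64--95, loop
  counters in 96--126, a constant 0 in 127, and entry \<open>i\<close> of array \<open>a < 8\<close> in \<open>128 + a + 8 * i\<close>.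
  The jump over \<open>Const t 0\<close> replaces negative array indices by 0, in accordance with \<open>nat\<close>.\<close>

definition addr_code :: "nat \<Rightarrow> nat \<Rightarrow> nat \<Rightarrow> instr list" where
  "addr_code q t a = [JPos t (q + 2), Const t 0, Add t t t, Add t t t, Add t t t,
     Const (Suc t) (128 + int a), Add t t (Suc t)]"

text \<open>Jump targets are absolute, hence the parameter \<open>pc\<close>. Only the registers
  from \<open>t\<close> on are scratch, so a first operand survives the evaluation of the second.
  Adding register 127, which stays 0, serves as a move.\<close>

primrec ce :: "nat \<Rightarrow> nat \<Rightarrow> aexp \<Rightarrow> instr list" where
  "ce pc t (Lit z) = [Const t z]"
| "ce pc t (Var x) = [Add t x 127]"
| "ce pc t (Ar a e) = ce pc t e @ addr_code (pc + asz e) t a @ [Load t t]"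
| "ce pc t (In e) = ce pc t e @ [Read t t]"
| "ce pc t (Plus e1 e2) = ce pc t e1 @ ce (pc + asz e1) (Suc t) e2 @ [Add t t (Suc t)]"
| "ce pc t (Minus e1 e2) = ce pc t e1 @ ce (pc + asz e1) (Suc t) e2 @ [Sub t t (Suc t)]"
| "ce pc t (Hlf e) = ce pc t e @ [Half t t]"
| "ce pc t (Pos e) = ce pc t e @ (let q = pc + asz e in
     [JPos t (q + 3), Const t 0, Jump (q + 4), Const t 1])"

primrec csz :: "com \<Rightarrow> nat" where
  "csz Skip = 0"
| "csz (Assign x e) = asz e + 1"
| "csz (AStore a e1 e2) = asz e1 + asz e2 + 8"
| "csz (Seq c1 c2) = csz c1 + csz c2"
| "csz (IfPos e c1 c2) = asz e + csz c1 + csz c2 + 2"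
| "csz (For x e c) = asz e + csz c + 8"

text \<open>Register \<open>h\<close> holds the number of iterations left; it is separate from the
  program variable \<open>x\<close>, which counts upwards, and inner loops use higher registers. The
  else branch comes first because \<open>JPos\<close> jumps in the positive case.\<close>

primrec cc :: "nat \<Rightarrow> nat \<Rightarrow> com \<Rightarrow> instr list" where
  "cc pc h Skip = []"
| "cc pc h (Assign x e) = ce pc 64 e @ [Add x 64 127]"
| "cc pc h (AStore a e1 e2) = ce pc 64 e1 @ addr_code (pc + asz e1) 64 a @
     ce (pc + asz e1 + 7) 65 e2 @ [Store 64 65]"
| "cc pc h (Seq c1 c2) = cc pc h c1 @ cc (pc + csz c1) h c2"
| "cc pc h (IfPos e c1 c2) = (let q = pc + asz e in
     ce pc 64 e @ [JPos 64 (q + 2 + csz c2)] @ cc (q + 1) h c2 @ [Jump (q + 2 + csz c2 + csz c1)] @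
     cc (q + 2 + csz c2) h c1)"
| "cc pc h (For x e c) = (let q = pc + asz e in
     ce pc 64 e @ [Add h 64 127, Const x 0, JPos h (q + 4), Jump (q + 8 + csz c)] @
     cc (q + 4) (Suc h) c @ [Const 64 1, Add x x 64, Sub h h 64, Jump (q + 2)])"

lemma length_addr_code [simp]: "length (addr_code q t a) = 7"
  by (simp add: addr_code_def)

lemma length_ce [simp]: "length (ce pc t e) = asz e"
  by (induction e arbitrary: pc t) (auto simp: Let_def)

lemma length_cc [simp]: "length (cc pc h c) = csz c"
  by (induction c arbitrary: pc h) (auto simp: Let_def)

primrec wfe :: "nat \<Rightarrow> aexp \<Rightarrow> bool" where
  "wfe t (Lit z) = (64 \<le> t \<and> t < 95)"
| "wfe t (Var x) = (64 \<le> t \<and> t < 95 \<and> x < 64)"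
| "wfe t (Ar a e) = (wfe t e \<and> a < 8)"
| "wfe t (In e) = wfe t e"
| "wfe t (Plus e1 e2) = (wfe t e1 \<and> wfe (Suc t) e2)"
| "wfe t (Minus e1 e2) = (wfe t e1 \<and> wfe (Suc t) e2)"
| "wfe t (Hlf e) = wfe t e"
| "wfe t (Pos e) = wfe t e"

primrec wfc :: "nat \<Rightarrow> com \<Rightarrow> bool" where
  "wfc h Skip = True"
| "wfc h (Assign x e) = (x < 64 \<and> wfe 64 e)"
| "wfc h (AStore a e1 e2) = (a < 8 \<and> wfe 64 e1 \<and> wfe 65 e2)"
| "wfc h (Seq c1 c2) = (wfc h c1 \<and> wfc h c2)"
| "wfc h (IfPos e c1 c2) = (wfe 64 e \<and> wfc h c1 \<and> wfc h c2)"
| "wfc h (For x e c) = (x < 64 \<and> wfe 64 e \<and> 96 \<le> h \<and> h < 127 \<and> wfc (Suc h) c)"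

section \<open>Simulation of the structured semantics by the compiled code\<close>

lemma wfe_bounds: "wfe t e \<Longrightarrow> 64 \<le> t \<and> t < 95"
  by (induction e arbitrary: t) auto

definition code_at :: "instr list \<Rightarrow> nat \<Rightarrow> instr list \<Rightarrow> bool" where
  "code_at P pc c \<longleftrightarrow> (\<exists>xs ys. P = xs @ c @ ys \<and> length xs = pc)"

lemma code_at_append: "code_at P pc (c1 @ c2) \<Longrightarrow> code_at P pc c1 \<and> code_at P (pc + length c1) c2"
  unfolding code_at_def by (metis append.assoc length_append)

lemma code_at_nth: "code_at P pc c \<Longrightarrow> i < length c \<Longrightarrow> pc + i < length P \<and> P ! (pc + i) = c ! i"
  unfolding code_at_def by (auto simp: nth_append)

lemma code_at_Cons: "code_at P pc (i # c) \<Longrightarrow>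
    (pc < length P \<and> P ! pc = i) \<and> code_at P (Suc pc) c"
  using code_at_append[of P pc "[i]" c] code_at_nth[of P pc "i # c" 0] by simp

definition reach :: "instr list \<Rightarrow> int list \<Rightarrow> nat \<Rightarrow> config \<Rightarrow> config \<Rightarrow> bool" where
  "reach P w T s s' \<longleftrightarrow> (\<exists>t\<le>T. (step P w ^^ t) s = s')"

lemma reach_refl: "reach P w T s s"
  unfolding reach_def by (rule exI[of _ 0]) auto

lemma reach_trans: "reach P w T1 s1 s2 \<Longrightarrow> reach P w T2 s2 s3 \<Longrightarrow> reach P w (T1 + T2) s1 s3"
proof -
  assume "reach P w T1 s1 s2" "reach P w T2 s2 s3"
  then obtain t1 t2 where "t1 \<le> T1" "(step P w ^^ t1) s1 = s2" "t2 \<le> T2" "(step P w ^^ t2) s2 = s3"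
    unfolding reach_def by blast
  thus ?thesis unfolding reach_def
    by (intro exI[of _ "t2 + t1"]) (simp add: funpow_add)
qed

lemma reach_mono: "reach P w T s s' \<Longrightarrow> T \<le> T' \<Longrightarrow> reach P w T' s s'"
  unfolding reach_def using order_trans by blast

lemma reach_step:
  assumes "pc < length P \<and> P ! pc = i" "reach P w T (exec w i (pc, R)) s"
  shows "reach P w (Suc T) (pc, R) s"
proof -
  have "step P w (pc, R) = exec w i (pc, R)"
    using assms(1) by (simp add: step_def halted_def)
  hence "reach P w 1 (pc, R) (exec w i (pc, R))"
    unfolding reach_def by (intro exI[of _ 1]) simp
  from reach_trans[OF this assms(2)] show ?thesis by simp
qed

lemma reach_1: "pc < length P \<and> P ! pc = i \<Longrightarrow> exec w i (pc, R) = s \<Longrightarrow> reach P w 1 (pc, R) s"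
  using reach_step[of pc P i w 0 R s] reach_refl[of P w 0 s] by simp

definition rel :: "mem \<Rightarrow> (nat \<Rightarrow> int) \<Rightarrow> bool" where
  "rel s R \<longleftrightarrow> (\<forall>x<64. R x = fst s x) \<and> (\<forall>a<8. \<forall>i. R (128 + a + 8 * i) = snd s a i) \<and> R 127 = 0"

definition same_regs :: "nat \<Rightarrow> (nat \<Rightarrow> int) \<Rightarrow> (nat \<Rightarrow> int) \<Rightarrow> bool" where
  "same_regs t R R' \<longleftrightarrow> (\<forall>r. r < t \<or> 96 \<le> r \<longrightarrow> R' r = R r)"

lemma rel_same: "rel s R \<Longrightarrow> same_regs t R R' \<Longrightarrow> 64 \<le> t \<Longrightarrow> rel s R'"
  unfolding rel_def same_regs_def by auto

lemma addr_code_correct: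
  assumes "code_at P q (addr_code q t a)" "64 \<le> t" "t < 95"
  shows "\<exists>R'. reach P w 7 (q, R) (q + 7, R') \<and> R' t = 128 + int a + 8 * int (nat (R t)) \<and>
           same_regs t R R'"
proof -
  have e: "i < 7 \<Longrightarrow> q + i < length P \<and> P ! (q + i) = addr_code q t a ! i" for i
    using code_at_nth[OF assms(1), of i] by simp
  have i0: "q < length P \<and> P ! q = JPos t (q + 2)"
    and i1: "Suc q < length P \<and> P ! Suc q = Const t 0"
    and i2: "Suc (Suc q) < length P \<and> P ! Suc (Suc q) = Add t t t"
    and i3: "Suc (Suc (Suc q)) < length P \<and> P ! Suc (Suc (Suc q)) = Add t t t"
    and i4: "Suc (Suc (Suc (Suc q))) < length P \<and> P ! Suc (Suc (Suc (Suc q))) = Add t t t"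
    and i5: "Suc (Suc (Suc (Suc (Suc q)))) < length P \<and> P ! Suc (Suc (Suc (Suc (Suc q)))) = Const (Suc t) (128 + int a)"
    and i6: "Suc (Suc (Suc (Suc (Suc (Suc q))))) < length P \<and> P ! Suc (Suc (Suc (Suc (Suc (Suc q))))) = Add t t (Suc t)"
    using e[of 0] e[of 1] e[of 2] e[of 3] e[of 4] e[of 5] e[of 6]
    by (simp_all add: addr_code_def eval_nat_numeral)
  define R1 where "R1 = R(t := int (nat (R t)))"
  have s1: "reach P w 2 (q, R) (q + 2, R1)"
  proof (cases "R t > 0")
    case True
    hence "R1 = R" by (simp add: R1_def)
    thus ?thesis using True by (intro reach_mono[OF reach_step[OF i0]]) (auto intro: reach_refl)
  next
    case False
    hence "R1 = R(t := 0)" by (simp add: R1_def)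
    hence "reach P w (Suc (Suc 0)) (q, R) (q + 2, R1)" using False
      by (intro reach_step[OF i0]) (auto intro!: reach_step[OF i1] reach_refl)
    thus ?thesis by (simp add: eval_nat_numeral)
  qed
  \<comment> \<open>Three doublings multiply the index by 8, as the machine has no
    multiplication.\<close>
  define R2 where "R2 = R1(t := 2 * R1 t)"
  define R3 where "R3 = R2(t := 2 * R2 t)"
  define R4 where "R4 = R3(t := 2 * R3 t)"
  define R5 where "R5 = R4(Suc t := 128 + int a)"
  define R6 where "R6 = R5(t := R5 t + R5 (Suc t))"
  have s2: "reach P w (Suc (Suc (Suc (Suc (Suc 0))))) (Suc (Suc q), R1) (q + 7, R6)"
    apply (rule reach_step[OF i2], simp)
    apply (rule reach_step[OF i3], simp)
    apply (rule reach_step[OF i4], simp)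
    apply (rule reach_step[OF i5], simp)
    apply (rule reach_step[OF i6], simp)
    apply (simp add: R6_def R5_def R4_def R3_def R2_def eval_nat_numeral reach_refl)
    done
  have "reach P w 7 (q, R) (q + 7, R6)"
    using reach_trans[OF s1, of 5 "(q + 7, R6)"] s2 by (simp add: eval_nat_numeral)
  moreover have "R6 t = 128 + int a + 8 * int (nat (R t))"
    by (simp add: R6_def R5_def R4_def R3_def R2_def R1_def)
  moreover have "same_regs t R R6" using assms
    by (auto simp: same_regs_def R6_def R5_def R4_def R3_def R2_def R1_def)
  ultimately show ?thesis by blast
qed

lemma ce_correct:
  assumes "code_at P pc (ce pc t e)" "wfe t e" "rel s R"
  shows "\<exists>R'. reach P w (asz e) (pc, R) (pc + asz e, R') \<and> R' t = aval w e s \<and> same_regs t R R'"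
  using assms
proof (induction e arbitrary: pc t R)
  case (Lit z)
  have "reach P w 1 (pc, R) (Suc pc, R(t := z))"
    using Lit code_at_Cons[of P pc "Const t z" "[]"] by (intro reach_1) auto
  with Lit show ?case
    by (intro exI[of _ "R(t := z)"]) (auto simp: same_regs_def fun_upd_def)
next
  case (Var x)
  have "R 127 = 0" "R x = fst s x" using Var by (auto simp: rel_def)
  hence "reach P w 1 (pc, R) (Suc pc, R(t := fst s x))"
    using Var code_at_Cons[of P pc "Add t x 127" "[]"] by (intro reach_1) auto
  with Var show ?case
    by (intro exI[of _ "R(t := fst s x)"]) (auto simp: same_regs_def fun_upd_def)
next
  case (Ar a e)
  have tb: "64 \<le> t" "t < 95" using wfe_bounds Ar.prems by auto
  from Ar.prems(1) have c1: "code_at P pc (ce pc t e)"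
    and c23: "code_at P (pc + asz e) (addr_code (pc + asz e) t a @ [Load t t])"
    by (auto dest: code_at_append)
  from code_at_append[OF c23] have c2: "code_at P (pc + asz e) (addr_code (pc + asz e) t a)"
    and c3: "code_at P (pc + asz e + 7) [Load t t]" by auto
  obtain R1 where R1: "reach P w (asz e) (pc, R) (pc + asz e, R1)" "R1 t = aval w e s" "same_regs t R R1"
    using Ar.IH[OF c1] Ar.prems by auto
  obtain R2 where R2: "reach P w 7 (pc + asz e, R1) (pc + asz e + 7, R2)"
     "R2 t = 128 + int a + 8 * int (nat (R1 t))" "same_regs t R1 R2"
    using addr_code_correct[OF c2 tb] by blast
  have rl: "rel s R2" using rel_same R1(3) R2(3) Ar.prems(3) tb by blast
  define v where "v = snd s a (nat (aval w e s))"
  have ad: "nat (R2 t) = 128 + a + 8 * nat (aval w e s)"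
    unfolding R2(2) R1(2) by linarith
  have "R2 (nat (R2 t)) = v" unfolding ad using rl Ar.prems(2) by (simp add: rel_def v_def)
  hence r3: "reach P w (Suc 0) (pc + asz e + 7, R2) (pc + asz e + 8, R2(t := v))"
    using code_at_Cons[OF c3] by (auto intro!: reach_step reach_refl simp: eval_nat_numeral)
  have "reach P w (asz e + 7 + Suc 0) (pc, R) (pc + asz e + 8, R2(t := v))"
    using reach_trans[OF reach_trans[OF R1(1) R2(1)] r3] .
  moreover have "same_regs t R (R2(t := v))" using R1(3) R2(3) tb by (auto simp: same_regs_def fun_upd_def)
  ultimately show ?case by (intro exI[of _ "R2(t := v)"]) (auto simp: v_def add_ac fun_upd_def)
next
  case (In e)
  have tb: "64 \<le> t" "t < 95" using wfe_bounds In.prems by auto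
  from In.prems(1) have c1: "code_at P pc (ce pc t e)" and c2: "code_at P (pc + asz e) [Read t t]"
    by (auto dest: code_at_append)
  obtain R1 where R1: "reach P w (asz e) (pc, R) (pc + asz e, R1)" "R1 t = aval w e s" "same_regs t R R1"
    using In.IH[OF c1] In.prems by auto
  have r2: "reach P w (Suc 0) (pc + asz e, R1) (pc + asz e + 1, R1(t := aval w (In e) s))"
    using code_at_Cons[OF c2] R1(2) by (auto intro!: reach_step reach_refl simp: Let_def)
  from reach_trans[OF R1(1) r2] R1(3) tb show ?case
    by (intro exI[of _ "R1(t := aval w (In e) s)"]) (auto simp: same_regs_def fun_upd_def)
next
  case (Plus e1 e2)
  have tb: "64 \<le> t" "t < 95" using wfe_bounds Plus.prems by auto
  from Plus.prems(1) have c1: "code_at P pc (ce pc t e1)"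
    and c23: "code_at P (pc + asz e1) (ce (pc + asz e1) (Suc t) e2 @ [Add t t (Suc t)])"
    by (auto dest: code_at_append)
  from code_at_append[OF c23] have c2: "code_at P (pc + asz e1) (ce (pc + asz e1) (Suc t) e2)"
    and c3: "code_at P (pc + asz e1 + asz e2) [Add t t (Suc t)]" by auto
  obtain R1 where R1: "reach P w (asz e1) (pc, R) (pc + asz e1, R1)" "R1 t = aval w e1 s" "same_regs t R R1"
    using Plus.IH(1)[OF c1] Plus.prems by auto
  have "rel s R1" using rel_same R1(3) Plus.prems(3) tb by blast
  then obtain R2 where R2: "reach P w (asz e2) (pc + asz e1, R1) (pc + asz e1 + asz e2, R2)"
    "R2 (Suc t) = aval w e2 s" "same_regs (Suc t) R1 R2"
    using Plus.IH(2)[OF c2] Plus.prems by auto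
  have "R2 t = aval w e1 s" using R2(3) R1(2) by (auto simp: same_regs_def fun_upd_def)
  hence r3: "reach P w (Suc 0) (pc + asz e1 + asz e2, R2)
      (pc + asz e1 + asz e2 + 1, R2(t := aval w (Plus e1 e2) s))"
    using code_at_Cons[OF c3] R2(2) by (auto intro!: reach_step reach_refl)
  from reach_trans[OF reach_trans[OF R1(1) R2(1)] r3] R1(3) R2(3) tb show ?case
    by (intro exI[of _ "R2(t := aval w (Plus e1 e2) s)"]) (auto simp: same_regs_def fun_upd_def add.assoc)
next
  case (Minus e1 e2)
  have tb: "64 \<le> t" "t < 95" using wfe_bounds Minus.prems by auto
  from Minus.prems(1) have c1: "code_at P pc (ce pc t e1)"
    and c23: "code_at P (pc + asz e1) (ce (pc + asz e1) (Suc t) e2 @ [Sub t t (Suc t)])"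
    by (auto dest: code_at_append)
  from code_at_append[OF c23] have c2: "code_at P (pc + asz e1) (ce (pc + asz e1) (Suc t) e2)"
    and c3: "code_at P (pc + asz e1 + asz e2) [Sub t t (Suc t)]" by auto
  obtain R1 where R1: "reach P w (asz e1) (pc, R) (pc + asz e1, R1)" "R1 t = aval w e1 s" "same_regs t R R1"
    using Minus.IH(1)[OF c1] Minus.prems by auto
  have "rel s R1" using rel_same R1(3) Minus.prems(3) tb by blast
  then obtain R2 where R2: "reach P w (asz e2) (pc + asz e1, R1) (pc + asz e1 + asz e2, R2)"
    "R2 (Suc t) = aval w e2 s" "same_regs (Suc t) R1 R2"
    using Minus.IH(2)[OF c2] Minus.prems by auto
  have "R2 t = aval w e1 s" using R2(3) R1(2) by (auto simp: same_regs_def fun_upd_def)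
  hence r3: "reach P w (Suc 0) (pc + asz e1 + asz e2, R2)
      (pc + asz e1 + asz e2 + 1, R2(t := aval w (Minus e1 e2) s))"
    using code_at_Cons[OF c3] R2(2) by (auto intro!: reach_step reach_refl)
  from reach_trans[OF reach_trans[OF R1(1) R2(1)] r3] R1(3) R2(3) tb show ?case
    by (intro exI[of _ "R2(t := aval w (Minus e1 e2) s)"]) (auto simp: same_regs_def fun_upd_def add.assoc)
next
  case (Hlf e)
  have tb: "64 \<le> t" "t < 95" using wfe_bounds Hlf.prems by auto
  from Hlf.prems(1) have c1: "code_at P pc (ce pc t e)" and c2: "code_at P (pc + asz e) [Half t t]"
    by (auto dest: code_at_append)
  obtain R1 where R1: "reach P w (asz e) (pc, R) (pc + asz e, R1)" "R1 t = aval w e s" "same_regs t R R1"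
    using Hlf.IH[OF c1] Hlf.prems by auto
  have r2: "reach P w (Suc 0) (pc + asz e, R1) (pc + asz e + 1, R1(t := aval w (Hlf e) s))"
    using code_at_Cons[OF c2] R1(2) by (auto intro!: reach_step reach_refl simp: Let_def)
  from reach_trans[OF R1(1) r2] R1(3) tb show ?case
    by (intro exI[of _ "R1(t := aval w (Hlf e) s)"]) (auto simp: same_regs_def fun_upd_def)
next
  case (Pos e)
  have tb: "64 \<le> t" "t < 95" using wfe_bounds Pos.prems by auto
  define q where "q = pc + asz e"
  from Pos.prems(1) have c1: "code_at P pc (ce pc t e)"
    and c2: "code_at P q [JPos t (q + 3), Const t 0, Jump (q + 4), Const t 1]"
    by (auto dest: code_at_append simp: Let_def q_def)
  obtain R1 where R1: "reach P w (asz e) (pc, R) (q, R1)" "R1 t = aval w e s" "same_regs t R R1"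
    using Pos.IH[OF c1] Pos.prems by (auto simp: q_def)
  have i0: "q < length P \<and> P ! q = JPos t (q + 3)"
    and i1: "Suc q < length P \<and> P ! Suc q = Const t 0"
    and i2: "Suc (Suc q) < length P \<and> P ! Suc (Suc q) = Jump (q + 4)"
    and i3: "q + 3 < length P \<and> P ! (q + 3) = Const t 1"
    using code_at_nth[OF c2, of 0] code_at_nth[OF c2, of 1] code_at_nth[OF c2, of 2]
      code_at_nth[OF c2, of 3] by (auto simp: eval_nat_numeral)
  have r2: "reach P w 4 (q, R1) (q + 4, R1(t := aval w (Pos e) s))"
  proof (cases "R1 t > 0")
    case True
    have "reach P w 1 (q + 3, R1) (q + 4, R1(t := 1))"
      by (rule reach_1[OF i3]) (simp add: eval_nat_numeral)
    with True have "reach P w (Suc 1) (q, R1) (q + 4, R1(t := 1))"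
      by (intro reach_step[OF i0]) simp
    thus ?thesis using True R1(2) by (auto intro: reach_mono)
  next
    case False
    have "reach P w (Suc (Suc (Suc 0))) (q, R1) (q + 4, R1(t := 0))" using False
      by (intro reach_step[OF i0]) (auto intro!: reach_step[OF i1] reach_step[OF i2] reach_refl)
    thus ?thesis using False R1(2) by (auto intro: reach_mono)
  qed
  from reach_trans[OF R1(1) r2] R1(3) tb show ?case
    by (intro exI[of _ "R1(t := aval w (Pos e) s)"]) (auto simp: same_regs_def fun_upd_def q_def add.assoc)
qed

lemma rel_setv: "rel s R \<Longrightarrow> x < 64 \<Longrightarrow> rel (setv x z s) (R(x := z))"
  unfolding rel_def setv_def by auto

lemma rel_seta: "rel s R \<Longrightarrow> a < 8 \<Longrightarrow> rel (seta a i z s) (R(128 + a + 8 * i := z))"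
proof -
  \<comment> \<open>The stride 8 separates the cells of different arrays: modulo 8 the address
    determines the array.\<close>
  have "b = a \<and> j = i" if "a < 8" "b < 8" "b + 8 * j = a + 8 * i" for b j using that by presburger
  thus "rel s R \<Longrightarrow> a < 8 \<Longrightarrow> ?thesis" unfolding rel_def seta_def by auto
qed

text \<open>The registers below \<open>h\<close> are the counters of the enclosing loops, which a
  loop body must leave alone.\<close>

definition same_loops :: "nat \<Rightarrow> (nat \<Rightarrow> int) \<Rightarrow> (nat \<Rightarrow> int) \<Rightarrow> bool" where
  "same_loops h R R' \<longleftrightarrow> (\<forall>r. 96 \<le> r \<and> r < h \<and> r < 127 \<longrightarrow> R' r = R r)"

lemma same_loops_trans: "same_loops h R R' \<Longrightarrow> same_loops h R' R'' \<Longrightarrow> same_loops h R R''"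
  unfolding same_loops_def by auto

lemma same_regs_loops: "same_regs t R R' \<Longrightarrow> same_loops h R R'"
  unfolding same_regs_def same_loops_def by auto

lemma cc_correct:
  assumes "code_at P pc (cc pc h c)" "wfc h c" "rel s R"
  shows "\<exists>R'. reach P w (tm w c s) (pc, R) (pc + csz c, R') \<and> rel (sem w c s) R' \<and> same_loops h R R'"
  using assms
proof (induction c arbitrary: pc h R s)
  case Skip
  then show ?case by (auto intro!: exI[of _ R] reach_refl simp: same_loops_def)
next
  case (Assign x e)
  from Assign.prems(1) have c1: "code_at P pc (ce pc 64 e)" and c2: "code_at P (pc + asz e) [Add x 64 127]"
    by (auto dest: code_at_append)
  obtain R1 where R1: "reach P w (asz e) (pc, R) (pc + asz e, R1)" "R1 64 = aval w e s" "same_regs 64 R R1"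
    using ce_correct[OF c1 _ Assign.prems(3)] Assign.prems(2) by auto
  have rl: "rel s R1" using rel_same[OF Assign.prems(3) R1(3)] by simp
  hence "R1 127 = 0" by (simp add: rel_def)
  hence r2: "reach P w (Suc 0) (pc + asz e, R1) (pc + asz e + 1, R1(x := aval w e s))"
    using code_at_Cons[OF c2] R1(2) by (auto intro!: reach_step reach_refl)
  from reach_trans[OF R1(1) r2] rel_setv[OF rl] R1(3) Assign.prems(2) show ?case
    by (intro exI[of _ "R1(x := aval w e s)"]) (auto simp: same_loops_def same_regs_def fun_upd_def)
next
  case (AStore a e1 e2)
  let ?q = "pc + asz e1"
  have w: "a < 8" "wfe 64 e1" "wfe 65 e2" using AStore.prems(2) by auto
  from AStore.prems(1) have c1: "code_at P pc (ce pc 64 e1)"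
    and c': "code_at P ?q (addr_code ?q 64 a @ ce (?q + 7) 65 e2 @ [Store 64 65])"
    by (auto dest: code_at_append)
  from code_at_append[OF c'] have c2: "code_at P ?q (addr_code ?q 64 a)"
    and c'': "code_at P (?q + 7) (ce (?q + 7) 65 e2 @ [Store 64 65])" by auto
  from code_at_append[OF c''] have c3: "code_at P (?q + 7) (ce (?q + 7) 65 e2)"
    and c4: "code_at P (?q + 7 + asz e2) [Store 64 65]" by auto
  obtain R1 where R1: "reach P w (asz e1) (pc, R) (?q, R1)" "R1 64 = aval w e1 s" "same_regs 64 R R1"
    using ce_correct[OF c1 w(2) AStore.prems(3)] by auto
  obtain R2 where R2: "reach P w 7 (?q, R1) (?q + 7, R2)"
     "R2 64 = 128 + int a + 8 * int (nat (R1 64))" "same_regs 64 R1 R2"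
    using addr_code_correct[OF c2] by auto
  have rl2: "rel s R2" using rel_same[OF rel_same[OF AStore.prems(3) R1(3)] R2(3)] by simp
  obtain R3 where R3: "reach P w (asz e2) (?q + 7, R2) (?q + 7 + asz e2, R3)" "R3 65 = aval w e2 s"
    "same_regs 65 R2 R3"
    using ce_correct[OF c3 w(3) rl2] by auto
  have rl3: "rel s R3" using rel_same[OF rl2 R3(3)] by simp
  have "R3 64 = R2 64" using R3(3) by (simp add: same_regs_def)
  hence ad: "nat (R3 64) = 128 + a + 8 * nat (aval w e1 s)"
    unfolding R2(2) R1(2) by linarith
  define R4 where "R4 = R3(128 + a + 8 * nat (aval w e1 s) := aval w e2 s)"
  have r4: "reach P w (Suc 0) (?q + 7 + asz e2, R3) (Suc (?q + 7 + asz e2), R4)"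
    using code_at_Cons[OF c4] ad R3(2) unfolding R4_def
    by (intro reach_step[of _ _ "Store 64 65"]) (auto intro!: reach_refl)
  have "rel (sem w (AStore a e1 e2) s) R4"
    unfolding R4_def using rel_seta[OF rl3 w(1)] by simp
  moreover have "same_loops h R R4" using R1(3) R2(3) R3(3) unfolding R4_def
    by (auto simp: same_loops_def same_regs_def)
  moreover have "reach P w (asz e1 + 7 + asz e2 + Suc 0) (pc, R) (Suc (?q + 7 + asz e2), R4)"
    using reach_trans[OF reach_trans[OF reach_trans[OF R1(1) R2(1)] R3(1)] r4] .
  ultimately show ?case by (intro exI[of _ R4]) (auto elim!: reach_mono simp: add_ac eval_nat_numeral)
next
  case (Seq c1 c2)
  from Seq.prems(1) have c: "code_at P pc (cc pc h c1)" "code_at P (pc + csz c1) (cc (pc + csz c1) h c2)"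
    by (auto dest: code_at_append)
  obtain R1 where R1: "reach P w (tm w c1 s) (pc, R) (pc + csz c1, R1)" "rel (sem w c1 s) R1" "same_loops h R R1"
    using Seq.IH(1)[OF c(1) _ Seq.prems(3)] Seq.prems(2) by auto
  obtain R2 where R2: "reach P w (tm w c2 (sem w c1 s)) (pc + csz c1, R1) (pc + csz c1 + csz c2, R2)"
     "rel (sem w c2 (sem w c1 s)) R2" "same_loops h R1 R2"
    using Seq.IH(2)[OF c(2) _ R1(2)] Seq.prems(2) by auto
  from reach_trans[OF R1(1) R2(1)] R2(2) same_loops_trans[OF R1(3) R2(3)] show ?case
    by (intro exI[of _ R2]) (auto simp: add.assoc)
next
  case (IfPos e c1 c2)
  define q where "q = pc + asz e"
  from IfPos.prems(1) have k1: "code_at P pc (ce pc 64 e)"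
    and k': "code_at P q ([JPos 64 (q + 2 + csz c2)] @ cc (q + 1) h c2 @ [Jump (q + 2 + csz c2 + csz c1)] @
     cc (q + 2 + csz c2) h c1)"
    by (auto dest: code_at_append simp: q_def Let_def)
  from code_at_append[OF k'] have k2: "q < length P \<and> P ! q = JPos 64 (q + 2 + csz c2)"
    and k'': "code_at P (q + 1) (cc (q + 1) h c2 @ [Jump (q + 2 + csz c2 + csz c1)] @
     cc (q + 2 + csz c2) h c1)"
    by (auto dest!: code_at_Cons)
  from code_at_append[OF k''] have k3: "code_at P (q + 1) (cc (q + 1) h c2)"
    and k''': "code_at P (q + 1 + csz c2) ([Jump (q + 2 + csz c2 + csz c1)] @ cc (q + 2 + csz c2) h c1)"
    by auto
  from k''' have k4: "q + 1 + csz c2 < length P \<and> P ! (q + 1 + csz c2) = Jump (q + 2 + csz c2 + csz c1)"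
    and k5: "code_at P (q + 2 + csz c2) (cc (q + 2 + csz c2) h c1)"
    by (auto dest!: code_at_Cons)
  have w: "wfe 64 e" "wfc h c1" "wfc h c2" using IfPos.prems(2) by auto
  obtain R1 where R1: "reach P w (asz e) (pc, R) (q, R1)" "R1 64 = aval w e s" "same_regs 64 R R1"
    using ce_correct[OF k1 w(1) IfPos.prems(3)] by (auto simp: q_def)
  have rl: "rel s R1" using rel_same[OF IfPos.prems(3) R1(3)] by simp
  show ?case
  proof (cases "aval w e s > 0")
    case True
    obtain R2 where R2: "reach P w (tm w c1 s) (q + 2 + csz c2, R1) (q + 2 + csz c2 + csz c1, R2)"
      "rel (sem w c1 s) R2" "same_loops h R1 R2"
      using IfPos.IH(1)[OF k5 w(2) rl] by auto
    have "reach P w (Suc (tm w c1 s)) (q, R1) (q + 2 + csz c2 + csz c1, R2)"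
      using True R1(2) R2(1) by (intro reach_step[OF k2]) auto
    from reach_trans[OF R1(1) this] R2(2) same_loops_trans[OF same_regs_loops[OF R1(3)] R2(3)] True
    show ?thesis
      by (intro exI[of _ R2]) (auto elim!: reach_mono simp: q_def add_ac)
  next
    case False
    obtain R2 where R2: "reach P w (tm w c2 s) (q + 1, R1) (q + 1 + csz c2, R2)"
      "rel (sem w c2 s) R2" "same_loops h R1 R2"
      using IfPos.IH(2)[OF k3 w(3) rl] by auto
    have a: "reach P w (Suc (tm w c2 s)) (q, R1) (q + 1 + csz c2, R2)"
      using False R1(2) R2(1) by (intro reach_step[OF k2]) auto
    have b: "reach P w (Suc 0) (q + 1 + csz c2, R2) (q + 2 + csz c2 + csz c1, R2)"
      by (intro reach_step[OF k4]) (auto intro: reach_refl)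
    from reach_trans[OF reach_trans[OF R1(1) a] b] R2(2) same_loops_trans[OF same_regs_loops[OF R1(3)] R2(3)] False
    show ?thesis
      by (intro exI[of _ R2]) (auto elim!: reach_mono simp: q_def add_ac)
  qed
next
  case (For x e c)
  define q where "q = pc + asz e"
  from For.prems(1) have k1: "code_at P pc (ce pc 64 e)"
    and k': "code_at P q ([Add h 64 127, Const x 0, JPos h (q + 4), Jump (q + 8 + csz c)] @
     cc (q + 4) (Suc h) c @ [Const 64 1, Add x x 64, Sub h h 64, Jump (q + 2)])"
    by (auto dest: code_at_append simp: q_def Let_def)
  from code_at_append[OF k'] have
      k2: "code_at P q [Add h 64 127, Const x 0, JPos h (q + 4), Jump (q + 8 + csz c)]"
    and k'': "code_at P (q + 4) (cc (q + 4) (Suc h) c @ [Const 64 1, Add x x 64, Sub h h 64, Jump (q + 2)])"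
    by (auto simp: eval_nat_numeral)
  from code_at_append[OF k''] have k3: "code_at P (q + 4) (cc (q + 4) (Suc h) c)"
    and k4: "code_at P (q + 4 + csz c) [Const 64 1, Add x x 64, Sub h h 64, Jump (q + 2)]" by auto
  have w: "x < 64" "wfe 64 e" "96 \<le> h" "h < 127" "wfc (Suc h) c" using For.prems(2) by auto
  have i0: "q < length P \<and> P ! q = Add h 64 127"
    and i1: "Suc q < length P \<and> P ! Suc q = Const x 0"
    and i2: "q + 2 < length P \<and> P ! (q + 2) = JPos h (q + 4)"
    and i3: "Suc (q + 2) < length P \<and> P ! Suc (q + 2) = Jump (q + 8 + csz c)"
    using code_at_nth[OF k2, of 0] code_at_nth[OF k2, of 1] code_at_nth[OF k2, of 2]
      code_at_nth[OF k2, of 3] by (auto simp: eval_nat_numeral)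
  let ?r = "q + 4 + csz c"
  have j0: "?r < length P \<and> P ! ?r = Const 64 1"
    and j1: "Suc ?r < length P \<and> P ! Suc ?r = Add x x 64"
    and j2: "Suc (Suc ?r) < length P \<and> P ! Suc (Suc ?r) = Sub h h 64"
    and j3: "Suc (Suc (Suc ?r)) < length P \<and> P ! Suc (Suc (Suc ?r)) = Jump (q + 2)"
    using code_at_nth[OF k4, of 0] code_at_nth[OF k4, of 1] code_at_nth[OF k4, of 2]
      code_at_nth[OF k4, of 3] by (auto simp: eval_nat_numeral)
  obtain R1 where R1: "reach P w (asz e) (pc, R) (q, R1)" "R1 64 = aval w e s" "same_regs 64 R R1"
    using ce_correct[OF k1 w(2) For.prems(3)] by (auto simp: q_def)
  have rl: "rel s R1" using rel_same[OF For.prems(3) R1(3)] by simp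
  define R2 where "R2 = R1(h := aval w e s, x := 0)"
  have r2: "reach P w (Suc (Suc 0)) (q, R1) (q + 2, R2)"
    unfolding R2_def using rl R1(2)
    by (intro reach_step[OF i0]) (auto intro!: reach_step[OF i1] reach_refl simp: rel_def)
  have rl2: "rel (setv x 0 s) R2" unfolding R2_def
    by (rule rel_setv[OF _ w(1)]) (use rl w in \<open>auto simp: rel_def\<close>)
  have h2: "R2 h = aval w e s" unfolding R2_def using w by auto
  have s2: "same_loops h R R2" unfolding R2_def using R1(3) w
    by (auto simp: same_loops_def same_regs_def)
  define F where "F = (\<lambda>s. incv x (sem w c s))"
  define n where "n = nat (aval w e s)"
  \<comment> \<open>The hidden counter falls while \<open>x\<close> rises. The body is compiled with
    \<open>Suc h\<close>, so it cannot touch register \<open>h\<close>.\<close>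
  have loop: "\<exists>R'. reach P w (\<Sum>i<m. tm w c ((F ^^ i) (setv x 0 s)) + 5) (q + 2, R2) (q + 2, R') \<and>
      rel ((F ^^ m) (setv x 0 s)) R' \<and> R' h = aval w e s - int m \<and> same_loops h R R'"
    if "m \<le> n" for m
    using that
  proof (induction m)
    case 0
    show ?case using rl2 h2 s2 by (auto intro!: exI[of _ R2] reach_refl)
  next
    case (Suc m)
    define s' where "s' = (F ^^ m) (setv x 0 s)"
    from Suc obtain R3 where R3: "reach P w (\<Sum>i<m. tm w c ((F ^^ i) (setv x 0 s)) + 5) (q + 2, R2) (q + 2, R3)"
      "rel s' R3" "R3 h = aval w e s - int m" "same_loops h R R3" unfolding s'_def by auto
    have pos: "R3 h > 0" using Suc.prems R3(3) by (simp add: n_def)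
    obtain R4 where R4: "reach P w (tm w c s') (q + 4, R3) (q + 4 + csz c, R4)"
      "rel (sem w c s') R4" "same_loops (Suc h) R3 R4"
      using For.IH[OF k3 w(5) R3(2)] by auto
    have a: "reach P w (Suc (tm w c s')) (q + 2, R3) (q + 4 + csz c, R4)"
      using pos R4(1) by (intro reach_step[OF i2]) auto
    have R4h: "R4 h = R3 h" using R4(3) w by (auto simp: same_loops_def)
    define R5 where "R5 = R4(64 := 1, x := R4 x + 1, h := R4 h - 1)"
    have b: "reach P w (Suc (Suc (Suc (Suc 0)))) (q + 4 + csz c, R4) (q + 2, R5)"
      apply (rule reach_step[OF j0], unfold exec.simps)
      apply (rule reach_step[OF j1], unfold exec.simps)
      apply (rule reach_step[OF j2], unfold exec.simps)
      apply (rule reach_step[OF j3], unfold exec.simps)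
      using w by (simp add: R5_def reach_refl)
    have "rel (sem w c s') (R4(64 := 1, h := R4 h - 1))" using R4(2) w by (auto simp: rel_def)
    moreover have R4x: "R4 x = fst (sem w c s') x" using R4(2) w by (simp add: rel_def)
    ultimately have "rel (F s') (R4(64 := 1, h := R4 h - 1, x := R4 x + 1))"
      using rel_setv[OF _ w(1), of "sem w c s'" _ "R4 x + 1"] by (simp add: F_def incv_def)
    moreover have "R4(64 := 1, h := R4 h - 1, x := R4 x + 1) = R5"
      unfolding R5_def using w by (auto simp: fun_eq_iff)
    ultimately have rl5: "rel (F s') R5" by simp
    have h5: "R5 h = aval w e s - int (Suc m)" unfolding R5_def using R4h R3(3) by simp
    have s5: "same_loops h R R5" unfolding R5_def using R3(4) R4(3) w
      by (auto simp: same_loops_def)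
    have "reach P w ((\<Sum>i<m. tm w c ((F ^^ i) (setv x 0 s)) + 5) + (Suc (tm w c s') + Suc (Suc (Suc (Suc 0)))))
       (q + 2, R2) (q + 2, R5)"
      using reach_trans[OF R3(1) reach_trans[OF a b]] .
    thus ?case using rl5 h5 s5
      by (intro exI[of _ R5]) (auto simp: s'_def eval_nat_numeral)
  qed
  from loop[of n] obtain R3 where R3: "reach P w (\<Sum>i<n. tm w c ((F ^^ i) (setv x 0 s)) + 5) (q + 2, R2) (q + 2, R3)"
      "rel ((F ^^ n) (setv x 0 s)) R3" "R3 h = aval w e s - int n" "same_loops h R R3" by auto
  \<comment> \<open>This includes a negative bound: then \<open>n = 0\<close> and the counter is
    negative from the start.\<close>
  have np: "\<not> R3 h > 0" using R3(3) by (simp add: n_def)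
  have fin: "reach P w (Suc (Suc 0)) (q + 2, R3) (q + 8 + csz c, R3)"
    apply (rule reach_step[OF i2], unfold exec.simps)
    using np by (simp only: if_False) (rule reach_step[OF i3], simp add: reach_refl)
  have "reach P w (asz e + Suc (Suc 0) + ((\<Sum>i<n. tm w c ((F ^^ i) (setv x 0 s)) + 5) + Suc (Suc 0)))
     (pc, R) (q + 8 + csz c, R3)"
    using reach_trans[OF reach_trans[OF R1(1) r2] reach_trans[OF R3(1) fin]] .
  also have "asz e + Suc (Suc 0) + ((\<Sum>i<n. tm w c ((F ^^ i) (setv x 0 s)) + 5) + Suc (Suc 0)) =
      tm w (For x e c) s" by (simp add: F_def n_def)
  also have "q + 8 + csz c = pc + csz (For x e c)" by (simp add: q_def)
  finally show ?case using R3(2,4)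
    by (intro exI[of _ R3]) (simp add: F_def n_def)
qed

definition init :: mem where "init = (\<lambda>_. 0, \<lambda>_ _. 0)"

lemma compile_correct:
  assumes "wfc 96 c" "fst (sem w c init) 0 = (if b then 1 else 0)" "tm w c init \<le> T"
  shows "answers_within (cc 0 96 c) w T b"
proof -
  have "code_at (cc 0 96 c) 0 (cc 0 96 c)"
    unfolding code_at_def by (intro exI[of _ "[]"]) simp
  from cc_correct[OF this assms(1), of init "\<lambda>_. 0" w]
  obtain R' where "reach (cc 0 96 c) w (tm w c init) (0, \<lambda>_. 0) (csz c, R')"
    and r: "rel (sem w c init) R'" by (auto simp: rel_def init_def)
  then obtain t where t: "t \<le> tm w c init" "run (cc 0 96 c) w t = (csz c, R')"
    unfolding reach_def run_def by blast
  have "R' 0 = fst (sem w c init) 0" using r by (simp add: rel_def)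
  thus ?thesis unfolding answers_within_def
    using t assms by (intro exI[of _ t]) (auto simp: halted_def)
qed

section \<open>Hall's theorem with capacities and the fairness measures\<close>

text \<open>A vertex with \<open>N u\<close> inside both sets is counted twice on either side. The
  inequality can be strict, since \<open>N u\<close> may lie in the union without lying in
  \<open>A\<close> or in \<open>B\<close>.\<close>

lemma card_subset_supermodular:
  assumes "finite U"
  shows "card {u\<in>U. N u \<subseteq> A} + card {u\<in>U. N u \<subseteq> B} \<le>
    card {u\<in>U. N u \<subseteq> A \<union> B} + card {u\<in>U. N u \<subseteq> A \<inter> B}"
proof -
  let ?T = "\<lambda>S. {u\<in>U. N u \<subseteq> S}"
  have "card (?T A) + card (?T B) = card (?T A \<union> ?T B) + card (?T A \<inter> ?T B)"
    by (rule card_Un_Int) (use assms in simp_all)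
  moreover have "?T A \<inter> ?T B = ?T (A \<inter> B)" by auto
  moreover have "card (?T A \<union> ?T B) \<le> card (?T (A \<union> B))"
    using assms by (intro card_mono) auto
  ultimately show ?thesis by simp
qed

text \<open>Rado's argument: as long as some \<open>N u\<close> has two elements, one of them can be dropped.\<close>

lemma hall_capacities:
  fixes N :: "'u \<Rightarrow> 'w set" and x :: "'w \<Rightarrow> nat"
  assumes "finite U" "finite W" "\<And>u. u \<in> U \<Longrightarrow> N u \<subseteq> W"
    and "\<And>S. S \<subseteq> W \<Longrightarrow> card {u\<in>U. N u \<subseteq> S} \<le> sum x S"
  shows "\<exists>f. (\<forall>u\<in>U. f u \<in> N u) \<and> (\<forall>w\<in>W. card {u\<in>U. f u = w} \<le> x w)"
  using assms(3,4)
proof (induction "\<Sum>u\<in>U. card (N u)" arbitrary: N rule: less_induct)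
  case less
  have fN: "finite (N u)" if "u \<in> U" for u
    by (rule finite_subset[OF less.prems(1)[OF that] assms(2)])
  have "{u\<in>U. N u \<subseteq> {}} = {}" using less.prems(2)[of "{}"] assms(1) by simp
  hence ne: "N u \<noteq> {}" if "u \<in> U" for u using that by auto
  show ?case
  proof (cases "\<exists>u\<in>U. \<exists>w1\<in>N u. \<exists>w2\<in>N u. w1 \<noteq> w2")
    case False
    define f where "f u = (SOME w. w \<in> N u)" for u
    have f: "N u = {f u}" if "u \<in> U" for u
    proof -
      have "f u \<in> N u" unfolding f_def using ne[OF that] by (simp add: some_in_eq)
      moreover have "w = f u" if "w \<in> N u" for w
        using False \<open>u \<in> U\<close> that \<open>f u \<in> N u\<close> by blast
      ultimately show ?thesis by blast
    qed
    have "card {u\<in>U. f u = w} \<le> x w" if "w \<in> W" for w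
    proof -
      have "{u\<in>U. f u = w} = {u\<in>U. N u \<subseteq> {w}}" by (rule Collect_cong) (use f in auto)
      with less.prems(2)[of "{w}"] that show ?thesis by simp
    qed
    moreover have "f u \<in> N u" if "u \<in> U" for u using f[OF that] by simp
    ultimately show ?thesis by blast
  next
    case True
    then obtain u w1 w2 where u: "u \<in> U" "w1 \<in> N u" "w2 \<in> N u" "w1 \<noteq> w2" by blast
    define T where "T S = {u'\<in>U - {u}. N u' \<subseteq> S}" for S
    have cardT: "card {u'\<in>U. N u' \<subseteq> S} = card (T S) + (if N u \<subseteq> S then 1 else 0)" for S
    proof -
      have "{u'\<in>U. N u' \<subseteq> S} = (if N u \<subseteq> S then insert u (T S) else T S)"
        unfolding T_def using u(1) by auto
      moreover have "u \<notin> T S" "finite (T S)" unfolding T_def using assms(1) by auto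
      ultimately show ?thesis by simp
    qed
    \<comment> \<open>Dropping \<open>w\<close> from \<open>N u\<close> can hurt only those sets
      that contain the rest of \<open>N u\<close>: there \<open>u\<close> counts on top of
      \<open>T S\<close>.\<close>
    have reduce: ?thesis if w: "w \<in> N u" and
      hall: "\<And>S. S \<subseteq> W \<Longrightarrow> N u - {w} \<subseteq> S \<Longrightarrow> card (T S) + 1 \<le> sum x S" for w
    proof -
      define N' where "N' = N(u := N u - {w})"
      have dec: "(\<Sum>u\<in>U. card (N' u)) < (\<Sum>u\<in>U. card (N u))"
      proof (rule sum_strict_mono_ex1)
        show "\<forall>u\<in>U. card (N' u) \<le> card (N u)" unfolding N'_def by (simp add: card_Diff1_le)
        show "\<exists>u\<in>U. card (N' u) < card (N u)" unfolding N'_def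
          using card_Diff1_less[OF fN[OF u(1)] w] u(1) by (intro bexI[of _ u]) simp_all
      qed (fact assms(1))
      have sub: "N' u' \<subseteq> W" if "u' \<in> U" for u' using less.prems(1)[OF that] by (auto simp: N'_def)
      have "card {u'\<in>U. N' u' \<subseteq> S} \<le> sum x S" if "S \<subseteq> W" for S
      proof (cases "N u - {w} \<subseteq> S")
        case True
        have "{u'\<in>U. N' u' \<subseteq> S} = insert u (T S)" unfolding T_def N'_def using True u(1) by auto
        moreover have "finite (T S)" "u \<notin> T S" using assms(1) by (auto simp: T_def)
        ultimately show ?thesis using hall[OF that True] by simp
      next
        case False
        have "{u'\<in>U. N' u' \<subseteq> S} = T S" unfolding T_def N'_def using False by auto
        moreover have "card (T S) \<le> card {u'\<in>U. N u' \<subseteq> S}"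
          unfolding T_def using assms(1) by (intro card_mono) auto
        ultimately show ?thesis using less.prems(2)[OF that] by simp
      qed
      from less.hyps[OF dec sub this]
      obtain f where f: "\<forall>u\<in>U. f u \<in> N' u" "\<forall>w\<in>W. card {u\<in>U. f u = w} \<le> x w" by blast
      have "\<forall>u\<in>U. f u \<in> N u" using f(1) by (auto simp: N'_def split: if_splits)
      with f(2) show ?thesis by blast
    qed
    show ?thesis
    proof (rule ccontr)
      assume no: "\<not> ?thesis"
      have "\<exists>S. S \<subseteq> W \<and> N u - {w1} \<subseteq> S \<and> \<not> card (T S) + 1 \<le> sum x S"
        using reduce[OF u(2)] no by blast
      then obtain S1 where S1: "S1 \<subseteq> W" "N u - {w1} \<subseteq> S1" "\<not> card (T S1) + 1 \<le> sum x S1"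
        by blast
      have "\<exists>S. S \<subseteq> W \<and> N u - {w2} \<subseteq> S \<and> \<not> card (T S) + 1 \<le> sum x S"
        using reduce[OF u(3)] no by blast
      then obtain S2 where S2: "S2 \<subseteq> W" "N u - {w2} \<subseteq> S2" "\<not> card (T S2) + 1 \<le> sum x S2"
        by blast
      \<comment> \<open>This uses that \<open>w1\<close> and \<open>w2\<close> differ. Hall's
        condition for the union therefore counts \<open>u\<close> as well, and this extra 1
        contradicts supermodularity if both removals are blocked.\<close>
      have "N u \<subseteq> S1 \<union> S2" using S1(2) S2(2) u(4) by auto
      with less.prems(2)[of "S1 \<union> S2"] S1(1) S2(1) have a: "card (T (S1 \<union> S2)) + 1 \<le> sum x (S1 \<union> S2)"
        by (simp add: cardT)
      have b: "card (T (S1 \<inter> S2)) \<le> sum x (S1 \<inter> S2)"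
      proof -
        have "card (T (S1 \<inter> S2)) \<le> card {u'\<in>U. N u' \<subseteq> S1 \<inter> S2}" unfolding cardT by simp
        also have "\<dots> \<le> sum x (S1 \<inter> S2)" using S1(1) by (intro less.prems(2)) auto
        finally show ?thesis .
      qed
      have c: "card (T S1) + card (T S2) \<le> card (T (S1 \<union> S2)) + card (T (S1 \<inter> S2))"
        unfolding T_def using assms(1) by (intro card_subset_supermodular) auto
      have d: "sum x (S1 \<union> S2) + sum x (S1 \<inter> S2) = sum x S1 + sum x S2"
        by (rule sum.union_inter[OF finite_subset[OF S1(1) assms(2)] finite_subset[OF S2(1) assms(2)]])
      from a b c d S1(3) S2(3) show False by linarith
    qed
  qed
qed

lemma hall_exact:
  fixes N :: "'u \<Rightarrow> 'w set" and x :: "'w \<Rightarrow> nat"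
  assumes "finite U" "finite W" "\<And>u. u \<in> U \<Longrightarrow> N u \<subseteq> W"
  shows "(\<exists>f. (\<forall>u\<in>U. f u \<in> N u) \<and> (\<forall>w\<in>W. card {u\<in>U. f u = w} = x w)) \<longleftrightarrow>
    (\<forall>S. S \<subseteq> W \<longrightarrow> card {u\<in>U. N u \<subseteq> S} \<le> sum x S) \<and> sum x W \<le> card U"
proof (intro iffI conjI allI impI)
  assume "\<exists>f. (\<forall>u\<in>U. f u \<in> N u) \<and> (\<forall>w\<in>W. card {u\<in>U. f u = w} = x w)"
  then obtain f where f': "\<forall>u\<in>U. f u \<in> N u" "\<forall>w\<in>W. card {u\<in>U. f u = w} = x w"
    by (elim exE conjE)
  note f = f'(1)[rule_format] f'(2)[rule_format]
  have sum: "sum x S = card {u\<in>U. f u \<in> S}" if "S \<subseteq> W" for S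
  proof -
    have "sum x S = (\<Sum>w\<in>S. card {u\<in>U. f u = w})" using f(2) that by (intro sum.cong) auto
    also have "\<dots> = card (\<Union>w\<in>S. {u\<in>U. f u = w})"
      by (rule card_UN_disjoint[symmetric])
        (use assms(1) finite_subset[OF that assms(2)] in auto)
    also have "(\<Union>w\<in>S. {u\<in>U. f u = w}) = {u\<in>U. f u \<in> S}" by auto
    finally show ?thesis .
  qed
  show "card {u\<in>U. N u \<subseteq> S} \<le> sum x S" if "S \<subseteq> W" for S
    unfolding sum[OF that] using f(1) assms(1) by (intro card_mono) auto
  show "sum x W \<le> card U"
    unfolding sum[OF subset_refl] using assms(1) by (intro card_mono) auto
next
  assume *: "(\<forall>S. S \<subseteq> W \<longrightarrow> card {u\<in>U. N u \<subseteq> S} \<le> sum x S) \<and> sum x W \<le> card U"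
  have "\<exists>f. (\<forall>u\<in>U. f u \<in> N u) \<and> (\<forall>w\<in>W. card {u\<in>U. f u = w} \<le> x w)"
    by (rule hall_capacities) (use assms * in auto)
  then obtain f where
    f': "\<forall>u\<in>U. f u \<in> N u" "\<forall>w\<in>W. card {u\<in>U. f u = w} \<le> x w"
    by (elim exE conjE)
  note f = f'(1)[rule_format] f'(2)[rule_format]
  have "f u \<in> W" if "u \<in> U" for u using f(1) assms(3) that by blast
  hence "(\<Union>w\<in>W. {u\<in>U. f u = w}) = U" by auto
  hence "card U = card (\<Union>w\<in>W. {u\<in>U. f u = w})" by simp
  also have "\<dots> = (\<Sum>w\<in>W. card {u\<in>U. f u = w})"
    by (rule card_UN_disjoint) (use assms(1,2) in auto)
  finally have tot: "card U = (\<Sum>w\<in>W. card {u\<in>U. f u = w})" .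
  have "card {u\<in>U. f u = w} = x w" if "w \<in> W" for w
  proof (rule ccontr)
    assume "card {u\<in>U. f u = w} \<noteq> x w"
    hence "card {u\<in>U. f u = w} < x w" using f(2)[OF that] by simp
    hence "(\<Sum>w\<in>W. card {u\<in>U. f u = w}) < sum x W"
      using f(2) that assms(2) by (intro sum_strict_mono_ex1) auto
    with tot * show False by linarith
  qed
  with f(1) show "\<exists>f. (\<forall>u\<in>U. f u \<in> N u) \<and> (\<forall>w\<in>W. card {u\<in>U. f u = w} = x w)"
    by (intro exI[of _ f]) simp
qed

text \<open>The witness \<open>m\<close> is the smallest count. That all counts reach
  \<open>m\<close> is written with a cardinality, so that the two measures differ only in the number
  of counts required.\<close>

lemma MaxMin_le_iff:
  assumes "finite C" and B: "\<And>c. c \<in> C \<Longrightarrow> card (color_class cl U' c) \<le> B"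
  shows "MaxMin cl C U' \<le> l \<longleftrightarrow> (\<exists>m\<le>B. (\<forall>c\<in>C. card (color_class cl U' c) \<le> m + l) \<and>
     (m = 0 \<or> card C \<le> card {c\<in>C. m \<le> card (color_class cl U' c)}))"
proof (cases "C = {}")
  case True
  thus ?thesis by (auto simp: MaxMin_def)
next
  case False
  define k where "k c = card (color_class cl U' c)" for c
  have fin: "finite (k ` C)" "k ` C \<noteq> {}" using assms(1) False by auto
  have eq: "MaxMin cl C U' = Max (k ` C) - Min (k ` C)" using False by (simp add: MaxMin_def k_def)
  have all: "(card C \<le> card {c\<in>C. m \<le> k c}) \<longleftrightarrow> (\<forall>c\<in>C. m \<le> k c)" for m
  proof
    assume "card C \<le> card {c\<in>C. m \<le> k c}"
    hence "{c\<in>C. m \<le> k c} = C" using assms(1) by (intro card_seteq) auto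
    thus "\<forall>c\<in>C. m \<le> k c" by blast
  next
    assume "\<forall>c\<in>C. m \<le> k c"
    hence "{c\<in>C. m \<le> k c} = C" by blast
    thus "card C \<le> card {c\<in>C. m \<le> k c}" by simp
  qed
  have "Max (k ` C) - Min (k ` C) \<le> l \<longleftrightarrow>
      (\<exists>m\<le>B. (\<forall>c\<in>C. k c \<le> m + l) \<and> (m = 0 \<or> (\<forall>c\<in>C. m \<le> k c)))"
  proof
    assume a: "Max (k ` C) - Min (k ` C) \<le> l"
    have "Min (k ` C) \<in> k ` C" using fin by simp
    hence "Min (k ` C) \<le> B" using B by (auto simp: k_def)
    moreover have "k c \<le> Min (k ` C) + l" if "c \<in> C" for c
      using Max_ge[OF fin(1), of "k c"] that a by auto
    moreover have "Min (k ` C) \<le> k c" if "c \<in> C" for c using fin that by simp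
    ultimately show "\<exists>m\<le>B. (\<forall>c\<in>C. k c \<le> m + l) \<and> (m = 0 \<or> (\<forall>c\<in>C. m \<le> k c))" by blast
  next
    assume "\<exists>m\<le>B. (\<forall>c\<in>C. k c \<le> m + l) \<and> (m = 0 \<or> (\<forall>c\<in>C. m \<le> k c))"
    then obtain m where m: "\<forall>c\<in>C. k c \<le> m + l" "\<forall>c\<in>C. m \<le> k c" by auto
    have "Max (k ` C) \<in> k ` C" "Min (k ` C) \<in> k ` C" using fin by auto
    then obtain a b where "a \<in> C" "b \<in> C" "Max (k ` C) = k a" "Min (k ` C) = k b" by auto
    moreover from this have "k a \<le> m + l" "m \<le> k b" using m by blast+
    ultimately show "Max (k ` C) - Min (k ` C) \<le> l" by simp
  qed
  thus ?thesis unfolding eq all[unfolded k_def, symmetric] k_def .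
qed

text \<open>The witness \<open>m\<close> is the second largest count, since two counts reach
  \<open>m\<close> iff this one does. With fewer than two colors only \<open>m = 0\<close> remains,
  which agrees with counting an absent entry as 0.\<close>

lemma MoV_le_iff:
  assumes "finite C" and B: "\<And>c. c \<in> C \<Longrightarrow> card (color_class cl U' c) \<le> B"
  shows "MoV cl C U' \<le> l \<longleftrightarrow> (\<exists>m\<le>B. (\<forall>c\<in>C. card (color_class cl U' c) \<le> m + l) \<and>
     (m = 0 \<or> 2 \<le> card {c\<in>C. m \<le> card (color_class cl U' c)}))"
proof -
  define k where "k c = card (color_class cl U' c)" for c
  define L where "L = rev (sorted_list_of_multiset (image_mset k (mset_set C)))"
  have mL: "mset L = image_mset k (mset_set C)" by (simp add: L_def)
  have sL: "sorted (rev L)" by (simp add: L_def)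
  have set: "set L = k ` C" using arg_cong[OF mL, of set_mset] assms(1) by simp
  have cnt: "card {c\<in>C. m \<le> k c} = length (filter (\<lambda>z. m \<le> z) L)" for m
  proof -
    have "length (filter (\<lambda>z. m \<le> z) L) = size (filter_mset (\<lambda>z. m \<le> z) (mset L))"
      by (metis mset_filter size_mset)
    also have "\<dots> = size (mset_set {c\<in>C. m \<le> k c})"
      unfolding mL by (simp add: filter_mset_image_mset filter_mset_mset_set assms(1))
    finally show ?thesis by simp
  qed
  have eq: "MoV cl C U' = (case L of [] \<Rightarrow> 0 | [x] \<Rightarrow> x | x # y # _ \<Rightarrow> x - y)"
    by (simp add: MoV_def L_def k_def[abs_def])
  have "(case L of [] \<Rightarrow> 0 | [x] \<Rightarrow> x | x # y # _ \<Rightarrow> x - y) \<le> l \<longleftrightarrow>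
      (\<exists>m\<le>B. (\<forall>z\<in>set L. z \<le> m + l) \<and> (m = 0 \<or> 2 \<le> length (filter (\<lambda>z. m \<le> z) L)))"
  proof (cases L)
    case Nil
    thus ?thesis by auto
  next
    case (Cons x L')
    show ?thesis
    proof (cases L')
      case Nil
      thus ?thesis using Cons by auto
    next
      case (Cons y r)
      have L: "L = x # y # r" using \<open>L = x # L'\<close> Cons by simp
      have ord: "y \<le> x" "\<And>z. z \<in> set r \<Longrightarrow> z \<le> y" using sL unfolding L by (auto simp: sorted_append)
      have "y \<in> k ` C" using set L by auto
      hence yB: "y \<le> B" using B by (auto simp: k_def)
      show ?thesis
      proof
        assume "(case L of [] \<Rightarrow> 0 | [x] \<Rightarrow> x | x # y # _ \<Rightarrow> x - y) \<le> l"
        hence "x \<le> y + l" by (simp add: L)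
        moreover have "z \<le> y + l" if "z \<in> set r" for z using ord(2)[OF that] by simp
        ultimately have "\<forall>z\<in>set L. z \<le> y + l" unfolding L by auto
        moreover have "2 \<le> length (filter (\<lambda>z. y \<le> z) L)" using ord(1) by (simp add: L)
        ultimately show "\<exists>m\<le>B. (\<forall>z\<in>set L. z \<le> m + l) \<and> (m = 0 \<or> 2 \<le> length (filter (\<lambda>z. m \<le> z) L))"
          using yB by (intro exI[of _ y] conjI disjI2)
      next
        assume "\<exists>m\<le>B. (\<forall>z\<in>set L. z \<le> m + l) \<and> (m = 0 \<or> 2 \<le> length (filter (\<lambda>z. m \<le> z) L))"
        then obtain m where m: "\<forall>z\<in>set L. z \<le> m + l" "m = 0 \<or> 2 \<le> length (filter (\<lambda>z. m \<le> z) L)" by blast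
        \<comment> \<open>Only the first entry could reach an \<open>m\<close> above
          \<open>y\<close>, which is one entry too few.\<close>
        have "m \<le> y"
        proof (rule ccontr)
          assume "\<not> m \<le> y"
          moreover have "\<not> m \<le> z" if "z \<in> set r" for z
            using ord(2)[OF that] \<open>\<not> m \<le> y\<close> by simp
          ultimately have "filter (\<lambda>z. m \<le> z) (y # r) = []" by (simp add: filter_empty_conv)
          with m(2) \<open>\<not> m \<le> y\<close> show False by (simp add: L split: if_splits)
        qed
        thus "(case L of [] \<Rightarrow> 0 | [x] \<Rightarrow> x | x # y # _ \<Rightarrow> x - y) \<le> l" using m(1) by (simp add: L) linarith
      qed
    qed
  qed
  thus ?thesis unfolding eq set cnt[unfolded k_def, symmetric] k_def by simp
qed

section \<open>Matchings as solutions of linear constraints\<close>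

text \<open>A left-perfect matching is the graph of a function on the left side. As the two sides
  are disjoint, an undirected edge determines its orientation, so the pairs \<open>ES\<close> can
  replace \<open>edges I\<close>.\<close>

lemma Fair_Matching_assignment:
  assumes wf: "fm_wf I" and es: "ES \<subseteq> left I \<times> right I" "edges I = (\<lambda>(u, v). {u, v}) ` ES"
  shows "Fair_Matching \<Pi> I \<longleftrightarrow> (\<exists>a. (\<forall>u\<in>left I. (u, a u) \<in> ES) \<and>
     (\<forall>v\<in>right I. \<Pi> (col I) (colors I) {u\<in>left I. a u = v} \<le> fairness I \<and>
        lower I \<le> int (card {u\<in>left I. a u = v}) \<and> int (card {u\<in>left I. a u = v}) \<le> upper I))"
    (is "_ \<longleftrightarrow> (\<exists>a. ?A a \<and> ?B a)")
proof -
  have disj: "left I \<inter> right I = {}" using wf by (simp add: fm_wf_def bipartite_def)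
  have edge: "(u, v) \<in> ES" if "{u, v} \<in> edges I" "u \<in> left I" for u v
  proof -
    have "{u, v} \<in> (\<lambda>(u, v). {u, v}) ` ES" using es(2) \<open>{u, v} \<in> edges I\<close> by simp
    then obtain u' v' where p: "(u', v') \<in> ES" "{u, v} = {u', v'}" by (elim imageE) (simp split: prod.splits)
    hence "u' \<in> left I" "v' \<in> right I" using es(1) by auto
    hence "u \<noteq> v'" using disj \<open>u \<in> left I\<close> by auto
    with p(2) have "u = u'" "v = v'" by (auto simp: doubleton_eq_iff)
    with p(1) show ?thesis by simp
  qed
  show ?thesis
  proof
    assume "Fair_Matching \<Pi> I"
    then obtain M where M: "M \<subseteq> edges I" "\<And>u. u \<in> left I \<Longrightarrow> card (nbs M u) = 1"
      "\<And>v. v \<in> right I \<Longrightarrow> \<Pi> (col I) (colors I) (nbs M v) \<le> fairness I"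
      "\<And>v. v \<in> right I \<Longrightarrow> lower I \<le> int (card (nbs M v)) \<and> int (card (nbs M v)) \<le> upper I"
      unfolding Fair_Matching_def many_to_one_matching_def left_perfect_def fair_matching_def
      by (elim exE conjE) simp
    define a where "a u = the_elem (nbs M u)" for u
    have a: "nbs M u = {a u}" if u: "u \<in> left I" for u
    proof -
      obtain x where "nbs M u = {x}" using M(2)[OF u] by (elim card_1_singletonE)
      thus ?thesis by (simp add: a_def)
    qed
    have aM: "{u, v} \<in> M \<longleftrightarrow> v = a u" if u: "u \<in> left I" for u v
    proof -
      have "v \<in> nbs M u \<longleftrightarrow> v = a u" unfolding a[OF u] by simp
      thus ?thesis by (simp add: nbs_def)
    qed
    have nb: "nbs M v = {u\<in>left I. a u = v}" if v: "v \<in> right I" for v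
    proof (intro set_eqI iffI)
      fix u assume "u \<in> nbs M v"
      hence uv: "{u, v} \<in> M" by (simp add: nbs_def insert_commute)
      hence "{u, v} \<in> (\<lambda>(u, v). {u, v}) ` ES" using M(1) es(2) by blast
      then obtain u' v' where p: "(u', v') \<in> ES" "{u, v} = {u', v'}" by (elim imageE) (simp split: prod.splits)
      hence "u' \<in> left I" "v' \<in> right I" using es(1) by auto
      hence "v \<noteq> u'" using disj v by auto
      with p(2) have "u = u'" by (auto simp: doubleton_eq_iff)
      hence "u \<in> left I" using \<open>u' \<in> left I\<close> by simp
      thus "u \<in> {u\<in>left I. a u = v}" using aM[of u v] uv by simp
    next
      fix u assume "u \<in> {u\<in>left I. a u = v}"
      hence "{u, v} \<in> M" using aM[of u v] by simp
      thus "u \<in> nbs M v" by (simp add: nbs_def insert_commute)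
    qed
    have "?A a"
    proof
      fix u assume u: "u \<in> left I"
      have "{u, a u} \<in> edges I" using aM[OF u, of "a u"] M(1) by blast
      thus "(u, a u) \<in> ES" by (rule edge[OF _ u])
    qed
    moreover have "?B a" using M(3,4) by (simp add: nb)
    ultimately show "\<exists>a. ?A a \<and> ?B a" by blast
  next
    assume "\<exists>a. ?A a \<and> ?B a"
    then obtain a where a: "?A a" and b: "?B a" by (elim exE conjE)
    define M where "M = (\<lambda>u. {u, a u}) ` left I"
    have aR: "a u \<in> right I" if "u \<in> left I" for u using a es(1) that by auto
    have nl: "nbs M u = {a u}" if u: "u \<in> left I" for u
    proof (intro set_eqI iffI)
      fix w assume "w \<in> nbs M u"
      then obtain u' where u': "u' \<in> left I" "{u, w} = {u', a u'}" by (auto simp: nbs_def M_def)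
      have "u \<noteq> a u'" using aR[OF u'(1)] u disj by auto
      with u'(2) show "w \<in> {a u}" by (auto simp: doubleton_eq_iff)
    next
      fix w assume "w \<in> {a u}"
      thus "w \<in> nbs M u" using u by (auto simp: nbs_def M_def)
    qed
    have nr: "nbs M v = {u\<in>left I. a u = v}" if v: "v \<in> right I" for v
    proof (intro set_eqI iffI)
      fix w assume "w \<in> nbs M v"
      then obtain u' where u': "u' \<in> left I" "{v, w} = {u', a u'}" by (auto simp: nbs_def M_def)
      have "v \<noteq> u'" using u'(1) v disj by auto
      with u' show "w \<in> {u\<in>left I. a u = v}" by (auto simp: doubleton_eq_iff)
    next
      fix w assume "w \<in> {u\<in>left I. a u = v}"
      thus "w \<in> nbs M v" by (auto simp: nbs_def M_def insert_commute)
    qed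
    have "M \<subseteq> edges I" using a es(2) by (auto simp: M_def)
    moreover have "\<forall>u\<in>left I. card (nbs M u) = 1" by (simp add: nl)
    ultimately show "Fair_Matching \<Pi> I"
      unfolding Fair_Matching_def many_to_one_matching_def left_perfect_def fair_matching_def
      using b by (intro exI[of _ M]) (simp add: nr)
  qed
qed

text \<open>The number \<open>v * length cs + c\<close> stands for the pair of the
  \<open>v\<close>-th right vertex and the \<open>c\<close>-th color. A left vertex may only use
  slots of its own color, so an assignment to slots yields the color counts at each right vertex as
  plain class sizes, to which Hall's theorem applies.\<close>

definition slots :: "('v, 'c) fm_instance \<Rightarrow> ('v \<times> 'v) set \<Rightarrow> 'v list \<Rightarrow> 'c list \<Rightarrow> 'v \<Rightarrow> nat set" where
  "slots I ES vs cs u = {i. i < length vs * length cs \<and> (u, vs ! (i div length cs)) \<in> ES \<and>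
     col I u = cs ! (i mod length cs)}"

lemma mult_add_less: "v < nv \<Longrightarrow> c < nc \<Longrightarrow> v * nc + c < nv * (nc :: nat)"
proof -
  assume "v < nv" "c < nc"
  hence "Suc v * nc \<le> nv * nc" by (intro mult_le_mono1) simp
  with \<open>c < nc\<close> show ?thesis by simp
qed

lemma mult_add_less_index:
  "i < nv * nc \<Longrightarrow> i div nc < nv \<and> i mod nc < (nc :: nat) \<and> (i div nc) * nc + i mod nc = i"
  by (cases "nc = 0") (auto simp: less_mult_imp_div_less)

lemma Fair_Matching_slots:
  assumes wf: "fm_wf I" and es: "ES \<subseteq> left I \<times> right I" "edges I = (\<lambda>(u, v). {u, v}) ` ES"
    and vs: "distinct vs" "set vs = right I" and cs: "distinct cs" "set cs = colors I"
  defines "nc \<equiv> length cs"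
  shows "Fair_Matching \<Pi> I \<longleftrightarrow> (\<exists>f. (\<forall>u\<in>left I. f u \<in> slots I ES vs cs u) \<and>
     (\<forall>v<length vs. \<Pi> (col I) (colors I) {u\<in>left I. f u div nc = v} \<le> fairness I \<and>
        lower I \<le> int (card {u\<in>left I. f u div nc = v}) \<and> int (card {u\<in>left I. f u div nc = v}) \<le> upper I))"
    (is "_ \<longleftrightarrow> (\<exists>f. ?A f \<and> ?B f)")
proof -
  have colin: "col I u \<in> colors I" if "u \<in> left I" for u using wf that by (auto simp: fm_wf_def)
  show ?thesis unfolding Fair_Matching_assignment[OF wf es]
  proof
    assume "\<exists>a. (\<forall>u\<in>left I. (u, a u) \<in> ES) \<and>
     (\<forall>v\<in>right I. \<Pi> (col I) (colors I) {u\<in>left I. a u = v} \<le> fairness I \<and>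
        lower I \<le> int (card {u\<in>left I. a u = v}) \<and> int (card {u\<in>left I. a u = v}) \<le> upper I)"
    then obtain a where a: "\<And>u. u \<in> left I \<Longrightarrow> (u, a u) \<in> ES"
      "\<And>v. v \<in> right I \<Longrightarrow> \<Pi> (col I) (colors I) {u\<in>left I. a u = v} \<le> fairness I \<and>
        lower I \<le> int (card {u\<in>left I. a u = v}) \<and> int (card {u\<in>left I. a u = v}) \<le> upper I" by auto
    define vi where "vi x = (SOME i. i < length vs \<and> vs ! i = x)" for x
    define ci where "ci x = (SOME i. i < length cs \<and> cs ! i = x)" for x
    have vi: "vi x < length vs \<and> vs ! vi x = x" if "x \<in> right I" for x
      unfolding vi_def by (rule someI_ex) (use that vs(2) in \<open>auto simp: in_set_conv_nth\<close>)
    have ci: "ci x < length cs \<and> cs ! ci x = x" if "x \<in> colors I" for x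
      unfolding ci_def by (rule someI_ex) (use that cs(2) in \<open>auto simp: in_set_conv_nth\<close>)
    define f where "f u = vi (a u) * nc + ci (col I u)" for u
    have aR: "a u \<in> right I" if "u \<in> left I" for u using a(1)[OF that] es(1) by auto
    have dm: "f u div nc = vi (a u)" "f u mod nc = ci (col I u)" "f u < length vs * nc"
      if "u \<in> left I" for u
    proof -
      have "ci (col I u) < nc" "vi (a u) < length vs"
        using ci[OF colin[OF that]] vi[OF aR[OF that]] by (auto simp: nc_def)
      thus "f u div nc = vi (a u)" "f u mod nc = ci (col I u)" "f u < length vs * nc"
        unfolding f_def by (auto intro: mult_add_less)
    qed
    have "?A f"
    proof
      fix u assume u: "u \<in> left I"
      show "f u \<in> slots I ES vs cs u" unfolding slots_def
        using dm[OF u] vi[OF aR[OF u]] ci[OF colin[OF u]] a(1)[OF u] by (simp add: nc_def)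
    qed
    moreover have "?B f"
    proof (intro allI impI)
      fix v assume v: "v < length vs"
      have "f u div nc = v \<longleftrightarrow> a u = vs ! v" if u: "u \<in> left I" for u
        using dm(1)[OF u] vi[OF aR[OF u]] v nth_eq_iff_index_eq[OF vs(1), of "vi (a u)" v] by auto
      hence "{u\<in>left I. f u div nc = v} = {u\<in>left I. a u = vs ! v}" by (intro Collect_cong conj_cong) auto
      moreover have "vs ! v \<in> right I" using v vs(2) nth_mem by blast
      ultimately show "\<Pi> (col I) (colors I) {u\<in>left I. f u div nc = v} \<le> fairness I \<and>
        lower I \<le> int (card {u\<in>left I. f u div nc = v}) \<and> int (card {u\<in>left I. f u div nc = v}) \<le> upper I"
        using a(2) by simp
    qed
    ultimately show "\<exists>f. ?A f \<and> ?B f" by blast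
  next
    assume "\<exists>f. ?A f \<and> ?B f"
    then obtain f where f: "?A f" and b: "?B f" by (elim exE conjE)
    define a where "a u = vs ! (f u div nc)" for u
    have fu: "f u div nc < length vs \<and> (u, a u) \<in> ES" if "u \<in> left I" for u
      using f[rule_format, OF that] mult_add_less_index[of "f u" "length vs" nc]
      by (simp add: slots_def nc_def a_def)
    show "\<exists>a. (\<forall>u\<in>left I. (u, a u) \<in> ES) \<and>
     (\<forall>v\<in>right I. \<Pi> (col I) (colors I) {u\<in>left I. a u = v} \<le> fairness I \<and>
        lower I \<le> int (card {u\<in>left I. a u = v}) \<and> int (card {u\<in>left I. a u = v}) \<le> upper I)"
    proof (intro exI[of _ a] conjI ballI)
      fix u assume "u \<in> left I" thus "(u, a u) \<in> ES" using fu by blast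
    next
      fix v assume "v \<in> right I"
      hence "v \<in> set vs" by (simp add: vs(2))
      then obtain i where i: "i < length vs" "vs ! i = v" by (auto simp: in_set_conv_nth)
      have "a u = v \<longleftrightarrow> f u div nc = i" if u: "u \<in> left I" for u
        unfolding a_def i(2)[symmetric]
        using fu[OF u] i(1) nth_eq_iff_index_eq[OF vs(1), of "f u div nc" i] by auto
      hence eq: "{u\<in>left I. a u = v} = {u\<in>left I. f u div nc = i}" by (intro Collect_cong conj_cong) auto
      show "\<Pi> (col I) (colors I) {u\<in>left I. a u = v} \<le> fairness I"
        "lower I \<le> int (card {u\<in>left I. a u = v})" "int (card {u\<in>left I. a u = v}) \<le> upper I"
        unfolding eq using b i(1) by blast+
    qed
  qed
qed

text \<open>All that the algorithm has to know of a measure: \<open>thr\<close> is the only place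
  where \<open>MaxMin\<close> and \<open>MoV\<close> differ. The bound \<open>B\<close> on the
  counts is arbitrary, so it can be enlarged to admit a given witness.\<close>

definition fair_threshold :: "nat \<Rightarrow> nat \<Rightarrow> (('v, 'c) fairness_measure) \<Rightarrow> bool" where
  "fair_threshold nc thr \<Pi> \<longleftrightarrow> (\<forall>cl C U' l B. finite C \<longrightarrow> card C = nc \<longrightarrow>
     (\<forall>c\<in>C. card (color_class cl U' c) \<le> B) \<longrightarrow>
     (\<Pi> cl C U' \<le> l \<longleftrightarrow> (\<exists>m\<le>B. (\<forall>c\<in>C. card (color_class cl U' c) \<le> m + l) \<and>
     (m = 0 \<or> thr \<le> card {c\<in>C. m \<le> card (color_class cl U' c)}))))"

lemma fair_threshold_MaxMin: "fair_threshold nc nc MaxMin"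
  unfolding fair_threshold_def
proof (intro allI impI)
  fix cl :: "'a \<Rightarrow> 'b" and C U' l B
  assume "finite C" "card C = nc" "\<forall>c\<in>C. card (color_class cl U' c) \<le> B"
  thus "MaxMin cl C U' \<le> l \<longleftrightarrow> (\<exists>m\<le>B. (\<forall>c\<in>C. card (color_class cl U' c) \<le> m + l) \<and>
     (m = 0 \<or> nc \<le> card {c\<in>C. m \<le> card (color_class cl U' c)}))"
    using MaxMin_le_iff[of C cl U' B l] by simp
qed

lemma fair_threshold_MoV: "fair_threshold nc 2 MoV"
  unfolding fair_threshold_def
proof (intro allI impI)
  fix cl :: "'a \<Rightarrow> 'b" and C U' l B
  assume "finite C" "card C = nc" "\<forall>c\<in>C. card (color_class cl U' c) \<le> B"
  thus "MoV cl C U' \<le> l \<longleftrightarrow> (\<exists>m\<le>B. (\<forall>c\<in>C. card (color_class cl U' c) \<le> m + l) \<and>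
     (m = 0 \<or> 2 \<le> card {c\<in>C. m \<le> card (color_class cl U' c)}))"
    using MoV_le_iff[of C cl U' B l] by simp
qed

text \<open>The numbers \<open>X (v * nc + c)\<close> count the partners of the \<open>v\<close>-th right vertex that have the
  \<open>c\<close>-th color, and \<open>X (nv * nc + v)\<close> is the witness \<open>m\<close> of fairness at this vertex.\<close>

definition count_solution :: "nat \<Rightarrow> nat \<Rightarrow> nat \<Rightarrow> nat \<Rightarrow> (nat set \<Rightarrow> nat) \<Rightarrow> nat \<Rightarrow> int \<Rightarrow> int \<Rightarrow> (nat \<Rightarrow> int) \<Rightarrow> bool" where
  "count_solution nu nv nc thr g l p q X \<longleftrightarrow>
     (\<forall>i<nv * nc + nv. 0 \<le> X i) \<and>
     (\<forall>S. S \<subseteq> {..<nv * nc} \<longrightarrow> int (g S) \<le> sum X S) \<and> sum X {..<nv * nc} \<le> int nu \<and>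
     (\<forall>v<nv. (\<forall>c<nc. X (v * nc + c) \<le> X (nv * nc + v) + int l) \<and>
        p \<le> (\<Sum>c<nc. X (v * nc + c)) \<and> (\<Sum>c<nc. X (v * nc + c)) \<le> q \<and>
        (X (nv * nc + v) \<le> 0 \<or> thr \<le> card {c. c < nc \<and> X (nv * nc + v) \<le> X (v * nc + c)}))"

lemma card_filter_nth:
  assumes "distinct xs"
  shows "card {x\<in>set xs. P x} = card {i. i < length xs \<and> P (xs ! i)}"
proof -
  have "{x\<in>set xs. P x} = (\<lambda>i. xs ! i) ` {i. i < length xs \<and> P (xs ! i)}"
    unfolding set_conv_nth by blast
  moreover have "inj_on (\<lambda>i. xs ! i) {i. i < length xs \<and> P (xs ! i)}"
    using nth_eq_iff_index_eq[OF assms] by (auto simp: inj_on_def)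
  ultimately show ?thesis by (simp add: card_image)
qed

section \<open>Instances with enumerated right vertices and colors\<close>

locale listed_instance =
  fixes I :: "('v, 'c) fm_instance" and ES :: "('v \<times> 'v) set" and vs :: "'v list" and cs :: "'c list"
    and \<Pi> :: "('v, 'c) fairness_measure" and thr :: nat
  assumes wf: "fm_wf I" and es: "ES \<subseteq> left I \<times> right I" "edges I = (\<lambda>(u, v). {u, v}) ` ES"
    and vs: "distinct vs" "set vs = right I" and cs: "distinct cs" "set cs = colors I"
    and thr: "fair_threshold (length cs) thr \<Pi>"
begin

definition "U = left I"
definition "nv = length vs"
definition "nc = length cs"
definition "N = slots I ES vs cs"

lemma finite_U: "finite U"
  using wf by (simp add: U_def fm_wf_def bipartite_def)

lemma card_colors: "finite (colors I)" "card (colors I) = length cs"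
  using distinct_card[OF cs(1)] unfolding cs(2)[symmetric] by auto

lemma N_subset: "N u \<subseteq> {..<nv * nc}"
  by (auto simp: N_def slots_def nv_def nc_def)

definition slotting :: "('v \<Rightarrow> nat) \<Rightarrow> bool" where "slotting f \<longleftrightarrow> (\<forall>u\<in>U. f u \<in> N u)"

definition cnt :: "('v \<Rightarrow> nat) \<Rightarrow> nat \<Rightarrow> nat" where "cnt f i = card {u\<in>U. f u = i}"

lemma cnt_le: "cnt f i \<le> card U"
  unfolding cnt_def using finite_U by (intro card_mono) auto

lemma color_class_slotting:
  assumes f: "slotting f" and c: "c < nc"
  shows "card (color_class (col I) {u\<in>U. f u div nc = v} (cs ! c)) = cnt f (v * nc + c)"
proof -
  have "col I u = cs ! c \<and> f u div nc = v \<longleftrightarrow> f u = v * nc + c" if u: "u \<in> U" for u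
  proof -
    have fu: "f u < nv * nc" "col I u = cs ! (f u mod nc)"
      using f u by (auto simp: slotting_def N_def slots_def nv_def nc_def)
    have "col I u = cs ! c \<longleftrightarrow> f u mod nc = c"
      unfolding fu(2) using nth_eq_iff_index_eq[OF cs(1), of "f u mod nc" c] c mult_add_less_index[OF fu(1)]
      by (simp add: nc_def)
    moreover have "f u div nc = v" "f u mod nc = c" if "f u = v * nc + c" using that c by auto
    moreover have "f u = (f u div nc) * nc + f u mod nc" by simp
    ultimately show ?thesis by auto
  qed
  hence "color_class (col I) {u\<in>U. f u div nc = v} (cs ! c) = {u\<in>U. f u = v * nc + c}"
    unfolding color_class_def by auto
  thus ?thesis by (simp add: cnt_def)
qed

lemma card_slotting:
  assumes f: "slotting f"
  shows "card {u\<in>U. f u div nc = v} = (\<Sum>c<nc. cnt f (v * nc + c))"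
proof -
  have "{u\<in>U. f u div nc = v} = (\<Union>c\<in>{..<nc}. {u\<in>U. f u = v * nc + c})"
  proof (intro set_eqI iffI)
    fix u assume u: "u \<in> {u\<in>U. f u div nc = v}"
    hence "f u < nv * nc" using f N_subset[of u] by (auto simp: slotting_def)
    from mult_add_less_index[OF this] u show "u \<in> (\<Union>c\<in>{..<nc}. {u\<in>U. f u = v * nc + c})"
      by (intro UN_I[of "f u mod nc"]) auto
  qed auto
  moreover have "card (\<Union>c\<in>{..<nc}. {u\<in>U. f u = v * nc + c}) = (\<Sum>c<nc. card {u\<in>U. f u = v * nc + c})"
    by (rule card_UN_disjoint) (use finite_U in auto)
  ultimately show ?thesis by (simp add: cnt_def)
qed

lemma ball_colors: "(\<forall>c\<in>colors I. P c) \<longleftrightarrow> (\<forall>c<nc. P (cs ! c))"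
  unfolding cs(2)[symmetric] nc_def set_conv_nth by blast

lemma card_colors_filter: "card {c\<in>colors I. P c} = card {c. c < nc \<and> P (cs ! c)}"
  unfolding cs(2)[symmetric] nc_def by (rule card_filter_nth[OF cs(1)])

definition fair_at :: "('v \<Rightarrow> nat) \<Rightarrow> nat \<Rightarrow> nat \<Rightarrow> bool" where
  "fair_at f v m \<longleftrightarrow> (\<forall>c<nc. cnt f (v * nc + c) \<le> m + fairness I) \<and>
     (m = 0 \<or> thr \<le> card {c. c < nc \<and> m \<le> cnt f (v * nc + c)})"

lemma fair_slotting:
  assumes f: "slotting f" and B: "card U \<le> B"
  shows "\<Pi> (col I) (colors I) {u\<in>U. f u div nc = v} \<le> fairness I \<longleftrightarrow> (\<exists>m\<le>B. fair_at f v m)"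
proof -
  let ?S = "{u\<in>U. f u div nc = v}"
  have "card (color_class (col I) ?S c) \<le> B" for c
    using card_mono[OF finite_U, of "color_class (col I) ?S c"] B by (auto simp: color_class_def)
  hence "\<Pi> (col I) (colors I) ?S \<le> fairness I \<longleftrightarrow>
    (\<exists>m\<le>B. (\<forall>c\<in>colors I. card (color_class (col I) ?S c) \<le> m + fairness I) \<and>
     (m = 0 \<or> thr \<le> card {c\<in>colors I. m \<le> card (color_class (col I) ?S c)}))"
    by (intro thr[unfolded fair_threshold_def, rule_format] card_colors)
  also have "\<dots> \<longleftrightarrow> (\<exists>m\<le>B. fair_at f v m)"
  proof -
    have "{c. c < nc \<and> m \<le> card (color_class (col I) ?S (cs ! c))} = {c. c < nc \<and> m \<le> cnt f (v * nc + c)}" for m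
      by (rule Collect_cong, rule conj_cong[OF refl]) (simp only: color_class_slotting[OF f])
    moreover have "(\<forall>c<nc. card (color_class (col I) ?S (cs ! c)) \<le> m + fairness I) \<longleftrightarrow>
       (\<forall>c<nc. cnt f (v * nc + c) \<le> m + fairness I)" for m
      using color_class_slotting[OF f] by simp
    ultimately show ?thesis unfolding fair_at_def ball_colors card_colors_filter by simp
  qed
  finally show ?thesis .
qed

lemma Fair_Matching_slotting:
  "Fair_Matching \<Pi> I \<longleftrightarrow> (\<exists>f. slotting f \<and> (\<forall>v<nv. \<Pi> (col I) (colors I) {u\<in>U. f u div nc = v} \<le> fairness I \<and>
     lower I \<le> int (\<Sum>c<nc. cnt f (v * nc + c)) \<and> int (\<Sum>c<nc. cnt f (v * nc + c)) \<le> upper I))"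
  unfolding Fair_Matching_slots[OF wf es vs cs] U_def[symmetric] N_def[symmetric] nc_def[symmetric]
    nv_def[symmetric] slotting_def[symmetric]
  by (rule ex_cong1, rule conj_cong[OF refl]) (simp only: card_slotting)

text \<open>The solution consists of the counts of a slotting and its fairness witnesses. The bound
  by \<open>card U\<close> later limits the number of binary digits.\<close>

lemma count_solution_exists:
  assumes "Fair_Matching \<Pi> I"
  shows "\<exists>X. count_solution (card U) nv nc thr (\<lambda>S. card {u\<in>U. N u \<subseteq> S}) (fairness I) (lower I) (upper I) X \<and>
     (\<forall>i<nv * nc + nv. X i \<le> int (card U))"
proof -
  from assms obtain f where f: "slotting f"
    and fa: "\<And>v. v < nv \<Longrightarrow> \<Pi> (col I) (colors I) {u\<in>U. f u div nc = v} \<le> fairness I"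
    and size: "\<And>v. v < nv \<Longrightarrow> lower I \<le> int (\<Sum>c<nc. cnt f (v * nc + c)) \<and> int (\<Sum>c<nc. cnt f (v * nc + c)) \<le> upper I"
    unfolding Fair_Matching_slotting by auto
  have "\<forall>v. \<exists>m. v < nv \<longrightarrow> m \<le> card U \<and> fair_at f v m"
    using fa fair_slotting[OF f order_refl] by blast
  from choice[OF this] obtain m where m: "\<forall>v. v < nv \<longrightarrow> m v \<le> card U \<and> fair_at f v (m v)" ..
  define X where "X i = (if i < nv * nc then int (cnt f i) else int (m (i - nv * nc)))" for i
  have "\<exists>f'. (\<forall>u\<in>U. f' u \<in> N u) \<and> (\<forall>w\<in>{..<nv * nc}. card {u\<in>U. f' u = w} = cnt f w)"
    using f by (intro exI[of _ f]) (simp add: cnt_def slotting_def)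
  note h = iffD1[OF hall_exact[OF finite_U finite_lessThan N_subset] this]
  have sumX: "sum X S = int (sum (cnt f) S)" if "S \<subseteq> {..<nv * nc}" for S
    unfolding of_nat_sum by (rule sum.cong) (use that in \<open>auto simp: X_def\<close>)
  have xv: "X (v * nc + c) = int (cnt f (v * nc + c))" if "v < nv" "c < nc" for v c
    using mult_add_less[OF that] by (simp add: X_def)
  have sumv: "(\<Sum>c<nc. X (v * nc + c)) = int (\<Sum>c<nc. cnt f (v * nc + c))" if "v < nv" for v
    unfolding of_nat_sum by (rule sum.cong) (use xv that in auto)
  have mv: "X (nv * nc + v) = int (m v)" for v by (simp add: X_def)
  have bound: "0 \<le> X i \<and> X i \<le> int (card U)" if i: "i < nv * nc + nv" for i
  proof (cases "i < nv * nc")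
    case True
    thus ?thesis using cnt_le[of f i] by (simp add: X_def)
  next
    case False
    with i have "i - nv * nc < nv" by simp
    thus ?thesis using m False by (simp add: X_def)
  qed
  have "int (card {u\<in>U. N u \<subseteq> S}) \<le> sum X S" if "S \<subseteq> {..<nv * nc}" for S
    unfolding sumX[OF that] of_nat_le_iff using conjunct1[OF h] that by blast
  moreover have "sum X {..<nv * nc} \<le> int (card U)"
    unfolding sumX[OF order_refl] of_nat_le_iff by (rule conjunct2[OF h])
  moreover have "(\<forall>c<nc. X (v * nc + c) \<le> X (nv * nc + v) + int (fairness I)) \<and>
      lower I \<le> (\<Sum>c<nc. X (v * nc + c)) \<and> (\<Sum>c<nc. X (v * nc + c)) \<le> upper I \<and>
      (X (nv * nc + v) \<le> 0 \<or> thr \<le> card {c. c < nc \<and> X (nv * nc + v) \<le> X (v * nc + c)})"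
    if v: "v < nv" for v
  proof -
    have fv: "fair_at f v (m v)" using m v by blast
    have "{c. c < nc \<and> X (nv * nc + v) \<le> X (v * nc + c)} = {c. c < nc \<and> m v \<le> cnt f (v * nc + c)}"
      using xv[OF v] mv by auto
    moreover have "X (v * nc + c) \<le> X (nv * nc + v) + int (fairness I)" if "c < nc" for c
    proof -
      have "cnt f (v * nc + c) \<le> m v + fairness I" using fv that by (simp add: fair_at_def)
      thus ?thesis by (simp add: xv[OF v that] mv)
    qed
    moreover have "m v = 0 \<or> thr \<le> card {c. c < nc \<and> m v \<le> cnt f (v * nc + c)}"
      using fv unfolding fair_at_def by blast
    ultimately show ?thesis using size[OF v] by (simp add: mv sumv[OF v] del: of_nat_sum)
  qed
  ultimately have "count_solution (card U) nv nc thr (\<lambda>S. card {u \<in> U. N u \<subseteq> S}) (fairness I) (lower I)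
       (upper I) X"
    unfolding count_solution_def using bound by blast
  thus ?thesis using bound by blast
qed

lemma count_solution_sound:
  assumes "count_solution (card U) nv nc thr (\<lambda>S. card {u\<in>U. N u \<subseteq> S}) (fairness I) (lower I) (upper I) X"
  shows "Fair_Matching \<Pi> I"
proof -
  note X = assms[unfolded count_solution_def]
  define x where "x i = nat (X i)" for i
  have Xx: "X i = int (x i)" if "i < nv * nc + nv" for i using conjunct1[OF X] that by (simp add: x_def)
  have sumX: "sum X S = int (sum x S)" if "S \<subseteq> {..<nv * nc}" for S
    unfolding of_nat_sum by (rule sum.cong) (use that Xx in auto)
  have xv: "X (v * nc + c) = int (x (v * nc + c))" if "v < nv" "c < nc" for v c
    using mult_add_less[OF that] by (intro Xx) simp
  have mv: "X (nv * nc + v) = int (x (nv * nc + v))" if "v < nv" for v by (rule Xx) (use that in simp)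
  have sumv: "(\<Sum>c<nc. X (v * nc + c)) = int (\<Sum>c<nc. x (v * nc + c))" if "v < nv" for v
    unfolding of_nat_sum by (rule sum.cong) (use xv that in auto)
  have "(\<forall>S. S \<subseteq> {..<nv * nc} \<longrightarrow> card {u\<in>U. N u \<subseteq> S} \<le> sum x S) \<and> sum x {..<nv * nc} \<le> card U"
  proof (intro conjI allI impI)
    fix S assume S: "S \<subseteq> {..<nv * nc}"
    hence "int (card {u\<in>U. N u \<subseteq> S}) \<le> sum X S" using X by blast
    thus "card {u\<in>U. N u \<subseteq> S} \<le> sum x S" unfolding sumX[OF S] of_nat_le_iff .
  next
    have "sum X {..<nv * nc} \<le> int (card U)" using X by blast
    thus "sum x {..<nv * nc} \<le> card U" unfolding sumX[OF order_refl] of_nat_le_iff .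
  qed
  from iffD2[OF hall_exact[OF finite_U finite_lessThan N_subset] this]
  obtain f where f: "slotting f" "\<forall>w\<in>{..<nv * nc}. cnt f w = x w"
    unfolding slotting_def cnt_def by (elim exE conjE)
  have fx: "cnt f (v * nc + c) = x (v * nc + c)" if "v < nv" "c < nc" for v c
    using f(2) mult_add_less[OF that] by simp
  \<comment> \<open>A witness in \<open>X\<close> may exceed \<open>card U\<close>. As
    \<open>fair_slotting\<close> accepts every larger bound, the sum of all witnesses is
    added.\<close>
  define B where "B = card U + (\<Sum>v<nv. x (nv * nc + v))"
  have "\<Pi> (col I) (colors I) {u\<in>U. f u div nc = v} \<le> fairness I \<and>
     lower I \<le> int (\<Sum>c<nc. cnt f (v * nc + c)) \<and> int (\<Sum>c<nc. cnt f (v * nc + c)) \<le> upper I"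
    if v: "v < nv" for v
  proof (intro conjI)
    have s: "(\<Sum>c<nc. cnt f (v * nc + c)) = (\<Sum>c<nc. x (v * nc + c))"
      by (rule sum.cong) (use fx[OF v] in auto)
    have "lower I \<le> (\<Sum>c<nc. X (v * nc + c))" "(\<Sum>c<nc. X (v * nc + c)) \<le> upper I"
      using X v by blast+
    thus "lower I \<le> int (\<Sum>c<nc. cnt f (v * nc + c))" "int (\<Sum>c<nc. cnt f (v * nc + c)) \<le> upper I"
      unfolding s sumv[OF v] .
    have c: "{c. c < nc \<and> X (nv * nc + v) \<le> X (v * nc + c)} =
        {c. c < nc \<and> x (nv * nc + v) \<le> cnt f (v * nc + c)}"
      by (rule Collect_cong) (use fx[OF v] xv[OF v] mv[OF v] in auto)
    have "cnt f (v * nc + c) \<le> x (nv * nc + v) + fairness I" if cc: "c < nc" for c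
    proof -
      have "X (v * nc + c) \<le> X (nv * nc + v) + int (fairness I)" using X v cc by blast
      thus ?thesis using xv[OF v cc] fx[OF v cc] mv[OF v] by linarith
    qed
    moreover have "X (nv * nc + v) \<le> 0 \<or> thr \<le> card {c. c < nc \<and> x (nv * nc + v) \<le> cnt f (v * nc + c)}"
      unfolding c[symmetric] using X v by blast
    ultimately have "fair_at f v (x (nv * nc + v))" unfolding mv[OF v] fair_at_def by simp
    moreover have "x (nv * nc + v) \<le> B"
      unfolding B_def using member_le_sum[of v "{..<nv}" "\<lambda>v. x (nv * nc + v)"] v by simp
    ultimately have "\<exists>m\<le>B. fair_at f v m" by blast
    thus "\<Pi> (col I) (colors I) {u\<in>U. f u div nc = v} \<le> fairness I"
      by (intro iffD2[OF fair_slotting[OF f(1)]]) (simp_all add: B_def)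
  qed
  with f(1) show ?thesis unfolding Fair_Matching_slotting by blast
qed

end

section \<open>Search over the binary digits\<close>

type_synonym row = "(nat \<Rightarrow> int) \<times> int"

text \<open>A row is the constraint that the linear form \<open>fst r\<close> is at least
  \<open>snd r\<close>; this is its slack.\<close>

definition row_val :: "nat \<Rightarrow> row \<Rightarrow> (nat \<Rightarrow> int) \<Rightarrow> int" where
  "row_val n r z = (\<Sum>i<n. fst r i * z i) - snd r"

definition clip :: "int \<Rightarrow> int \<Rightarrow> int" where
  "clip K x = (if x > K then K else if x < - K then - K else x)"

definition signature :: "nat \<Rightarrow> int \<Rightarrow> row list \<Rightarrow> (nat \<Rightarrow> int) \<Rightarrow> int list" where
  "signature n K rows z = map (\<lambda>r. clip K (row_val n r z)) rows"

text \<open>For \<open>K = (int n + 1) * D\<close> the allowance \<open>K - (int n + 1)\<close> is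
  (n + 1) (D - 1). This is at least the n (D - 1) by which the digits still to come can raise a row
  with coefficients 0, 1 and -1. For \<open>D = 1\<close> it vanishes, so that liveness means that
  all rows of \<open>hs\<close> hold.\<close>

definition live :: "nat \<Rightarrow> int \<Rightarrow> row list \<Rightarrow> (nat \<Rightarrow> int) \<Rightarrow> bool" where
  "live n K hs z \<longleftrightarrow> (\<forall>r\<in>set hs. 0 \<le> row_val n r z + K - (int n + 1))"

definition refine :: "int \<Rightarrow> (nat \<Rightarrow> int) \<Rightarrow> nat \<Rightarrow> nat \<Rightarrow> int" where
  "refine D y m = (\<lambda>i. y i + (if odd (m div 2 ^ i) then D else 0))"

definition extend :: "nat \<Rightarrow> int \<Rightarrow> row list \<Rightarrow> row list \<Rightarrow> (nat \<Rightarrow> int) list \<Rightarrow> (nat \<Rightarrow> int) \<Rightarrow> (nat \<Rightarrow> int) list" where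
  "extend n K hs rows acc z =
     (if live n K hs z \<and> signature n K rows z \<notin> signature n K rows ` set acc then acc @ [z] else acc)"

text \<open>The folds are nested like the loops of the program, so that a loop invariant can speak
  of a partial fold.\<close>

definition next_level :: "nat \<Rightarrow> int \<Rightarrow> row list \<Rightarrow> row list \<Rightarrow> (nat \<Rightarrow> int) list \<Rightarrow> (nat \<Rightarrow> int) list" where
  "next_level n D hs rows reps =
     foldl (\<lambda>acc y. foldl (\<lambda>acc m. extend n ((int n + 1) * D) hs rows acc (refine D y m)) acc [0..<2 ^ n]) [] reps"

primrec levels :: "nat \<Rightarrow> nat \<Rightarrow> row list \<Rightarrow> row list \<Rightarrow> nat \<Rightarrow> (nat \<Rightarrow> int) list" where
  "levels n L hs rows 0 = [\<lambda>_. 0]"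
| "levels n L hs rows (Suc k) = next_level n (2 ^ (L - Suc k)) hs rows (levels n L hs rows k)"

section \<open>Soundness and completeness of the digit search\<close>

lemma foldl_extend:
  fixes zs acc n K hs rows
  defines "acc' \<equiv> foldl (extend n K hs rows) acc zs"
  shows "set acc \<subseteq> set acc'"
    and "set acc' \<subseteq> set acc \<union> {z\<in>set zs. live n K hs z}"
    and "distinct (map (signature n K rows) acc) \<Longrightarrow> distinct (map (signature n K rows) acc')"
    and "z \<in> set zs \<Longrightarrow> live n K hs z \<Longrightarrow> signature n K rows z \<in> signature n K rows ` set acc'"
proof -
  have "set acc \<subseteq> set acc' \<and> set acc' \<subseteq> set acc \<union> {z\<in>set zs. live n K hs z} \<and>
    (distinct (map (signature n K rows) acc) \<longrightarrow> distinct (map (signature n K rows) acc')) \<and>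
    (\<forall>z\<in>set zs. live n K hs z \<longrightarrow> signature n K rows z \<in> signature n K rows ` set acc')"
    unfolding acc'_def
  proof (induction zs arbitrary: acc)
    case Nil
    then show ?case by simp
  next
    case (Cons z zs)
    let ?a = "extend n K hs rows acc z"
    have a: "set acc \<subseteq> set ?a" "set ?a \<subseteq> set acc \<union> (if live n K hs z then {z} else {})"
      "distinct (map (signature n K rows) acc) \<Longrightarrow> distinct (map (signature n K rows) ?a)"
      "live n K hs z \<Longrightarrow> signature n K rows z \<in> signature n K rows ` set ?a"
      by (auto simp: extend_def)
    note IH = Cons.IH[of ?a]
    let ?b = "foldl (extend n K hs rows) ?a zs"
    have "set acc \<subseteq> set ?b" using IH a(1) by blast
    moreover have "set ?b \<subseteq> set acc \<union> {z'\<in>set (z # zs). live n K hs z'}"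
      using IH a(2) by (auto split: if_splits)
    moreover have "distinct (map (signature n K rows) acc) \<longrightarrow> distinct (map (signature n K rows) ?b)"
      using IH a(3) by blast
    moreover have "signature n K rows z' \<in> signature n K rows ` set ?b"
      if "z' \<in> set (z # zs)" "live n K hs z'" for z'
    proof (cases "z' = z")
      case True
      hence "signature n K rows z' \<in> signature n K rows ` set ?a" using a(4) that by simp
      thus ?thesis using IH by blast
    next
      case False
      thus ?thesis using IH that by simp
    qed
    ultimately show ?case by simp
  qed
  thus "set acc \<subseteq> set acc'" "set acc' \<subseteq> set acc \<union> {z\<in>set zs. live n K hs z}"
    "distinct (map (signature n K rows) acc) \<Longrightarrow> distinct (map (signature n K rows) acc')"
    "z \<in> set zs \<Longrightarrow> live n K hs z \<Longrightarrow> signature n K rows z \<in> signature n K rows ` set acc'"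
    by blast+
qed

lemma next_level_eq:
  "next_level n D hs rows reps = foldl (extend n ((int n + 1) * D) hs rows) []
     (concat (map (\<lambda>y. map (refine D y) [0..<2 ^ n]) reps))"
proof -
  have "foldl (\<lambda>acc y. foldl (\<lambda>acc m. extend n K hs rows acc (refine D y m)) acc [0..<2 ^ n]) acc reps =
     foldl (extend n K hs rows) acc (concat (map (\<lambda>y. map (refine D y) [0..<2 ^ n]) reps))" for acc K
    by (induction reps arbitrary: acc) (auto simp: foldl_map)
  thus ?thesis by (simp add: next_level_def)
qed

lemma next_level_props:
  fixes n D hs rows reps
  defines "K \<equiv> (int n + 1) * D" and "reps' \<equiv> next_level n D hs rows reps"
  shows "distinct (map (signature n K rows) reps')"
    and "z \<in> set reps' \<Longrightarrow> live n K hs z \<and> (\<exists>y\<in>set reps. \<exists>m. z = refine D y m)"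
    and "y \<in> set reps \<Longrightarrow> m < 2 ^ n \<Longrightarrow> live n K hs (refine D y m) \<Longrightarrow>
       \<exists>z\<in>set reps'. signature n K rows z = signature n K rows (refine D y m)"
proof -
  let ?zs = "concat (map (\<lambda>y. map (refine D y) [0..<2 ^ n]) reps)"
  have eq: "reps' = foldl (extend n K hs rows) [] ?zs" unfolding reps'_def K_def by (rule next_level_eq)
  show "distinct (map (signature n K rows) reps')" unfolding eq by (rule foldl_extend(3)) simp
  show "live n K hs z \<and> (\<exists>y\<in>set reps. \<exists>m. z = refine D y m)" if "z \<in> set reps'"
  proof -
    have "z \<in> {z\<in>set ?zs. live n K hs z}"
      using foldl_extend(2)[of n K hs rows "[]" ?zs] that unfolding eq[symmetric] by auto
    thus ?thesis by (simp add: image_iff) blast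
  qed
  show "\<exists>z\<in>set reps'. signature n K rows z = signature n K rows (refine D y m)"
    if "y \<in> set reps" "m < 2 ^ n" "live n K hs (refine D y m)"
  proof -
    have "refine D y m \<in> refine D y ` {0..<2 ^ n}" using that(2) by simp
    hence "refine D y m \<in> set ?zs" using that(1) by auto
    from foldl_extend(4)[OF this that(3), of rows "[]"]
    have "signature n K rows (refine D y m) \<in> signature n K rows ` set reps'" unfolding eq .
    thus ?thesis by (elim imageE) (rule bexI, simp_all)
  qed
qed

lemma mask_exists: "\<exists>m<2 ^ n. \<forall>i<n. odd ((m :: nat) div 2 ^ i) \<longleftrightarrow> P i" for n :: nat
proof (induction n)
  case 0
  show ?case by (intro exI[of _ 0]) simp
next
  case (Suc n)
  then obtain m :: nat where m: "m < 2 ^ n" "\<And>i. i < n \<Longrightarrow> odd (m div 2 ^ i) \<longleftrightarrow> P i" by blast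
  define m' where "m' = m + (if P n then 2 ^ n else 0)"
  have "m' < 2 ^ Suc n" using m(1) by (simp add: m'_def)
  moreover have "odd (m' div 2 ^ i) \<longleftrightarrow> P i" if "i < Suc n" for i
  proof (cases "i = n")
    case True
    thus ?thesis using m(1) by (simp add: m'_def)
  next
    case False
    hence i: "i < n" using that by simp
    hence "(2 :: nat) ^ n = 2 ^ (n - i) * 2 ^ i" by (simp flip: power_add)
    hence "(m + 2 ^ n) div 2 ^ i = m div 2 ^ i + 2 ^ (n - i)" by simp
    moreover have "even ((2 :: nat) ^ (n - i))" using i by simp
    ultimately show ?thesis using m(2)[OF i] by (simp add: m'_def)
  qed
  ultimately show ?case by blast
qed

lemma row_val_diff:
  assumes "\<And>i. i < n \<Longrightarrow> \<bar>fst r i\<bar> \<le> 1" "\<And>i. i < n \<Longrightarrow> 0 \<le> d i \<and> d i \<le> B"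
  shows "row_val n r (\<lambda>i. z i + d i) = row_val n r z + (\<Sum>i<n. fst r i * d i)"
    and "\<bar>\<Sum>i<n. fst r i * d i\<bar> \<le> int n * B"
proof -
  show "row_val n r (\<lambda>i. z i + d i) = row_val n r z + (\<Sum>i<n. fst r i * d i)"
    by (simp add: row_val_def distrib_left sum.distrib)
  have "\<bar>\<Sum>i<n. fst r i * d i\<bar> \<le> (\<Sum>i<n. \<bar>fst r i * d i\<bar>)" by (rule sum_abs)
  also have "\<dots> \<le> (\<Sum>i<n. B)"
  proof (rule sum_mono)
    fix i assume "i \<in> {..<n}"
    hence a: "\<bar>fst r i\<bar> \<le> 1" "0 \<le> d i" "d i \<le> B" using assms by auto
    have "\<bar>fst r i * d i\<bar> = \<bar>fst r i\<bar> * d i" using a by (simp add: abs_mult)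
    also have "\<dots> \<le> 1 * B" using a by (intro mult_mono) auto
    finally show "\<bar>fst r i * d i\<bar> \<le> B" by simp
  qed
  finally show "\<bar>\<Sum>i<n. fst r i * d i\<bar> \<le> int n * B" by simp
qed

text \<open>Either the two values agree, or both lie at or beyond the same end of the interval from
  -K to K, where a change smaller than \<open>K\<close> cannot reverse the sign.\<close>

lemma clip_sign:
  "clip K a = clip K b \<Longrightarrow> \<bar>d\<bar> < K \<Longrightarrow> (0 \<le> a + d) = (0 \<le> b + d)"
  by (auto simp: clip_def split: if_splits)

lemma row_val_cong: "(\<And>i. i < n \<Longrightarrow> z i = z' i) \<Longrightarrow> row_val n r z = row_val n r z'"
  unfolding row_val_def by (intro arg_cong2[where f="(-)"] sum.cong) auto

text \<open>Divisibility by the weight of the last digit is what later bounds the number of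
  signatures: all values of one row then lie in one residue class.\<close>

lemma levels_sound:
  assumes "k \<le> L" "y \<in> set (levels n L hs rows k)"
  shows "\<forall>i<n. 0 \<le> y i \<and> 2 ^ (L - k) dvd y i"
    and "0 < k \<Longrightarrow> live n ((int n + 1) * 2 ^ (L - k)) hs y"
  using assms
proof (induction k arbitrary: y)
  case (Suc k)
  let ?D = "2 ^ (L - Suc k) :: int"
  {
    case 1
    from next_level_props(2)[of y n ?D hs rows "levels n L hs rows k"] 1
    obtain y' m where y': "y' \<in> set (levels n L hs rows k)" "y = refine ?D y' m" by auto
    have D2: "2 ^ (L - k) = 2 * ?D" using 1(1) by (simp flip: power_Suc add: Suc_diff_Suc)
    have "\<forall>i<n. 0 \<le> y' i \<and> 2 ^ (L - k) dvd y' i" using Suc.IH(1)[OF _ y'(1)] 1 by simp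
    hence "0 \<le> y' i \<and> ?D dvd y' i" if "i < n" for i
      using that unfolding D2 by (meson dvd_mult_right)
    thus ?case unfolding y'(2) refine_def by simp
  next
    case 2
    thus ?case using next_level_props(2)[of y n ?D hs rows "levels n L hs rows k"] by simp
  }
qed auto

lemma levels_distinct:
  "distinct (map (signature n ((int n + 1) * 2 ^ (L - Suc k)) rows) (levels n L hs rows (Suc k)))"
  using next_level_props(1) by simp

text \<open>The completion \<open>x'\<close> of a kept prefix is in general not \<open>x\<close>:
  whenever a prefix has been replaced by another one of the same signature, only the signs of the
  rows have been preserved. Hence the invariant compares signs.\<close>

lemma levels_complete:
  assumes coef: "\<And>r i. r \<in> set rows \<Longrightarrow> i < n \<Longrightarrow> \<bar>fst r i\<bar> \<le> 1"
    and hs: "set hs \<subseteq> set rows"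
    and x: "\<And>i. i < n \<Longrightarrow> 0 \<le> x i \<and> x i < 2 ^ L" "\<And>r. r \<in> set hs \<Longrightarrow> 0 \<le> row_val n r x"
    and "k \<le> L"
  shows "\<exists>y\<in>set (levels n L hs rows k). \<exists>x'. (\<forall>i<n. y i \<le> x' i \<and> x' i < y i + 2 ^ (L - k)) \<and>
     (\<forall>r\<in>set rows. (0 \<le> row_val n r x') = (0 \<le> row_val n r x))"
  using \<open>k \<le> L\<close>
proof (induction k)
  case 0
  show ?case using x(1) by auto
next
  case (Suc k)
  define D :: int where "D = 2 ^ (L - Suc k)"
  define K where "K = (int n + 1) * D"
  have D: "2 ^ (L - k) = 2 * D" "D > 0" using Suc.prems by (simp_all flip: power_Suc add: Suc_diff_Suc D_def)
  from Suc obtain y x' where y: "y \<in> set (levels n L hs rows k)"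
    and x': "\<And>i. i < n \<Longrightarrow> y i \<le> x' i \<and> x' i < y i + 2 * D"
    and same: "\<And>r. r \<in> set rows \<Longrightarrow> (0 \<le> row_val n r x') = (0 \<le> row_val n r x)"
    unfolding D(1) by auto
  \<comment> \<open>Bit \<open>i\<close> of \<open>m\<close> is the next digit of
    \<open>x' i\<close>; the vector \<open>d\<close> below collects the digits after it.\<close>
  obtain m :: nat where m: "m < 2 ^ n" "\<And>i. i < n \<Longrightarrow> odd (m div 2 ^ i) \<longleftrightarrow> y i + D \<le> x' i"
    using mask_exists[of n "\<lambda>i. y i + D \<le> x' i"] by blast
  define z where "z = refine D y m"
  define d where "d i = x' i - z i" for i
  have d: "0 \<le> d i \<and> d i \<le> D - 1" if "i < n" for i
    using x'[OF that] m(2)[OF that] by (auto simp: d_def z_def refine_def)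
  have small: "\<bar>\<Sum>i<n. fst r i * d i\<bar> \<le> int n * (D - 1)" if "r \<in> set rows" for r
    by (rule row_val_diff(2)) (use coef[OF that] d in auto)
  have nD: "int n * (D - 1) \<le> K - (int n + 1)" "int n * (D - 1) < K"
    using D(2) by (auto simp: K_def algebra_simps)
  have add: "row_val n r (\<lambda>i. z' i + d i) = row_val n r z' + (\<Sum>i<n. fst r i * d i)" for r z'
    by (simp add: row_val_def distrib_left sum.distrib)
  have zx: "row_val n r x' = row_val n r z + (\<Sum>i<n. fst r i * d i)" for r
    unfolding add[symmetric] by (rule row_val_cong) (simp add: d_def)
  have "live n K hs z" unfolding live_def
  proof
    fix r assume r: "r \<in> set hs"
    hence "0 \<le> row_val n r x'" using x(2) same hs by blast
    moreover have "\<bar>\<Sum>i<n. fst r i * d i\<bar> \<le> int n * (D - 1)" using small r hs by blast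
    ultimately show "0 \<le> row_val n r z + K - (int n + 1)" using zx[of r] nD by linarith
  qed
  then obtain z' where z': "z' \<in> set (levels n L hs rows (Suc k))"
    "signature n K rows z' = signature n K rows z"
    using next_level_props(3)[OF y m(1), of D hs rows] by (auto simp: z_def K_def D_def)
  \<comment> \<open>The digits still to come are carried over from \<open>z\<close> to its
    representative \<open>z'\<close>; by \<open>small\<close> they are too small to tell the two
    apart.\<close>
  have "(0 \<le> row_val n r (\<lambda>i. z' i + d i)) = (0 \<le> row_val n r x)" if r: "r \<in> set rows" for r
  proof -
    have "clip K (row_val n r z') = clip K (row_val n r z)"
      using z'(2) r unfolding signature_def by simp
    from clip_sign[OF this, of "\<Sum>i<n. fst r i * d i"] small[OF r] nD(2)
    have "(0 \<le> row_val n r (\<lambda>i. z' i + d i)) = (0 \<le> row_val n r x')"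
      unfolding add zx by linarith
    thus ?thesis using same[OF r] by simp
  qed
  moreover have "\<forall>i<n. z' i \<le> z' i + d i \<and> z' i + d i < z' i + 2 ^ (L - Suc k)"
    using d unfolding D_def by force
  ultimately show ?case using z'(1) by (intro bexI[of _ z'] exI[of _ "\<lambda>i. z' i + d i"] conjI) auto
qed

text \<open>The property \<Phi> may be anything that depends only on the signs of the rows. The rows
  in \<open>hs\<close> are enforced by liveness, which is exact at weight 1; the other rows matter
  only through \<Phi>.\<close>

lemma levels_decide:
  assumes coef: "\<And>r i. r \<in> set rows \<Longrightarrow> i < n \<Longrightarrow> \<bar>fst r i\<bar> \<le> 1"
    and hs: "set hs \<subseteq> set rows" and L: "0 < L"
    and \<Phi>: "\<And>x x' :: nat \<Rightarrow> int. (\<And>r. r \<in> set rows \<Longrightarrow> (0 \<le> row_val n r x') = (0 \<le> row_val n r x)) \<Longrightarrow> \<Phi> x = \<Phi> x'"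
  shows "(\<forall>i<n. 0 \<le> x i \<and> x i < 2 ^ L) \<Longrightarrow> (\<forall>r\<in>set hs. 0 \<le> row_val n r x) \<Longrightarrow> \<Phi> x \<Longrightarrow>
      \<exists>y\<in>set (levels n L hs rows L). \<Phi> y"
    and "y \<in> set (levels n L hs rows L) \<Longrightarrow> (\<forall>i<n. 0 \<le> y i) \<and> (\<forall>r\<in>set hs. 0 \<le> row_val n r y)"
proof -
  assume x: "\<forall>i<n. 0 \<le> x i \<and> x i < 2 ^ L" "\<forall>r\<in>set hs. 0 \<le> row_val n r x" "\<Phi> x"
  have "\<exists>y\<in>set (levels n L hs rows L). \<exists>x'. (\<forall>i<n. y i \<le> x' i \<and> x' i < y i + 2 ^ (L - L)) \<and>
     (\<forall>r\<in>set rows. (0 \<le> row_val n r x') = (0 \<le> row_val n r x))"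
    by (rule levels_complete[OF coef hs]) (use x in auto)
  then obtain y x' where y: "y \<in> set (levels n L hs rows L)" "\<forall>i<n. y i \<le> x' i \<and> x' i < y i + 1"
    "\<forall>r\<in>set rows. (0 \<le> row_val n r x') = (0 \<le> row_val n r x)" by auto
  \<comment> \<open>After the last digit the completion has no freedom left.\<close>
  have "row_val n r x' = row_val n r y" for r
  proof (rule row_val_cong)
    fix i assume "i < n"
    with y(2) have "y i \<le> x' i" "x' i < y i + 1" by blast+
    thus "x' i = y i" by linarith
  qed
  hence "(0 \<le> row_val n r y) = (0 \<le> row_val n r x)" if "r \<in> set rows" for r using y(3) that by simp
  from \<Phi>[OF this] x(3) y(1) show "\<exists>y\<in>set (levels n L hs rows L). \<Phi> y" by blast
next
  assume y: "y \<in> set (levels n L hs rows L)"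
  have "live n (int n + 1) hs y" using levels_sound(2)[OF order_refl y L] by simp
  thus "(\<forall>i<n. 0 \<le> y i) \<and> (\<forall>r\<in>set hs. 0 \<le> row_val n r y)"
    using levels_sound(1)[OF order_refl y] by (simp add: live_def)
qed

section \<open>Near-tight sets of a supermodular function\<close>

text \<open>The bound on the number of different restrictions of \<open>\<rho> y S = y(S) - g(S)\<close> to the nearly
  tight sets \<open>S\<close>, those with \<open>\<rho> y S \<le> K\<close>: by submodularity the nearly tight sets
  generate a lattice of sets on which \<open>\<rho> y\<close> is still small, and \<open>key y\<close> encodes a maximal chain
  \<open>chain y\<close> of this lattice. The chain together with the values of \<open>y\<close> on it determines the values
  of \<open>y\<close> on all nearly tight sets.\<close>

locale near_tight =
  fixes kap :: nat and g :: "nat set \<Rightarrow> int" and K :: int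
  assumes super: "A \<subseteq> {..<kap} \<Longrightarrow> B \<subseteq> {..<kap} \<Longrightarrow> g A + g B \<le> g (A \<union> B) + g (A \<inter> B)"
    and g_empty: "0 \<le> g {}" and K_nonneg: "0 \<le> K"
begin

definition rho :: "(nat \<Rightarrow> int) \<Rightarrow> nat set \<Rightarrow> int" where "rho y S = sum y S - g S"

text \<open>Both bounds come from liveness: the first from the rows of Hall's condition, the second
  from the row that bounds the total.\<close>

definition adm :: "(nat \<Rightarrow> int) \<Rightarrow> bool" where
  "adm y \<longleftrightarrow> (\<forall>S. S \<subseteq> {..<kap} \<longrightarrow> - K \<le> rho y S) \<and> rho y {..<kap} \<le> K"

definition near :: "(nat \<Rightarrow> int) \<Rightarrow> nat set set" where
  "near y = {S. S \<subseteq> {..<kap} \<and> rho y S \<le> K}"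

definition thull :: "(nat \<Rightarrow> int) \<Rightarrow> nat \<Rightarrow> nat set" where
  "thull y w = \<Inter> {S\<in>near y. w \<in> S}"

text \<open>For \<open>w < kap\<close> the second summand is below \<open>kap\<close>; so it can be
  recovered modulo \<open>kap\<close>, and equal keys mean equal hulls. A strictly larger hull
  raises the first summand by at least \<open>kap\<close>. The keys therefore number the classes of
  equal hulls along a linear extension of the inclusion of hulls.\<close>

definition key :: "(nat \<Rightarrow> int) \<Rightarrow> nat \<Rightarrow> nat" where
  "key y w = kap * card (thull y w) + Min {w'. w' < kap \<and> thull y w' = thull y w}"

text \<open>The initial segments of this linear order; they contain the hull of each of their
  elements.\<close>

definition chain :: "(nat \<Rightarrow> int) \<Rightarrow> nat \<Rightarrow> nat set" where
  "chain y w = {w'. w' < kap \<and> key y w' \<le> key y w}"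

lemma rho_submodular:
  assumes "A \<subseteq> {..<kap}" "B \<subseteq> {..<kap}"
  shows "rho y (A \<union> B) + rho y (A \<inter> B) \<le> rho y A + rho y B"
proof -
  have "finite A" "finite B" using assms finite_subset[OF _ finite_lessThan] by auto
  hence "sum y (A \<union> B) + sum y (A \<inter> B) = sum y A + sum y B" by (rule sum.union_inter)
  with super[OF assms] show ?thesis by (simp add: rho_def)
qed

context
  fixes y assumes adm: "adm y"
begin

lemma rho_low: "S \<subseteq> {..<kap} \<Longrightarrow> - K \<le> rho y S"
  using adm by (simp add: adm_def)

text \<open>Submodularity, with -K as lower bound for the union: each further nearly tight set adds
  at most 2K, starting with \<open>K\<close> for the full set.\<close>

lemma rho_Int:
  assumes "finite T" "\<And>t. t \<in> T \<Longrightarrow> A t \<in> near y"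
  shows "rho y ({..<kap} \<inter> (\<Inter>t\<in>T. A t)) \<le> (2 * int (card T) + 1) * K"
  using assms
proof (induction T)
  case empty
  thus ?case using adm by (simp add: adm_def)
next
  case (insert t T)
  let ?X = "{..<kap} \<inter> (\<Inter>t\<in>T. A t)"
  have A: "A t \<subseteq> {..<kap}" "rho y (A t) \<le> K" using insert.prems[of t] by (auto simp: near_def)
  have "rho y (?X \<union> A t) + rho y (?X \<inter> A t) \<le> rho y ?X + rho y (A t)"
    by (rule rho_submodular) (use A in auto)
  moreover have "- K \<le> rho y (?X \<union> A t)" by (rule rho_low) (use A in auto)
  moreover have "rho y ?X \<le> (2 * int (card T) + 1) * K" using insert by simp
  moreover have "?X \<inter> A t = {..<kap} \<inter> (\<Inter>t\<in>insert t T. A t)" by auto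
  ultimately have "rho y ({..<kap} \<inter> (\<Inter>t\<in>insert t T. A t)) \<le> (2 * int (card T) + 1) * K + 2 * K"
    using A(2) by simp
  also have "\<dots> = (2 * int (card (insert t T)) + 1) * K" using insert.hyps by (simp add: algebra_simps)
  finally show ?case .
qed

text \<open>Here -K bounds the intersection from below. The empty union has slack at most 0 by
  \<open>g_empty\<close>.\<close>

lemma rho_Un:
  assumes "finite T" "\<And>t. t \<in> T \<Longrightarrow> B t \<subseteq> {..<kap} \<and> rho y (B t) \<le> Q"
  shows "rho y (\<Union>t\<in>T. B t) \<le> int (card T) * (Q + K)"
  using assms
proof (induction T)
  case empty
  thus ?case using g_empty by (simp add: rho_def)
next
  case (insert t T)
  let ?X = "\<Union>t\<in>T. B t"
  have sub: "?X \<subseteq> {..<kap}" "B t \<subseteq> {..<kap}" using insert.prems by auto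
  have "rho y (?X \<union> B t) + rho y (?X \<inter> B t) \<le> rho y ?X + rho y (B t)"
    by (rule rho_submodular) (use sub in auto)
  moreover have "- K \<le> rho y (?X \<inter> B t)" by (rule rho_low) (use sub in auto)
  moreover have "rho y ?X \<le> int (card T) * (Q + K)" using insert by simp
  moreover have "rho y (B t) \<le> Q" using insert.prems by simp
  moreover have "?X \<union> B t = (\<Union>t\<in>insert t T. B t)" by auto
  ultimately have "rho y (\<Union>t\<in>insert t T. B t) \<le> int (card T) * (Q + K) + (Q + K)" by simp
  also have "\<dots> = int (card (insert t T)) * (Q + K)" using insert.hyps by (simp add: algebra_simps)
  finally show ?case .
qed

lemma full_near: "{..<kap} \<in> near y"
  using adm by (simp add: adm_def near_def)

lemma thull_subset: "w < kap \<Longrightarrow> thull y w \<subseteq> {..<kap}"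
  unfolding thull_def using full_near by (intro Inter_lower) simp

lemma thull_self: "w \<in> thull y w"
  by (simp add: thull_def)

lemma thull_near: "S \<in> near y \<Longrightarrow> w \<in> S \<Longrightarrow> thull y w \<subseteq> S"
  unfolding thull_def by (intro Inter_lower) simp

lemma thull_mono: "w \<in> thull y w' \<Longrightarrow> thull y w \<subseteq> thull y w'"
  unfolding thull_def by (intro Inter_anti_mono) auto

text \<open>The hull may be an intersection of exponentially many sets, but one of them for each
  excluded element suffices, so that at most \<open>kap\<close> sets enter the bound.\<close>

lemma rho_thull:
  assumes w: "w < kap"
  shows "rho y (thull y w) \<le> (2 * int kap + 1) * K"
proof -
  let ?T = "{..<kap} - thull y w"
  have "\<forall>t\<in>?T. \<exists>S. S \<in> near y \<and> w \<in> S \<and> t \<notin> S" by (auto simp: thull_def)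
  from bchoice[OF this] obtain A where A: "\<forall>t\<in>?T. A t \<in> near y \<and> w \<in> A t \<and> t \<notin> A t" ..
  have "thull y w = {..<kap} \<inter> (\<Inter>t\<in>?T. A t)"
  proof
    show "thull y w \<subseteq> {..<kap} \<inter> (\<Inter>t\<in>?T. A t)"
    proof (intro Int_greatest thull_subset[OF w] INT_greatest)
      fix t assume "t \<in> ?T"
      thus "thull y w \<subseteq> A t" using A by (intro thull_near) auto
    qed
    show "{..<kap} \<inter> (\<Inter>t\<in>?T. A t) \<subseteq> thull y w"
    proof
      fix t assume t: "t \<in> {..<kap} \<inter> (\<Inter>t\<in>?T. A t)"
      show "t \<in> thull y w"
      proof (rule ccontr)
        assume "t \<notin> thull y w"
        hence "t \<in> ?T" using t by simp
        hence "t \<in> A t" "t \<notin> A t" using t A by auto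
        thus False by simp
      qed
    qed
  qed
  moreover have "rho y ({..<kap} \<inter> (\<Inter>t\<in>?T. A t)) \<le> (2 * int (card ?T) + 1) * K"
    by (rule rho_Int) (use A in auto)
  moreover have "card ?T \<le> kap" using card_mono[of "{..<kap}" ?T] by auto
  hence "(2 * int (card ?T) + 1) * K \<le> (2 * int kap + 1) * K"
    using K_nonneg by (intro mult_right_mono) auto
  ultimately show ?thesis by simp
qed

lemma Min_class:
  assumes "w < kap"
  shows "Min {w'. w' < kap \<and> thull y w' = thull y w} < kap"
    and "thull y (Min {w'. w' < kap \<and> thull y w' = thull y w}) = thull y w"
proof -
  have "Min {w'. w' < kap \<and> thull y w' = thull y w} \<in> {w'. w' < kap \<and> thull y w' = thull y w}"
    by (rule Min_in) (use assms in auto)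
  thus "Min {w'. w' < kap \<and> thull y w' = thull y w} < kap"
    "thull y (Min {w'. w' < kap \<and> thull y w' = thull y w}) = thull y w" by auto
qed

lemma key_bound: "w < kap \<Longrightarrow> key y w < kap * kap + kap"
proof -
  assume w: "w < kap"
  have "card (thull y w) \<le> kap" using card_mono[OF _ thull_subset[OF w]] by simp
  hence "kap * card (thull y w) \<le> kap * kap" by simp
  with Min_class(1)[OF w] show ?thesis unfolding key_def by linarith
qed

lemma key_eqD:
  assumes "w < kap" "w' < kap" "key y w = key y w'"
  shows "thull y w = thull y w'"
proof -
  define m where "m w = Min {w'. w' < kap \<and> thull y w' = thull y w}" for w
  have m: "m v < kap" "thull y (m v) = thull y v" if "v < kap" for v
    using Min_class[OF that] by (simp_all only: m_def)
  have "key y v = kap * card (thull y v) + m v" for v by (simp only: key_def m_def)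
  hence "key y v mod kap = m v" if "v < kap" for v using m(1)[OF that] by simp
  from this[OF assms(1)] this[OF assms(2)] have "m w = m w'" by (simp only: assms(3))
  thus ?thesis using m(2)[OF assms(1)] m(2)[OF assms(2)] by (simp only:)
qed

lemma key_mono:
  assumes "w < kap" "w' < kap" "w \<in> thull y w'"
  shows "key y w \<le> key y w'"
proof (cases "thull y w = thull y w'")
  case True
  thus ?thesis by (simp add: key_def)
next
  case False
  with thull_mono[OF assms(3)] have "thull y w \<subset> thull y w'" by blast
  moreover have "finite (thull y w')" by (rule finite_subset[OF thull_subset[OF assms(2)]]) simp
  ultimately have "Suc (card (thull y w)) \<le> card (thull y w')" by (simp add: psubset_card_mono Suc_leI)
  hence "kap * Suc (card (thull y w)) \<le> kap * card (thull y w')" by (rule mult_le_mono2)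
  thus ?thesis using Min_class(1)[OF assms(1)] by (simp add: key_def)
qed

lemma chain_subset: "chain y w \<subseteq> {..<kap}" by (auto simp: chain_def)

text \<open>By \<open>key_mono\<close> an initial segment is the union of the hulls of its elements,
  so \<open>rho_Un\<close> applies with the bound of \<open>rho_thull\<close>.\<close>

lemma rho_chain:
  "rho y (chain y w) \<le> int kap * ((2 * int kap + 2) * K)"
proof -
  let ?T = "chain y w"
  have "?T = (\<Union>t\<in>?T. thull y t)"
  proof
    show "?T \<subseteq> (\<Union>t\<in>?T. thull y t)" using thull_self by blast
    show "(\<Union>t\<in>?T. thull y t) \<subseteq> ?T"
    proof
      fix x assume "x \<in> (\<Union>t\<in>?T. thull y t)"
      then obtain t where t: "t < kap" "key y t \<le> key y w" "x \<in> thull y t" by (auto simp: chain_def)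
      hence "x < kap" using thull_subset by auto
      with t key_mono[of x t] show "x \<in> ?T" by (simp add: chain_def)
    qed
  qed
  moreover have "rho y (\<Union>t\<in>?T. thull y t) \<le> int (card ?T) * ((2 * int kap + 1) * K + K)"
  proof (rule rho_Un)
    show "finite ?T" by (rule finite_subset[OF chain_subset]) simp
    show "thull y t \<subseteq> {..<kap} \<and> rho y (thull y t) \<le> (2 * int kap + 1) * K" if "t \<in> ?T" for t
      using that thull_subset rho_thull by (simp add: chain_def)
  qed
  moreover have "card ?T \<le> kap" using card_mono[OF _ chain_subset] by simp
  hence "int (card ?T) * ((2 * int kap + 1) * K + K) \<le> int kap * ((2 * int kap + 1) * K + K)"
    using K_nonneg by (intro mult_right_mono) auto
  ultimately show ?thesis by (simp add: algebra_simps)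
qed

text \<open>Equal keys mean equal hulls, and a nearly tight set contains the hull of each of its
  elements.\<close>

lemma near_saturated: "S \<in> near y \<Longrightarrow> w \<in> S \<Longrightarrow> w' < kap \<Longrightarrow> key y w = key y w' \<Longrightarrow> w' \<in> S"
proof -
  assume S: "S \<in> near y" "w \<in> S" "w' < kap" "key y w = key y w'"
  hence "w < kap" by (auto simp: near_def)
  from key_eqD[OF this S(3,4)] thull_near[OF S(1,2)] thull_self[of w'] show "w' \<in> S" by blast
qed

end

text \<open>A class is the difference of two consecutive initial segments.\<close>

lemma sum_key_class:
  fixes d :: "nat \<Rightarrow> int" and f :: "nat \<Rightarrow> nat"
  assumes "\<And>w. w < kap \<Longrightarrow> sum d {w'. w' < kap \<and> f w' \<le> f w} = 0"
  shows "sum d {w. w < kap \<and> f w = t} = 0"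
proof -
  have le: "sum d {w. w < kap \<and> f w < t} = 0" for t
  proof (induction t)
    case (Suc t)
    have eq: "{w. w < kap \<and> f w < Suc t} = {w. w < kap \<and> f w \<le> t}" by auto
    show ?case
    proof (cases "\<exists>w<kap. f w = t")
      case True
      thus ?thesis unfolding eq using assms by blast
    next
      case False
      hence "{w. w < kap \<and> f w < Suc t} = {w. w < kap \<and> f w < t}" by (auto simp: less_Suc_eq)
      thus ?thesis using Suc by simp
    qed
  qed simp
  have "{w. w < kap \<and> f w < Suc t} = {w. w < kap \<and> f w < t} \<union> {w. w < kap \<and> f w = t}" by auto
  moreover have "sum d ({w. w < kap \<and> f w < t} \<union> {w. w < kap \<and> f w = t}) =
     sum d {w. w < kap \<and> f w < t} + sum d {w. w < kap \<and> f w = t}"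
    by (rule sum.union_disjoint) auto
  ultimately show ?thesis using le[of t] le[of "Suc t"] by simp
qed

text \<open>By \<open>near_saturated\<close>, \<open>S\<close> is a disjoint union of key classes;
  each of these is a difference of sets of the chain, on which both vectors have the same sums.
  \<open>S\<close> has to be nearly tight for \<open>y\<close> only.\<close>

lemma sum_near_eq:
  assumes y: "adm y" and keys: "\<And>w. w < kap \<Longrightarrow> key y w = key y' w"
    and vals: "\<And>w. w < kap \<Longrightarrow> sum y (chain y w) = sum y' (chain y' w)"
    and S: "S \<in> near y"
  shows "sum y S = sum y' S"
proof -
  define d where "d w = y w - y' w" for w
  have "chain y w = chain y' w" if "w < kap" for w using keys that by (auto simp: chain_def)
  hence "sum d (chain y w) = 0" if "w < kap" for w
    using vals that by (simp add: d_def sum_subtractf)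
  hence cls: "sum d {w. w < kap \<and> key y w = t} = 0" for t
    by (intro sum_key_class) (simp add: chain_def)
  have fS: "finite S" using S finite_subset[OF _ finite_lessThan] by (auto simp: near_def)
  have "sum d S = (\<Sum>t\<in>key y ` S. sum d {w\<in>S. key y w = t})"
    by (rule sum.image_gen[OF fS])
  also have "\<dots> = (\<Sum>t\<in>key y ` S. 0)"
  proof (rule sum.cong[OF refl])
    fix t assume "t \<in> key y ` S"
    then obtain v where v: "v \<in> S" "key y v = t" by auto
    have "{w\<in>S. key y w = t} = {w. w < kap \<and> key y w = t}"
      using near_saturated[OF y S v(1)] v(2) S by (auto simp: near_def)
    thus "sum d {w\<in>S. key y w = t} = 0" using cls by simp
  qed
  finally show ?thesis by (simp add: d_def sum_subtractf)
qed

text \<open>If \<open>S\<close> is nearly tight for one of the vectors, the slacks agree by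
  \<open>sum_near_eq\<close>; otherwise both exceed \<open>K\<close>.\<close>

lemma rho_determined:
  assumes y: "adm y" "adm y'" and keys: "\<And>w. w < kap \<Longrightarrow> key y w = key y' w"
    and vals: "\<And>w. w < kap \<Longrightarrow> sum y (chain y w) = sum y' (chain y' w)"
    and S: "S \<subseteq> {..<kap}"
  shows "min K (rho y S) = min K (rho y' S)"
proof -
  have eq: "rho y S = rho y' S" if "S \<in> near y \<or> S \<in> near y'"
    using that
  proof
    assume "S \<in> near y"
    from sum_near_eq[OF y(1) keys vals this] show ?thesis by (simp only: rho_def)
  next
    assume "S \<in> near y'"
    from sum_near_eq[OF y(2) keys[symmetric] vals[symmetric] this] show ?thesis by (simp only: rho_def)
  qed
  show ?thesis
  proof (cases "rho y S \<le> K \<or> rho y' S \<le> K")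
    case True
    hence "S \<in> near y \<or> S \<in> near y'" using S by (simp add: near_def)
    from eq[OF this] show ?thesis by (simp only:)
  next
    case False
    thus ?thesis by simp
  qed
qed

text \<open>For vectors that are divisible by \<open>D\<close> the values on the chain can be scaled down by \<open>D\<close>.\<close>

definition code :: "int \<Rightarrow> (nat \<Rightarrow> int) \<Rightarrow> (nat \<times> int) list" where
  "code D y = map (\<lambda>w. (key y w, sum y (chain y w) div D - g (chain y w) div D)) [0..<kap]"

text \<open>Equal keys give equal chains, so the same offset \<open>g (chain y w) div D\<close> is
  subtracted on both sides; by divisibility the quotients then give back the sums.\<close>

lemma code_determines:
  assumes y: "adm y" "adm y'" and D: "D > 0" "\<And>w. w < kap \<Longrightarrow> D dvd y w" "\<And>w. w < kap \<Longrightarrow> D dvd y' w"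
    and eq: "code D y = code D y'" and S: "S \<subseteq> {..<kap}"
  shows "min K (rho y S) = min K (rho y' S)"
proof (rule rho_determined[OF y _ _ S])
  have *: "key y w = key y' w \<and> sum y (chain y w) div D - g (chain y w) div D =
      sum y' (chain y' w) div D - g (chain y' w) div D" if "w < kap" for w
    using arg_cong[OF eq, of "\<lambda>l. l ! w"] that by (simp add: code_def)
  show keys: "key y w = key y' w" if "w < kap" for w using *[OF that] by simp
  have ch: "chain y w = chain y' w" if "w < kap" for w using keys that by (auto simp: chain_def)
  have dvd: "D dvd sum y (chain y w)" "D dvd sum y' (chain y' w)" for w
    using D(2,3) by (auto simp: chain_def intro!: dvd_sum)
  show "sum y (chain y w) = sum y' (chain y' w)" if w: "w < kap" for w
  proof -
    have "sum y (chain y w) div D = sum y' (chain y' w) div D" using *[OF w] ch[OF w] by simp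
    thus ?thesis using dvd[of w] by (simp add: dvd_div_eq_iff)
  qed
qed

text \<open>Subtracting \<open>g (chain y w) div D\<close> turns the value on the chain into its
  slack divided by \<open>D\<close>, up to rounding, so that the range does not depend on the size
  of the numbers. The final \<open>+ 1\<close> absorbs the remainder of \<open>g\<close> modulo
  \<open>D\<close>.\<close>

lemma code_range:
  assumes y: "adm y" and D: "D > 0" "\<And>w. w < kap \<Longrightarrow> D dvd y w" and K: "K = m * D"
  shows "set (code D y) \<subseteq> {..<kap * kap + kap} \<times> {- m .. int kap * (2 * int kap + 2) * m + 1}"
proof
  fix p assume "p \<in> set (code D y)"
  then obtain w where w: "w < kap" "p = (key y w, sum y (chain y w) div D - g (chain y w) div D)"
    by (auto simp: code_def)
  define s where "s = sum y (chain y w) div D"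
  define c where "c = g (chain y w) div D"
  have "D dvd sum y (chain y w)" using D(2) by (auto simp: chain_def intro!: dvd_sum)
  hence s: "sum y (chain y w) = D * s" by (simp add: s_def)
  have g: "g (chain y w) = D * c + g (chain y w) mod D" by (simp add: c_def)
  have md: "0 \<le> g (chain y w) mod D" "g (chain y w) mod D < D" using D(1) by auto
  have r: "- K \<le> rho y (chain y w)" by (rule rho_low[OF y chain_subset[OF y]])
  have "- (m * D) \<le> D * (s - c)" using r s g md unfolding rho_def K by (simp add: algebra_simps)
  hence "D * (- m) \<le> D * (s - c)" by (simp add: mult.commute)
  hence lo: "- m \<le> s - c" using D(1) by (simp only: mult_le_cancel_left_pos)
  have "D * (s - c) \<le> int kap * ((2 * int kap + 2) * (m * D)) + D"
    using rho_chain[OF y, of w] s g md unfolding rho_def K by (simp add: algebra_simps)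
  hence "D * (s - c) \<le> D * (int kap * (2 * int kap + 2) * m + 1)" by (simp add: algebra_simps)
  hence "s - c \<le> int kap * (2 * int kap + 2) * m + 1" using D(1) by (simp only: mult_le_cancel_left_pos)
  with lo key_bound[OF y w(1)] show "p \<in> {..<kap * kap + kap} \<times> {- m .. int kap * (2 * int kap + 2) * m + 1}"
    by (simp add: w(2) s_def c_def)
qed

lemma card_codes:
  assumes Y: "\<And>y. y \<in> Y \<Longrightarrow> adm y \<and> (\<forall>w<kap. D dvd y w)" and D: "D > 0" "K = m * D"
  shows "finite (code D ` Y)"
    and "card (code D ` Y) \<le> ((kap * kap + kap) * nat (int kap * (2 * int kap + 2) * m + m + 2)) ^ kap"
proof -
  let ?A = "{..<kap * kap + kap} \<times> {- m .. int kap * (2 * int kap + 2) * m + 1}"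
  have sub: "code D ` Y \<subseteq> {xs. set xs \<subseteq> ?A \<and> length xs = kap}"
  proof
    fix c assume "c \<in> code D ` Y"
    then obtain y where "y \<in> Y" "c = code D y" by blast
    moreover have "length (code D y) = kap" by (simp add: code_def)
    moreover have "set (code D y) \<subseteq> ?A" using code_range[of y D m] Y[OF \<open>y \<in> Y\<close>] D by blast
    ultimately show "c \<in> {xs. set xs \<subseteq> ?A \<and> length xs = kap}" by blast
  qed
  have fin: "finite {xs. set xs \<subseteq> ?A \<and> length xs = kap}" by (rule finite_lists_length_eq) simp
  show "finite (code D ` Y)" by (rule finite_subset[OF sub fin])
  have "card (code D ` Y) \<le> card {xs. set xs \<subseteq> ?A \<and> length xs = kap}" by (rule card_mono[OF fin sub])
  also have "\<dots> = card ?A ^ kap" by (rule card_lists_length_eq) simp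
  also have "card ?A = (kap * kap + kap) * nat (int kap * (2 * int kap + 2) * m + m + 2)"
    by (simp add: card_cartesian_product algebra_simps)
  finally show "card (code D ` Y) \<le> ((kap * kap + kap) * nat (int kap * (2 * int kap + 2) * m + m + 2)) ^ kap" .
qed

end

section \<open>Reasoning about programs\<close>

lemma fst_setv [simp]: "fst (setv x z s) = (fst s)(x := z)" by (simp add: setv_def)
lemma snd_setv [simp]: "snd (setv x z s) = snd s" by (simp add: setv_def)
lemma fst_seta [simp]: "fst (seta a i z s) = fst s" by (simp add: seta_def)
lemma snd_seta [simp]: "snd (seta a i z s) = (snd s)(a := (snd s a)(i := z))" by (simp add: seta_def)
lemma fst_incv [simp]: "fst (incv x s) = (fst s)(x := fst s x + 1)" by (simp add: incv_def)
lemma snd_incv [simp]: "snd (incv x s) = snd s" by (simp add: incv_def)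

section \<open>Frame conditions and running time\<close>

primrec modv :: "com \<Rightarrow> nat set" where
  "modv Skip = {}"
| "modv (Assign x e) = {x}"
| "modv (AStore a e1 e2) = {}"
| "modv (Seq c1 c2) = modv c1 \<union> modv c2"
| "modv (IfPos e c1 c2) = modv c1 \<union> modv c2"
| "modv (For x e c) = insert x (modv c)"

primrec moda :: "com \<Rightarrow> nat set" where
  "moda Skip = {}"
| "moda (Assign x e) = {}"
| "moda (AStore a e1 e2) = {a}"
| "moda (Seq c1 c2) = moda c1 \<union> moda c2"
| "moda (IfPos e c1 c2) = moda c1 \<union> moda c2"
| "moda (For x e c) = moda c"

definition unchanged :: "nat set \<Rightarrow> nat set \<Rightarrow> mem \<Rightarrow> mem \<Rightarrow> bool" where
  "unchanged X Y s s' \<longleftrightarrow> (\<forall>x. x \<notin> X \<longrightarrow> fst s' x = fst s x) \<and> (\<forall>a. a \<notin> Y \<longrightarrow> snd s' a = snd s a)"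

lemma unchangedD:
  assumes "unchanged X Y s s'"
  shows "x \<notin> X \<Longrightarrow> fst s' x = fst s x" "a \<notin> Y \<Longrightarrow> snd s' a = snd s a"
  using assms by (auto simp: unchanged_def)

lemma unchanged_refl: "unchanged X Y s s" by (simp add: unchanged_def)

lemma unchanged_trans: "unchanged X Y s s' \<Longrightarrow> unchanged X' Y' s' s'' \<Longrightarrow> unchanged (X \<union> X') (Y \<union> Y') s s''"
  by (simp add: unchanged_def)

lemma unchanged_mono: "unchanged X Y s s' \<Longrightarrow> X \<subseteq> X' \<Longrightarrow> Y \<subseteq> Y' \<Longrightarrow> unchanged X' Y' s s'"
  unfolding unchanged_def by blast

lemma unchanged_funpow:
  assumes "\<And>s. unchanged X Y s (F s)"
  shows "unchanged X Y s ((F ^^ n) s)"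
proof (induction n)
  case (Suc n)
  from unchanged_trans[OF this assms] show ?case by simp
qed (simp add: unchanged_refl)

lemma sem_unchanged: "unchanged (modv c) (moda c) s (sem w c s)"
proof (induction c arbitrary: s)
  case (For x e c)
  have "unchanged (insert x (modv c)) (moda c) s (incv x (sem w c s))" for s
    using For[of s] by (auto simp: unchanged_def)
  from unchanged_funpow[OF this]
  have "unchanged (insert x (modv c)) (moda c) (setv x 0 s) (sem w (For x e c) s)" by simp
  thus ?case by (auto simp: unchanged_def)
qed (auto simp: unchanged_def)

text \<open>For the running time it suffices to know that every loop that is executed has at most
  \<open>B\<close> iterations.\<close>

primrec bdd :: "int list \<Rightarrow> nat \<Rightarrow> com \<Rightarrow> mem \<Rightarrow> bool" where
  "bdd w B Skip s = True"
| "bdd w B (Assign x e) s = True"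
| "bdd w B (AStore a e1 e2) s = True"
| "bdd w B (Seq c1 c2) s = (bdd w B c1 s \<and> bdd w B c2 (sem w c1 s))"
| "bdd w B (IfPos e c1 c2) s = (if aval w e s > 0 then bdd w B c1 s else bdd w B c2 s)"
| "bdd w B (For x e c) s = (nat (aval w e s) \<le> B \<and>
     (\<forall>i<nat (aval w e s). bdd w B c (((\<lambda>s. incv x (sem w c s)) ^^ i) (setv x 0 s))))"

primrec dep :: "com \<Rightarrow> nat" where
  "dep Skip = 0"
| "dep (Assign x e) = 0"
| "dep (AStore a e1 e2) = 0"
| "dep (Seq c1 c2) = dep c1 + dep c2"
| "dep (IfPos e c1 c2) = dep c1 + dep c2"
| "dep (For x e c) = Suc (dep c)"

text \<open>Both \<open>csz c\<close> and \<open>dep c\<close> depend on the program alone, so for a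
  fixed program this is a polynomial in \<open>B\<close> of fixed degree. Adding the depths of
  consecutive commands is generous, but any constant exponent will do.\<close>

lemma tm_bound: "bdd w B c s \<Longrightarrow> tm w c s \<le> csz c * (B + 1) ^ dep c"
proof (induction c arbitrary: s)
  case (Seq c1 c2)
  have "tm w c1 s \<le> csz c1 * (B + 1) ^ dep c1" "tm w c2 (sem w c1 s) \<le> csz c2 * (B + 1) ^ dep c2"
    using Seq by simp_all
  moreover have "csz c1 * (B + 1) ^ dep c1 \<le> csz c1 * (B + 1) ^ (dep c1 + dep c2)"
    "csz c2 * (B + 1) ^ dep c2 \<le> csz c2 * (B + 1) ^ (dep c1 + dep c2)"
    by (intro mult_le_mono2 power_increasing; simp)+
  ultimately show ?case unfolding tm.simps csz.simps dep.simps distrib_right by linarith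
next
  case (IfPos e c1 c2)
  have m: "csz c1 * (B + 1) ^ dep c1 \<le> csz c1 * (B + 1) ^ (dep c1 + dep c2)"
    "csz c2 * (B + 1) ^ dep c2 \<le> csz c2 * (B + 1) ^ (dep c1 + dep c2)"
    by (intro mult_le_mono2 power_increasing; simp)+
  have o: "asz e + 2 \<le> (asz e + 2) * (B + 1) ^ (dep c1 + dep c2)"
    using mult_le_mono2[of 1 "(B + 1) ^ (dep c1 + dep c2)" "asz e + 2"] by simp
  have t: "(if aval w e s > 0 then tm w c1 s else tm w c2 s) \<le>
      csz c1 * (B + 1) ^ (dep c1 + dep c2) + csz c2 * (B + 1) ^ (dep c1 + dep c2)"
  proof (cases "aval w e s > 0")
    case True
    hence "tm w c1 s \<le> csz c1 * (B + 1) ^ dep c1" using IfPos by simp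
    thus ?thesis using m True by (simp only: if_True)
  next
    case False
    hence "tm w c2 s \<le> csz c2 * (B + 1) ^ dep c2" using IfPos by simp
    thus ?thesis using m False by (simp only: if_False)
  qed
  have "tm w (IfPos e c1 c2) s \<le> (asz e + 2) * (B + 1) ^ (dep c1 + dep c2) +
     (csz c1 * (B + 1) ^ (dep c1 + dep c2) + csz c2 * (B + 1) ^ (dep c1 + dep c2))"
    using add_mono[OF o t] by simp
  also have "\<dots> = csz (IfPos e c1 c2) * (B + 1) ^ dep (IfPos e c1 c2)" by (simp add: algebra_simps)
  finally show ?case .
next
  case (For x e c)
  let ?n = "nat (aval w e s)"
  let ?X = "(B + 1) ^ dep c"
  have n: "?n \<le> B" using For.prems by simp
  have "(\<Sum>i<?n. tm w c (((\<lambda>s. incv x (sem w c s)) ^^ i) (setv x 0 s)) + 5) \<le> (\<Sum>i<?n. csz c * ?X + 5)"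
    by (rule sum_mono) (use For in simp)
  also have "\<dots> = ?n * (csz c * ?X + 5)" by simp
  also have "\<dots> \<le> B * (csz c * ?X + 5)" by (rule mult_le_mono1[OF n])
  finally have "tm w (For x e c) s \<le> asz e + 4 + B * (csz c * ?X + 5)" by simp
  also have "\<dots> \<le> asz e * (B + 1) + csz c * ?X * (B + 1) + 8 * (B + 1)" by (simp add: algebra_simps)
  also have "\<dots> \<le> asz e * (B + 1) * ?X + csz c * ?X * (B + 1) + 8 * (B + 1) * ?X"
    by (intro add_mono) simp_all
  also have "\<dots> = csz (For x e c) * (B + 1) ^ dep (For x e c)" by (simp add: algebra_simps)
  finally show ?case .
qed auto

text \<open>The invariant and the loop bounds are established together. The step may assume that
  only modified variables and arrays differ from the state before the loop, so the invariant need
  not mention anything else.\<close>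

lemma For_rule:
  assumes n: "nat (aval w e s) = n" "n \<le> B" and x: "x \<notin> modv c"
    and base: "Q 0 (setv x 0 s)"
    and step: "\<And>i s'. i < n \<Longrightarrow> fst s' x = int i \<Longrightarrow> unchanged (insert x (modv c)) (moda c) s s' \<Longrightarrow> Q i s' \<Longrightarrow>
      bdd w B c s' \<and> Q (Suc i) (incv x (sem w c s'))"
  shows "Q n (sem w (For x e c) s) \<and> bdd w B (For x e c) s"
proof -
  define F where "F = (\<lambda>s. incv x (sem w c s))"
  have u: "unchanged (insert x (modv c)) (moda c) s (F s)" for s
    using sem_unchanged[of c s w] by (auto simp: unchanged_def F_def)
  have uk: "unchanged (insert x (modv c)) (moda c) s ((F ^^ k) (setv x 0 s))" for k
    using unchanged_funpow[OF u, of "setv x 0 s" k] by (auto simp: unchanged_def)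
  have inv: "k \<le> n \<Longrightarrow> Q k ((F ^^ k) (setv x 0 s)) \<and> fst ((F ^^ k) (setv x 0 s)) x = int k" for k
  proof (induction k)
    case 0
    show ?case using base by simp
  next
    case (Suc k)
    let ?s = "(F ^^ k) (setv x 0 s)"
    have IH: "Q k ?s" "fst ?s x = int k" using Suc by simp_all
    have "Q (Suc k) (F ?s)" using step[OF _ IH(2) uk IH(1)] Suc.prems by (simp add: F_def)
    moreover have "fst (sem w c ?s) x = fst ?s x" using unchangedD(1)[OF sem_unchanged x] .
    hence "fst (F ?s) x = int (Suc k)" using IH(2) by (simp add: F_def)
    ultimately show ?case by simp
  qed
  have "bdd w B c ((F ^^ k) (setv x 0 s))" if "k < n" for k
    using step[OF that _ uk] inv[of k] that by simp
  thus ?thesis using inv[of n] n by (simp add: F_def)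
qed

text \<open>Loops are treated by \<open>For_rule\<close> and not by unfolding their
  iterates.\<close>

declare sem.simps(6) [simp del] bdd.simps(6) [simp del]

abbreviation (input) seq_syntax (infixr ";;" 60) where "c1 ;; c2 \<equiv> Seq c1 c2"

text \<open>The names \<open>x_\<dots>\<close> stand for variables and \<open>a_\<dots>\<close> for arrays; variable 0 holds the answer. The number 1
  is avoided because the simplifier rewrites it to \<open>Suc 0\<close>, unlike the other numerals.\<close>

abbreviation (input) "x_nu \<equiv> 2 :: nat"
abbreviation (input) "x_nv \<equiv> 3 :: nat"
abbreviation (input) "x_ne \<equiv> 4 :: nat"
abbreviation (input) "x_nc \<equiv> 5 :: nat"
abbreviation (input) "x_oV \<equiv> 6 :: nat"
abbreviation (input) "x_oE \<equiv> 7 :: nat"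
abbreviation (input) "x_oC \<equiv> 8 :: nat"
abbreviation (input) "x_kap \<equiv> 10 :: nat"
abbreviation (input) "x_n \<equiv> 11 :: nat"
abbreviation (input) "x_pk \<equiv> 12 :: nat"
abbreviation (input) "x_pn \<equiv> 13 :: nat"
abbreviation (input) "x_ap \<equiv> 14 :: nat"
abbreviation (input) "x_m \<equiv> 15 :: nat"
abbreviation (input) "x_mh \<equiv> 16 :: nat"
abbreviation (input) "x_i \<equiv> 17 :: nat"
abbreviation (input) "x_v \<equiv> 18 :: nat"
abbreviation (input) "x_c \<equiv> 19 :: nat"
abbreviation (input) "x_v' \<equiv> 20 :: nat"
abbreviation (input) "x_c' \<equiv> 21 :: nat"
abbreviation (input) "x_j \<equiv> 22 :: nat"
abbreviation (input) "x_u \<equiv> 23 :: nat"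
abbreviation (input) "x_e \<equiv> 24 :: nat"
abbreviation (input) "x_t \<equiv> 25 :: nat"
abbreviation (input) "x_h \<equiv> 26 :: nat"
abbreviation (input) "x_g \<equiv> 27 :: nat"
abbreviation (input) "x_f \<equiv> 28 :: nat"
abbreviation (input) "x_mask \<equiv> 29 :: nat"
abbreviation (input) "a_A \<equiv> 0 :: nat"
abbreviation (input) "a_b \<equiv> 2 :: nat"
abbreviation (input) "a_bits \<equiv> 3 :: nat"

section \<open>Bit masks and the writing of one row\<close>

definition BITS :: "nat \<Rightarrow> com" where
  "BITS l = Assign x_t (Var x_mask) ;; For x_i (Var l)
     (Assign x_h (Hlf (Var x_t)) ;; AStore a_bits (Var x_i) (Minus (Var x_t) (Plus (Var x_h) (Var x_h))) ;;
      Assign x_t (Var x_h))"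

lemma mod_BITS [simp]: "modv (BITS l) = {x_t, x_h, x_i}" "moda (BITS l) = {a_bits}"
  by (auto simp: BITS_def)

lemma BITS_correct:
  assumes "fst s x_mask = int m" "fst s l = int k" "k \<le> B" "l \<noteq> x_t"
  shows "(\<forall>i<k. snd (sem w (BITS l) s) a_bits i = int (m div 2 ^ i mod 2)) \<and> bdd w B (BITS l) s"
proof -
  define c where "c = (Assign x_h (Hlf (Var x_t)) ;; AStore a_bits (Var x_i) (Minus (Var x_t) (Plus (Var x_h) (Var x_h))) ;;
      Assign x_t (Var x_h))"
  define Q where "Q i s \<longleftrightarrow> fst s x_t = int (m div 2 ^ i) \<and>
     (\<forall>i'<i. snd s a_bits i' = int (m div 2 ^ i' mod 2))" for i and s :: mem
  define s0 where "s0 = setv x_t (fst s x_mask) s"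
  have "Q k (sem w (For x_i (Var l) c) s0) \<and> bdd w B (For x_i (Var l) c) s0"
  proof (rule For_rule)
    show "nat (aval w (Var l) s0) = k" using assms by (simp add: s0_def)
    show "x_i \<notin> modv c" by (simp add: c_def)
    show "Q 0 (setv x_i 0 s0)" using assms by (simp add: Q_def s0_def)
    fix i s' assume i: "i < k" "fst s' x_i = int i" "Q i s'"
    have q: "int (m div 2 ^ i) div 2 = int (m div 2 ^ Suc i)"
      unfolding power_Suc2 div_mult2_eq by (simp add: zdiv_int)
    have "int (m div 2 ^ i) - (int (m div 2 ^ i) div 2 + int (m div 2 ^ i) div 2) = int (m div 2 ^ i mod 2)"
      by (simp add: zmod_int minus_mult_div_eq_mod[symmetric])
    thus "bdd w B c s' \<and> Q (Suc i) (incv x_i (sem w c s'))"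
      using i q by (auto simp: c_def Q_def less_Suc_eq)
  qed (use assms in auto)
  moreover have "sem w (BITS l) s = sem w (For x_i (Var l) c) s0" "bdd w B (BITS l) s = bdd w B (For x_i (Var l) c) s0"
    by (simp_all add: BITS_def c_def s0_def)
  ultimately show ?thesis by (simp add: Q_def)
qed

lemma unchanged_updates:
  "unchanged X Y s s' \<Longrightarrow> x \<in> X \<Longrightarrow> unchanged X Y s (setv x z s')"
  "unchanged X Y s s' \<Longrightarrow> x \<in> X \<Longrightarrow> unchanged X Y s (incv x s')"
  "unchanged X Y s s' \<Longrightarrow> a \<in> Y \<Longrightarrow> unchanged X Y s (seta a i z s')"
  by (auto simp: unchanged_def)

text \<open>\<open>x_ap\<close> runs through the table in row-major order and \<open>x_j\<close>
  through the indices \<open>v * nc + c\<close>, because addresses cannot be computed by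
  multiplication.\<close>

definition EMIT :: "aexp \<Rightarrow> aexp \<Rightarrow> aexp \<Rightarrow> com" where
  "EMIT ex em eb = Assign x_j (Lit 0) ;;
     For x_v' (Var x_nv) (For x_c' (Var x_nc)
       (AStore a_A (Var x_ap) ex ;; Assign x_ap (Plus (Var x_ap) (Lit 1)) ;; Assign x_j (Plus (Var x_j) (Lit 1)))) ;;
     For x_v' (Var x_nv) (AStore a_A (Var x_ap) em ;; Assign x_ap (Plus (Var x_ap) (Lit 1))) ;;
     AStore a_b (Var x_m) eb ;; Assign x_m (Plus (Var x_m) (Lit 1))"

lemma mod_EMIT [simp]: "modv (EMIT ex em eb) = {x_j, x_v', x_c', x_ap, x_m}" "moda (EMIT ex em eb) = {a_A, a_b}"
  by (auto simp: EMIT_def)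

definition table :: "nat \<Rightarrow> row list \<Rightarrow> mem \<Rightarrow> bool" where
  "table n rows s \<longleftrightarrow> (\<forall>r<length rows. (\<forall>i<n. snd s a_A (r * n + i) = fst (rows ! r) i) \<and>
     snd s a_b r = snd (rows ! r))"

definition tab :: "nat \<Rightarrow> row list \<Rightarrow> mem \<Rightarrow> bool" where
  "tab n rows s \<longleftrightarrow> table n rows s \<and> fst s x_m = int (length rows) \<and> fst s x_ap = int (length rows * n)"

text \<open>The array from \<open>base + k\<close> on is left open, which suits arrays that are
  filled from left to right.\<close>

definition extends :: "(nat \<Rightarrow> int) \<Rightarrow> nat \<Rightarrow> nat \<Rightarrow> (nat \<Rightarrow> int) \<Rightarrow> (nat \<Rightarrow> int) \<Rightarrow> bool" where
  "extends \<alpha> base k f \<alpha>' \<longleftrightarrow> (\<forall>q<base. \<alpha>' q = \<alpha> q) \<and> (\<forall>i<k. \<alpha>' (base + i) = f i)"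

lemma extends_0: "extends \<alpha> base 0 f \<alpha>" by (simp add: extends_def)

lemma extends_Suc: "extends \<alpha> base k f \<alpha>' \<Longrightarrow> z = f k \<Longrightarrow> extends \<alpha> base (Suc k) f (\<alpha>'(base + k := z))"
  by (auto simp: extends_def less_Suc_eq)

text \<open>The three expressions are assumed to be correct in every state in which they may be
  evaluated; such a state differs from \<open>s\<close> only in the loop variables,
  \<open>x_j\<close>, the pointer and the table.\<close>

lemma EMIT_correct:
  assumes nv: "fst s x_nv = int nv" "nv \<le> B" and nc: "fst s x_nc = int nc" "nc \<le> B"
    and tab: "tab (nv * nc + nv) rows s"
    and hx: "\<And>s' v c. unchanged {x_v', x_c', x_j, x_ap} {a_A} s s' \<Longrightarrow> v < nv \<Longrightarrow> c < nc \<Longrightarrow>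
       fst s' x_v' = int v \<Longrightarrow> fst s' x_c' = int c \<Longrightarrow> fst s' x_j = int (v * nc + c) \<Longrightarrow> aval w ex s' = f (v * nc + c)"
    and hm: "\<And>s' v. unchanged {x_v', x_c', x_j, x_ap} {a_A} s s' \<Longrightarrow> v < nv \<Longrightarrow> fst s' x_v' = int v \<Longrightarrow>
       aval w em s' = f (nv * nc + v)"
    and hb: "\<And>s'. unchanged {x_v', x_c', x_j, x_ap} {a_A} s s' \<Longrightarrow> aval w eb s' = b"
  shows "tab (nv * nc + nv) (rows @ [(f, b)]) (sem w (EMIT ex em eb) s) \<and> bdd w B (EMIT ex em eb) s"
proof -
  let ?X = "{x_v', x_c', x_j, x_ap}"
  define n where "n = nv * nc + nv"
  define base where "base = length rows * n"
  define \<alpha> where "\<alpha> = snd s a_A"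
  define ci where "ci = (AStore a_A (Var x_ap) ex ;; Assign x_ap (Plus (Var x_ap) (Lit 1)) ;; Assign x_j (Plus (Var x_j) (Lit 1)))"
  define cm where "cm = (AStore a_A (Var x_ap) em ;; Assign x_ap (Plus (Var x_ap) (Lit 1)))"
  define J where "J k s' \<longleftrightarrow> unchanged ?X {a_A} s s' \<and> fst s' x_ap = int (base + k) \<and>
      extends \<alpha> base k f (snd s' a_A)" for k s'
  have J_loop: "J k (setv x z s')" if "J k s'" "x \<in> {x_v', x_c', x_j}" for k x z s'
    using that by (auto simp: J_def intro!: unchanged_updates)
  have J_incv: "J k (incv x s')" if "J k s'" "x \<in> {x_v', x_c', x_j}" for k x s'
    using that by (auto simp: J_def intro!: unchanged_updates)
  have row: "(J (v * nc + nc) (sem w (For x_c' (Var x_nc) ci) s') \<and>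
       fst (sem w (For x_c' (Var x_nc) ci) s') x_j = int (v * nc + nc) \<and>
       fst (sem w (For x_c' (Var x_nc) ci) s') x_v' = int v) \<and> bdd w B (For x_c' (Var x_nc) ci) s'"
    if v: "v < nv" and s': "J (v * nc) s'" "fst s' x_j = int (v * nc)" "fst s' x_v' = int v" for v s'
  proof (rule For_rule[where Q="\<lambda>c t. J (v * nc + c) t \<and> fst t x_j = int (v * nc + c) \<and> fst t x_v' = int v"])
    have "fst s' x_nc = int nc" using s'(1) nc by (simp add: J_def unchanged_def)
    thus "nat (aval w (Var x_nc) s') = nc" by simp
    show "x_c' \<notin> modv ci" by (simp add: ci_def)
    show "J (v * nc + 0) (setv x_c' 0 s') \<and> fst (setv x_c' 0 s') x_j = int (v * nc + 0) \<and> fst (setv x_c' 0 s') x_v' = int v"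
      using s' J_loop by simp
    fix c t assume c: "c < nc" "fst t x_c' = int c"
      and Q: "J (v * nc + c) t \<and> fst t x_j = int (v * nc + c) \<and> fst t x_v' = int v"
    have val: "aval w ex t = f (v * nc + c)"
      using Q by (intro hx[OF _ v c(1) _ c(2)]) (auto simp: J_def)
    have ap: "nat (fst t x_ap) = base + (v * nc + c)" using Q by (simp only: J_def nat_int)
    show "bdd w B ci t \<and> (J (v * nc + Suc c) (incv x_c' (sem w ci t)) \<and>
        fst (incv x_c' (sem w ci t)) x_j = int (v * nc + Suc c) \<and> fst (incv x_c' (sem w ci t)) x_v' = int v)"
    proof
      show "bdd w B ci t" by (simp add: ci_def)
      have "sem w ci t = setv x_j (fst t x_j + 1) (setv x_ap (fst t x_ap + 1)
         (seta a_A (nat (fst t x_ap)) (aval w ex t) t))" by (simp add: ci_def)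
      thus "J (v * nc + Suc c) (incv x_c' (sem w ci t)) \<and>
          fst (incv x_c' (sem w ci t)) x_j = int (v * nc + Suc c) \<and> fst (incv x_c' (sem w ci t)) x_v' = int v"
        unfolding ap
        using Q extends_Suc[of \<alpha> base "v * nc + c" f "snd t a_A", OF _ val]
        by (auto simp: J_def intro!: unchanged_updates)
    qed
  qed (use nc in auto)
  define s0 where "s0 = sem w (Assign x_j (Lit 0)) s"
  define s1 where "s1 = sem w (For x_v' (Var x_nv) (For x_c' (Var x_nc) ci)) s0"
  have L1: "(J (nv * nc) s1 \<and> fst s1 x_j = int (nv * nc)) \<and> bdd w B (For x_v' (Var x_nv) (For x_c' (Var x_nc) ci)) s0"
    unfolding s1_def
  proof (rule For_rule[where Q="\<lambda>v t. J (v * nc) t \<and> fst t x_j = int (v * nc)"])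
    show "nat (aval w (Var x_nv) s0) = nv" using nv by (simp add: s0_def)
    show "x_v' \<notin> modv (For x_c' (Var x_nc) ci)" by (simp add: ci_def)
    show "J (0 * nc) (setv x_v' 0 s0) \<and> fst (setv x_v' 0 s0) x_j = int (0 * nc)"
      using tab by (auto simp: J_def s0_def tab_def base_def n_def \<alpha>_def extends_0
          intro!: unchanged_updates unchanged_refl)
    fix v t assume v: "v < nv" "fst t x_v' = int v" and Q: "J (v * nc) t \<and> fst t x_j = int (v * nc)"
    let ?t = "sem w (For x_c' (Var x_nc) ci) t"
    have r: "J (v * nc + nc) ?t" "fst ?t x_j = int (v * nc + nc)" "bdd w B (For x_c' (Var x_nc) ci) t"
      using row[OF v(1), of t] Q v(2) by blast+
    have e: "v * nc + nc = Suc v * nc" by simp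
    show "bdd w B (For x_c' (Var x_nc) ci) t \<and> (J (Suc v * nc) (incv x_v' ?t) \<and>
       fst (incv x_v' ?t) x_j = int (Suc v * nc))"
      using r J_incv[of _ ?t x_v'] unfolding e by simp
  qed (use nv in auto)
  define s2 where "s2 = sem w (For x_v' (Var x_nv) cm) s1"
  have L2: "J (nv * nc + nv) s2 \<and> bdd w B (For x_v' (Var x_nv) cm) s1"
    unfolding s2_def
  proof (rule For_rule[where Q="\<lambda>v. J (nv * nc + v)"])
    have "fst s1 x_nv = int nv" using L1 nv by (simp add: J_def unchanged_def)
    thus "nat (aval w (Var x_nv) s1) = nv" by simp
    show "x_v' \<notin> modv cm" by (simp add: cm_def)
    show "J (nv * nc + 0) (setv x_v' 0 s1)" using L1 J_loop by simp
    fix v t assume v: "v < nv" "fst t x_v' = int v" and Q: "J (nv * nc + v) t"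
    have val: "aval w em t = f (nv * nc + v)"
      using Q by (intro hm[OF _ v]) (auto simp: J_def)
    have ap: "nat (fst t x_ap) = base + (nv * nc + v)" using Q by (simp only: J_def nat_int)
    show "bdd w B cm t \<and> J (nv * nc + Suc v) (incv x_v' (sem w cm t))"
    proof
      show "bdd w B cm t" by (simp add: cm_def)
      have "sem w cm t = setv x_ap (fst t x_ap + 1) (seta a_A (nat (fst t x_ap)) (aval w em t) t)"
        by (simp add: cm_def)
      thus "J (nv * nc + Suc v) (incv x_v' (sem w cm t))"
        unfolding ap
        using Q extends_Suc[of \<alpha> base "nv * nc + v" f "snd t a_A", OF _ val]
        by (auto simp: J_def intro!: unchanged_updates)
    qed
  qed (use nv in auto)
  have s2: "unchanged ?X {a_A} s s2" "fst s2 x_ap = int (base + n)" "extends \<alpha> base n f (snd s2 a_A)"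
    using L2 by (auto simp: J_def n_def)
  have eb: "aval w eb s2 = b" by (rule hb[OF s2(1)])
  have m: "fst s2 x_m = int (length rows)" "snd s2 a_b = snd s a_b"
    using s2(1) tab by (auto simp: unchanged_def tab_def)
  define s3 where "s3 = setv x_m (fst s2 x_m + 1) (seta a_b (length rows) b s2)"
  have "sem w (EMIT ex em eb) s = sem w (AStore a_b (Var x_m) eb ;; Assign x_m (Plus (Var x_m) (Lit 1))) s2"
    unfolding EMIT_def sem.simps(4) s2_def s1_def s0_def ci_def cm_def ..
  moreover have "bdd w B (EMIT ex em eb) s"
    unfolding EMIT_def bdd.simps(4) sem.simps(4) using L1 L2
    unfolding s2_def s1_def s0_def ci_def cm_def by (simp del: sem.simps)
  ultimately have eq: "sem w (EMIT ex em eb) s = s3" "bdd w B (EMIT ex em eb) s"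
    by (simp_all add: s3_def eb m)
  have "table n (rows @ [(f, b)]) s3" unfolding table_def
  proof (intro allI impI)
    fix r assume r: "r < length (rows @ [(f, b)])"
    show "(\<forall>i<n. snd s3 a_A (r * n + i) = fst ((rows @ [(f, b)]) ! r) i) \<and> snd s3 a_b r = snd ((rows @ [(f, b)]) ! r)"
    proof (cases "r = length rows")
      case True
      thus ?thesis using s2(3) by (simp add: s3_def extends_def base_def)
    next
      case False
      hence r': "r < length rows" using r by simp
      have "r * n + i < base" if "i < n" for i
        unfolding base_def using mult_le_mono1[of "Suc r" "length rows" n] r' that by simp
      thus ?thesis using s2(3) tab r' m(2)
        by (simp add: s3_def extends_def \<alpha>_def tab_def table_def n_def nth_append)
    qed
  qed
  moreover have "fst s3 x_m = int (length (rows @ [(f, b)]))" "fst s3 x_ap = int (length (rows @ [(f, b)]) * n)"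
    using s2(2) m(1) by (simp_all add: s3_def base_def)
  ultimately show ?thesis using eq by (simp add: tab_def n_def)
qed

section \<open>Building the table of constraints\<close>

abbreviation (input) "x_l \<equiv> 30 :: nat"
abbreviation (input) "x_p \<equiv> 31 :: nat"
abbreviation (input) "x_q \<equiv> 32 :: nat"

section \<open>Counting the left vertices confined to a set of slots\<close>

definition NEQ :: "aexp \<Rightarrow> aexp \<Rightarrow> aexp" where
  "NEQ a b = Plus (Pos (Minus a b)) (Pos (Minus b a))"

definition EQ :: "aexp \<Rightarrow> aexp \<Rightarrow> aexp" where
  "EQ a b = Minus (Lit 1) (NEQ a b)"

definition EQ2 :: "aexp \<Rightarrow> aexp \<Rightarrow> aexp \<Rightarrow> aexp \<Rightarrow> aexp" where
  "EQ2 a b c d = Minus (Lit 1) (Pos (Plus (NEQ a b) (NEQ c d)))"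

lemma aval_NEQ [simp]: "aval w (NEQ a b) s = (if aval w a s = aval w b s then 0 else 1)"
  by (simp add: NEQ_def)

lemma aval_EQ [simp]: "aval w (EQ a b) s = (if aval w a s = aval w b s then 1 else 0)"
  by (simp add: EQ_def)

lemma aval_EQ2 [simp]: "aval w (EQ2 a b c d) s =
    (if aval w a s = aval w b s \<and> aval w c s = aval w d s then 1 else 0)"
  by (simp add: EQ2_def)

definition input_at :: "int list \<Rightarrow> nat \<Rightarrow> int" where
  "input_at w i = (if i < length w then w ! i else 0)"

lemma aval_In [simp]: "aval w (In e) s = input_at w (nat (aval w e s))"
  by (simp add: input_at_def Let_def)

declare aval.simps(4) [simp del]

text \<open>The equations compare names at their positions in the input: edge \<open>e\<close> joins
  the left vertex \<open>u\<close> to the right vertex \<open>v\<close>, and \<open>u\<close> has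
  color \<open>c\<close>. So they express that \<open>v * nc + c\<close> is a slot of
  \<open>u\<close>.\<close>

definition fits :: "int list \<Rightarrow> nat \<Rightarrow> nat \<Rightarrow> nat \<Rightarrow> nat \<Rightarrow> nat \<Rightarrow> nat \<Rightarrow> nat \<Rightarrow> bool" where
  "fits w oV oE oC u e v c \<longleftrightarrow> input_at w (1 + 2 * u) = input_at w (oE + 2 * e) \<and>
     input_at w (oE + 2 * e + 1) = input_at w (oV + v) \<and> input_at w (2 + 2 * u) = input_at w (oC + c)"

text \<open>A sum of 0/1 reasons why the current edge and slot do not show that \<open>x_u\<close>
  has a slot outside the mask. It is positive if there is such a reason, and then
  \<open>GCOUNT\<close> keeps its flag.\<close>

definition VIOL :: aexp where
  "VIOL = Plus (Plus
      (NEQ (In (Plus (Lit 1) (Plus (Var x_u) (Var x_u)))) (In (Plus (Var x_oE) (Plus (Var x_e) (Var x_e)))))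
      (NEQ (In (Plus (Plus (Var x_oE) (Plus (Var x_e) (Var x_e))) (Lit 1))) (In (Plus (Var x_oV) (Var x_v')))))
     (Plus (NEQ (In (Plus (Lit 2) (Plus (Var x_u) (Var x_u)))) (In (Plus (Var x_oC) (Var x_c'))))
      (Pos (Ar a_bits (Var x_j))))"

lemma VIOL_iff:
  assumes "fst s x_u = int u" "fst s x_e = int e" "fst s x_v' = int v" "fst s x_c' = int c"
    "fst s x_oV = int oV" "fst s x_oE = int oE" "fst s x_oC = int oC" "fst s x_j = int j"
    "snd s a_bits j = int (m div 2 ^ j mod 2)"
  shows "0 < aval w VIOL s \<longleftrightarrow> \<not> fits w oV oE oC u e v c \<or> odd (m div 2 ^ j)"
proof -
  have n: "nat (1 + 2 * int u) = 1 + 2 * u" "nat (2 + 2 * int u) = 2 + 2 * u"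
    "nat (int oE + 2 * int e) = oE + 2 * e" "nat (int oE + 2 * int e + 1) = oE + 2 * e + 1"
    "nat (int oV + int v) = oV + v" "nat (int oC + int c) = oC + c" by linarith+
  have "0 < snd s a_bits j \<longleftrightarrow> odd (m div 2 ^ j)"
    unfolding assms(9) by (simp add: odd_iff_mod_2_eq_one del: of_nat_mod)
  thus ?thesis using assms(1-8) unfolding VIOL_def fits_def by (simp add: n)
qed

definition GCOUNT :: com where
  "GCOUNT = Assign x_g (Lit 0) ;;
     For x_u (Var x_nu) (Assign x_f (Lit 1) ;;
       For x_e (Var x_ne) (Assign x_j (Lit 0) ;;
         For x_v' (Var x_nv) (For x_c' (Var x_nc)
           (IfPos VIOL Skip (Assign x_f (Lit 0)) ;; Assign x_j (Plus (Var x_j) (Lit 1))))) ;;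
       Assign x_g (Plus (Var x_g) (Var x_f)))"

lemma mod_GCOUNT [simp]: "modv GCOUNT = {x_g, x_u, x_f, x_e, x_v', x_c', x_j}" "moda GCOUNT = {}"
  by (auto simp: GCOUNT_def)

text \<open>The function \<open>g\<close> of Hall's condition, at the set whose characteristic bits
  form \<open>m\<close>.\<close>

definition gval :: "int list \<Rightarrow> nat \<Rightarrow> nat \<Rightarrow> nat \<Rightarrow> nat \<Rightarrow> nat \<Rightarrow> nat \<Rightarrow> nat \<Rightarrow> nat \<Rightarrow> nat" where
  "gval w oV oE oC nu ne nv nc m = card {u. u < nu \<and>
     (\<forall>e<ne. \<forall>v<nv. \<forall>c<nc. fits w oV oE oC u e v c \<longrightarrow> odd (m div 2 ^ (v * nc + c)))}"

definition layout :: "nat \<Rightarrow> nat \<Rightarrow> nat \<Rightarrow> nat \<Rightarrow> nat \<Rightarrow> nat \<Rightarrow> nat \<Rightarrow> mem \<Rightarrow> bool" where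
  "layout oV oE oC nu ne nv nc s \<longleftrightarrow> fst s x_oV = int oV \<and> fst s x_oE = int oE \<and> fst s x_oC = int oC \<and>
     fst s x_nu = int nu \<and> fst s x_ne = int ne \<and> fst s x_nv = int nv \<and> fst s x_nc = int nc"

lemma layout_unchanged:
  "unchanged X Y s s' \<Longrightarrow> layout oV oE oC nu ne nv nc s \<Longrightarrow>
   X \<inter> {x_oV, x_oE, x_oC, x_nu, x_ne, x_nv, x_nc} = {} \<Longrightarrow> layout oV oE oC nu ne nv nc s'"
  by (auto simp: unchanged_def layout_def)

lemma all_less_Suc: "(\<forall>i<Suc n. P i) \<longleftrightarrow> (\<forall>i<n. P i) \<and> P n"
  by (auto simp: less_Suc_eq)

lemma GCOUNT_correct:
  assumes lay: "layout oV oE oC nu ne nv nc s" and B: "nu \<le> B" "ne \<le> B" "nv \<le> B" "nc \<le> B"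
    and bits: "\<forall>i<nv * nc. snd s a_bits i = int (m div 2 ^ i mod 2)"
  shows "fst (sem w GCOUNT s) x_g = int (gval w oV oE oC nu ne nv nc m) \<and> bdd w B GCOUNT s"
proof -
  let ?X = "{x_g, x_u, x_f, x_e, x_v', x_c', x_j}"
  define F where "F u e v c \<longleftrightarrow> (fits w oV oE oC u e v c \<longrightarrow> odd (m div 2 ^ (v * nc + c)))" for u e v c
  define U where "U t \<longleftrightarrow> unchanged ?X {} s t" for t
  have U_lay: "layout oV oE oC nu ne nv nc t" if "U t" for t
    using layout_unchanged[OF that[unfolded U_def] lay] by simp
  have U_bits: "snd t a_bits i = int (m div 2 ^ i mod 2)" if "U t" "i < nv * nc" for t i
    using bits that by (simp add: U_def unchanged_def)
  have U_setv: "U (setv x z t)" if "U t" "x \<in> ?X" for x z t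
    using unchanged_updates(1)[of ?X "{}" s t x z] that by (simp add: U_def)
  have U_incv: "U (incv x t)" if "U t" "x \<in> ?X" for x t
    using unchanged_updates(2)[of ?X "{}" s t x] that by (simp add: U_def)
  define c4 where "c4 = IfPos VIOL Skip (Assign x_f (Lit 0)) ;; Assign x_j (Plus (Var x_j) (Lit 1))"
  define c3 where "c3 = For x_c' (Var x_nc) c4"
  define c2 where "c2 = Assign x_j (Lit 0) ;; For x_v' (Var x_nv) c3"
  define c1 where "c1 = Assign x_f (Lit 1) ;; For x_e (Var x_ne) c2 ;; Assign x_g (Plus (Var x_g) (Var x_f))"
  have sem4: "sem w c4 t = setv x_j (fst t x_j + 1) (if 0 < aval w VIOL t then t else setv x_f 0 t)" for t
    by (simp add: c4_def)
  \<comment> \<open>\<open>p\<close> tells whether all triples treated before this loop were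
    harmless, so that the flag \<open>x_f\<close> can be followed through the nested loops.\<close>
  define Q3 where "Q3 u e v p z c t \<longleftrightarrow> U t \<and> fst t x_f = (if p \<and> (\<forall>c'<c. F u e v c') then 1 else 0) \<and>
      fst t x_j = int (v * nc + c) \<and> fst t x_u = int u \<and> fst t x_e = int e \<and> fst t x_v' = int v \<and> fst t x_g = z"
    for u e v p z c t
  have L3: "Q3 u e v p z nc (sem w c3 t) \<and> bdd w B c3 t" if Q: "Q3 u e v p z 0 t" and v: "v < nv" for u e v p z t
    unfolding c3_def
  proof (rule For_rule[where Q="Q3 u e v p z"])
    show "nat (aval w (Var x_nc) t) = nc" using U_lay[of t] Q by (simp add: Q3_def layout_def)
    show "x_c' \<notin> modv c4" by (simp add: c4_def)
    show "Q3 u e v p z 0 (setv x_c' 0 t)" using Q U_setv[of t x_c' 0] by (simp add: Q3_def)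
    fix c r assume c: "c < nc" "fst r x_c' = int c" and q: "Q3 u e v p z c r"
    have Ur: "U r" using q by (simp add: Q3_def)
    have "0 < aval w VIOL r \<longleftrightarrow> \<not> fits w oV oE oC u e v c \<or> odd (m div 2 ^ (v * nc + c))"
      by (rule VIOL_iff) (use q c U_lay[OF Ur] U_bits[OF Ur] mult_add_less[OF v c(1)] in \<open>auto simp: Q3_def layout_def\<close>)
    hence viol: "0 < aval w VIOL r \<longleftrightarrow> F u e v c" by (auto simp: F_def)
    have "bdd w B c4 r" by (simp add: c4_def)
    moreover have "U (incv x_c' (sem w c4 r))" using Ur by (auto simp: sem4 intro!: U_setv U_incv)
    ultimately show "bdd w B c4 r \<and> Q3 u e v p z (Suc c) (incv x_c' (sem w c4 r))"
      using q viol by (auto simp: Q3_def sem4 all_less_Suc)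
  qed (use B in simp)
  define Q2 where "Q2 u e p z v t \<longleftrightarrow> U t \<and> fst t x_f = (if p \<and> (\<forall>v'<v. \<forall>c'<nc. F u e v' c') then 1 else 0) \<and>
      fst t x_j = int (v * nc) \<and> fst t x_u = int u \<and> fst t x_e = int e \<and> fst t x_g = z" for u e p z v t
  have L2: "Q2 u e p z nv (sem w c2 t) \<and> bdd w B c2 t"
    if Q: "U t" "fst t x_f = (if p then 1 else 0)" "fst t x_u = int u" "fst t x_e = int e" "fst t x_g = z" for u e p z t
  proof -
    have "Q2 u e p z nv (sem w (For x_v' (Var x_nv) c3) (setv x_j 0 t)) \<and> bdd w B (For x_v' (Var x_nv) c3) (setv x_j 0 t)"
    proof (rule For_rule[where Q="Q2 u e p z"])
      show "nat (aval w (Var x_nv) (setv x_j 0 t)) = nv" using U_lay[OF Q(1)] by (simp add: layout_def)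
      show "x_v' \<notin> modv c3" by (simp add: c3_def c4_def)
      show "Q2 u e p z 0 (setv x_v' 0 (setv x_j 0 t))" using Q by (auto simp: Q2_def intro!: U_setv)
      fix v r assume v: "v < nv" "fst r x_v' = int v" and q: "Q2 u e p z v r"
      have "Q3 u e v (p \<and> (\<forall>v'<v. \<forall>c'<nc. F u e v' c')) z 0 r" using q v by (simp add: Q2_def Q3_def)
      from L3[OF this v(1)] show "bdd w B c3 r \<and> Q2 u e p z (Suc v) (incv x_v' (sem w c3 r))"
        by (auto simp: Q3_def Q2_def all_less_Suc intro!: U_incv)
    qed (use B in simp)
    thus ?thesis by (simp add: c2_def)
  qed
  define good where "good u \<longleftrightarrow> (\<forall>e<ne. \<forall>v<nv. \<forall>c<nc. F u e v c)" for u
  define Q1 where "Q1 u z e t \<longleftrightarrow> U t \<and> fst t x_f = (if \<forall>e'<e. \<forall>v<nv. \<forall>c<nc. F u e' v c then 1 else 0) \<and>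
      fst t x_u = int u \<and> fst t x_g = z" for u z e t
  have L1: "U (sem w c1 t) \<and> fst (sem w c1 t) x_g = z + (if good u then 1 else 0) \<and> bdd w B c1 t"
    if Q: "U t" "fst t x_u = int u" "fst t x_g = z" for u z t
  proof -
    let ?r = "sem w (For x_e (Var x_ne) c2) (setv x_f 1 t)"
    have "Q1 u z ne ?r \<and> bdd w B (For x_e (Var x_ne) c2) (setv x_f 1 t)"
    proof (rule For_rule[where Q="Q1 u z"])
      show "nat (aval w (Var x_ne) (setv x_f 1 t)) = ne" using U_lay[OF Q(1)] by (simp add: layout_def)
      show "x_e \<notin> modv c2" by (simp add: c2_def c3_def c4_def)
      show "Q1 u z 0 (setv x_e 0 (setv x_f 1 t))" using Q by (auto simp: Q1_def intro!: U_setv)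
      fix e r assume e: "e < ne" "fst r x_e = int e" and q: "Q1 u z e r"
      from q e(2) L2[of r "\<forall>e'<e. \<forall>v<nv. \<forall>c<nc. F u e' v c" u e z]
      show "bdd w B c2 r \<and> Q1 u z (Suc e) (incv x_e (sem w c2 r))"
        by (auto simp: Q1_def Q2_def all_less_Suc intro!: U_incv)
    qed (use B in simp)
    hence "Q1 u z ne ?r" "bdd w B (For x_e (Var x_ne) c2) (setv x_f 1 t)" by blast+
    thus ?thesis by (simp add: c1_def Q1_def good_def U_setv)
  qed
  define Q0 where "Q0 u t \<longleftrightarrow> U t \<and> fst t x_g = int (card {u'. u' < u \<and> good u'})" for u t
  have "Q0 nu (sem w (For x_u (Var x_nu) c1) (setv x_g 0 s)) \<and> bdd w B (For x_u (Var x_nu) c1) (setv x_g 0 s)"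
  proof (rule For_rule[where Q=Q0])
    show "nat (aval w (Var x_nu) (setv x_g 0 s)) = nu" using lay by (simp add: layout_def)
    show "x_u \<notin> modv c1" by (simp add: c1_def c2_def c3_def c4_def)
    show "Q0 0 (setv x_u 0 (setv x_g 0 s))"
      by (simp add: Q0_def U_setv) (simp add: U_def unchanged_def)
    fix u r assume u: "u < nu" "fst r x_u = int u" and q: "Q0 u r"
    have "{u'. u' < Suc u \<and> good u'} = (if good u then insert u {u'. u' < u \<and> good u'} else {u'. u' < u \<and> good u'})"
      by (auto simp: less_Suc_eq)
    hence "int (card {u'. u' < Suc u \<and> good u'}) = int (card {u'. u' < u \<and> good u'}) + (if good u then 1 else 0)"
      by simp
    with q u(2) L1[of r u] show "bdd w B c1 r \<and> Q0 (Suc u) (incv x_u (sem w c1 r))"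
      by (auto simp: Q0_def intro!: U_incv)
  qed (use B in simp)
  moreover have G: "GCOUNT = Assign x_g (Lit 0) ;; For x_u (Var x_nu) c1"
    by (simp add: GCOUNT_def c1_def c2_def c3_def c4_def)
  ultimately show ?thesis unfolding G by (simp add: Q0_def gval_def good_def F_def)
qed

section \<open>The rows for Hall's condition, the total, fairness and sizes\<close>

definition hall_row :: "nat \<Rightarrow> nat \<Rightarrow> (nat \<Rightarrow> nat) \<Rightarrow> nat \<Rightarrow> row" where
  "hall_row nv nc g m = ((\<lambda>i. if i < nv * nc \<and> odd (m div 2 ^ i) then 1 else 0), int (g m))"

definition total_row :: "nat \<Rightarrow> nat \<Rightarrow> nat \<Rightarrow> row" where
  "total_row nv nc nu = ((\<lambda>i. if i < nv * nc then -1 else 0), - int nu)"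

definition cap_row :: "nat \<Rightarrow> nat \<Rightarrow> int \<Rightarrow> nat \<Rightarrow> nat \<Rightarrow> row" where
  "cap_row nv nc l v c = ((\<lambda>i. if i = nv * nc + v then 1 else if i = v * nc + c then -1 else 0), - l)"

definition size_row :: "nat \<Rightarrow> nat \<Rightarrow> int \<Rightarrow> int \<Rightarrow> nat \<Rightarrow> row" where
  "size_row nv nc sg b v = ((\<lambda>i. if i < nv * nc \<and> i div nc = v then sg else 0), b)"

definition reach_row :: "nat \<Rightarrow> nat \<Rightarrow> nat \<Rightarrow> nat \<Rightarrow> row" where
  "reach_row nv nc v c = ((\<lambda>i. if i = nv * nc + v then -1 else if i = v * nc + c then 1 else 0), 0)"

definition zero_row :: "nat \<Rightarrow> nat \<Rightarrow> nat \<Rightarrow> row" where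
  "zero_row nv nc v = ((\<lambda>i. if i = nv * nc + v then -1 else 0), 0)"

text \<open>The rows that every solution has to satisfy. There is one Hall row for each set of
  slots, listed by its bit mask.\<close>

definition hard_rows :: "nat \<Rightarrow> nat \<Rightarrow> nat \<Rightarrow> (nat \<Rightarrow> nat) \<Rightarrow> int \<Rightarrow> int \<Rightarrow> int \<Rightarrow> row list" where
  "hard_rows nu nv nc g l p q = map (hall_row nv nc g) [0..<2 ^ (nv * nc)] @ [total_row nv nc nu] @
     concat (map (\<lambda>v. map (cap_row nv nc l v) [0..<nc]) [0..<nv]) @
     concat (map (\<lambda>v. [size_row nv nc 1 p v, size_row nv nc (-1) (-q) v]) [0..<nv])"

text \<open>A solution may violate some of these rows; fairness depends on which of them hold. So
  they belong to the signature but not to the liveness test.\<close>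

definition soft_rows :: "nat \<Rightarrow> nat \<Rightarrow> row list" where
  "soft_rows nv nc = concat (map (\<lambda>v. map (reach_row nv nc v) [0..<nc] @ [zero_row nv nc v]) [0..<nv])"

definition ROWS :: com where
  "ROWS = Assign x_ap (Lit 0) ;; Assign x_m (Lit 0) ;;
     For x_mask (Var x_pk) (BITS x_kap ;; GCOUNT ;; EMIT (Ar a_bits (Var x_j)) (Lit 0) (Var x_g)) ;;
     EMIT (Lit (-1)) (Lit 0) (Minus (Lit 0) (Var x_nu)) ;;
     For x_v (Var x_nv) (For x_c (Var x_nc)
       (EMIT (Minus (Lit 0) (EQ2 (Var x_v) (Var x_v') (Var x_c) (Var x_c'))) (EQ (Var x_v) (Var x_v')) (Minus (Lit 0) (Var x_l)))) ;;
     For x_v (Var x_nv) (EMIT (EQ (Var x_v) (Var x_v')) (Lit 0) (Var x_p) ;;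
       EMIT (Minus (Lit 0) (EQ (Var x_v) (Var x_v'))) (Lit 0) (Minus (Lit 0) (Var x_q))) ;;
     Assign x_mh (Var x_m) ;;
     For x_v (Var x_nv) (For x_c (Var x_nc)
       (EMIT (EQ2 (Var x_v) (Var x_v') (Var x_c) (Var x_c')) (Minus (Lit 0) (EQ (Var x_v) (Var x_v'))) (Lit 0)) ;;
       EMIT (Lit 0) (Minus (Lit 0) (EQ (Var x_v) (Var x_v'))) (Lit 0))"

lemma mod_ROWS [simp]: "modv ROWS = {x_ap, x_m, x_mask, x_t, x_h, x_i, x_g, x_u, x_f, x_e, x_v', x_c', x_j, x_v, x_c, x_mh}"
  "moda ROWS = {a_A, a_b, a_bits}"
  by (auto simp: ROWS_def)

lemma index_eq_iff: "c < nc \<Longrightarrow> c' < nc \<Longrightarrow> v * nc + c = v' * nc + c' \<longleftrightarrow> v = v' \<and> c = (c' :: nat)"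
proof
  assume c: "c < nc" "c' < nc" and eq: "v * nc + c = v' * nc + c'"
  have "v = (v * nc + c) div nc" "v' = (v' * nc + c') div nc" using c by auto
  with eq have "v = v'" by simp
  with eq show "v = v' \<and> c = c'" by simp
qed simp

lemma ROWS_correct:
  fixes w :: "int list"
  assumes lay: "layout oV oE oC nu ne nv nc s"
    and B: "nu \<le> B" "ne \<le> B" "nv \<le> B" "nc \<le> B" "2 ^ (nv * nc) \<le> B" "nv * nc \<le> B"
    and kap: "fst s x_kap = int (nv * nc)" "fst s x_pk = int (2 ^ (nv * nc))"
    and lpq: "fst s x_l = l" "fst s x_p = p" "fst s x_q = q"
  defines "hard \<equiv> hard_rows nu nv nc (gval w oV oE oC nu ne nv nc) l p q"
  shows "tab (nv * nc + nv) (hard @ soft_rows nv nc) (sem w ROWS s) \<and>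
     fst (sem w ROWS s) x_mh = int (length hard) \<and> bdd w B ROWS s"
proof -
  let ?n = "nv * nc + nv"
  let ?X = "{x_ap, x_m, x_mask, x_t, x_h, x_i, x_g, x_u, x_f, x_e, x_v', x_c', x_j, x_v, x_c, x_mh}"
  let ?Y = "{a_A, a_b, a_bits}"
  let ?g = "gval w oV oE oC nu ne nv nc"
  define U where "U t \<longleftrightarrow> unchanged ?X ?Y s t" for t
  have U_lay: "layout oV oE oC nu ne nv nc t" if "U t" for t
    using layout_unchanged[OF that[unfolded U_def] lay] by simp
  have U_val: "fst t x_l = l" "fst t x_p = p" "fst t x_q = q" "fst t x_kap = int (nv * nc)"
     "fst t x_pk = int (2 ^ (nv * nc))" "fst t x_nv = int nv" "fst t x_nc = int nc" "fst t x_nu = int nu" if "U t" for t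
    using unchangedD(1)[OF that[unfolded U_def]] kap lpq lay by (simp_all add: layout_def)
  have U_setv: "U (setv x z t)" if "U t" "x \<in> ?X" for x z t
    using unchanged_updates(1)[of ?X ?Y s t x z] that by (simp add: U_def)
  have U_incv: "U (incv x t)" if "U t" "x \<in> ?X" for x t
    using unchanged_updates(2)[of ?X ?Y s t x] that by (simp add: U_def)
  have U_sem: "U (sem w c t)" if "U t" "modv c \<subseteq> ?X" "moda c \<subseteq> ?Y" for c t
  proof -
    have "unchanged (?X \<union> modv c) (?Y \<union> moda c) s (sem w c t)"
      using unchanged_trans[OF that(1)[unfolded U_def] sem_unchanged] .
    moreover have "?X \<union> modv c = ?X" "?Y \<union> moda c = ?Y" using that by blast+
    ultimately show ?thesis by (simp add: U_def)
  qed
  have tab_setv: "tab ?n rows (setv x z t)" if "tab ?n rows t" "x \<noteq> x_m" "x \<noteq> x_ap" for rows x z t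
    using that by (simp add: tab_def table_def)
  have tab_incv: "tab ?n rows (incv x t)" if "tab ?n rows t" "x \<noteq> x_m" "x \<noteq> x_ap" for rows x t
    using that by (simp add: tab_def table_def)
  have EMIT: "(tab ?n (rows @ [r]) (sem w (EMIT ex em eb) t) \<and> U (sem w (EMIT ex em eb) t)) \<and> bdd w B (EMIT ex em eb) t"
    if "U t" "tab ?n rows t"
      and hx: "\<And>t' v c. unchanged {x_v', x_c', x_j, x_ap} {a_A} t t' \<Longrightarrow> v < nv \<Longrightarrow> c < nc \<Longrightarrow>
       fst t' x_v' = int v \<Longrightarrow> fst t' x_c' = int c \<Longrightarrow> fst t' x_j = int (v * nc + c) \<Longrightarrow> aval w ex t' = fst r (v * nc + c)"
      and hm: "\<And>t' v. unchanged {x_v', x_c', x_j, x_ap} {a_A} t t' \<Longrightarrow> v < nv \<Longrightarrow> fst t' x_v' = int v \<Longrightarrow>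
       aval w em t' = fst r (nv * nc + v)"
      and hb: "\<And>t'. unchanged {x_v', x_c', x_j, x_ap} {a_A} t t' \<Longrightarrow> aval w eb t' = snd r"
    for rows r t ex em eb
    using EMIT_correct[of t nv B nc rows w ex "fst r" em eb "snd r"] that U_val B U_sem[OF that(1), of "EMIT ex em eb"]
    by simp
  define s0 where "s0 = setv x_m 0 (setv x_ap 0 s)"
  define H where "H k = map (hall_row nv nc ?g) [0..<k]" for k
  define b1 where "b1 = BITS x_kap ;; GCOUNT ;; EMIT (Ar a_bits (Var x_j)) (Lit 0) (Var x_g)"
  define s1 where "s1 = sem w (For x_mask (Var x_pk) b1) s0"
  have "U s0" by (simp add: s0_def U_def unchanged_def)
  have "(tab ?n (H (2 ^ (nv * nc))) s1 \<and> U s1) \<and> bdd w B (For x_mask (Var x_pk) b1) s0"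
    unfolding s1_def
  proof (rule For_rule[where Q="\<lambda>k t. tab ?n (H k) t \<and> U t"])
    show "nat (aval w (Var x_pk) s0) = 2 ^ (nv * nc)" using U_val(5)[OF \<open>U s0\<close>] by (simp add: nat_power_eq)
    show "x_mask \<notin> modv b1" by (simp add: b1_def)
    show "tab ?n (H 0) (setv x_mask 0 s0) \<and> U (setv x_mask 0 s0)"
      using U_setv[OF \<open>U s0\<close>] by (simp add: H_def tab_def table_def s0_def)
    fix k t assume k: "fst t x_mask = int k" and Q: "tab ?n (H k) t \<and> U t"
    define t1 where "t1 = sem w (BITS x_kap) t"
    have b: "\<forall>i<nv * nc. snd t1 a_bits i = int (k div 2 ^ i mod 2)" "bdd w B (BITS x_kap) t"
      unfolding t1_def using BITS_correct[OF k, of x_kap "nv * nc" B w] U_val(4) Q B by auto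
    have U1: "U t1" unfolding t1_def using Q by (intro U_sem) auto
    define t2 where "t2 = sem w GCOUNT t1"
    have g: "fst t2 x_g = int (?g k)" "bdd w B GCOUNT t1"
      unfolding t2_def using GCOUNT_correct[OF U_lay[OF U1] B(1-4) b(1)] by auto
    have U2: "U t2" unfolding t2_def using U1 by (intro U_sem) auto
    have bits2: "\<forall>i<nv * nc. snd t2 a_bits i = int (k div 2 ^ i mod 2)"
      using b(1) unchangedD(2)[OF sem_unchanged, of a_bits GCOUNT w t1] by (simp add: t2_def)
    have tab2: "tab ?n (H k) t2"
      using Q unchangedD[OF sem_unchanged[of GCOUNT t1 w]] unchangedD[OF sem_unchanged[of "BITS x_kap" t w]]
      by (simp add: tab_def table_def t2_def t1_def)
    have e: "(tab ?n (H k @ [hall_row nv nc ?g k]) (sem w (EMIT (Ar a_bits (Var x_j)) (Lit 0) (Var x_g)) t2) \<and>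
        U (sem w (EMIT (Ar a_bits (Var x_j)) (Lit 0) (Var x_g)) t2)) \<and> bdd w B (EMIT (Ar a_bits (Var x_j)) (Lit 0) (Var x_g)) t2"
    proof (rule EMIT[OF U2 tab2])
      fix t' v c assume a: "unchanged {x_v', x_c', x_j, x_ap} {a_A} t2 t'" "v < nv" "c < nc" "fst t' x_j = int (v * nc + c)"
      have j: "nat (fst t' x_j) = v * nc + c" unfolding a(4) by (rule nat_int)
      have "snd t' a_bits (v * nc + c) = int (k div 2 ^ (v * nc + c) mod 2)"
        using unchangedD(2)[OF a(1), of a_bits] bits2 mult_add_less[OF a(2,3)] by simp
      thus "aval w (Ar a_bits (Var x_j)) t' = fst (hall_row nv nc ?g k) (v * nc + c)"
        using mult_add_less[OF a(2,3)] unfolding aval.simps j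
        by (simp add: hall_row_def odd_iff_mod_2_eq_one del: of_nat_mod)
    next
      fix t' assume a: "unchanged {x_v', x_c', x_j, x_ap} {a_A} t2 t'"
      show "aval w (Var x_g) t' = snd (hall_row nv nc ?g k)"
        using unchangedD(1)[OF a, of x_g] g(1) by (simp add: hall_row_def)
    qed (simp add: hall_row_def)
    have "sem w b1 t = sem w (EMIT (Ar a_bits (Var x_j)) (Lit 0) (Var x_g)) t2" by (simp add: b1_def t2_def t1_def)
    moreover have "bdd w B b1 t" using b(2) g(2) e by (simp add: b1_def t2_def t1_def)
    ultimately show "bdd w B b1 t \<and> tab ?n (H (Suc k)) (incv x_mask (sem w b1 t)) \<and> U (incv x_mask (sem w b1 t))"
      using e by (auto simp: H_def intro!: tab_incv U_incv)
  qed (use B in simp)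
  hence s1: "tab ?n (H (2 ^ (nv * nc))) s1" "U s1" "bdd w B (For x_mask (Var x_pk) b1) s0" by blast+
  define e2 where "e2 = EMIT (Lit (-1)) (Lit 0) (Minus (Lit 0) (Var x_nu))"
  define s2 where "s2 = sem w e2 s1"
  define R2 where "R2 = H (2 ^ (nv * nc)) @ [total_row nv nc nu]"
  have s2: "(tab ?n R2 s2 \<and> U s2) \<and> bdd w B e2 s1"
    unfolding R2_def s2_def e2_def
  proof (rule EMIT[OF s1(2,1)])
    fix t' assume "unchanged {x_v', x_c', x_j, x_ap} {a_A} s1 t'"
    from unchangedD(1)[OF this, of x_nu] U_val[OF s1(2)]
    show "aval w (Minus (Lit 0) (Var x_nu)) t' = snd (total_row nv nc nu)" by (simp add: total_row_def)
  qed (auto simp: total_row_def dest: mult_add_less)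
  have vc: "fst t' x_v = fst t x_v" "fst t' x_c = fst t x_c" "fst t' x_l = fst t x_l" "fst t' x_p = fst t x_p" "fst t' x_q = fst t x_q"
    if "unchanged {x_v', x_c', x_j, x_ap} {a_A} t t'" for t t'
    using unchangedD(1)[OF that] by simp_all
  define e3 where "e3 = EMIT (Minus (Lit 0) (EQ2 (Var x_v) (Var x_v') (Var x_c) (Var x_c'))) (EQ (Var x_v) (Var x_v')) (Minus (Lit 0) (Var x_l))"
  define s3 where "s3 = sem w (For x_v (Var x_nv) (For x_c (Var x_nc) e3)) s2"
  define C3 where "C3 k = concat (map (\<lambda>v. map (cap_row nv nc l v) [0..<nc]) [0..<k])" for k
  have nm: "v * nc + c \<noteq> nv * nc + v'" if "v < nv" "c < nc" for v c v'
    using mult_add_less[OF that] by simp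
  have "(tab ?n (R2 @ C3 nv) s3 \<and> U s3) \<and> bdd w B (For x_v (Var x_nv) (For x_c (Var x_nc) e3)) s2"
    unfolding s3_def
  proof (rule For_rule[where Q="\<lambda>k t. tab ?n (R2 @ C3 k) t \<and> U t"])
    show "nat (aval w (Var x_nv) s2) = nv" using U_val s2 by simp
    show "x_v \<notin> modv (For x_c (Var x_nc) e3)" by (simp add: e3_def)
    show "tab ?n (R2 @ C3 0) (setv x_v 0 s2) \<and> U (setv x_v 0 s2)"
      using s2 by (auto simp: C3_def intro!: tab_setv U_setv)
    fix v t assume v: "v < nv" "fst t x_v = int v" and Q: "tab ?n (R2 @ C3 v) t \<and> U t"
    let ?t = "sem w (For x_c (Var x_nc) e3) t"
    have "(tab ?n (R2 @ C3 v @ map (cap_row nv nc l v) [0..<nc]) ?t \<and> U ?t \<and> fst ?t x_v = int v) \<and> bdd w B (For x_c (Var x_nc) e3) t"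
    proof (rule For_rule[where Q="\<lambda>c t. tab ?n (R2 @ C3 v @ map (cap_row nv nc l v) [0..<c]) t \<and> U t \<and> fst t x_v = int v"])
      show "nat (aval w (Var x_nc) t) = nc" using U_val Q by simp
      show "x_c \<notin> modv e3" by (simp add: e3_def)
      show "tab ?n (R2 @ C3 v @ map (cap_row nv nc l v) [0..<0]) (setv x_c 0 t) \<and> U (setv x_c 0 t) \<and> fst (setv x_c 0 t) x_v = int v"
        using Q v by (auto intro!: tab_setv U_setv)
      fix c r assume c: "c < nc" "fst r x_c = int c"
        and q: "tab ?n (R2 @ C3 v @ map (cap_row nv nc l v) [0..<c]) r \<and> U r \<and> fst r x_v = int v"
      have "(tab ?n ((R2 @ C3 v @ map (cap_row nv nc l v) [0..<c]) @ [cap_row nv nc l v c]) (sem w e3 r) \<and> U (sem w e3 r)) \<and> bdd w B e3 r"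
        unfolding e3_def
      proof (rule EMIT)
        fix t' v1 c1 assume a: "unchanged {x_v', x_c', x_j, x_ap} {a_A} r t'" "v1 < nv" "c1 < nc" "fst t' x_v' = int v1" "fst t' x_c' = int c1"
        show "aval w (Minus (Lit 0) (EQ2 (Var x_v) (Var x_v') (Var x_c) (Var x_c'))) t' = fst (cap_row nv nc l v c) (v1 * nc + c1)"
          using a q c vc[OF a(1)] nm[OF a(2,3)] index_eq_iff[OF a(3) c(1), of v1 v] by (auto simp: cap_row_def)
      next
        fix t' v1 assume a: "unchanged {x_v', x_c', x_j, x_ap} {a_A} r t'" "v1 < nv" "fst t' x_v' = int v1"
        show "aval w (EQ (Var x_v) (Var x_v')) t' = fst (cap_row nv nc l v c) (nv * nc + v1)"
          using a q vc[OF a(1)] nm[OF v(1) c(1), of v1] by (auto simp: cap_row_def)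
      next
        fix t' assume a: "unchanged {x_v', x_c', x_j, x_ap} {a_A} r t'"
        show "aval w (Minus (Lit 0) (Var x_l)) t' = snd (cap_row nv nc l v c)"
          using U_val(1)[of r] q vc[OF a] by (simp add: cap_row_def)
      qed (use q in auto)
      moreover have "fst (sem w e3 r) x_v = fst r x_v"
        using unchangedD(1)[OF sem_unchanged[of e3 r w], of x_v] by (simp add: e3_def)
      ultimately show "bdd w B e3 r \<and> tab ?n (R2 @ C3 v @ map (cap_row nv nc l v) [0..<Suc c]) (incv x_c (sem w e3 r)) \<and>
           U (incv x_c (sem w e3 r)) \<and> fst (incv x_c (sem w e3 r)) x_v = int v"
        using q by (auto intro!: tab_incv U_incv)
    qed (use B in simp)
    thus "bdd w B (For x_c (Var x_nc) e3) t \<and> tab ?n (R2 @ C3 (Suc v)) (incv x_v ?t) \<and> U (incv x_v ?t)"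
      by (auto simp: C3_def intro!: tab_incv U_incv)
  qed (use B in simp)
  hence s3: "tab ?n (R2 @ C3 nv) s3" "U s3" "bdd w B (For x_v (Var x_nv) (For x_c (Var x_nc) e3)) s2" by blast+
  define e4 where "e4 = EMIT (EQ (Var x_v) (Var x_v')) (Lit 0) (Var x_p)"
  define e5 where "e5 = EMIT (Minus (Lit 0) (EQ (Var x_v) (Var x_v'))) (Lit 0) (Minus (Lit 0) (Var x_q))"
  define s4 where "s4 = sem w (For x_v (Var x_nv) (e4 ;; e5)) s3"
  define C4 where "C4 k = concat (map (\<lambda>v. [size_row nv nc 1 p v, size_row nv nc (-1) (-q) v]) [0..<k])" for k
  have dv: "(v1 * nc + c1) div nc = v1" if "c1 < nc" for v1 c1 using that by simp
  have "(tab ?n ((R2 @ C3 nv) @ C4 nv) s4 \<and> U s4) \<and> bdd w B (For x_v (Var x_nv) (e4 ;; e5)) s3"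
    unfolding s4_def
  proof (rule For_rule[where Q="\<lambda>k t. tab ?n ((R2 @ C3 nv) @ C4 k) t \<and> U t"])
    show "nat (aval w (Var x_nv) s3) = nv" using U_val s3 by simp
    show "x_v \<notin> modv (e4 ;; e5)" by (simp add: e4_def e5_def)
    show "tab ?n ((R2 @ C3 nv) @ C4 0) (setv x_v 0 s3) \<and> U (setv x_v 0 s3)"
      using s3 by (auto simp: C4_def intro!: tab_setv U_setv)
    fix v t assume v: "v < nv" "fst t x_v = int v" and Q: "tab ?n ((R2 @ C3 nv) @ C4 v) t \<and> U t"
    have 4: "(tab ?n (((R2 @ C3 nv) @ C4 v) @ [size_row nv nc 1 p v]) (sem w e4 t) \<and> U (sem w e4 t)) \<and> bdd w B e4 t"
      unfolding e4_def
    proof (rule EMIT)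
      fix t' v1 c1 assume a: "unchanged {x_v', x_c', x_j, x_ap} {a_A} t t'" "v1 < nv" "c1 < nc" "fst t' x_v' = int v1"
      show "aval w (EQ (Var x_v) (Var x_v')) t' = fst (size_row nv nc 1 p v) (v1 * nc + c1)"
        using a v vc[OF a(1)] mult_add_less[OF a(2,3)] dv[OF a(3), of v1] by (auto simp: size_row_def)
    next
      fix t' assume a: "unchanged {x_v', x_c', x_j, x_ap} {a_A} t t'"
      show "aval w (Var x_p) t' = snd (size_row nv nc 1 p v)"
        using U_val(2)[of t] Q vc[OF a] by (simp add: size_row_def)
    qed (use Q in \<open>auto simp: size_row_def\<close>)
    have v4: "fst (sem w e4 t) x_v = int v"
      using unchangedD(1)[OF sem_unchanged[of e4 t w], of x_v] v(2) by (simp add: e4_def)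
    have 5: "(tab ?n ((((R2 @ C3 nv) @ C4 v) @ [size_row nv nc 1 p v]) @ [size_row nv nc (-1) (-q) v]) (sem w e5 (sem w e4 t)) \<and>
        U (sem w e5 (sem w e4 t))) \<and> bdd w B e5 (sem w e4 t)"
      unfolding e5_def
    proof (rule EMIT)
      fix t' v1 c1 assume a: "unchanged {x_v', x_c', x_j, x_ap} {a_A} (sem w e4 t) t'" "v1 < nv" "c1 < nc" "fst t' x_v' = int v1"
      show "aval w (Minus (Lit 0) (EQ (Var x_v) (Var x_v'))) t' = fst (size_row nv nc (-1) (-q) v) (v1 * nc + c1)"
        using a v4 vc[OF a(1)] mult_add_less[OF a(2,3)] dv[OF a(3), of v1] by (auto simp: size_row_def)
    next
      fix t' assume a: "unchanged {x_v', x_c', x_j, x_ap} {a_A} (sem w e4 t) t'"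
      show "aval w (Minus (Lit 0) (Var x_q)) t' = snd (size_row nv nc (-1) (-q) v)"
        using U_val(3)[of "sem w e4 t"] 4 vc[OF a] by (simp add: size_row_def)
    qed (use 4 in \<open>auto simp: size_row_def\<close>)
    have "sem w (e4 ;; e5) t = sem w e5 (sem w e4 t)" "bdd w B (e4 ;; e5) t" using 4 5 by simp_all
    thus "bdd w B (e4 ;; e5) t \<and> tab ?n ((R2 @ C3 nv) @ C4 (Suc v)) (incv x_v (sem w (e4 ;; e5) t)) \<and> U (incv x_v (sem w (e4 ;; e5) t))"
      using 5 by (auto simp: C4_def intro!: tab_incv U_incv)
  qed (use B in simp)
  moreover have hard: "(R2 @ C3 nv) @ C4 nv = hard"
    by (simp add: R2_def C3_def C4_def H_def hard_def hard_rows_def)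
  ultimately have s4: "tab ?n hard s4" "U s4" "bdd w B (For x_v (Var x_nv) (e4 ;; e5)) s3" by simp_all
  define s5 where "s5 = setv x_mh (fst s4 x_m) s4"
  have s5: "tab ?n hard s5" "U s5" "fst s5 x_mh = int (length hard)"
    using s4 by (auto simp: s5_def tab_def intro!: U_setv) (simp add: table_def)
  define e6 where "e6 = EMIT (EQ2 (Var x_v) (Var x_v') (Var x_c) (Var x_c')) (Minus (Lit 0) (EQ (Var x_v) (Var x_v'))) (Lit 0)"
  define e7 where "e7 = EMIT (Lit 0) (Minus (Lit 0) (EQ (Var x_v) (Var x_v'))) (Lit 0)"
  define s6 where "s6 = sem w (For x_v (Var x_nv) (For x_c (Var x_nc) e6 ;; e7)) s5"
  define C6 where "C6 k = concat (map (\<lambda>v. map (reach_row nv nc v) [0..<nc] @ [zero_row nv nc v]) [0..<k])" for k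
  have "(tab ?n (hard @ C6 nv) s6 \<and> U s6) \<and> bdd w B (For x_v (Var x_nv) (For x_c (Var x_nc) e6 ;; e7)) s5"
    unfolding s6_def
  proof (rule For_rule[where Q="\<lambda>k t. tab ?n (hard @ C6 k) t \<and> U t"])
    show "nat (aval w (Var x_nv) s5) = nv" using U_val s5 by simp
    show "x_v \<notin> modv (For x_c (Var x_nc) e6 ;; e7)" by (simp add: e6_def e7_def)
    show "tab ?n (hard @ C6 0) (setv x_v 0 s5) \<and> U (setv x_v 0 s5)"
      using s5 by (auto simp: C6_def intro!: tab_setv U_setv)
    fix v t assume v: "v < nv" "fst t x_v = int v" and Q: "tab ?n (hard @ C6 v) t \<and> U t"
    let ?t = "sem w (For x_c (Var x_nc) e6) t"
    have 6: "(tab ?n (hard @ C6 v @ map (reach_row nv nc v) [0..<nc]) ?t \<and> U ?t \<and> fst ?t x_v = int v) \<and> bdd w B (For x_c (Var x_nc) e6) t"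
    proof (rule For_rule[where Q="\<lambda>c t. tab ?n (hard @ C6 v @ map (reach_row nv nc v) [0..<c]) t \<and> U t \<and> fst t x_v = int v"])
      show "nat (aval w (Var x_nc) t) = nc" using U_val Q by simp
      show "x_c \<notin> modv e6" by (simp add: e6_def)
      show "tab ?n (hard @ C6 v @ map (reach_row nv nc v) [0..<0]) (setv x_c 0 t) \<and> U (setv x_c 0 t) \<and> fst (setv x_c 0 t) x_v = int v"
        using Q v by (auto intro!: tab_setv U_setv)
      fix c r assume c: "c < nc" "fst r x_c = int c"
        and q: "tab ?n (hard @ C6 v @ map (reach_row nv nc v) [0..<c]) r \<and> U r \<and> fst r x_v = int v"
      have "(tab ?n ((hard @ C6 v @ map (reach_row nv nc v) [0..<c]) @ [reach_row nv nc v c]) (sem w e6 r) \<and> U (sem w e6 r)) \<and> bdd w B e6 r"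
        unfolding e6_def
      proof (rule EMIT)
        fix t' v1 c1 assume a: "unchanged {x_v', x_c', x_j, x_ap} {a_A} r t'" "v1 < nv" "c1 < nc" "fst t' x_v' = int v1" "fst t' x_c' = int c1"
        show "aval w (EQ2 (Var x_v) (Var x_v') (Var x_c) (Var x_c')) t' = fst (reach_row nv nc v c) (v1 * nc + c1)"
          using a q c vc[OF a(1)] nm[OF a(2,3)] index_eq_iff[OF a(3) c(1), of v1 v] by (auto simp: reach_row_def)
      next
        fix t' v1 assume a: "unchanged {x_v', x_c', x_j, x_ap} {a_A} r t'" "v1 < nv" "fst t' x_v' = int v1"
        show "aval w (Minus (Lit 0) (EQ (Var x_v) (Var x_v'))) t' = fst (reach_row nv nc v c) (nv * nc + v1)"
          using a q vc[OF a(1)] nm[OF v(1) c(1), of v1] by (auto simp: reach_row_def)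
      qed (use q in \<open>auto simp: reach_row_def\<close>)
      moreover have "fst (sem w e6 r) x_v = fst r x_v"
        using unchangedD(1)[OF sem_unchanged[of e6 r w], of x_v] by (simp add: e6_def)
      ultimately show "bdd w B e6 r \<and> tab ?n (hard @ C6 v @ map (reach_row nv nc v) [0..<Suc c]) (incv x_c (sem w e6 r)) \<and>
           U (incv x_c (sem w e6 r)) \<and> fst (incv x_c (sem w e6 r)) x_v = int v"
        using q by (auto intro!: tab_incv U_incv)
    qed (use B in simp)
    have 7: "(tab ?n ((hard @ C6 v @ map (reach_row nv nc v) [0..<nc]) @ [zero_row nv nc v]) (sem w e7 ?t) \<and> U (sem w e7 ?t)) \<and> bdd w B e7 ?t"
      unfolding e7_def
    proof (rule EMIT)
      fix t' v1 c1 assume a: "v1 < nv" "c1 < nc"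
      show "aval w (Lit 0) t' = fst (zero_row nv nc v) (v1 * nc + c1)"
        using nm[OF a] by (auto simp: zero_row_def)
    next
      fix t' v1 assume a: "unchanged {x_v', x_c', x_j, x_ap} {a_A} ?t t'" "v1 < nv" "fst t' x_v' = int v1"
      show "aval w (Minus (Lit 0) (EQ (Var x_v) (Var x_v'))) t' = fst (zero_row nv nc v) (nv * nc + v1)"
        using a 6 vc[OF a(1)] by (auto simp: zero_row_def)
    qed (use 6 in \<open>auto simp: zero_row_def\<close>)
    have "sem w (For x_c (Var x_nc) e6 ;; e7) t = sem w e7 ?t" "bdd w B (For x_c (Var x_nc) e6 ;; e7) t" using 6 7 by simp_all
    thus "bdd w B (For x_c (Var x_nc) e6 ;; e7) t \<and> tab ?n (hard @ C6 (Suc v)) (incv x_v (sem w (For x_c (Var x_nc) e6 ;; e7) t)) \<and>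
        U (incv x_v (sem w (For x_c (Var x_nc) e6 ;; e7) t))"
      using 7 by (auto simp: C6_def intro!: tab_incv U_incv)
  qed (use B in simp)
  hence s6: "tab ?n (hard @ C6 nv) s6" "bdd w B (For x_v (Var x_nv) (For x_c (Var x_nc) e6 ;; e7)) s5" by blast+
  have R: "ROWS = Assign x_ap (Lit 0) ;; Assign x_m (Lit 0) ;; For x_mask (Var x_pk) b1 ;; e2 ;;
     For x_v (Var x_nv) (For x_c (Var x_nc) e3) ;; For x_v (Var x_nv) (e4 ;; e5) ;; Assign x_mh (Var x_m) ;;
     For x_v (Var x_nv) (For x_c (Var x_nc) e6 ;; e7)"
    by (simp only: ROWS_def b1_def e2_def e3_def e4_def e5_def e6_def e7_def)
  have "sem w ROWS s = s6" unfolding R by (simp add: s6_def s5_def s4_def s3_def s2_def s1_def s0_def)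
  moreover have "bdd w B ROWS s" unfolding R
    using s1(3) s2 s3(3) s4(3) s6(2) by (simp add: s6_def s5_def s4_def s3_def s2_def s1_def s0_def)
  moreover have "fst s6 x_mh = fst s5 x_mh"
    unfolding s6_def using unchangedD(1)[OF sem_unchanged[of "For x_v (Var x_nv) (For x_c (Var x_nc) e6 ;; e7)" s5 w], of x_mh]
    by (simp add: e6_def e7_def)
  ultimately show ?thesis using s6(1) s5(3) by (simp add: C6_def soft_rows_def)
qed

section \<open>The search program\<close>

abbreviation (input) "x_D \<equiv> 33 :: nat"
abbreviation (input) "x_ND \<equiv> 34 :: nat"
abbreviation (input) "x_lv \<equiv> 35 :: nat"
abbreviation (input) "x_rp \<equiv> 36 :: nat"
abbreviation (input) "x_cl \<equiv> 37 :: nat"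
abbreviation (input) "x_cn \<equiv> 38 :: nat"
abbreviation (input) "x_pb \<equiv> 39 :: nat"
abbreviation (input) "x_pe \<equiv> 40 :: nat"
abbreviation (input) "x_nb \<equiv> 41 :: nat"
abbreviation (input) "x_ok \<equiv> 42 :: nat"
abbreviation (input) "x_s \<equiv> 43 :: nat"
abbreviation (input) "x_qp \<equiv> 44 :: nat"
abbreviation (input) "x_r \<equiv> 45 :: nat"
abbreviation (input) "x_r2 \<equiv> 46 :: nat"
abbreviation (input) "x_df \<equiv> 47 :: nat"
abbreviation (input) "x_cnt \<equiv> 48 :: nat"
abbreviation (input) "x_sp \<equiv> 49 :: nat"
abbreviation (input) "x_aq \<equiv> 50 :: nat"
abbreviation (input) "a_Q \<equiv> 4 :: nat"
abbreviation (input) "a_S \<equiv> 5 :: nat"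
abbreviation (input) "a_z \<equiv> 6 :: nat"
abbreviation (input) "a_sig \<equiv> 7 :: nat"

text \<open>The coefficients are 0, 1 or -1, so a case distinction replaces each product. Liveness
  is tested only for the first \<open>x_mh\<close> rows, the hard ones, and before the slack is
  clipped.\<close>

definition SIG :: com where
  "SIG = Assign x_ok (Lit 1) ;; Assign x_aq (Lit 0) ;;
     For x_j (Var x_m) (Assign x_s (Minus (Lit 0) (Ar a_b (Var x_j))) ;;
       For x_i (Var x_n) (IfPos (Ar a_A (Var x_aq)) (Assign x_s (Plus (Var x_s) (Ar a_z (Var x_i))))
         (IfPos (Minus (Lit 0) (Ar a_A (Var x_aq))) (Assign x_s (Minus (Var x_s) (Ar a_z (Var x_i)))) Skip) ;;
         Assign x_aq (Plus (Var x_aq) (Lit 1))) ;;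
       IfPos (Minus (Var x_mh) (Var x_j))
         (IfPos (Minus (Lit 0) (Minus (Plus (Var x_s) (Var x_ND)) (Plus (Var x_n) (Lit 1)))) (Assign x_ok (Lit 0)) Skip) Skip ;;
       IfPos (Minus (Var x_s) (Var x_ND)) (Assign x_s (Var x_ND))
         (IfPos (Minus (Minus (Lit 0) (Var x_ND)) (Var x_s)) (Assign x_s (Minus (Lit 0) (Var x_ND))) Skip) ;;
       AStore a_sig (Var x_j) (Var x_s))"

lemma mod_SIG [simp]: "modv SIG = {x_ok, x_aq, x_j, x_s, x_i}" "moda SIG = {a_sig}"
  by (auto simp: SIG_def)

text \<open>The data that stay fixed while one level is computed.\<close>

definition static :: "nat \<Rightarrow> row list \<Rightarrow> row list \<Rightarrow> int \<Rightarrow> mem \<Rightarrow> bool" where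
  "static n hs rows D s \<longleftrightarrow> table n rows s \<and> fst s x_n = int n \<and> fst s x_m = int (length rows) \<and>
     fst s x_mh = int (length hs) \<and> fst s x_D = D \<and> fst s x_ND = (int n + 1) * D"

lemma static_unchanged:
  "unchanged X Y s s' \<Longrightarrow> static n hs rows D s \<Longrightarrow> X \<inter> {x_n, x_m, x_mh, x_D, x_ND} = {} \<Longrightarrow> Y \<inter> {a_A, a_b} = {} \<Longrightarrow>
   static n hs rows D s'"
  by (auto simp: unchanged_def static_def table_def)

definition unit_rows :: "nat \<Rightarrow> row list \<Rightarrow> bool" where
  "unit_rows n rows \<longleftrightarrow> (\<forall>r\<in>set rows. \<forall>i<n. fst r i = 0 \<or> fst r i = 1 \<or> fst r i = -1)"

lemma SIG_correct:
  assumes st: "static n hs rows D s" and rows: "rows = hs @ ss" and u: "unit_rows n rows"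
    and z: "\<forall>i<n. snd s a_z i = z i" and B: "n \<le> B" "length rows \<le> B"
  defines "K \<equiv> (int n + 1) * D"
  shows "fst (sem w SIG s) x_ok = (if live n K hs z then 1 else 0) \<and>
     (\<forall>j<length rows. snd (sem w SIG s) a_sig j = signature n K rows z ! j) \<and> bdd w B SIG s"
proof -
  let ?X = "{x_ok, x_aq, x_j, x_s, x_i}"
  define U where "U t \<longleftrightarrow> unchanged ?X {a_sig} s t" for t
  have U_st: "static n hs rows D t" if "U t" for t
    using static_unchanged[OF that[unfolded U_def] st] by simp
  have U_z: "snd t a_z i = z i" if "U t" "i < n" for t i
    using unchangedD(2)[OF that(1)[unfolded U_def], of a_z] z that(2) by simp
  have U_setv: "U (setv x y t)" if "U t" "x \<in> ?X" for x y t
    using unchanged_updates(1)[of ?X "{a_sig}" s t x y] that by (simp add: U_def)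
  have U_incv: "U (incv x t)" if "U t" "x \<in> ?X" for x t
    using unchanged_updates(2)[of ?X "{a_sig}" s t x] that by (simp add: U_def)
  have U_seta: "U (seta a_sig i y t)" if "U t" for i y t
    using unchanged_updates(3)[of ?X "{a_sig}" s t a_sig i y] that by (simp add: U_def)
  define ci where "ci = IfPos (Ar a_A (Var x_aq)) (Assign x_s (Plus (Var x_s) (Ar a_z (Var x_i))))
         (IfPos (Minus (Lit 0) (Ar a_A (Var x_aq))) (Assign x_s (Minus (Var x_s) (Ar a_z (Var x_i)))) Skip) ;;
         Assign x_aq (Plus (Var x_aq) (Lit 1))"
  define ck where "ck = IfPos (Minus (Var x_mh) (Var x_j))
         (IfPos (Minus (Lit 0) (Minus (Plus (Var x_s) (Var x_ND)) (Plus (Var x_n) (Lit 1)))) (Assign x_ok (Lit 0)) Skip) Skip ;;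
       IfPos (Minus (Var x_s) (Var x_ND)) (Assign x_s (Var x_ND))
         (IfPos (Minus (Minus (Lit 0) (Var x_ND)) (Var x_s)) (Assign x_s (Minus (Lit 0) (Var x_ND))) Skip) ;;
       AStore a_sig (Var x_j) (Var x_s)"
  define cj where "cj = Assign x_s (Minus (Lit 0) (Ar a_b (Var x_j))) ;; For x_i (Var x_n) ci ;; ck"
  define Qi where "Qi j ok \<sigma> i t \<longleftrightarrow> U t \<and> fst t x_s = (\<Sum>i'<i. fst (rows ! j) i' * z i') - snd (rows ! j) \<and>
      fst t x_aq = int (j * n + i) \<and> fst t x_j = int j \<and> fst t x_ok = ok \<and> snd t a_sig = \<sigma>" for j ok \<sigma> i t
  have Li: "Qi j ok \<sigma> n (sem w (For x_i (Var x_n) ci) t) \<and> bdd w B (For x_i (Var x_n) ci) t"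
    if j: "j < length rows" and Q: "Qi j ok \<sigma> 0 t" for j ok \<sigma> t
  proof (rule For_rule[where Q="Qi j ok \<sigma>"])
    show "nat (aval w (Var x_n) t) = n" using U_st[of t] Q by (simp add: Qi_def static_def)
    show "x_i \<notin> modv ci" by (simp add: ci_def)
    show "Qi j ok \<sigma> 0 (setv x_i 0 t)" using Q U_setv[of t x_i 0] by (simp add: Qi_def)
    fix i r assume i: "i < n" "fst r x_i = int i" and q: "Qi j ok \<sigma> i r"
    have Ur: "U r" using q by (simp add: Qi_def)
    define a where "a = fst (rows ! j) i"
    have a: "a = 0 \<or> a = 1 \<or> a = -1" using u j i(1) by (simp add: unit_rows_def a_def)
    have aq: "nat (fst r x_aq) = j * n + i" using q by (simp only: Qi_def nat_int)
    have ar: "snd r a_A (j * n + i) = a" using U_st[OF Ur] j i(1) by (simp add: static_def table_def a_def)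
    have zi: "snd r a_z i = z i" by (rule U_z[OF Ur i(1)])
    have "sem w ci r = setv x_aq (fst r x_aq + 1) (setv x_s (fst r x_s + a * z i) r) \<or>
        a = 0 \<and> sem w ci r = setv x_aq (fst r x_aq + 1) r"
      using a by (auto simp: ci_def aq ar zi i(2))
    moreover have "bdd w B ci r" by (simp add: ci_def)
    ultimately show "bdd w B ci r \<and> Qi j ok \<sigma> (Suc i) (incv x_i (sem w ci r))"
      using q by (elim disjE) (auto simp: Qi_def a_def intro!: U_setv U_incv)
  qed (use B in simp)
  define lv where "lv j \<longleftrightarrow> (\<forall>j'<j. j' < length hs \<longrightarrow> 0 \<le> row_val n (rows ! j') z + K - (int n + 1))" for j
  define Qj where "Qj j t \<longleftrightarrow> U t \<and> fst t x_ok = (if lv j then 1 else 0) \<and> fst t x_aq = int (j * n) \<and>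
      (\<forall>j'<j. snd t a_sig j' = signature n K rows z ! j')" for j t
  define s0 where "s0 = setv x_aq 0 (setv x_ok 1 s)"
  have "Qj (length rows) (sem w (For x_j (Var x_m) cj) s0) \<and> bdd w B (For x_j (Var x_m) cj) s0"
  proof (rule For_rule[where Q=Qj])
    show "nat (aval w (Var x_m) s0) = length rows" using st by (simp add: s0_def static_def)
    show "x_j \<notin> modv cj" by (simp add: cj_def ci_def ck_def)
    have "U s" by (simp add: U_def unchanged_refl)
    thus "Qj 0 (setv x_j 0 s0)" by (simp add: Qj_def s0_def lv_def U_setv)
    fix j r assume j: "j < length rows" "fst r x_j = int j" and q: "Qj j r"
    define ok where "ok = fst r x_ok"
    define \<sigma> where "\<sigma> = snd r a_sig"
    define r0 where "r0 = setv x_s (- snd r a_b j) r"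
    have Ur: "U r" using q by (simp add: Qj_def)
    have "snd r a_b j = snd (rows ! j)" using U_st[OF Ur] j(1) by (simp add: static_def table_def)
    hence Q0: "Qi j ok \<sigma> 0 r0" using q j(2) by (simp add: Qi_def r0_def Qj_def ok_def \<sigma>_def U_setv)
    define r1 where "r1 = sem w (For x_i (Var x_n) ci) r0"
    have r1: "Qi j ok \<sigma> n r1" "bdd w B (For x_i (Var x_n) ci) r0" using Li[OF j(1) Q0] unfolding r1_def by blast+
    define x where "x = row_val n (rows ! j) z"
    have xs: "fst r1 x_s = x" using r1(1) by (simp add: Qi_def x_def row_val_def)
    have U1: "U r1" and jv: "fst r1 x_j = int j" "fst r1 x_ok = ok" "fst r1 x_aq = int (j * n + n)" "snd r1 a_sig = \<sigma>"
      using r1(1) by (auto simp: Qi_def)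
    have v: "fst r1 x_mh = int (length hs)" "fst r1 x_ND = K" "fst r1 x_n = int n"
      using U_st[OF U1] by (auto simp: static_def K_def)
    have ok': "fst (sem w ck r1) x_ok = (if j < length hs \<and> x + K - (int n + 1) < 0 then 0 else ok)"
      by (simp add: ck_def jv xs v)
    have sg': "snd (sem w ck r1) a_sig = \<sigma>(j := clip K x)" by (simp add: ck_def jv xs v clip_def)
    have aq': "fst (sem w ck r1) x_aq = int (j * n + n)" by (simp add: ck_def jv)
    have U': "U (sem w ck r1)" using U1 by (simp add: ck_def U_setv U_seta)
    have eq: "sem w cj r = sem w ck r1" by (simp add: cj_def r1_def r0_def j(2))
    have "bdd w B cj r" using r1(2) by (simp add: cj_def r0_def j(2) ck_def)
    moreover have "lv (Suc j) \<longleftrightarrow> lv j \<and> (j < length hs \<longrightarrow> 0 \<le> x + K - (int n + 1))"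
      by (auto simp: lv_def less_Suc_eq x_def)
    moreover have "signature n K rows z ! j = clip K x" using j(1) by (simp add: signature_def x_def)
    ultimately show "bdd w B cj r \<and> Qj (Suc j) (incv x_j (sem w cj r))"
      unfolding eq using q U' ok' sg' aq' by (auto simp: Qj_def ok_def \<sigma>_def less_Suc_eq intro!: U_incv)
  qed (use B in simp)
  moreover have S: "SIG = Assign x_ok (Lit 1) ;; Assign x_aq (Lit 0) ;; For x_j (Var x_m) cj"
    by (simp only: SIG_def cj_def ci_def ck_def)
  moreover have "lv (length rows) \<longleftrightarrow> live n K hs z"
    unfolding lv_def live_def rows all_set_conv_all_nth by (auto simp: nth_append)
  ultimately show ?thesis unfolding S by (simp add: Qj_def s0_def)
qed

text \<open>The pointer \<open>x_qp\<close> passes over all signatures stored so far and ends at the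
  first free cell of \<open>a_S\<close>, where \<open>TRY\<close> appends a new one.\<close>

definition DEDUP :: com where
  "DEDUP = Assign x_qp (Lit 0) ;; For x_r2 (Var x_cn) (Assign x_df (Lit 0) ;;
     For x_j (Var x_m) (IfPos (NEQ (Ar a_sig (Var x_j)) (Ar a_S (Var x_qp))) (Assign x_df (Lit 1)) Skip ;;
       Assign x_qp (Plus (Var x_qp) (Lit 1))) ;;
     IfPos (Var x_df) Skip (Assign x_ok (Lit 0)))"

lemma mod_DEDUP [simp]: "modv DEDUP = {x_qp, x_r2, x_df, x_j, x_ok}" "moda DEDUP = {}"
  by (auto simp: DEDUP_def)

lemma DEDUP_correct:
  assumes m: "fst s x_m = int m" "m \<le> B" and cn: "fst s x_cn = int (length L)" "length L \<le> B"
    and L: "\<forall>r<length L. length (L ! r) = m \<and> (\<forall>j<m. snd s a_S (r * m + j) = L ! r ! j)"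
    and \<sigma>: "length \<sigma> = m" "\<forall>j<m. snd s a_sig j = \<sigma> ! j" and ok: "fst s x_ok = (if p then 1 else 0)"
  shows "fst (sem w DEDUP s) x_ok = (if p \<and> \<sigma> \<notin> set L then 1 else 0) \<and>
     fst (sem w DEDUP s) x_qp = int (length L * m) \<and> bdd w B DEDUP s"
proof -
  let ?X = "{x_qp, x_r2, x_df, x_j, x_ok}"
  define U where "U t \<longleftrightarrow> unchanged ?X {} s t" for t
  have U_setv: "U (setv x y t)" if "U t" "x \<in> ?X" for x y t
    using unchanged_updates(1)[of ?X "{}" s t x y] that by (simp add: U_def)
  have U_incv: "U (incv x t)" if "U t" "x \<in> ?X" for x t
    using unchanged_updates(2)[of ?X "{}" s t x] that by (simp add: U_def)
  define ci where "ci = IfPos (NEQ (Ar a_sig (Var x_j)) (Ar a_S (Var x_qp))) (Assign x_df (Lit 1)) Skip ;;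
       Assign x_qp (Plus (Var x_qp) (Lit 1))"
  define cr where "cr = Assign x_df (Lit 0) ;; For x_j (Var x_m) ci ;; IfPos (Var x_df) Skip (Assign x_ok (Lit 0))"
  define Qj where "Qj r ok j t \<longleftrightarrow> U t \<and> fst t x_df = (if \<forall>j'<j. \<sigma> ! j' = L ! r ! j' then 0 else 1) \<and>
      fst t x_qp = int (r * m + j) \<and> fst t x_ok = ok" for r ok j t
  have Lj: "Qj r ok m (sem w (For x_j (Var x_m) ci) t) \<and> bdd w B (For x_j (Var x_m) ci) t"
    if r: "r < length L" and Q: "Qj r ok 0 t" for r ok t
  proof (rule For_rule[where Q="Qj r ok"])
    show "nat (aval w (Var x_m) t) = m" using Q m unchangedD(1)[of ?X "{}" s t x_m] by (simp add: Qj_def U_def)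
    show "x_j \<notin> modv ci" by (simp add: ci_def)
    show "Qj r ok 0 (setv x_j 0 t)" using Q U_setv[of t x_j 0] by (simp add: Qj_def)
    fix j t' assume j: "j < m" "fst t' x_j = int j" and q: "Qj r ok j t'"
    have Ut: "U t'" using q by (simp add: Qj_def)
    have qp: "nat (fst t' x_qp) = r * m + j" using q by (simp only: Qj_def nat_int)
    have "snd t' a_sig j = \<sigma> ! j" "snd t' a_S (r * m + j) = L ! r ! j"
      using unchangedD(2)[OF Ut[unfolded U_def]] \<sigma>(2) L r j(1) by simp_all
    hence e: "sem w ci t' = setv x_qp (fst t' x_qp + 1) (if \<sigma> ! j = L ! r ! j then t' else setv x_df 1 t')"
      by (simp add: ci_def qp j(2))
    have "bdd w B ci t'" by (simp add: ci_def)
    thus "bdd w B ci t' \<and> Qj r ok (Suc j) (incv x_j (sem w ci t'))"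
      unfolding e using q by (auto simp: Qj_def all_less_Suc intro!: U_setv U_incv)
  qed (use m in simp)
  define Qr where "Qr r t \<longleftrightarrow> U t \<and> fst t x_ok = (if p \<and> (\<forall>r'<r. \<sigma> \<noteq> L ! r') then 1 else 0) \<and>
      fst t x_qp = int (r * m)" for r t
  have "Qr (length L) (sem w (For x_r2 (Var x_cn) cr) (setv x_qp 0 s)) \<and> bdd w B (For x_r2 (Var x_cn) cr) (setv x_qp 0 s)"
  proof (rule For_rule[where Q=Qr])
    show "nat (aval w (Var x_cn) (setv x_qp 0 s)) = length L" using cn by simp
    show "x_r2 \<notin> modv cr" by (simp add: cr_def ci_def)
    have "U s" by (simp add: U_def unchanged_refl)
    thus "Qr 0 (setv x_r2 0 (setv x_qp 0 s))" using ok by (simp add: Qr_def U_setv)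
    fix r t assume r: "r < length L" "fst t x_r2 = int r" and q: "Qr r t"
    have "Qj r (fst t x_ok) 0 (setv x_df 0 t)" using q by (simp add: Qj_def Qr_def U_setv)
    from Lj[OF r(1) this] have t1: "Qj r (fst t x_ok) m (sem w (For x_j (Var x_m) ci) (setv x_df 0 t))"
      "bdd w B (For x_j (Var x_m) ci) (setv x_df 0 t)" by blast+
    have "length (L ! r) = m" using L r(1) by blast
    hence eqL: "(\<forall>j'<m. \<sigma> ! j' = L ! r ! j') \<longleftrightarrow> \<sigma> = L ! r" using \<sigma>(1) by (auto intro: nth_equalityI)
    have "bdd w B cr t" using t1(2) by (simp add: cr_def)
    thus "bdd w B cr t \<and> Qr (Suc r) (incv x_r2 (sem w cr t))"
      using t1(1) q unfolding Qj_def eqL by (auto simp: cr_def Qr_def all_less_Suc intro!: U_setv U_incv)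
  qed (use cn in simp)
  moreover have S: "DEDUP = Assign x_qp (Lit 0) ;; For x_r2 (Var x_cn) cr" by (simp only: DEDUP_def cr_def ci_def)
  moreover have "(\<forall>r'<length L. \<sigma> \<noteq> L ! r') \<longleftrightarrow> \<sigma> \<notin> set L" by (auto simp: in_set_conv_nth)
  ultimately show ?thesis unfolding S by (simp add: Qr_def)
qed

section \<open>Candidates, levels and the whole search\<close>

definition COPY :: "nat \<Rightarrow> nat \<Rightarrow> nat \<Rightarrow> nat \<Rightarrow> nat \<Rightarrow> com" where
  "COPY x l a ptr b = For x (Var l) (AStore a (Var ptr) (Ar b (Var x)) ;; Assign ptr (Plus (Var ptr) (Lit 1)))"

lemma mod_COPY [simp]: "modv (COPY x l a ptr b) = {x, ptr}" "moda (COPY x l a ptr b) = {a}"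
  by (auto simp: COPY_def)

lemma COPY_correct:
  assumes "fst s l = int k" "k \<le> B" "fst s ptr = int base" "x \<noteq> ptr" "a \<noteq> b"
  shows "extends (snd s a) base k (snd s b) (snd (sem w (COPY x l a ptr b) s) a) \<and>
     fst (sem w (COPY x l a ptr b) s) ptr = int (base + k) \<and> bdd w B (COPY x l a ptr b) s"
proof -
  let ?c = "AStore a (Var ptr) (Ar b (Var x)) ;; Assign ptr (Plus (Var ptr) (Lit 1))"
  define Q where "Q i t \<longleftrightarrow> extends (snd s a) base i (snd s b) (snd t a) \<and> fst t ptr = int (base + i) \<and> snd t b = snd s b" for i t
  have "Q k (sem w (For x (Var l) ?c) s) \<and> bdd w B (For x (Var l) ?c) s"
  proof (rule For_rule[where Q=Q])
    show "Q 0 (setv x 0 s)" using assms by (simp add: Q_def extends_0)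
    fix i t assume i: "fst t x = int i" and q: "Q i t"
    have p: "nat (fst t ptr) = base + i" using q by (simp only: Q_def nat_int)
    have e: "sem w ?c t = setv ptr (fst t ptr + 1) (seta a (base + i) (snd s b i) t)"
      using q by (simp add: p i) (simp add: Q_def)
    show "bdd w B ?c t \<and> Q (Suc i) (incv x (sem w ?c t))"
      unfolding e using q assms extends_Suc[of "snd s a" base i "snd s b" "snd t a" "snd s b i"]
      by (simp add: Q_def)
  qed (use assms in auto)
  thus ?thesis by (simp add: COPY_def Q_def)
qed

text \<open>The array \<open>a_Q\<close> is a queue of all prefixes kept so far; those of the current level start at
  \<open>x_pb\<close>, those of the next level at \<open>x_nb\<close> and the free part at \<open>x_pe\<close>. The signatures of the next
  level are in \<open>a_S\<close>, a new candidate and its signature in \<open>a_z\<close> and \<open>a_sig\<close>.\<close>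

definition TRY :: com where
  "TRY = BITS x_n ;;
     For x_i (Var x_n) (IfPos (Ar a_bits (Var x_i)) (AStore a_z (Var x_i) (Plus (Ar a_Q (Plus (Var x_rp) (Var x_i))) (Var x_D)))
       (AStore a_z (Var x_i) (Ar a_Q (Plus (Var x_rp) (Var x_i))))) ;;
     SIG ;; DEDUP ;;
     IfPos (Var x_ok) (COPY x_i x_n a_Q x_pe a_z ;; COPY x_j x_m a_S x_qp a_sig ;; Assign x_cn (Plus (Var x_cn) (Lit 1))) Skip"

lemma mod_TRY [simp]: "modv TRY = {x_t, x_h, x_i, x_ok, x_aq, x_j, x_s, x_qp, x_r2, x_df, x_pe, x_cn}"
  "moda TRY = {a_bits, a_z, a_sig, a_Q, a_S}"
  by (auto simp: TRY_def)

definition stored :: "nat \<Rightarrow> int \<Rightarrow> row list \<Rightarrow> nat \<Rightarrow> (nat \<Rightarrow> int) list \<Rightarrow> mem \<Rightarrow> bool" where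
  "stored n K rows base acc s \<longleftrightarrow> fst s x_cn = int (length acc) \<and> fst s x_pe = int (base + length acc * n) \<and>
     (\<forall>r<length acc. \<forall>i<n. snd s a_Q (base + r * n + i) = (acc ! r) i) \<and>
     (\<forall>r<length acc. \<forall>j<length rows. snd s a_S (r * length rows + j) = signature n K rows (acc ! r) ! j)"

lemma row_index_less: "r < k \<Longrightarrow> i < n \<Longrightarrow> r * n + i < k * (n :: nat)"
  by (rule mult_add_less)

text \<open>By \<open>rp + n \<le> base\<close> the prefix being refined lies before the region
  where new ones are appended. The queue below \<open>base\<close> is preserved, so the remaining
  masks see the same prefix.\<close>

lemma TRY_correct:
  assumes st: "static n hs rows D s" and rows: "rows = hs @ ss" and u: "unit_rows n rows"
    and mask: "fst s x_mask = int k" and rp: "fst s x_rp = int rp" "rp + n \<le> base"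
    and y: "\<forall>i<n. snd s a_Q (rp + i) = y i"
    and acc: "stored n ((int n + 1) * D) rows base acc s"
    and B: "n \<le> B" "length rows \<le> B" "length acc \<le> B"
  shows "stored n ((int n + 1) * D) rows base (extend n ((int n + 1) * D) hs rows acc (refine D y k)) (sem w TRY s) \<and>
     (\<forall>q<base. snd (sem w TRY s) a_Q q = snd s a_Q q) \<and> bdd w B TRY s"
proof -
  define K where "K = (int n + 1) * D"
  define m where "m = length rows"
  define z where "z = refine D y k"
  define s1 where "s1 = sem w (BITS x_n) s"
  have vals: "fst s x_n = int n" "fst s x_m = int m" "fst s x_D = D" using st by (auto simp: static_def m_def)
  have 1: "\<forall>i<n. snd s1 a_bits i = int (k div 2 ^ i mod 2)" "bdd w B (BITS x_n) s"
    unfolding s1_def using BITS_correct[OF mask vals(1) B(1), of w] by auto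
  have u1: "unchanged {x_t, x_h, x_i} {a_bits} s s1"
    unfolding s1_def using sem_unchanged[of "BITS x_n" s w] by simp
  define c2 where "c2 = IfPos (Ar a_bits (Var x_i)) (AStore a_z (Var x_i) (Plus (Ar a_Q (Plus (Var x_rp) (Var x_i))) (Var x_D)))
       (AStore a_z (Var x_i) (Ar a_Q (Plus (Var x_rp) (Var x_i))))"
  define s2 where "s2 = sem w (For x_i (Var x_n) c2) s1"
  have 2: "(unchanged {x_t, x_h, x_i} {a_bits, a_z} s s2 \<and> snd s2 a_bits = snd s1 a_bits \<and> (\<forall>i<n. snd s2 a_z i = z i)) \<and>
      bdd w B (For x_i (Var x_n) c2) s1"
    unfolding s2_def
  proof (rule For_rule[where Q="\<lambda>i t. unchanged {x_t, x_h, x_i} {a_bits, a_z} s t \<and> snd t a_bits = snd s1 a_bits \<and> (\<forall>i'<i. snd t a_z i' = z i')"])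
    show "nat (aval w (Var x_n) s1) = n" using unchangedD(1)[OF u1, of x_n] vals by simp
    show "x_i \<notin> modv c2" by (simp add: c2_def)
    show "unchanged {x_t, x_h, x_i} {a_bits, a_z} s (setv x_i 0 s1) \<and> snd (setv x_i 0 s1) a_bits = snd s1 a_bits \<and>
       (\<forall>i'<0. snd (setv x_i 0 s1) a_z i' = z i')"
      using u1 by (auto simp: unchanged_def)
    fix i t assume i: "i < n" "fst t x_i = int i"
      and q: "unchanged {x_t, x_h, x_i} {a_bits, a_z} s t \<and> snd t a_bits = snd s1 a_bits \<and> (\<forall>i'<i. snd t a_z i' = z i')"
    have uq: "unchanged {x_t, x_h, x_i} {a_bits, a_z} s t" using q by blast
    have v: "fst t x_rp = int rp" "fst t x_D = D" "snd t a_Q = snd s a_Q"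
      using unchangedD[OF uq] rp vals by simp_all
    have ix: "nat (int rp + int i) = rp + i" by simp
    have bt: "snd t a_bits i = int (k div 2 ^ i mod 2)" using q 1 i by simp
    have "0 < snd t a_bits i \<longleftrightarrow> odd (k div 2 ^ i)"
      unfolding bt by (simp add: odd_iff_mod_2_eq_one del: of_nat_mod)
    hence e: "sem w c2 t = seta a_z i (z i) t"
      using y i(1) by (simp add: c2_def i(2) v ix z_def refine_def)
    have "bdd w B c2 t" by (simp add: c2_def)
    thus "bdd w B c2 t \<and> unchanged {x_t, x_h, x_i} {a_bits, a_z} s (incv x_i (sem w c2 t)) \<and>
       snd (incv x_i (sem w c2 t)) a_bits = snd s1 a_bits \<and> (\<forall>i'<Suc i. snd (incv x_i (sem w c2 t)) a_z i' = z i')"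
      unfolding e using q by (auto simp: unchanged_def less_Suc_eq)
  qed (use B in simp)
  hence u2: "unchanged {x_t, x_h, x_i} {a_bits, a_z} s s2" and z2: "\<forall>i<n. snd s2 a_z i = z i" by blast+
  have st2: "static n hs rows D s2" by (rule static_unchanged[OF u2 st]) auto
  define s3 where "s3 = sem w SIG s2"
  have 3: "fst s3 x_ok = (if live n K hs z then 1 else 0)" "\<forall>j<m. snd s3 a_sig j = signature n K rows z ! j" "bdd w B SIG s2"
    using SIG_correct[OF st2 rows u z2 B(1,2), of w] by (auto simp: s3_def K_def m_def)
  have u23: "unchanged {x_ok, x_aq, x_j, x_s, x_i} {a_sig} s2 s3"
    unfolding s3_def using sem_unchanged[of SIG s2 w] by simp
  have u3: "unchanged {x_t, x_h, x_i, x_ok, x_aq, x_j, x_s} {a_bits, a_z, a_sig} s s3"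
    by (rule unchanged_mono[OF unchanged_trans[OF u2 u23]]) auto
  define L where "L = map (signature n K rows) acc"
  define s4 where "s4 = sem w DEDUP s3"
  have 4: "fst s4 x_ok = (if live n K hs z \<and> signature n K rows z \<notin> set L then 1 else 0)"
    "fst s4 x_qp = int (length L * m)" "bdd w B DEDUP s3"
  proof -
    have "fst s3 x_m = int m" "fst s3 x_cn = int (length L)"
      using unchangedD(1)[OF u3] vals acc by (simp_all add: stored_def L_def)
    moreover have "\<forall>r<length L. length (L ! r) = m \<and> (\<forall>j<m. snd s3 a_S (r * m + j) = L ! r ! j)"
      using unchangedD(2)[OF u3, of a_S] acc by (simp add: L_def stored_def m_def K_def signature_def)
    moreover have "length (signature n K rows z) = m" by (simp add: signature_def m_def)
    ultimately show "fst s4 x_ok = (if live n K hs z \<and> signature n K rows z \<notin> set L then 1 else 0)"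
    "fst s4 x_qp = int (length L * m)" "bdd w B DEDUP s3"
      using DEDUP_correct[of s3 m B L "signature n K rows z" "live n K hs z" w] 3 B
      by (simp_all add: s4_def m_def L_def)
  qed
  have u34: "unchanged {x_qp, x_r2, x_df, x_j, x_ok} {} s3 s4"
    unfolding s4_def using sem_unchanged[of DEDUP s3 w] by simp
  have u4: "unchanged {x_t, x_h, x_i, x_ok, x_aq, x_j, x_s, x_qp, x_r2, x_df} {a_bits, a_z, a_sig} s s4"
    by (rule unchanged_mono[OF unchanged_trans[OF u3 u34]]) auto
  define c5 where "c5 = COPY x_i x_n a_Q x_pe a_z ;; COPY x_j x_m a_S x_qp a_sig ;; Assign x_cn (Plus (Var x_cn) (Lit 1))"
  have acc4: "stored n K rows base acc s4"
    using acc unchangedD[OF u4] by (simp add: stored_def K_def)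
  have v4: "fst s4 x_n = int n" "fst s4 x_m = int m" "snd s4 a_Q = snd s a_Q"
    using unchangedD[OF u4] vals by simp_all
  have z4: "\<forall>i<n. snd s4 a_z i = z i" "\<forall>j<m. snd s4 a_sig j = signature n K rows z ! j"
    using unchangedD(2)[OF u34] unchangedD(2)[OF u23] z2 3(2) by simp_all
  have T: "sem w TRY s = sem w (IfPos (Var x_ok) c5 Skip) s4"
    by (simp add: TRY_def s4_def s3_def s2_def s1_def c2_def c5_def)
  have BT: "bdd w B TRY s \<longleftrightarrow> bdd w B (IfPos (Var x_ok) c5 Skip) s4"
    using 1(2) 2 3(3) 4(3) by (simp add: TRY_def s4_def s3_def s2_def s1_def c2_def c5_def)
  show ?thesis
  proof (cases "live n K hs z \<and> signature n K rows z \<notin> set L")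
    case False
    hence ok: "fst s4 x_ok = 0" using 4(1) by simp
    have "extend n K hs rows acc z = acc" using False by (auto simp: extend_def L_def)
    thus ?thesis using acc4 v4(3) unfolding T BT K_def[symmetric] z_def[symmetric] by (simp add: ok)
  next
    case True
    hence ok: "fst s4 x_ok = 1" using 4(1) by simp
    have ext: "extend n K hs rows acc z = acc @ [z]" using True by (auto simp: extend_def L_def)
    define s5 where "s5 = sem w (COPY x_i x_n a_Q x_pe a_z) s4"
    have 5: "extends (snd s4 a_Q) (base + length acc * n) n (snd s4 a_z) (snd s5 a_Q)"
      "fst s5 x_pe = int (base + length acc * n + n)" "bdd w B (COPY x_i x_n a_Q x_pe a_z) s4"
      using COPY_correct[of s4 x_n n B x_pe "base + length acc * n" x_i a_Q a_z w] v4 B acc4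
      by (simp_all add: s5_def stored_def)
    have u5: "unchanged {x_i, x_pe} {a_Q} s4 s5"
      unfolding s5_def using sem_unchanged[of "COPY x_i x_n a_Q x_pe a_z" s4 w] by simp
    define s6 where "s6 = sem w (COPY x_j x_m a_S x_qp a_sig) s5"
    have 6: "extends (snd s4 a_S) (length acc * m) m (snd s4 a_sig) (snd s6 a_S)"
      "bdd w B (COPY x_j x_m a_S x_qp a_sig) s5"
      using COPY_correct[of s5 x_m m B x_qp "length acc * m" x_j a_S a_sig w] v4 B unchangedD[OF u5] 4(2)
      by (simp_all add: s6_def m_def L_def)
    have u6: "unchanged {x_j, x_qp} {a_S} s5 s6"
      unfolding s6_def using sem_unchanged[of "COPY x_j x_m a_S x_qp a_sig" s5 w] by simp
    have cn: "fst s6 x_cn = int (length acc)" "fst s6 x_pe = int (base + length acc * n + n)" "snd s6 a_Q = snd s5 a_Q"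
      using unchangedD[OF u5] unchangedD[OF u6] acc4 5(2) by (simp_all add: stored_def)
    define s7 where "s7 = setv x_cn (fst s6 x_cn + 1) s6"
    have e: "sem w (IfPos (Var x_ok) c5 Skip) s4 = s7" "bdd w B (IfPos (Var x_ok) c5 Skip) s4"
      using 5(3) 6(2) by (simp_all add: ok c5_def s7_def s6_def s5_def)
    have "stored n K rows base (acc @ [z]) s7"
      unfolding stored_def
    proof (intro conjI allI impI)
      show "fst s7 x_cn = int (length (acc @ [z]))" "fst s7 x_pe = int (base + length (acc @ [z]) * n)"
        using cn by (simp_all add: s7_def)
    next
      fix r i assume r: "r < length (acc @ [z])" and i: "i < n"
      show "snd s7 a_Q (base + r * n + i) = ((acc @ [z]) ! r) i"
      proof (cases "r = length acc")
        case True
        thus ?thesis using 5(1) z4(1) i by (simp add: s7_def cn extends_def)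
      next
        case False
        hence r': "r < length acc" using r by simp
        have "base + r * n + i < base + length acc * n" using row_index_less[OF r' i] by simp
        hence "snd s5 a_Q (base + r * n + i) = snd s4 a_Q (base + r * n + i)" using 5(1) by (simp only: extends_def)
        thus ?thesis using acc4 r' i by (simp add: s7_def cn stored_def nth_append)
      qed
    next
      fix r j assume r: "r < length (acc @ [z])" and j: "j < length rows"
      show "snd s7 a_S (r * length rows + j) = signature n K rows ((acc @ [z]) ! r) ! j"
      proof (cases "r = length acc")
        case True
        thus ?thesis using 6(1) z4(2) j by (simp add: s7_def extends_def m_def)
      next
        case False
        hence r': "r < length acc" using r by simp
        have "r * m + j < length acc * m" using row_index_less[OF r', of j m] j by (simp add: m_def)
        hence "snd s6 a_S (r * m + j) = snd s4 a_S (r * m + j)" using 6(1) by (simp only: extends_def)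
        thus ?thesis using acc4 r' j by (simp add: s7_def stored_def nth_append m_def)
      qed
    qed
    moreover have "snd s7 a_Q q = snd s a_Q q" if "q < base" for q
      using 5(1) that v4(3) by (simp add: s7_def cn extends_def)
    ultimately show ?thesis unfolding T BT K_def[symmetric] z_def[symmetric] ext e(1) using e(2) by simp
  qed
qed

text \<open>Halving \<open>x_ND\<close> together with \<open>x_D\<close> avoids a product, and it is
  exact because a level starts from an even weight. The array \<open>a_S\<close> is overwritten, as
  signatures are compared only within a level.\<close>

definition LEVEL :: com where
  "LEVEL = Assign x_D (Hlf (Var x_D)) ;; Assign x_ND (Hlf (Var x_ND)) ;; Assign x_nb (Var x_pe) ;;
     Assign x_cn (Lit 0) ;; Assign x_rp (Var x_pb) ;;
     For x_r (Var x_cl) (For x_mask (Var x_pn) TRY ;; Assign x_rp (Plus (Var x_rp) (Var x_n))) ;;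
     Assign x_pb (Var x_nb) ;; Assign x_cl (Var x_cn)"

definition level_state :: "nat \<Rightarrow> row list \<Rightarrow> row list \<Rightarrow> int \<Rightarrow> (nat \<Rightarrow> int) list \<Rightarrow> nat \<Rightarrow> mem \<Rightarrow> bool" where
  "level_state n hs rows D reps base s \<longleftrightarrow> static n hs rows D s \<and> fst s x_pn = int (2 ^ n) \<and>
     fst s x_cl = int (length reps) \<and> fst s x_pb = int base \<and> fst s x_pe = int (base + length reps * n) \<and>
     (\<forall>r<length reps. \<forall>i<n. snd s a_Q (base + r * n + i) = (reps ! r) i)"

definition sigs_stored :: "nat \<Rightarrow> int \<Rightarrow> row list \<Rightarrow> (nat \<Rightarrow> int) list \<Rightarrow> mem \<Rightarrow> bool" where
  "sigs_stored n D rows reps s \<longleftrightarrow> (\<forall>r<length reps. \<forall>j<length rows.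
     snd s a_S (r * length rows + j) = signature n ((int n + 1) * D) rows (reps ! r) ! j)"

lemma length_foldl_le:
  assumes "\<And>acc x. length acc \<le> length (f acc x)"
  shows "length acc \<le> length (foldl f acc xs)"
proof (induction xs arbitrary: acc)
  case (Cons x xs)
  show ?case using order_trans[OF assms Cons.IH] by simp
qed simp

lemma length_extend_le: "length acc \<le> length (extend n K hs rows acc z)"
  by (simp add: extend_def)

lemma LEVEL_correct:
  assumes ls: "level_state n hs rows (2 * D) reps base s" and rows: "rows = hs @ ss" and u: "unit_rows n rows"
    and B: "n \<le> B" "length rows \<le> B" "2 ^ n \<le> B" "length reps \<le> B" "length (next_level n D hs rows reps) \<le> B"
  shows "level_state n hs rows D (next_level n D hs rows reps) (base + length reps * n) (sem w LEVEL s) \<and>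
     sigs_stored n D rows (next_level n D hs rows reps) (sem w LEVEL s) \<and> bdd w B LEVEL s"
proof -
  define K where "K = (int n + 1) * D"
  define base' where "base' = base + length reps * n"
  define ext where "ext = (\<lambda>acc y. foldl (\<lambda>acc m. extend n K hs rows acc (refine D y m)) acc [0..<2 ^ n])"
  define acc where "acc r = foldl ext [] (take r reps)" for r
  have final: "acc (length reps) = next_level n D hs rows reps"
    by (simp add: acc_def next_level_def ext_def K_def)
  have ext_le: "length a \<le> length (ext a y)" for a y
    unfolding ext_def by (rule length_foldl_le) (rule length_extend_le)
  \<comment> \<open>The list of representatives only grows, so the bound on the complete level also
    bounds every intermediate list, and with it the loop of \<open>DEDUP\<close> over the stored
    signatures.\<close>
  have acc_le: "length (acc r) \<le> B" for r
  proof -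
    have "acc (length reps) = foldl ext (acc r) (drop r reps)"
      unfolding acc_def foldl_append[symmetric] by simp
    hence "length (acc r) \<le> length (acc (length reps))" using length_foldl_le[of ext, OF ext_le] by simp
    thus ?thesis using B(5) final by simp
  qed
  have acc_Suc: "acc (Suc r) = ext (acc r) (reps ! r)" if "r < length reps" for r
    using that by (simp add: acc_def take_Suc_conv_app_nth)
  define s1 where "s1 = setv x_rp (int base) (setv x_cn 0 (setv x_nb (int base') (setv x_ND K (setv x_D D s))))"
  have vals: "fst s x_D = 2 * D" "fst s x_ND = (int n + 1) * (2 * D)" "fst s x_pe = int base'" "fst s x_pb = int base"
    "fst s x_cl = int (length reps)" "fst s x_pn = int (2 ^ n)" "fst s x_n = int n"
    using ls by (simp_all add: level_state_def static_def base'_def)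
  have h: "(int n + 1) * (2 * D) div 2 = K" by (simp add: K_def)
  define cr where "cr = For x_mask (Var x_pn) TRY ;; Assign x_rp (Plus (Var x_rp) (Var x_n))"
  have e1: "sem w LEVEL s = sem w (Assign x_pb (Var x_nb) ;; Assign x_cl (Var x_cn)) (sem w (For x_r (Var x_cl) cr) s1)"
     "bdd w B LEVEL s = bdd w B (For x_r (Var x_cl) cr) s1"
    by (simp_all add: LEVEL_def cr_def s1_def vals h)
  let ?X = "{x_t, x_h, x_i, x_ok, x_aq, x_j, x_s, x_qp, x_r2, x_df, x_pe, x_cn, x_mask, x_rp, x_r}"
  let ?Y = "{a_bits, a_z, a_sig, a_Q, a_S}"
  define U where "U t \<longleftrightarrow> unchanged ?X ?Y s1 t" for t
  have st1: "static n hs rows D s1"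
    using ls by (simp add: level_state_def static_def s1_def K_def table_def)
  have U_st: "static n hs rows D t" if "U t" for t
    using static_unchanged[OF that[unfolded U_def] st1] by simp
  have U_val: "fst t x_pn = int (2 ^ n)" "fst t x_n = int n" "fst t x_cl = int (length reps)" "fst t x_nb = int base'" if "U t" for t
    using unchangedD(1)[OF that[unfolded U_def]] vals by (simp_all add: s1_def)
  have U_setv: "U (setv x y t)" if "U t" "x \<in> ?X" for x y t
    using unchanged_updates(1)[of ?X ?Y s1 t x y] that by (simp add: U_def)
  have U_incv: "U (incv x t)" if "U t" "x \<in> ?X" for x t
    using unchanged_updates(2)[of ?X ?Y s1 t x] that by (simp add: U_def)
  have U_TRY: "U (sem w TRY t)" if "U t" for t
    unfolding U_def
    by (rule unchanged_mono[OF unchanged_trans[OF that[unfolded U_def] sem_unchanged[of TRY t w]]]) auto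
  define Q where "Q a t \<longleftrightarrow> U t \<and> stored n K rows base' a t \<and> (\<forall>q<base'. snd t a_Q q = snd s a_Q q)" for a t
  have Q_setv: "Q a (setv x y t)" if "Q a t" "x \<in> ?X" "x \<noteq> x_cn" "x \<noteq> x_pe" for a x y t
    using that U_setv[of t x y] by (simp add: Q_def stored_def)
  have Q_incv: "Q a (incv x t)" if "Q a t" "x \<in> ?X" "x \<noteq> x_cn" "x \<noteq> x_pe" for a x t
    using that U_incv[of t x] by (simp add: Q_def stored_def)
  define Qm where "Qm r k t \<longleftrightarrow> Q (foldl (\<lambda>a m. extend n K hs rows a (refine D (reps ! r) m)) (acc r) [0..<k]) t \<and>
     fst t x_rp = int (base + r * n)" for r k t
  have Lm: "Qm r (2 ^ n) (sem w (For x_mask (Var x_pn) TRY) t) \<and> bdd w B (For x_mask (Var x_pn) TRY) t"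
    if r: "r < length reps" and q0: "Qm r 0 t" for r t
  proof (rule For_rule[where Q="Qm r"])
    have "U t" using q0 by (simp add: Qm_def Q_def)
    thus "nat (aval w (Var x_pn) t) = 2 ^ n" using U_val(1)[of t] by (simp add: nat_power_eq)
    show "x_mask \<notin> modv TRY" by simp
    show "Qm r 0 (setv x_mask 0 t)" using q0 by (auto simp: Qm_def intro!: Q_setv)
    fix k t' assume k: "k < 2 ^ n" "fst t' x_mask = int k" and q: "Qm r k t'"
    define a where "a = foldl (\<lambda>a m. extend n K hs rows a (refine D (reps ! r) m)) (acc r) [0..<k]"
    have qa: "Q a t'" "fst t' x_rp = int (base + r * n)" using q by (simp_all add: Qm_def a_def)
    have Ut: "U t'" using qa by (simp add: Q_def)
    have rn: "base + r * n + n \<le> base'" using mult_le_mono1[of "Suc r" "length reps" n] r by (simp add: base'_def)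
    have y: "\<forall>i<n. snd t' a_Q (base + r * n + i) = (reps ! r) i"
    proof (intro allI impI)
      fix i assume i: "i < n"
      hence "base + r * n + i < base'" using rn by simp
      hence "snd t' a_Q (base + r * n + i) = snd s a_Q (base + r * n + i)" using qa(1) by (simp add: Q_def)
      thus "snd t' a_Q (base + r * n + i) = (reps ! r) i" using ls r i by (simp add: level_state_def)
    qed
    have la: "length a \<le> B"
    proof -
      have "ext (acc r) (reps ! r) = foldl (\<lambda>a m. extend n K hs rows a (refine D (reps ! r) m)) a [k..<2 ^ n]"
        unfolding ext_def a_def foldl_append[symmetric] using upt_add_eq_append[of 0 k "2 ^ n - k"] k(1) by simp
      also have "length a \<le> length \<dots>" by (rule length_foldl_le) (rule length_extend_le)
      finally show ?thesis using acc_le[of "Suc r"] acc_Suc[OF r] by simp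
    qed
    have sa: "stored n ((int n + 1) * D) rows base' a t'" using qa(1) by (simp add: Q_def K_def)
    from TRY_correct[OF U_st[OF Ut] rows u k(2) qa(2) rn y sa B(1,2) la, of w]
    have "stored n K rows base' (extend n K hs rows a (refine D (reps ! r) k)) (sem w TRY t')"
      "\<forall>q<base'. snd (sem w TRY t') a_Q q = snd t' a_Q q" "bdd w B TRY t'" by (simp_all add: K_def)
    moreover have "fst (sem w TRY t') x_rp = fst t' x_rp"
      using unchangedD(1)[OF sem_unchanged[of TRY t' w], of x_rp] by simp
    ultimately have "Q (extend n K hs rows a (refine D (reps ! r) k)) (sem w TRY t')" "bdd w B TRY t'"
      "fst (sem w TRY t') x_rp = int (base + r * n)"
      using qa U_TRY[OF Ut] by (simp_all add: Q_def)
    thus "bdd w B TRY t' \<and> Qm r (Suc k) (incv x_mask (sem w TRY t'))"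
      by (auto simp: Qm_def a_def intro!: Q_incv)
  qed (use B in simp)
  have "(Q (acc (length reps)) (sem w (For x_r (Var x_cl) cr) s1) \<and>
     fst (sem w (For x_r (Var x_cl) cr) s1) x_rp = int (base + length reps * n)) \<and> bdd w B (For x_r (Var x_cl) cr) s1"
  proof (rule For_rule[where Q="\<lambda>r t. Q (acc r) t \<and> fst t x_rp = int (base + r * n)"])
    show "nat (aval w (Var x_cl) s1) = length reps" using vals by (simp add: s1_def)
    show "x_r \<notin> modv cr" by (simp add: cr_def)
    have "U s1" by (simp add: U_def unchanged_refl)
    hence "Q [] s1" using vals by (simp add: Q_def stored_def s1_def)
    thus "Q (acc 0) (setv x_r 0 s1) \<and> fst (setv x_r 0 s1) x_rp = int (base + 0 * n)"
      by (auto simp: acc_def s1_def intro!: Q_setv)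
    fix r t assume r: "r < length reps" and q: "Q (acc r) t \<and> fst t x_rp = int (base + r * n)"
    hence "Qm r 0 t" by (simp add: Qm_def)
    from Lm[OF r this] have t1: "Qm r (2 ^ n) (sem w (For x_mask (Var x_pn) TRY) t)" "bdd w B (For x_mask (Var x_pn) TRY) t" by blast+
    have "Q (acc (Suc r)) (sem w (For x_mask (Var x_pn) TRY) t)"
      using t1(1) by (simp add: Qm_def acc_Suc[OF r] ext_def)
    moreover from this have "fst (sem w (For x_mask (Var x_pn) TRY) t) x_n = int n" using U_val(2) by (simp add: Q_def)
    moreover have "fst (sem w (For x_mask (Var x_pn) TRY) t) x_rp = int (base + r * n)" using t1(1) by (simp add: Qm_def)
    ultimately show "bdd w B cr t \<and> Q (acc (Suc r)) (incv x_r (sem w cr t)) \<and> fst (incv x_r (sem w cr t)) x_rp = int (base + Suc r * n)"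
      using t1(2) by (auto simp: cr_def intro!: Q_incv Q_setv)
  qed (use B in simp)
  hence fin: "Q (next_level n D hs rows reps) (sem w (For x_r (Var x_cl) cr) s1)" "bdd w B (For x_r (Var x_cl) cr) s1"
    unfolding final by blast+
  let ?t = "sem w (For x_r (Var x_cl) cr) s1"
  have "U ?t" using fin(1) by (simp add: Q_def)
  from U_st[OF this] U_val[OF this] fin(1)
  have "level_state n hs rows D (next_level n D hs rows reps) base' (sem w LEVEL s)"
    "sigs_stored n D rows (next_level n D hs rows reps) (sem w LEVEL s)"
    unfolding e1(1) by (simp_all add: level_state_def sigs_stored_def static_def table_def Q_def stored_def K_def)
  thus ?thesis using fin(2) e1(2) by (simp add: base'_def)
qed

text \<open>One digit per left vertex and one more: far more than logarithmically many, but this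
  costs only a factor polynomial in the input size, and no logarithm has to be computed. The first
  queue entry is the zero vector, which is already in the memory.\<close>

definition SEARCH :: com where
  "SEARCH = Assign x_D (Lit 1) ;; Assign x_ND (Plus (Var x_n) (Lit 1)) ;;
     For x_lv (Plus (Var x_nu) (Lit 1)) (Assign x_D (Plus (Var x_D) (Var x_D)) ;; Assign x_ND (Plus (Var x_ND) (Var x_ND))) ;;
     Assign x_pb (Lit 0) ;; Assign x_pe (Var x_n) ;; Assign x_cl (Lit 1) ;;
     For x_lv (Plus (Var x_nu) (Lit 1)) LEVEL"

lemma mod_LEVEL [simp]: "modv LEVEL = {x_D, x_ND, x_nb, x_cn, x_rp, x_r, x_mask, x_pb, x_cl} \<union> modv TRY"
  "moda LEVEL = moda TRY"
  by (auto simp: LEVEL_def)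

lemma mod_SEARCH [simp]: "modv SEARCH = insert x_lv (modv LEVEL)" "moda SEARCH = moda TRY"
  by (auto simp: SEARCH_def)

lemma SEARCH_correct:
  fixes hs rows
  assumes tb: "table n rows s" "fst s x_n = int n" "fst s x_m = int (length rows)" "fst s x_mh = int (length hs)"
    "fst s x_pn = int (2 ^ n)" "fst s x_nu = int nu" "\<forall>i<n. snd s a_Q i = 0"
    and rows: "rows = hs @ ss" and u: "unit_rows n rows"
    and B: "n \<le> B" "length rows \<le> B" "2 ^ n \<le> B" "nu + 1 \<le> B"
      "\<And>k. k \<le> nu + 1 \<Longrightarrow> length (levels n (nu + 1) hs rows k) \<le> B"
  defines "reps \<equiv> levels n (nu + 1) hs rows (nu + 1)"
  shows "fst (sem w SEARCH s) x_cl = int (length reps) \<and> sigs_stored n 1 rows reps (sem w SEARCH s) \<and> bdd w B SEARCH s"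
proof -
  let ?L = "nu + 1"
  define c1 where "c1 = Assign x_D (Plus (Var x_D) (Var x_D)) ;; Assign x_ND (Plus (Var x_ND) (Var x_ND))"
  define s0 where "s0 = setv x_ND (int n + 1) (setv x_D 1 s)"
  define s1 where "s1 = sem w (For x_lv (Plus (Var x_nu) (Lit 1)) c1) s0"
  have un: "nat (int nu + 1) = ?L" by simp
  have "(fst s1 x_D = 2 ^ ?L \<and> fst s1 x_ND = (int n + 1) * 2 ^ ?L) \<and> bdd w B (For x_lv (Plus (Var x_nu) (Lit 1)) c1) s0"
    unfolding s1_def
  proof (rule For_rule[where Q="\<lambda>k t. fst t x_D = 2 ^ k \<and> fst t x_ND = (int n + 1) * 2 ^ k"])
    show "nat (aval w (Plus (Var x_nu) (Lit 1)) s0) = ?L" using tb(6) by (simp add: s0_def un)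
  qed (use B in \<open>auto simp: c1_def s0_def\<close>)
  hence s1: "fst s1 x_D = 2 ^ ?L" "fst s1 x_ND = (int n + 1) * 2 ^ ?L" "bdd w B (For x_lv (Plus (Var x_nu) (Lit 1)) c1) s0"
    by blast+
  have us1: "unchanged {x_D, x_ND, x_lv} {} s0 s1"
    unfolding s1_def using sem_unchanged[of "For x_lv (Plus (Var x_nu) (Lit 1)) c1" s0 w] by (simp add: c1_def insert_commute)
  have us: "unchanged {x_D, x_ND, x_lv} {} s s1" using us1 by (auto simp: unchanged_def s0_def)
  define s2 where "s2 = setv x_cl 1 (setv x_pe (int n) (setv x_pb 0 s1))"
  have ls: "level_state n hs rows (2 ^ (?L - 0)) (levels n ?L hs rows 0) 0 s2"
    using unchangedD[OF us] tb s1 by (simp add: level_state_def static_def table_def s2_def)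
  have nu2: "fst s2 x_nu = int nu" using unchangedD(1)[OF us, of x_nu] tb by (simp add: s2_def)
  \<comment> \<open>Level 0 has no stored signatures; this is harmless because at least one level
    follows.\<close>
  define Q where "Q k t \<longleftrightarrow> (\<exists>base. level_state n hs rows (2 ^ (?L - k)) (levels n ?L hs rows k) base t) \<and>
     (0 < k \<longrightarrow> sigs_stored n (2 ^ (?L - k)) rows (levels n ?L hs rows k) t)" for k t
  have ls_lv: "level_state n hs rows D r base (setv x_lv y t) = level_state n hs rows D r base t"
    "sigs_stored n D rows r (setv x_lv y t) = sigs_stored n D rows r t" for D r base y t
    by (simp_all add: level_state_def static_def table_def sigs_stored_def)
  have "Q ?L (sem w (For x_lv (Plus (Var x_nu) (Lit 1)) LEVEL) s2) \<and> bdd w B (For x_lv (Plus (Var x_nu) (Lit 1)) LEVEL) s2"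
  proof (rule For_rule[where Q=Q])
    show "nat (aval w (Plus (Var x_nu) (Lit 1)) s2) = ?L" using nu2 by (simp add: un)
    show "x_lv \<notin> modv LEVEL" by simp
    show "Q 0 (setv x_lv 0 s2)" using ls by (auto simp: Q_def ls_lv)
    fix k t assume k: "k < ?L" and q: "Q k t"
    then obtain base where b: "level_state n hs rows (2 ^ (?L - k)) (levels n ?L hs rows k) base t"
      by (auto simp: Q_def)
    have "(2 :: int) ^ (?L - k) = 2 * 2 ^ (?L - Suc k)" using k by (simp flip: power_Suc add: Suc_diff_Suc)
    from b[unfolded this] have "level_state n hs rows (2 ^ (?L - Suc k)) (levels n ?L hs rows (Suc k))
        (base + length (levels n ?L hs rows k) * n) (sem w LEVEL t) \<and>
      sigs_stored n (2 ^ (?L - Suc k)) rows (levels n ?L hs rows (Suc k)) (sem w LEVEL t) \<and> bdd w B LEVEL t"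
      unfolding levels.simps using B(5)[of k] B(5)[of "Suc k"] k
      by (intro LEVEL_correct[OF _ rows u B(1-3)]) simp_all
    thus "bdd w B LEVEL t \<and> Q (Suc k) (incv x_lv (sem w LEVEL t))"
      unfolding Q_def incv_def ls_lv by blast
  qed (use B in simp)
  hence fin: "Q ?L (sem w (For x_lv (Plus (Var x_nu) (Lit 1)) LEVEL) s2)" "bdd w B (For x_lv (Plus (Var x_nu) (Lit 1)) LEVEL) s2" by blast+
  have e: "sem w SEARCH s = sem w (For x_lv (Plus (Var x_nu) (Lit 1)) LEVEL) s2"
    "bdd w B SEARCH s \<longleftrightarrow> bdd w B (For x_lv (Plus (Var x_nu) (Lit 1)) c1) s0 \<and> bdd w B (For x_lv (Plus (Var x_nu) (Lit 1)) LEVEL) s2"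
    using unchangedD(1)[OF us, of x_n] tb(2)
    by (simp_all add: SEARCH_def s2_def s1_def s0_def c1_def)
  show ?thesis using fin s1(3) unfolding e Q_def reps_def by (auto simp: level_state_def)
qed

text \<open>Fairness expressed by the signs of the soft rows alone, as \<open>levels_decide\<close>
  demands of its property.\<close>

definition accepts :: "nat \<Rightarrow> nat \<Rightarrow> nat \<Rightarrow> (nat \<Rightarrow> int) \<Rightarrow> bool" where
  "accepts nv nc thr y \<longleftrightarrow> (\<forall>v<nv. 0 \<le> row_val (nv * nc + nv) (zero_row nv nc v) y \<or>
     thr \<le> card {c. c < nc \<and> 0 \<le> row_val (nv * nc + nv) (reach_row nv nc v c) y})"

text \<open>The signs are read off the signatures that the last level left in \<open>a_S\<close>.
  For each representative \<open>x_sp\<close> skips the \<open>x_mh\<close> entries of the hard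
  rows. The expression \<open>te\<close> stands for the threshold.\<close>

definition FINAL :: "aexp \<Rightarrow> com" where
  "FINAL te = Assign 0 (Lit 0) ;; Assign x_sp (Lit 0) ;;
     For x_r (Var x_cl) (Assign x_ok (Lit 1) ;; Assign x_sp (Plus (Var x_sp) (Var x_mh)) ;;
       For x_v (Var x_nv) (Assign x_cnt (Lit 0) ;;
         For x_c (Var x_nc) (Assign x_cnt (Plus (Var x_cnt) (Pos (Plus (Ar a_S (Var x_sp)) (Lit 1)))) ;;
           Assign x_sp (Plus (Var x_sp) (Lit 1))) ;;
         IfPos (Plus (Pos (Plus (Ar a_S (Var x_sp)) (Lit 1))) (Pos (Minus (Plus (Var x_cnt) (Lit 1)) te))) Skip
           (Assign x_ok (Lit 0)) ;;
         Assign x_sp (Plus (Var x_sp) (Lit 1))) ;;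
       IfPos (Var x_ok) (Assign 0 (Lit 1)) Skip)"

lemma concat_nth_equal:
  assumes "\<And>v. length (f v) = k" "v < m" "c < k"
  shows "concat (map f [0..<m]) ! (v * k + c) = f v ! c"
  using assms(2)
proof (induction m)
  case (Suc m)
  have len: "length (concat (map f [0..<m])) = m * k" for m
    by (induction m) (simp_all add: assms(1))
  show ?case
  proof (cases "v = m")
    case True
    thus ?thesis by (simp add: nth_append len)
  next
    case False
    hence "v < m" using Suc.prems by simp
    moreover have "v * k + c < m * k" by (rule mult_add_less[OF \<open>v < m\<close> assms(3)])
    ultimately show ?thesis using Suc.IH by (simp add: nth_append len)
  qed
qed simp

lemma length_soft_rows: "length (soft_rows nv nc) = nv * (nc + 1)"
  by (induction nv) (simp_all add: soft_rows_def length_concat sum_list_triv o_def)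

lemma soft_rows_nth:
  assumes "v < nv"
  shows "c < nc \<Longrightarrow> soft_rows nv nc ! (v * (nc + 1) + c) = reach_row nv nc v c"
    and "soft_rows nv nc ! (v * (nc + 1) + nc) = zero_row nv nc v"
  using concat_nth_equal[of "\<lambda>v. map (reach_row nv nc v) [0..<nc] @ [zero_row nv nc v]" "nc + 1" v nv c]
    concat_nth_equal[of "\<lambda>v. map (reach_row nv nc v) [0..<nc] @ [zero_row nv nc v]" "nc + 1" v nv nc] assms
  by (simp_all add: soft_rows_def nth_append)

lemma FINAL_correct:
  fixes hs :: "row list" and nv nc :: nat
  defines "n \<equiv> nv * nc + nv" and "rows \<equiv> hs @ soft_rows nv nc"
  assumes vals: "fst s x_cl = int (length reps)" "fst s x_mh = int (length hs)" "fst s x_nv = int nv" "fst s x_nc = int nc"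
    and sg: "sigs_stored n 1 rows reps s"
    and te: "\<And>s'. fst s' x_nc = fst s x_nc \<Longrightarrow> aval w te s' = int thr"
    and B: "length reps \<le> B" "nv \<le> B" "nc \<le> B"
  shows "fst (sem w (FINAL te) s) 0 = (if \<exists>y\<in>set reps. accepts nv nc thr y then 1 else 0) \<and> bdd w B (FINAL te) s"
proof -
  let ?X = "{0, x_sp, x_r, x_ok, x_v, x_cnt, x_c}"
  define U where "U t \<longleftrightarrow> unchanged ?X {} s t" for t
  have U_val: "fst t x_cl = int (length reps)" "fst t x_mh = int (length hs)" "fst t x_nv = int nv" "fst t x_nc = int nc"
    "snd t a_S = snd s a_S" "aval w te t = int thr" if "U t" for t
    using unchangedD[OF that[unfolded U_def]] vals te by simp_all
  have U_setv: "U (setv x y t)" if "U t" "x \<in> ?X" for x y t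
    using unchanged_updates(1)[of ?X "{}" s t x y] that by (simp add: U_def)
  have U_incv: "U (incv x t)" if "U t" "x \<in> ?X" for x t
    using unchanged_updates(2)[of ?X "{}" s t x] that by (simp add: U_def)
  define m where "m = length rows"
  have m: "m = length hs + nv * (nc + 1)" by (simp add: m_def rows_def length_soft_rows)
  \<comment> \<open>Clipping at a positive bound keeps the distinction between negative and
    nonnegative, and an integer is nonnegative iff adding 1 makes it positive.\<close>
  have sign: "0 < snd s a_S (r * m + (length hs + j)) + 1 \<longleftrightarrow> 0 \<le> row_val n (soft_rows nv nc ! j) (reps ! r)"
    if "r < length reps" "j < nv * (nc + 1)" for r j
  proof -
    have "snd s a_S (r * m + (length hs + j)) = signature n (int n + 1) rows (reps ! r) ! (length hs + j)"
      using sg that m by (simp add: sigs_stored_def m_def)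
    also have "\<dots> = clip (int n + 1) (row_val n (soft_rows nv nc ! j) (reps ! r))"
      using that by (simp add: signature_def rows_def nth_append length_soft_rows)
    finally show ?thesis by (simp add: clip_def)
  qed
  define cc1 where "cc1 = Assign x_cnt (Plus (Var x_cnt) (Pos (Plus (Ar a_S (Var x_sp)) (Lit 1)))) ;; Assign x_sp (Plus (Var x_sp) (Lit 1))"
  define ct where "ct = IfPos (Plus (Pos (Plus (Ar a_S (Var x_sp)) (Lit 1))) (Pos (Minus (Plus (Var x_cnt) (Lit 1)) te))) Skip
           (Assign x_ok (Lit 0)) ;; Assign x_sp (Plus (Var x_sp) (Lit 1))"
  define cv where "cv = Assign x_cnt (Lit 0) ;; For x_c (Var x_nc) cc1 ;; ct"
  define cr where "cr = Assign x_ok (Lit 1) ;; Assign x_sp (Plus (Var x_sp) (Var x_mh)) ;; For x_v (Var x_nv) cv ;; IfPos (Var x_ok) (Assign 0 (Lit 1)) Skip"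
  define R where "R r v c \<longleftrightarrow> 0 \<le> row_val n (reach_row nv nc v c) (reps ! r)" for r v c
  define Z where "Z r v \<longleftrightarrow> 0 \<le> row_val n (zero_row nv nc v) (reps ! r)" for r v
  have jless: "v * (nc + 1) + c < nv * (nc + 1)" if "v < nv" "c \<le> nc" for v c
    using that by (intro mult_add_less) auto
  define Qc where "Qc r v ok z c t \<longleftrightarrow> U t \<and> fst t x_cnt = int (card {c'. c' < c \<and> R r v c'}) \<and>
      fst t x_sp = int (r * m + (length hs + (v * (nc + 1) + c))) \<and> fst t x_ok = ok \<and> fst t 0 = z" for r v ok z c t
  have Lc: "Qc r v ok z nc (sem w (For x_c (Var x_nc) cc1) t) \<and> bdd w B (For x_c (Var x_nc) cc1) t"
    if r: "r < length reps" "v < nv" and q0: "Qc r v ok z 0 t" for r v ok z t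
  proof (rule For_rule[where Q="Qc r v ok z"])
    show "nat (aval w (Var x_nc) t) = nc" using q0 U_val(4)[of t] by (simp add: Qc_def)
    show "x_c \<notin> modv cc1" by (simp add: cc1_def)
    show "Qc r v ok z 0 (setv x_c 0 t)" using q0 U_setv[of t x_c 0] by (simp add: Qc_def)
    fix c t' assume c: "c < nc" and q: "Qc r v ok z c t'"
    have Ut: "U t'" using q by (simp add: Qc_def)
    have sp: "nat (fst t' x_sp) = r * m + (length hs + (v * (nc + 1) + c))" using q by (simp only: Qc_def nat_int)
    have "0 < snd t' a_S (r * m + (length hs + (v * (nc + 1) + c))) + 1 \<longleftrightarrow> R r v c"
      unfolding U_val(5)[OF Ut] sign[OF r(1) jless[OF r(2) less_imp_le[OF c]]] soft_rows_nth(1)[OF r(2) c] R_def ..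
    hence e: "sem w cc1 t' = setv x_sp (fst t' x_sp + 1) (setv x_cnt (fst t' x_cnt + (if R r v c then 1 else 0)) t')"
      by (simp add: cc1_def sp)
    have "{c'. c' < Suc c \<and> R r v c'} = (if R r v c then insert c {c'. c' < c \<and> R r v c'} else {c'. c' < c \<and> R r v c'})"
      by (auto simp: less_Suc_eq)
    hence "int (card {c'. c' < Suc c \<and> R r v c'}) = int (card {c'. c' < c \<and> R r v c'}) + (if R r v c then 1 else 0)" by simp
    moreover have "bdd w B cc1 t'" by (simp add: cc1_def)
    ultimately show "bdd w B cc1 t' \<and> Qc r v ok z (Suc c) (incv x_c (sem w cc1 t'))"
      unfolding e using q by (auto simp: Qc_def intro!: U_setv U_incv)
  qed (use B in simp)
  define A where "A r v \<longleftrightarrow> Z r v \<or> thr \<le> card {c. c < nc \<and> R r v c}" for r v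
  define Qv where "Qv r z v t \<longleftrightarrow> U t \<and> fst t x_ok = (if \<forall>v'<v. A r v' then 1 else 0) \<and>
      fst t x_sp = int (r * m + (length hs + v * (nc + 1))) \<and> fst t 0 = z" for r z v t
  have Lv: "Qv r z nv (sem w (For x_v (Var x_nv) cv) t) \<and> bdd w B (For x_v (Var x_nv) cv) t"
    if r: "r < length reps" and q0: "Qv r z 0 t" for r z t
  proof (rule For_rule[where Q="Qv r z"])
    show "nat (aval w (Var x_nv) t) = nv" using q0 U_val(3)[of t] by (simp add: Qv_def)
    show "x_v \<notin> modv cv" by (simp add: cv_def cc1_def ct_def)
    show "Qv r z 0 (setv x_v 0 t)" using q0 U_setv[of t x_v 0] by (simp add: Qv_def)
    fix v t' assume v: "v < nv" and q: "Qv r z v t'"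
    define ok where "ok = fst t' x_ok"
    have "Qc r v ok z 0 (setv x_cnt 0 t')" using q by (simp add: Qc_def Qv_def ok_def U_setv)
    from Lc[OF r v this] have t1: "Qc r v ok z nc (sem w (For x_c (Var x_nc) cc1) (setv x_cnt 0 t'))"
      "bdd w B (For x_c (Var x_nc) cc1) (setv x_cnt 0 t')" by blast+
    define t2 where "t2 = sem w (For x_c (Var x_nc) cc1) (setv x_cnt 0 t')"
    have U2: "U t2" and t2: "fst t2 x_cnt = int (card {c'. c' < nc \<and> R r v c'})" "fst t2 x_ok = ok" "fst t2 0 = z"
      using t1(1) by (auto simp: Qc_def t2_def)
    have sp2: "fst t2 x_sp = int (r * m + (length hs + (v * (nc + 1) + nc)))" using t1(1) unfolding Qc_def t2_def by blast
    have sp: "nat (fst t2 x_sp) = r * m + (length hs + (v * (nc + 1) + nc))" unfolding sp2 by (rule nat_int)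
    have zz: "0 < snd t2 a_S (r * m + (length hs + (v * (nc + 1) + nc))) + 1 \<longleftrightarrow> Z r v"
      unfolding U_val(5)[OF U2] sign[OF r jless[OF v order_refl]] soft_rows_nth(2)[OF v] Z_def ..
    have "0 < aval w (Plus (Pos (Plus (Ar a_S (Var x_sp)) (Lit 1))) (Pos (Minus (Plus (Var x_cnt) (Lit 1)) te))) t2 \<longleftrightarrow> A r v"
      unfolding aval.simps sp zz t2(1) U_val(6)[OF U2] A_def by auto
    hence e: "sem w ct t2 = setv x_sp (fst t2 x_sp + 1) (if A r v then t2 else setv x_ok 0 t2)"
      by (simp add: ct_def del: aval.simps) simp
    have "bdd w B cv t'" "sem w cv t' = sem w ct t2" using t1(2) by (simp_all add: cv_def ct_def t2_def)
    thus "bdd w B cv t' \<and> Qv r z (Suc v) (incv x_v (sem w cv t'))"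
      using q U2 t2(2,3) unfolding e sp2
      by (auto simp: Qv_def ok_def all_less_Suc algebra_simps intro!: U_setv U_incv)
  qed (use B in simp)
  have acc: "accepts nv nc thr (reps ! r) \<longleftrightarrow> (\<forall>v<nv. A r v)" for r
    by (simp add: accepts_def A_def Z_def R_def n_def)
  define Qr where "Qr r t \<longleftrightarrow> U t \<and> fst t x_sp = int (r * m) \<and>
     fst t 0 = (if \<exists>r'<r. accepts nv nc thr (reps ! r') then 1 else 0)" for r t
  define s0 where "s0 = setv x_sp 0 (setv 0 0 s)"
  have "Qr (length reps) (sem w (For x_r (Var x_cl) cr) s0) \<and> bdd w B (For x_r (Var x_cl) cr) s0"
  proof (rule For_rule[where Q=Qr])
    show "nat (aval w (Var x_cl) s0) = length reps" using vals by (simp add: s0_def)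
    show "x_r \<notin> modv cr" by (simp add: cr_def cv_def cc1_def ct_def)
    have "U s" by (simp add: U_def unchanged_refl)
    thus "Qr 0 (setv x_r 0 s0)" by (simp add: Qr_def s0_def U_setv)
    fix r t assume r: "r < length reps" and q: "Qr r t"
    have Ut: "U t" using q by (simp add: Qr_def)
    define z where "z = fst t 0"
    define t0 where "t0 = setv x_sp (fst t x_sp + fst t x_mh) (setv x_ok 1 t)"
    have "Qv r z 0 t0" using q U_val(2)[OF Ut] by (simp add: Qv_def Qr_def z_def t0_def U_setv)
    from Lv[OF r this] have t1: "Qv r z nv (sem w (For x_v (Var x_nv) cv) t0)" "bdd w B (For x_v (Var x_nv) cv) t0" by blast+
    have e: "sem w cr t = (let t1 = sem w (For x_v (Var x_nv) cv) t0 in if fst t1 x_ok > 0 then setv 0 1 t1 else t1)"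
      by (simp add: cr_def t0_def Let_def)
    have "bdd w B cr t" using t1(2) by (simp add: cr_def t0_def)
    moreover have "(\<exists>r'<Suc r. P r') \<longleftrightarrow> (\<exists>r'<r. P r') \<or> P r" for P by (auto simp: less_Suc_eq)
    ultimately show "bdd w B cr t \<and> Qr (Suc r) (incv x_r (sem w cr t))"
      unfolding e Let_def using t1(1) q
      by (auto simp: Qr_def Qv_def z_def acc m algebra_simps intro!: U_setv U_incv)
  qed (use B in simp)
  moreover have F: "FINAL te = Assign 0 (Lit 0) ;; Assign x_sp (Lit 0) ;; For x_r (Var x_cl) cr"
    by (simp only: FINAL_def cr_def cv_def cc1_def ct_def)
  moreover have "(\<exists>r'<length reps. accepts nv nc thr (reps ! r')) \<longleftrightarrow> (\<exists>y\<in>set reps. accepts nv nc thr y)"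
    by (auto simp: set_conv_nth)
  ultimately show ?thesis unfolding F by (simp add: Qr_def s0_def)
qed

section \<open>The number of signatures\<close>

definition bset :: "nat \<Rightarrow> nat \<Rightarrow> nat set" where
  "bset kap m = {i. i < kap \<and> odd (m div 2 ^ i)}"

lemma bset_subset: "bset kap m \<subseteq> {..<kap}" by (auto simp: bset_def)

lemma bset_surj: "S \<subseteq> {..<kap} \<Longrightarrow> \<exists>m<2 ^ kap. S = bset kap m"
proof -
  assume S: "S \<subseteq> {..<kap}"
  obtain m :: nat where m: "m < 2 ^ kap" "\<forall>i<kap. odd (m div 2 ^ i) \<longleftrightarrow> i \<in> S"
    using mask_exists[of kap "\<lambda>i. i \<in> S"] by blast
  have "S = bset kap m"
  proof (intro set_eqI iffI)
    fix i assume "i \<in> S" thus "i \<in> bset kap m" using S m(2) by (auto simp: bset_def)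
  next
    fix i assume "i \<in> bset kap m" thus "i \<in> S" using m(2) by (auto simp: bset_def)
  qed
  with m(1) show ?thesis by blast
qed

section \<open>The slacks of the rows in closed form\<close>

lemma row_val_hall:
  "row_val (nv * nc + nv) (hall_row nv nc g m) y = sum y (bset (nv * nc) m) - int (g m)"
proof -
  have "(\<Sum>i<nv * nc + nv. (if i < nv * nc \<and> odd (m div 2 ^ i) then 1 else 0) * y i) =
     (\<Sum>i<nv * nc + nv. if i \<in> bset (nv * nc) m then y i else 0)"
    by (rule sum.cong) (auto simp: bset_def)
  also have "\<dots> = sum y ({..<nv * nc + nv} \<inter> bset (nv * nc) m)"
    by (rule sum.inter_restrict[symmetric]) simp
  also have "{..<nv * nc + nv} \<inter> bset (nv * nc) m = bset (nv * nc) m" by (auto simp: bset_def)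
  finally show ?thesis by (simp add: row_val_def hall_row_def)
qed

lemma row_val_total:
  "row_val (nv * nc + nv) (total_row nv nc nu) y = int nu - sum y {..<nv * nc}"
proof -
  have "(\<Sum>i<nv * nc + nv. (if i < nv * nc then -1 else 0) * y i) =
     - (\<Sum>i<nv * nc + nv. if i \<in> {..<nv * nc} then y i else 0)"
    unfolding sum_negf[symmetric] by (rule sum.cong) auto
  also have "(\<Sum>i<nv * nc + nv. if i \<in> {..<nv * nc} then y i else 0) = sum y ({..<nv * nc + nv} \<inter> {..<nv * nc})"
    by (rule sum.inter_restrict[symmetric]) simp
  also have "{..<nv * nc + nv} \<inter> {..<nv * nc} = {..<nv * nc}" by auto
  finally show ?thesis by (simp add: row_val_def total_row_def)
qed

lemma sum_two_points:
  fixes y :: "nat \<Rightarrow> int"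
  assumes "a < n" "b < n" "a \<noteq> b"
  shows "(\<Sum>i<n. (if i = a then \<alpha> else if i = b then \<beta> else 0) * y i) = \<alpha> * y a + \<beta> * y b"
proof -
  have "(\<Sum>i<n. (if i = a then \<alpha> else if i = b then \<beta> else 0) * y i) =
     (\<Sum>i<n. (if i = a then \<alpha> * y i else 0) + (if i = b then \<beta> * y i else 0))"
    by (rule sum.cong) (use assms in auto)
  also have "\<dots> = \<alpha> * y a + \<beta> * y b" using assms by (simp add: sum.distrib)
  finally show ?thesis .
qed

lemma row_val_cap:
  assumes "v < nv" "c < nc"
  shows "row_val (nv * nc + nv) (cap_row nv nc l v c) y = y (nv * nc + v) + l - y (v * nc + c)"
  using sum_two_points[of "nv * nc + v" "nv * nc + nv" "v * nc + c" 1 "-1" y] mult_add_less[OF assms] assms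
  by (simp add: row_val_def cap_row_def)

lemma row_val_reach:
  assumes "v < nv" "c < nc"
  shows "row_val (nv * nc + nv) (reach_row nv nc v c) y = y (v * nc + c) - y (nv * nc + v)"
  using sum_two_points[of "nv * nc + v" "nv * nc + nv" "v * nc + c" "-1" 1 y] mult_add_less[OF assms] assms
  by (simp add: row_val_def reach_row_def)

lemma row_val_zero:
  assumes "v < nv"
  shows "row_val (nv * nc + nv) (zero_row nv nc v) y = - y (nv * nc + v)"
proof -
  have "(\<Sum>i<nv * nc + nv. (if i = nv * nc + v then -1 else 0) * y i) =
      (\<Sum>i<nv * nc + nv. if i = nv * nc + v then - y i else 0)" by (rule sum.cong) auto
  thus ?thesis using assms by (simp add: row_val_def zero_row_def)
qed

lemma row_val_size:
  assumes v: "v < nv"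
  shows "row_val (nv * nc + nv) (size_row nv nc sg b v) y = sg * (\<Sum>c<nc. y (v * nc + c)) - b"
proof -
  let ?S = "{i. i < nv * nc \<and> i div nc = v}"
  have "(\<Sum>i<nv * nc + nv. (if i < nv * nc \<and> i div nc = v then sg else 0) * y i) =
     (\<Sum>i<nv * nc + nv. if i \<in> ?S then sg * y i else 0)"
    by (rule sum.cong) auto
  also have "\<dots> = (\<Sum>i\<in>{..<nv * nc + nv} \<inter> ?S. sg * y i)" by (rule sum.inter_restrict[symmetric]) simp
  also have "{..<nv * nc + nv} \<inter> ?S = (\<lambda>c. v * nc + c) ` {..<nc}"
  proof (intro set_eqI iffI)
    fix i assume "i \<in> {..<nv * nc + nv} \<inter> ?S"
    hence "i < nv * nc" "i div nc = v" by auto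
    from mult_add_less_index[OF this(1)] this(2) show "i \<in> (\<lambda>c. v * nc + c) ` {..<nc}"
      by (intro image_eqI[of _ _ "i mod nc"]) auto
  next
    fix i assume "i \<in> (\<lambda>c. v * nc + c) ` {..<nc}"
    thus "i \<in> {..<nv * nc + nv} \<inter> ?S" using mult_add_less[OF v] by (auto simp: trans_less_add1)
  qed
  also have "(\<Sum>i\<in>(\<lambda>c. v * nc + c) ` {..<nc}. sg * y i) = (\<Sum>c<nc. sg * y (v * nc + c))"
    by (subst sum.reindex) (auto simp: inj_on_def)
  finally show ?thesis by (simp add: row_val_def size_row_def sum_distrib_left)
qed

lemma ball_hard_rows:
  "(\<forall>r\<in>set (hard_rows nu nv nc g l p q). P r) \<longleftrightarrow> (\<forall>m<2 ^ (nv * nc). P (hall_row nv nc g m)) \<and>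
     P (total_row nv nc nu) \<and> (\<forall>v<nv. \<forall>c<nc. P (cap_row nv nc l v c)) \<and>
     (\<forall>v<nv. P (size_row nv nc 1 p v) \<and> P (size_row nv nc (-1) (-q) v))"
  unfolding hard_rows_def by (auto simp: ball_Un)

definition acceptable :: "nat \<Rightarrow> nat \<Rightarrow> nat \<Rightarrow> (nat \<Rightarrow> int) \<Rightarrow> bool" where
  "acceptable nv nc thr y \<longleftrightarrow> (\<forall>v<nv. y (nv * nc + v) \<le> 0 \<or>
     thr \<le> card {c. c < nc \<and> y (nv * nc + v) \<le> y (v * nc + c)})"

lemma rows_iff_count_solution:
  "count_solution nu nv nc thr G l p q y \<longleftrightarrow> (\<forall>i<nv * nc + nv. 0 \<le> y i) \<and>
     (\<forall>r\<in>set (hard_rows nu nv nc (\<lambda>m. G (bset (nv * nc) m)) (int l) p q). 0 \<le> row_val (nv * nc + nv) r y) \<and>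
     acceptable nv nc thr y"
proof -
  have hall: "(\<forall>m<2 ^ (nv * nc). 0 \<le> row_val (nv * nc + nv) (hall_row nv nc (\<lambda>m. G (bset (nv * nc) m)) m) y) \<longleftrightarrow>
      (\<forall>S. S \<subseteq> {..<nv * nc} \<longrightarrow> int (G S) \<le> sum y S)"
  proof (intro iffI allI impI)
    fix S assume a: "\<forall>m<2 ^ (nv * nc). 0 \<le> row_val (nv * nc + nv) (hall_row nv nc (\<lambda>m. G (bset (nv * nc) m)) m) y"
      and "S \<subseteq> {..<nv * nc}"
    from bset_surj[OF this(2)] obtain m where "m < 2 ^ (nv * nc)" "S = bset (nv * nc) m" by blast
    with a show "int (G S) \<le> sum y S" by (simp add: row_val_hall)
  next
    fix m :: nat assume "\<forall>S. S \<subseteq> {..<nv * nc} \<longrightarrow> int (G S) \<le> sum y S"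
    with bset_subset show "0 \<le> row_val (nv * nc + nv) (hall_row nv nc (\<lambda>m. G (bset (nv * nc) m)) m) y"
      by (simp add: row_val_hall)
  qed
  have cap: "(\<forall>v<nv. \<forall>c<nc. 0 \<le> row_val (nv * nc + nv) (cap_row nv nc (int l) v c) y) \<longleftrightarrow>
     (\<forall>v<nv. \<forall>c<nc. y (v * nc + c) \<le> y (nv * nc + v) + int l)"
    by (simp add: row_val_cap cong: conj_cong)
  have size: "(\<forall>v<nv. 0 \<le> row_val (nv * nc + nv) (size_row nv nc 1 p v) y \<and>
      0 \<le> row_val (nv * nc + nv) (size_row nv nc (-1) (-q) v) y) \<longleftrightarrow>
     (\<forall>v<nv. p \<le> (\<Sum>c<nc. y (v * nc + c)) \<and> (\<Sum>c<nc. y (v * nc + c)) \<le> q)"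
    by (simp add: row_val_size cong: conj_cong)
  show ?thesis unfolding ball_hard_rows hall cap size row_val_total count_solution_def acceptable_def by auto
qed

text \<open>On \<open>Y\<close> the map \<open>h\<close> factors through \<open>f\<close>.\<close>

lemma card_image_determined:
  assumes fin: "finite (f ` Y)" and det: "\<And>x y. x \<in> Y \<Longrightarrow> y \<in> Y \<Longrightarrow> f x = f y \<Longrightarrow> h x = h y"
  shows "finite (h ` Y) \<and> card (h ` Y) \<le> card (f ` Y)"
proof -
  define k where "k v = h (SOME x. x \<in> Y \<and> f x = v)" for v
  have "h x = k (f x)" if x: "x \<in> Y" for x
  proof -
    have "(SOME x'. x' \<in> Y \<and> f x' = f x) \<in> Y \<and> f (SOME x'. x' \<in> Y \<and> f x' = f x) = f x"
      by (rule someI[of _ x]) (simp add: x)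
    thus ?thesis unfolding k_def using det[OF x] by simp
  qed
  hence "h ` Y = k ` f ` Y" by (auto simp: image_iff)
  thus ?thesis using fin card_image_le[OF fin, of k] by simp
qed

lemma card_map_image:
  assumes "\<And>r. r \<in> set rs \<Longrightarrow> finite (F r ` Y) \<and> card (F r ` Y) \<le> M"
  shows "finite ((\<lambda>y. map (\<lambda>r. F r y) rs) ` Y) \<and> card ((\<lambda>y. map (\<lambda>r. F r y) rs) ` Y) \<le> M ^ length rs"
  using assms
proof (induction rs)
  case Nil
  have "(\<lambda>y. map (\<lambda>r. F r y) []) ` Y \<subseteq> {[]}" by auto
  from card_mono[OF _ this] finite_subset[OF this] show ?case by simp
next
  case (Cons r rs)
  let ?A = "F r ` Y" and ?B = "(\<lambda>y. map (\<lambda>r. F r y) rs) ` Y"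
  have A: "finite ?A" "card ?A \<le> M" using Cons.prems by auto
  have B: "finite ?B" "card ?B \<le> M ^ length rs" using Cons by auto
  have sub: "(\<lambda>y. map (\<lambda>r. F r y) (r # rs)) ` Y \<subseteq> (\<lambda>(a, b). a # b) ` (?A \<times> ?B)" by auto
  have fin: "finite (?A \<times> ?B)" using A B by simp
  have "card ((\<lambda>y. map (\<lambda>r. F r y) (r # rs)) ` Y) \<le> card ((\<lambda>(a, b). a # b) ` (?A \<times> ?B))"
    using fin sub by (intro card_mono) auto
  also have "\<dots> \<le> card (?A \<times> ?B)" by (rule card_image_le[OF fin])
  also have "\<dots> = card ?A * card ?B" by (rule card_cartesian_product)
  also have "\<dots> \<le> M * M ^ length rs" using A B by (intro mult_le_mono) auto
  finally show ?case using finite_subset[OF sub finite_imageI[OF fin]] by simp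
qed

text \<open>The slacks lie in one residue class modulo \<open>D\<close>. At most 2 (n + 1) + 1 of
  them are between -K and K, and the two clipped values bring the count to 2n + 5.\<close>

lemma card_clip_values:
  assumes D: "D > 0" and K: "K = (int n + 1) * D" and Y: "\<And>y. y \<in> Y \<Longrightarrow> \<forall>i<n. D dvd y i"
  shows "finite ((\<lambda>y. clip K (row_val n r y)) ` Y) \<and> card ((\<lambda>y. clip K (row_val n r y)) ` Y) \<le> 2 * n + 5"
proof -
  define b where "b = snd r"
  define A where "A = {b div D - (int n + 1) .. b div D + (int n + 1)}"
  have sub: "(\<lambda>y. clip K (row_val n r y)) ` Y \<subseteq> {K, - K} \<union> (\<lambda>t. D * t - b) ` A"
  proof
    fix x assume "x \<in> (\<lambda>y. clip K (row_val n r y)) ` Y"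
    then obtain y where y: "y \<in> Y" "x = clip K (row_val n r y)" by blast
    have "D dvd (\<Sum>i<n. fst r i * y i)" using Y[OF y(1)] by (intro dvd_sum) simp
    then obtain t where t: "(\<Sum>i<n. fst r i * y i) = D * t" by (elim dvdE)
    have rv: "row_val n r y = D * t - b" by (simp add: row_val_def t b_def)
    show "x \<in> {K, - K} \<union> (\<lambda>t. D * t - b) ` A"
    proof (cases "- K \<le> row_val n r y \<and> row_val n r y \<le> K")
      case False
      thus ?thesis using y(2) by (auto simp: clip_def)
    next
      case True
      hence x: "x = D * t - b" using y(2) rv by (simp add: clip_def)
      have "D * t \<le> b + (int n + 1) * D" "b + (- (int n + 1)) * D \<le> D * t"
        using True K unfolding rv by (auto simp: algebra_simps)
      from zdiv_mono1[OF this(1) D] zdiv_mono1[OF this(2) D]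
      have "t \<le> b div D + (int n + 1)" "b div D - (int n + 1) \<le> t"
        using D div_mult_self1[of D b "int n + 1"] div_mult_self1[of D b "- (int n + 1)"] by auto
      hence "t \<in> A" by (simp add: A_def)
      thus ?thesis unfolding x by blast
    qed
  qed
  have fin: "finite ({K, - K} \<union> (\<lambda>t. D * t - b) ` A)" by (simp add: A_def)
  have "card ((\<lambda>y. clip K (row_val n r y)) ` Y) \<le> card ({K, - K} \<union> (\<lambda>t. D * t - b) ` A)"
    by (rule card_mono[OF fin sub])
  also have "\<dots> \<le> card {K, - K} + card ((\<lambda>t. D * t - b) ` A)" by (rule card_Un_le)
  also have "\<dots> \<le> 2 + card A"
    using card_image_le[of A "\<lambda>t. D * t - b"] by (intro add_mono) (auto simp: A_def card_insert_if)
  also have "\<dots> = 2 * n + 5" by (simp add: A_def)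
  finally show ?thesis using finite_subset[OF sub fin] by simp
qed

definition other_rows :: "nat \<Rightarrow> nat \<Rightarrow> nat \<Rightarrow> int \<Rightarrow> int \<Rightarrow> int \<Rightarrow> row list" where
  "other_rows nu nv nc l p q = [total_row nv nc nu] @
     concat (map (\<lambda>v. map (cap_row nv nc l v) [0..<nc]) [0..<nv]) @
     concat (map (\<lambda>v. [size_row nv nc 1 p v, size_row nv nc (-1) (-q) v]) [0..<nv]) @ soft_rows nv nc"

lemma rows_split: "hard_rows nu nv nc g l p q @ soft_rows nv nc =
    map (hall_row nv nc g) [0..<2 ^ (nv * nc)] @ other_rows nu nv nc l p q"
  by (simp add: hard_rows_def other_rows_def)

lemma length_other_rows: "length (other_rows nu nv nc l p q) = 1 + 2 * (nv * nc) + 3 * nv"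
  by (simp add: other_rows_def soft_rows_def length_concat o_def sum_list_triv algebra_simps)

text \<open>Every level keeps few representatives: the signature on the Hall rows is controlled by
  the codes of near-tight chains, and there are only \<open>O(nv * nc)\<close> other rows.\<close>

lemma card_signatures:
  fixes G :: "nat set \<Rightarrow> nat" and nv nc nu :: nat and l p q :: int
  assumes super: "\<And>A B. A \<subseteq> {..<nv * nc} \<Longrightarrow> B \<subseteq> {..<nv * nc} \<Longrightarrow> G A + G B \<le> G (A \<union> B) + G (A \<inter> B)"
    and full: "G {..<nv * nc} = nu" and D: "D > 0"
  defines "n \<equiv> nv * nc + nv" and "hs \<equiv> hard_rows nu nv nc (\<lambda>m. G (bset (nv * nc) m)) l p q"
  defines "K \<equiv> (int n + 1) * D"
  defines "Y \<equiv> {y. (\<forall>i<n. 0 \<le> y i \<and> D dvd y i) \<and> live n K hs y}"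
  shows "finite (signature n K (hs @ soft_rows nv nc) ` Y)"
    and "card (signature n K (hs @ soft_rows nv nc) ` Y) \<le>
      ((nv * nc * (nv * nc) + nv * nc) * (nv * nc * (2 * (nv * nc) + 2) * (n + 1) + (n + 1) + 2)) ^ (nv * nc) *
      (2 * n + 5) ^ (1 + 2 * (nv * nc) + 3 * nv)"
proof -
  let ?kap = "nv * nc"
  let ?g = "\<lambda>m. G (bset ?kap m)"
  have K0: "0 \<le> K" using D by (simp add: K_def)
  interpret nt: near_tight ?kap "\<lambda>S. int (G S)" K
  proof
    fix A B assume "A \<subseteq> {..<?kap}" "B \<subseteq> {..<?kap}"
    from super[OF this] show "int (G A) + int (G B) \<le> int (G (A \<union> B)) + int (G (A \<inter> B))" by linarith
  qed (use K0 in auto)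
  have lv: "0 \<le> row_val n r y + K - (int n + 1)" if "y \<in> Y" "r \<in> set hs" for y r
    using that by (simp add: Y_def live_def)
  have hall_val: "row_val n (hall_row nv nc ?g m) y = nt.rho y (bset ?kap m)" for m y
    unfolding n_def row_val_hall nt.rho_def ..
  have low: "- K \<le> nt.rho y S" if y: "y \<in> Y" and S: "S \<subseteq> {..<?kap}" for y S
  proof -
    obtain m where m: "m < 2 ^ ?kap" "S = bset ?kap m" using bset_surj[OF S] by blast
    have "hall_row nv nc ?g m \<in> set hs" using m(1) unfolding hs_def hard_rows_def by simp
    from lv[OF y this] show ?thesis unfolding hall_val m(2) by linarith
  qed
  have adm: "nt.adm y" if y: "y \<in> Y" for y
  proof -
    have "total_row nv nc nu \<in> set hs" by (simp add: hs_def hard_rows_def)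
    from lv[OF y this] have "sum y {..<?kap} - int nu \<le> K" unfolding n_def row_val_total by linarith
    thus ?thesis using low[OF y] full by (simp add: nt.adm_def nt.rho_def)
  qed
  have dvd: "\<forall>w<?kap. D dvd y w" if "y \<in> Y" for y using that by (simp add: Y_def n_def)
  have Kn: "K = (int n + 1) * D" by (simp add: K_def)
  have codes: "finite (nt.code D ` Y)" "card (nt.code D ` Y) \<le>
     ((?kap * ?kap + ?kap) * nat (int ?kap * (2 * int ?kap + 2) * (int n + 1) + (int n + 1) + 2)) ^ ?kap"
    by (rule nt.card_codes[OF _ D Kn], use adm dvd in blast)+
  have nat_eq: "nat (int ?kap * (2 * int ?kap + 2) * (int n + 1) + (int n + 1) + 2) =
     ?kap * (2 * ?kap + 2) * (n + 1) + (n + 1) + 2"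
  proof -
    have "int ?kap * (2 * int ?kap + 2) * (int n + 1) + (int n + 1) + 2 =
      int (?kap * (2 * ?kap + 2) * (n + 1) + (n + 1) + 2)"
      by (simp only: of_nat_add of_nat_mult of_nat_numeral of_nat_1)
    thus ?thesis by (simp only: nat_int)
  qed
  define hall where "hall = map (hall_row nv nc ?g) [0..<2 ^ ?kap]"
  define oth where "oth = other_rows nu nv nc l p q"
  define f where "f = (\<lambda>y. map (\<lambda>r. clip K (row_val n r y)) hall)"
  define h where "h = (\<lambda>y. map (\<lambda>r. clip K (row_val n r y)) oth)"
  have "finite (f ` Y) \<and> card (f ` Y) \<le> card (nt.code D ` Y)"
  proof (rule card_image_determined[OF codes(1)])
    fix x y assume xy: "x \<in> Y" "y \<in> Y" "nt.code D x = nt.code D y"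
    show "f x = f y" unfolding f_def
    proof (rule map_cong[OF refl])
      fix r assume "r \<in> set hall"
      then obtain m where r: "r = hall_row nv nc ?g m" by (auto simp: hall_def)
      have "min K (nt.rho x (bset ?kap m)) = min K (nt.rho y (bset ?kap m))"
        by (rule nt.code_determines[OF adm[OF xy(1)] adm[OF xy(2)] D _ _ xy(3) bset_subset])
          (use dvd[OF xy(1)] dvd[OF xy(2)] in auto)
      \<comment> \<open>No Hall slack is below -K here, so only clipping from above matters, and
        this is what the codes determine.\<close>
      moreover have "clip K z = min K z" if "- K \<le> z" for z using that by (auto simp: clip_def)
      ultimately show "clip K (row_val n r x) = clip K (row_val n r y)"
        unfolding r hall_val using low[OF xy(1) bset_subset[of ?kap m]] low[OF xy(2) bset_subset[of ?kap m]] by simp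
    qed
  qed
  with codes(2) have f: "finite (f ` Y)" "card (f ` Y) \<le>
     ((?kap * ?kap + ?kap) * (?kap * (2 * ?kap + 2) * (n + 1) + (n + 1) + 2)) ^ ?kap"
    unfolding nat_eq by linarith+
  have h: "finite (h ` Y) \<and> card (h ` Y) \<le> (2 * n + 5) ^ length oth"
    unfolding h_def
    by (rule card_map_image, rule card_clip_values[OF D Kn]) (simp add: Y_def)
  have sub: "signature n K (hs @ soft_rows nv nc) ` Y \<subseteq> (\<lambda>(a, b). a @ b) ` (f ` Y \<times> h ` Y)"
    unfolding hs_def rows_split signature_def f_def h_def hall_def oth_def by auto
  have fin: "finite (f ` Y \<times> h ` Y)" using f h by simp
  show "finite (signature n K (hs @ soft_rows nv nc) ` Y)" by (rule finite_subset[OF sub finite_imageI[OF fin]])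
  have "card (signature n K (hs @ soft_rows nv nc) ` Y) \<le> card ((\<lambda>(a, b). a @ b) ` (f ` Y \<times> h ` Y))"
    by (rule card_mono[OF finite_imageI[OF fin] sub])
  also have "\<dots> \<le> card (f ` Y \<times> h ` Y)" by (rule card_image_le[OF fin])
  also have "\<dots> = card (f ` Y) * card (h ` Y)" by (rule card_cartesian_product)
  also have "\<dots> \<le> ((?kap * ?kap + ?kap) * (?kap * (2 * ?kap + 2) * (n + 1) + (n + 1) + 2)) ^ ?kap * (2 * n + 5) ^ length oth"
    using f h by (intro mult_le_mono) auto
  finally show "card (signature n K (hs @ soft_rows nv nc) ` Y) \<le>
      ((nv * nc * (nv * nc) + nv * nc) * (nv * nc * (2 * (nv * nc) + 2) * (n + 1) + (n + 1) + 2)) ^ (nv * nc) *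
      (2 * n + 5) ^ (1 + 2 * (nv * nc) + 3 * nv)"
    by (simp add: oth_def length_other_rows)
qed

text \<open>The exponent splits into \<open>5 * kap\<close> for the codes, whose entries take at
  most the fifth power of the base many values, and \<open>5 * kap + 1\<close> for the
  \<open>1 + 2 * kap + 3 * nv\<close> other rows, each with at most as many values as the
  base.\<close>

definition level_bound :: "nat \<Rightarrow> nat" where
  "level_bound kap = (10 * (kap + 1)) ^ (10 * kap + 1)"

lemma level_bound_arith:
  assumes "nv \<le> kap"
  shows "((kap * kap + kap) * (kap * (2 * kap + 2) * (kap + nv + 1) + (kap + nv + 1) + 2)) ^ kap *
      (2 * (kap + nv) + 5) ^ (1 + 2 * kap + 3 * nv) \<le> level_bound kap"
proof -
  define k where "k = kap + 1"
  have a: "(kap * kap + kap) * (kap * (2 * kap + 2) * (kap + nv + 1) + (kap + nv + 1) + 2) \<le> (10 * k) ^ 5"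
  proof -
    have 1: "kap * kap + kap \<le> k * k" by (simp add: k_def)
    have "kap * (2 * kap + 2) \<le> 2 * (k * k)" by (simp add: k_def algebra_simps)
    moreover have "kap + nv + 1 \<le> 2 * k" using assms by (simp add: k_def)
    ultimately have "kap * (2 * kap + 2) * (kap + nv + 1) \<le> 2 * (k * k) * (2 * k)" by (rule mult_le_mono)
    moreover have "kap + nv + 1 \<le> 2 * k * (k * k)"
    proof -
      have "kap + nv + 1 \<le> 2 * k * 1" using assms by (simp add: k_def)
      also have "\<dots> \<le> 2 * k * (k * k)" by (intro mult_le_mono2) (simp add: k_def)
      finally show ?thesis .
    qed
    moreover have "2 \<le> 2 * (k * k * k)" by (simp add: k_def)
    moreover have "2 * (k * k) * (2 * k) = 4 * (k * k * k)" "2 * k * (k * k) = 2 * (k * k * k)" by simp_all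
    ultimately have 2: "kap * (2 * kap + 2) * (kap + nv + 1) + (kap + nv + 1) + 2 \<le> 8 * (k * k * k)" by linarith
    have "(kap * kap + kap) * (kap * (2 * kap + 2) * (kap + nv + 1) + (kap + nv + 1) + 2) \<le> (k * k) * (8 * (k * k * k))"
      using 1 2 by (rule mult_le_mono)
    also have "\<dots> = 8 * (k * k * (k * k * k))" by simp
    also have "k * k * (k * k * k) = k ^ 5" by (simp add: eval_nat_numeral mult.assoc)
    also have "8 * k ^ 5 \<le> (10 * k) ^ 5" unfolding power_mult_distrib by (rule mult_le_mono1) simp
    finally show ?thesis .
  qed
  have b: "2 * (kap + nv) + 5 \<le> 10 * k" using assms by (simp add: k_def)
  have "((kap * kap + kap) * (kap * (2 * kap + 2) * (kap + nv + 1) + (kap + nv + 1) + 2)) ^ kap \<le> ((10 * k) ^ 5) ^ kap"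
    by (rule power_mono[OF a]) simp
  moreover have "(2 * (kap + nv) + 5) ^ (1 + 2 * kap + 3 * nv) \<le> (10 * k) ^ (1 + 2 * kap + 3 * nv)"
    by (rule power_mono[OF b]) simp
  moreover have "(10 * k) ^ (1 + 2 * kap + 3 * nv) \<le> (10 * k) ^ (5 * kap + 1)"
    using assms by (intro power_increasing) (auto simp: k_def)
  ultimately have "((kap * kap + kap) * (kap * (2 * kap + 2) * (kap + nv + 1) + (kap + nv + 1) + 2)) ^ kap *
      (2 * (kap + nv) + 5) ^ (1 + 2 * kap + 3 * nv) \<le> ((10 * k) ^ 5) ^ kap * (10 * k) ^ (5 * kap + 1)"
    by (intro mult_le_mono) linarith+
  also have "\<dots> = level_bound kap"
    unfolding level_bound_def k_def[symmetric] power_mult[symmetric] power_add[symmetric] by simp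
  finally show ?thesis .
qed

text \<open>The representatives of a level have different signatures and lie in the set
  \<open>Y\<close> of \<open>card_signatures\<close>. The assumption \<open>0 < nc\<close> gives
  \<open>nv \<le> nv * nc\<close>; without colors the parameter would not bound the number of right
  vertices.\<close>

lemma length_levels:
  fixes G :: "nat set \<Rightarrow> nat" and nv nc nu :: nat and l p q :: int
  assumes super: "\<And>A B. A \<subseteq> {..<nv * nc} \<Longrightarrow> B \<subseteq> {..<nv * nc} \<Longrightarrow> G A + G B \<le> G (A \<union> B) + G (A \<inter> B)"
    and full: "G {..<nv * nc} = nu" and nc: "0 < nc" and k: "k \<le> L"
  defines "hs \<equiv> hard_rows nu nv nc (\<lambda>m. G (bset (nv * nc) m)) l p q"
  shows "length (levels (nv * nc + nv) L hs (hs @ soft_rows nv nc) k) \<le> level_bound (nv * nc)"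
proof (cases k)
  case 0
  have "1 \<le> level_bound (nv * nc)" by (simp add: level_bound_def)
  thus ?thesis by (simp add: 0)
next
  case (Suc k')
  let ?n = "nv * nc + nv"
  let ?rows = "hs @ soft_rows nv nc"
  define D :: int where "D = 2 ^ (L - k)"
  define K where "K = (int ?n + 1) * D"
  define Y where "Y = {y. (\<forall>i<?n. 0 \<le> y i \<and> D dvd y i) \<and> live ?n K hs y}"
  let ?reps = "levels ?n L hs ?rows k"
  have "D > 0" by (simp add: D_def)
  note c = card_signatures[OF super full \<open>D > 0\<close>, of l p q, folded hs_def, folded K_def, folded Y_def]
  have sub: "signature ?n K ?rows ` set ?reps \<subseteq> signature ?n K ?rows ` Y"
  proof (rule image_mono, rule subsetI)
    fix y assume y: "y \<in> set ?reps"
    from levels_sound(1)[OF k y] levels_sound(2)[OF k y] Suc show "y \<in> Y"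
      by (simp add: Y_def D_def K_def)
  qed
  have "distinct (map (signature ?n K ?rows) ?reps)"
    unfolding K_def D_def Suc by (rule levels_distinct)
  from distinct_card[OF this] have "length ?reps = card (signature ?n K ?rows ` set ?reps)" by simp
  also have "\<dots> \<le> card (signature ?n K ?rows ` Y)" by (rule card_mono[OF c(1) sub])
  also have "\<dots> \<le> level_bound (nv * nc)"
    using order_trans[OF c(2) level_bound_arith[of nv "nv * nc"]] nc by simp
  finally show ?thesis .
qed

section \<open>The complete program\<close>

lemma accepts_iff_acceptable: "accepts nv nc thr y \<longleftrightarrow> acceptable nv nc thr y"
proof -
  have "{c. c < nc \<and> 0 \<le> row_val (nv * nc + nv) (reach_row nv nc v c) y} =
      {c. c < nc \<and> y (nv * nc + v) \<le> y (v * nc + c)}" if "v < nv" for v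
    using row_val_reach[OF that] by auto
  thus ?thesis unfolding accepts_def acceptable_def using row_val_zero by simp
qed

lemma ball_soft_rows: "(\<forall>r\<in>set (soft_rows nv nc). P r) \<longleftrightarrow>
    (\<forall>v<nv. (\<forall>c<nc. P (reach_row nv nc v c)) \<and> P (zero_row nv nc v))"
  unfolding soft_rows_def by (auto simp: ball_Un)

lemma unit_rows_all_rows: "unit_rows n (hard_rows nu nv nc g l p q @ soft_rows nv nc)"
  unfolding unit_rows_def set_append ball_Un ball_hard_rows ball_soft_rows
  by (auto simp: hall_row_def total_row_def cap_row_def size_row_def reach_row_def zero_row_def)

lemma length_all_rows: "length (hard_rows nu nv nc g l p q @ soft_rows nv nc) = 2 ^ (nv * nc) + (1 + 2 * (nv * nc) + 3 * nv)"
  unfolding rows_split by (simp add: length_other_rows)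

lemma level_bound_large:
  "10 * (k + 1) * 4 ^ k \<le> level_bound k"
proof -
  have "(4 :: nat) ^ k \<le> (10 * (k + 1)) ^ k" by (rule power_mono) simp_all
  also have "\<dots> \<le> (10 * (k + 1)) ^ (10 * k)" by (rule power_increasing) simp_all
  finally have "10 * (k + 1) * 4 ^ k \<le> 10 * (k + 1) * (10 * (k + 1)) ^ (10 * k)" by (rule mult_le_mono2)
  thus ?thesis unfolding level_bound_def power_add power_one_right by (simp only: mult.commute)
qed

text \<open>The remaining loops run over indices, masks and rows. Their lengths are at most
  \<open>10 * (k + 1) * 4 ^ k\<close>, because \<open>k + nv \<le> 2 * k\<close>.\<close>

lemma level_bound_ge:
  assumes "nv \<le> k"
  shows "1 \<le> level_bound k" "2 ^ k \<le> level_bound k" "2 ^ (k + nv) \<le> level_bound k" "k + nv \<le> level_bound k"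
    "2 ^ k + (1 + 2 * k + 3 * nv) \<le> level_bound k"
proof -
  have 4: "(1 :: nat) \<le> 4 ^ k" by simp
  have 2: "(2 :: nat) ^ k \<le> 4 ^ k" by (rule power_mono) simp_all
  have lin: "a * 4 ^ k \<le> level_bound k" if "a \<le> 10 * (k + 1)" for a
    using order_trans[OF mult_le_mono1[OF that] level_bound_large] .
  show "1 \<le> level_bound k" by (rule order_trans[OF 4]) (use lin[of 1] in simp)
  show "2 ^ k \<le> level_bound k" by (rule order_trans[OF 2]) (use lin[of 1] in simp)
  have "(2 :: nat) ^ (k + nv) \<le> 2 ^ (2 * k)" by (rule power_increasing) (use assms in simp_all)
  also have "\<dots> = 4 ^ k" by (simp add: power_mult)
  finally show "2 ^ (k + nv) \<le> level_bound k" using lin[of 1] by simp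
  have "(k + nv) * 1 \<le> (k + nv) * 4 ^ k" by (rule mult_le_mono2[OF 4])
  thus "k + nv \<le> level_bound k"
    using order_trans[OF _ lin[of "k + nv"], of "k + nv"] assms by simp
  have "(1 + 2 * k + 3 * nv) * 1 \<le> (1 + 2 * k + 3 * nv) * 4 ^ k" by (rule mult_le_mono2[OF 4])
  hence "2 ^ k + (1 + 2 * k + 3 * nv) \<le> (2 + 2 * k + 3 * nv) * 4 ^ k" using 2 by (simp add: algebra_simps)
  thus "2 ^ k + (1 + 2 * k + 3 * nv) \<le> level_bound k" using lin[of "2 + 2 * k + 3 * nv"] assms by simp
qed

text \<open>For k at least 2 the base satisfies \<open>10 * (k + 1) \<le> k ^ 5\<close>, and
  \<open>5 * (10 * k + 1) \<le> 55 * k\<close>. The factor \<open>20 ^ 11\<close> is the value at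
  \<open>k = 1\<close>, where the self-power is 1 and absorbs nothing; it also covers
  \<open>k = 0\<close>.\<close>

lemma level_bound_self_power: "level_bound k \<le> 20 ^ 11 * k ^ (55 * k)"
proof (cases "k \<le> 1")
  case True
  hence "k = 0 \<or> k = 1" by auto
  thus ?thesis by (auto simp: level_bound_def)
next
  case False
  have "2 * 2 * 2 * 2 \<le> k * k * k * k" using False by (intro mult_le_mono) auto
  hence "15 * k \<le> k * k * k * k * k" by simp
  moreover have "10 * (k + 1) \<le> 15 * k" using False by simp
  ultimately have "10 * (k + 1) \<le> k ^ 5" by (simp add: eval_nat_numeral mult.assoc)
  hence "level_bound k \<le> (k ^ 5) ^ (10 * k + 1)" unfolding level_bound_def by (rule power_mono) simp
  also have "\<dots> = k ^ (5 * (10 * k + 1))" by (simp only: power_mult)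
  also have "\<dots> \<le> k ^ (55 * k)" by (rule power_increasing) (use False in simp_all)
  also have "\<dots> \<le> 20 ^ 11 * k ^ (55 * k)" by simp
  finally show ?thesis .
qed

text \<open>The product of \<open>x_nv\<close> and \<open>x_nc\<close> and the powers of two are
  built by repeated addition and doubling.\<close>

definition BODY :: "aexp \<Rightarrow> com" where
  "BODY te = Assign x_kap (Lit 0) ;; For x_i (Var x_nv) (Assign x_kap (Plus (Var x_kap) (Var x_nc))) ;;
     Assign x_n (Plus (Var x_kap) (Var x_nv)) ;;
     Assign x_pk (Lit 1) ;; For x_i (Var x_kap) (Assign x_pk (Plus (Var x_pk) (Var x_pk))) ;;
     Assign x_pn (Var x_pk) ;; For x_i (Var x_nv) (Assign x_pn (Plus (Var x_pn) (Var x_pn))) ;;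
     ROWS ;; SEARCH ;; FINAL te"

lemma BODY_correct:
  fixes G :: "nat set \<Rightarrow> nat" and w :: "int list"
  assumes lay: "layout oV oE oC nu ne nv nc s" and lpq: "fst s x_l = l" "fst s x_p = p" "fst s x_q = q"
    and Q0: "snd s a_Q = (\<lambda>_. 0)" and te: "\<And>s'. fst s' x_nc = fst s x_nc \<Longrightarrow> aval w te s' = int thr"
    and G: "gval w oV oE oC nu ne nv nc = (\<lambda>m. G (bset (nv * nc) m))"
    and super: "\<And>A B. A \<subseteq> {..<nv * nc} \<Longrightarrow> B \<subseteq> {..<nv * nc} \<Longrightarrow> G A + G B \<le> G (A \<union> B) + G (A \<inter> B)"
    and full: "G {..<nv * nc} = nu" and nc: "0 < nc"
    and NB: "nu \<le> M" "ne \<le> M" "nv \<le> M" "nc \<le> M"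
  defines "B \<equiv> M + level_bound (nv * nc)"
  defines "hs \<equiv> hard_rows nu nv nc (\<lambda>m. G (bset (nv * nc) m)) l p q"
  shows "fst (sem w (BODY te) s) 0 =
      (if \<exists>y\<in>set (levels (nv * nc + nv) (nu + 1) hs (hs @ soft_rows nv nc) (nu + 1)). accepts nv nc thr y then 1 else 0) \<and>
    bdd w B (BODY te) s"
proof -
  let ?kap = "nv * nc"
  let ?n = "nv * nc + nv"
  have nvk: "nv \<le> ?kap" using nc by simp
  note lb = level_bound_ge[OF nvk]
  have B: "nu \<le> B" "ne \<le> B" "nv \<le> B" "nc \<le> B" "2 ^ ?kap \<le> B" "?kap \<le> B" "?n \<le> B" "2 ^ ?n \<le> B" "nu + 1 \<le> B"
    "2 ^ ?kap + (1 + 2 * ?kap + 3 * nv) \<le> B" "level_bound ?kap \<le> B"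
    using NB lb unfolding B_def by linarith+
  have v0: "fst s x_nv = int nv" "fst s x_nc = int nc" using lay by (auto simp: layout_def)
  define c1 where "c1 = For x_i (Var x_nv) (Assign x_kap (Plus (Var x_kap) (Var x_nc)))"
  define s1 where "s1 = sem w c1 (setv x_kap 0 s)"
  have "(unchanged {x_kap, x_i} {} s s1 \<and> fst s1 x_kap = int (nv * nc)) \<and> bdd w B c1 (setv x_kap 0 s)"
    unfolding s1_def c1_def
  proof (rule For_rule[where Q="\<lambda>k t. unchanged {x_kap, x_i} {} s t \<and> fst t x_kap = int (k * nc)"])
    show "nat (aval w (Var x_nv) (setv x_kap 0 s)) = nv" using v0 by simp
  qed (use B v0 in \<open>auto simp: unchanged_def\<close>)
  hence s1: "unchanged {x_kap, x_i} {} s s1" "fst s1 x_kap = int ?kap" "bdd w B c1 (setv x_kap 0 s)" by blast+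
  define s2 where "s2 = setv x_pk 1 (setv x_n (int ?n) s1)"
  have u2: "unchanged {x_kap, x_i, x_pk, x_n} {} s s2" using s1(1) by (auto simp: unchanged_def s2_def)
  define c3 where "c3 = For x_i (Var x_kap) (Assign x_pk (Plus (Var x_pk) (Var x_pk)))"
  define s3 where "s3 = sem w c3 s2"
  have "(unchanged {x_kap, x_i, x_pk, x_n} {} s s3 \<and> fst s3 x_kap = int ?kap \<and> fst s3 x_n = int ?n \<and> fst s3 x_pk = 2 ^ ?kap) \<and> bdd w B c3 s2"
    unfolding s3_def c3_def
  proof (rule For_rule[where Q="\<lambda>k t. unchanged {x_kap, x_i, x_pk, x_n} {} s t \<and> fst t x_kap = int ?kap \<and> fst t x_n = int ?n \<and> fst t x_pk = 2 ^ k"])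
    show "nat (aval w (Var x_kap) s2) = ?kap" unfolding aval.simps s2_def fst_setv using s1(2) by (simp del: of_nat_mult)
  qed (use B u2 s1(2) in \<open>auto simp: unchanged_def s2_def\<close>)
  hence s3: "unchanged {x_kap, x_i, x_pk, x_n} {} s s3" "fst s3 x_kap = int ?kap" "fst s3 x_n = int ?n" "fst s3 x_pk = 2 ^ ?kap"
    "bdd w B c3 s2" by blast+
  define s4 where "s4 = setv x_pn (2 ^ ?kap) s3"
  define c5 where "c5 = For x_i (Var x_nv) (Assign x_pn (Plus (Var x_pn) (Var x_pn)))"
  define s5 where "s5 = sem w c5 s4"
  have "(unchanged {x_pn, x_i} {} s3 s5 \<and> fst s5 x_pn = 2 ^ (?kap + nv)) \<and> bdd w B c5 s4"
    unfolding s5_def c5_def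
  proof (rule For_rule[where Q="\<lambda>k t. unchanged {x_pn, x_i} {} s3 t \<and> fst t x_pn = 2 ^ (?kap + k)"])
    show "nat (aval w (Var x_nv) s4) = nv" using v0 unchangedD(1)[OF s3(1), of x_nv] by (simp add: s4_def)
  qed (use B in \<open>auto simp: unchanged_def s4_def\<close>)
  hence s5: "unchanged {x_pn, x_i} {} s3 s5" "fst s5 x_pn = 2 ^ ?n" "bdd w B c5 s4" by blast+
  have u5: "unchanged {x_kap, x_i, x_pk, x_n, x_pn} {} s s5"
    by (rule unchanged_mono[OF unchanged_trans[OF s3(1) s5(1)]]) auto
  have lay5: "layout oV oE oC nu ne nv nc s5" by (rule layout_unchanged[OF u5 lay]) simp
  have v5: "fst s5 x_kap = int ?kap" "fst s5 x_pk = int (2 ^ ?kap)" "fst s5 x_l = l" "fst s5 x_p = p" "fst s5 x_q = q"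
     "fst s5 x_n = int ?n" "snd s5 a_Q = (\<lambda>_. 0)"
    using unchangedD(1)[OF s5(1)] s3 unchangedD[OF u5] lpq Q0 by simp_all
  define s6 where "s6 = sem w ROWS s5"
  have 6: "tab ?n (hs @ soft_rows nv nc) s6" "fst s6 x_mh = int (length hs)" "bdd w B ROWS s5"
    using ROWS_correct[OF lay5 B(1-6) v5(1-5), of w] unfolding G hs_def s6_def by blast+
  note u6 = unchangedD[OF sem_unchanged[of ROWS s5 w], folded s6_def, unfolded mod_ROWS]
  define reps where "reps = levels ?n (nu + 1) hs (hs @ soft_rows nv nc) (nu + 1)"
  have lens: "length (levels ?n (nu + 1) hs (hs @ soft_rows nv nc) k) \<le> B" if "k \<le> nu + 1" for k
    using order_trans[OF length_levels[OF super full nc that, of l p q] B(11)] unfolding hs_def .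
  define s7 where "s7 = sem w SEARCH s6"
  have 7: "fst s7 x_cl = int (length reps) \<and> sigs_stored ?n 1 (hs @ soft_rows nv nc) reps s7 \<and> bdd w B SEARCH s6"
    unfolding s7_def reps_def
  proof (rule SEARCH_correct[OF _ _ _ 6(2) _ _ _ refl])
    show "table ?n (hs @ soft_rows nv nc) s6" "fst s6 x_m = int (length (hs @ soft_rows nv nc))"
      using 6(1) by (auto simp: tab_def)
    show "fst s6 x_n = int ?n" "fst s6 x_pn = int (2 ^ ?n)" "fst s6 x_nu = int nu" "\<forall>i<?n. snd s6 a_Q i = 0"
      using u6 v5 s5(2) lay5 by (simp_all add: layout_def)
    show "unit_rows ?n (hs @ soft_rows nv nc)" unfolding hs_def by (rule unit_rows_all_rows)
    show "length (hs @ soft_rows nv nc) \<le> B" using B(10) unfolding hs_def length_all_rows .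
  qed (use B lens in auto)
  note u7 = unchangedD[OF sem_unchanged[of SEARCH s6 w], folded s7_def, unfolded mod_SEARCH mod_LEVEL mod_TRY]
  have 8: "fst (sem w (FINAL te) s7) 0 = (if \<exists>y\<in>set reps. accepts nv nc thr y then 1 else 0) \<and> bdd w B (FINAL te) s7"
  proof (rule FINAL_correct)
    show "fst s7 x_cl = int (length reps)" using 7 by blast
    show "fst s7 x_mh = int (length hs)" using u7 6(2) by simp
    show "fst s7 x_nv = int nv" using u7 u6 lay5 by (simp add: layout_def)
    show nc7: "fst s7 x_nc = int nc" using u7 u6 lay5 by (simp add: layout_def)
    show "sigs_stored (nv * nc + nv) 1 (hs @ soft_rows nv nc) reps s7" using 7 by blast
    show "aval w te s' = int thr" if "fst s' x_nc = fst s7 x_nc" for s'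
      by (rule te) (use that nc7 v0 in simp)
    show "length reps \<le> B" unfolding reps_def by (rule lens) simp
  qed (use B in auto)
  have e1: "sem w (Assign x_kap (Lit 0)) s = setv x_kap 0 s" by simp
  have e2: "sem w (Assign x_pk (Lit 1)) (sem w (Assign x_n (Plus (Var x_kap) (Var x_nv))) s1) = s2"
    using s1(2) unchangedD(1)[OF s1(1), of x_nv] v0 by (simp add: s2_def)
  have e4: "sem w (Assign x_pn (Var x_pk)) s3 = s4" using s3(4) by (simp add: s4_def)
  have "sem w (BODY te) s = sem w (FINAL te) s7"
    unfolding BODY_def sem.simps(4) c1_def[symmetric] c3_def[symmetric] c5_def[symmetric] e1
      s1_def[symmetric] e2 s3_def[symmetric] e4 s5_def[symmetric] s6_def[symmetric] s7_def[symmetric] ..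
  moreover have "bdd w B (BODY te) s"
    unfolding BODY_def bdd.simps(4) bdd.simps(2) sem.simps(4) c1_def[symmetric] c3_def[symmetric] c5_def[symmetric] e1
      s1_def[symmetric] e2 s3_def[symmetric] e4 s5_def[symmetric] s6_def[symmetric] s7_def[symmetric]
    using s1(3) s3(5) s5(3) 6(3) 7 8 by blast
  ultimately show ?thesis using 8 by (simp add: reps_def)
qed

section \<open>Reading the instance from the input\<close>

lemma input_at_middle: "w = xs @ ys @ zs \<Longrightarrow> length xs = k \<Longrightarrow> i < length ys \<Longrightarrow> input_at w (k + i) = ys ! i"
  by (auto simp: input_at_def nth_append)

lemma concat_pairs:
  "length (concat (map (\<lambda>x. [f x, g x]) xs)) = 2 * length xs"
  "i < length xs \<Longrightarrow> concat (map (\<lambda>x. [f x, g x]) xs) ! (2 * i) = f (xs ! i)"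
  "i < length xs \<Longrightarrow> concat (map (\<lambda>x. [f x, g x]) xs) ! Suc (2 * i) = g (xs ! i)"
proof -
  show "length (concat (map (\<lambda>x. [f x, g x]) xs)) = 2 * length xs" by (induction xs) auto
  have "i < length xs \<longrightarrow> concat (map (\<lambda>x. [f x, g x]) xs) ! (2 * i) = f (xs ! i) \<and>
     concat (map (\<lambda>x. [f x, g x]) xs) ! Suc (2 * i) = g (xs ! i)"
    by (induction xs arbitrary: i) (auto simp: nth_Cons split: nat.split)
  thus "i < length xs \<Longrightarrow> concat (map (\<lambda>x. [f x, g x]) xs) ! (2 * i) = f (xs ! i)"
    "i < length xs \<Longrightarrow> concat (map (\<lambda>x. [f x, g x]) xs) ! Suc (2 * i) = g (xs ! i)" by blast+
qed

definition encode :: "nat list \<Rightarrow> (nat \<Rightarrow> nat) \<Rightarrow> nat list \<Rightarrow> (nat \<times> nat) list \<Rightarrow> nat list \<Rightarrow> int \<Rightarrow> int \<Rightarrow> int \<Rightarrow> int list" where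
  "encode us cl vs es cs l p q = [int (length us)] @ concat (map (\<lambda>u. [int u, int (cl u)]) us) @
     [int (length vs)] @ map int vs @
     [int (length es)] @ concat (map (\<lambda>(u, v). [int u, int v]) es) @
     [int (length cs)] @ map int cs @ [l, p, q]"

text \<open>Each of the offsets \<open>oV\<close>, \<open>oE\<close> and \<open>oC\<close> is the
  position just behind the length entry of its block.\<close>

lemma encode_at:
  fixes us vs cs :: "nat list" and es :: "(nat \<times> nat) list" and cl :: "nat \<Rightarrow> nat" and l p q :: int
  defines "w \<equiv> encode us cl vs es cs l p q"
  defines "oV \<equiv> 2 * length us + 2"
  defines "oE \<equiv> oV + length vs + 1"
  defines "oC \<equiv> oE + 2 * length es + 1"
  shows "input_at w 0 = int (length us)"
    and "u < length us \<Longrightarrow> input_at w (1 + 2 * u) = int (us ! u)"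
    and "u < length us \<Longrightarrow> input_at w (2 + 2 * u) = int (cl (us ! u))"
    and "input_at w (2 * length us + 1) = int (length vs)"
    and "v < length vs \<Longrightarrow> input_at w (oV + v) = int (vs ! v)"
    and "input_at w (oV + length vs) = int (length es)"
    and "e < length es \<Longrightarrow> input_at w (oE + 2 * e) = int (fst (es ! e))"
    and "e < length es \<Longrightarrow> input_at w (oE + 2 * e + 1) = int (snd (es ! e))"
    and "input_at w (oE + 2 * length es) = int (length cs)"
    and "c < length cs \<Longrightarrow> input_at w (oC + c) = int (cs ! c)"
    and "input_at w (oC + length cs) = l" "input_at w (oC + length cs + 1) = p" "input_at w (oC + length cs + 2) = q"
    and "length us \<le> length w" "length vs \<le> length w" "length es \<le> length w" "length cs \<le> length w"
proof -
  define P1 where "P1 = concat (map (\<lambda>u. [int u, int (cl u)]) us)"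
  define P2 where "P2 = concat (map (\<lambda>e. [int (fst e), int (snd e)]) es)"
  have P2: "concat (map (\<lambda>(u, v). [int u, int v]) es) = P2"
    unfolding P2_def by (simp add: case_prod_unfold)
  have w: "w = [int (length us)] @ P1 @ [int (length vs)] @ map int vs @ [int (length es)] @ P2 @
     [int (length cs)] @ map int cs @ [l, p, q]"
    by (simp add: w_def encode_def P1_def P2)
  have l1: "length P1 = 2 * length us" unfolding P1_def by (rule concat_pairs(1))
  have l2: "length P2 = 2 * length es" unfolding P2_def by (rule concat_pairs(1))
  show "input_at w 0 = int (length us)" by (simp add: w input_at_def)
  show "input_at w (1 + 2 * u) = int (us ! u)" if "u < length us"
    using input_at_middle[of w "[int (length us)]" P1 _ 1 "2 * u"] w l1 concat_pairs(2)[OF that, of int] that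
    by (simp add: P1_def)
  show "input_at w (2 + 2 * u) = int (cl (us ! u))" if "u < length us"
    using input_at_middle[of w "[int (length us)]" P1 _ 1 "Suc (2 * u)"] w l1 concat_pairs(3)[OF that, of int] that
    by (simp add: P1_def)
  show "input_at w (2 * length us + 1) = int (length vs)"
    using input_at_middle[of w "[int (length us)] @ P1" "[int (length vs)]" _ "2 * length us + 1" 0] w l1 by simp
  show "input_at w (oV + v) = int (vs ! v)" if "v < length vs"
    using input_at_middle[of w "[int (length us)] @ P1 @ [int (length vs)]" "map int vs" _ oV v] w l1 that
    by (simp add: oV_def)
  show "input_at w (oV + length vs) = int (length es)"
    using input_at_middle[of w "[int (length us)] @ P1 @ [int (length vs)] @ map int vs" "[int (length es)]" _ "oV + length vs" 0] w l1
    by (simp add: oV_def)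
  show "input_at w (oE + 2 * e) = int (fst (es ! e))" if "e < length es"
    using input_at_middle[of w "[int (length us)] @ P1 @ [int (length vs)] @ map int vs @ [int (length es)]" P2 _ oE "2 * e"] w l1 l2
      concat_pairs(2)[OF that, of "\<lambda>e. int (fst e)"] that
    by (simp add: oV_def oE_def P2_def)
  show "input_at w (oE + 2 * e + 1) = int (snd (es ! e))" if "e < length es"
    using input_at_middle[of w "[int (length us)] @ P1 @ [int (length vs)] @ map int vs @ [int (length es)]" P2 _ oE "Suc (2 * e)"] w l1 l2
      concat_pairs(3)[OF that, of "\<lambda>e. int (fst e)"] that
    by (simp add: oV_def oE_def P2_def)
  show "input_at w (oE + 2 * length es) = int (length cs)"
    using input_at_middle[of w "[int (length us)] @ P1 @ [int (length vs)] @ map int vs @ [int (length es)] @ P2" "[int (length cs)]" _ "oE + 2 * length es" 0] w l1 l2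
    by (simp add: oV_def oE_def)
  show "input_at w (oC + c) = int (cs ! c)" if "c < length cs"
    using input_at_middle[of w "[int (length us)] @ P1 @ [int (length vs)] @ map int vs @ [int (length es)] @ P2 @ [int (length cs)]" "map int cs" _ oC c] w l1 l2 that
    by (simp add: oV_def oE_def oC_def)
  have last: "input_at w (oC + length cs + i) = [l, p, q] ! i" if "i < 3" for i
    using input_at_middle[of w "[int (length us)] @ P1 @ [int (length vs)] @ map int vs @ [int (length es)] @ P2 @ [int (length cs)] @ map int cs" "[l, p, q]" "[]" "oC + length cs" i] w l1 l2 that
    by (simp add: oV_def oE_def oC_def)
  show "input_at w (oC + length cs) = l" "input_at w (oC + length cs + 1) = p" "input_at w (oC + length cs + 2) = q"
    using last[of 0] last[of 1] last[of 2] by simp_all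
  show "length us \<le> length w" "length vs \<le> length w" "length es \<le> length w" "length cs \<le> length w"
    unfolding w by (simp_all add: l1 l2)
qed

definition PARSE :: com where
  "PARSE = Assign x_nu (In (Lit 0)) ;; Assign x_oV (Plus (Plus (Var x_nu) (Var x_nu)) (Lit 2)) ;;
     Assign x_t (Minus (Var x_oV) (Lit 1)) ;; Assign x_nv (In (Var x_t)) ;;
     Assign x_t (Plus (Var x_oV) (Var x_nv)) ;; Assign x_ne (In (Var x_t)) ;;
     Assign x_oE (Plus (Var x_t) (Lit 1)) ;; Assign x_t (Plus (Plus (Var x_oE) (Var x_ne)) (Var x_ne)) ;; Assign x_nc (In (Var x_t)) ;;
     Assign x_oC (Plus (Var x_t) (Lit 1)) ;; Assign x_t (Plus (Var x_oC) (Var x_nc)) ;; Assign x_l (In (Var x_t)) ;;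
     Assign x_t (Plus (Var x_t) (Lit 1)) ;; Assign x_p (In (Var x_t)) ;;
     Assign x_t (Plus (Var x_t) (Lit 1)) ;; Assign x_q (In (Var x_t))"

lemma PARSE_correct:
  fixes us vs cs :: "nat list" and es :: "(nat \<times> nat) list" and cl :: "nat \<Rightarrow> nat" and l p q :: int
  defines "w \<equiv> encode us cl vs es cs l p q"
  defines "oV \<equiv> 2 * length us + 2"
  defines "oE \<equiv> oV + length vs + 1"
  defines "oC \<equiv> oE + 2 * length es + 1"
  shows "layout oV oE oC (length us) (length es) (length vs) (length cs) (sem w PARSE s)"
    "fst (sem w PARSE s) x_l = l" "fst (sem w PARSE s) x_p = p" "fst (sem w PARSE s) x_q = q"
    "snd (sem w PARSE s) = snd s" "fst (sem w PARSE s) 0 = fst s 0"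
proof -
  note at = encode_at[where us=us and cl=cl and vs=vs and es=es and cs=cs and l=l and p=p and q=q, folded w_def, folded oV_def, folded oE_def, folded oC_def]
  define k1 where "k1 = 2 * length us + 1"
  define k2 where "k2 = oV + length vs"
  define k3 where "k3 = oE + 2 * length es"
  define k4 where "k4 = oC + length cs"
  define k5 where "k5 = k4 + 1"
  define k6 where "k6 = k4 + 2"
  have i: "2 * int (length us) + 2 = int oV" "int oV - 1 = int k1" "int oV + int (length vs) = int k2" "int k2 + 1 = int oE"
    "int oE + 2 * int (length es) = int k3" "int k3 + 1 = int oC" "int oC + int (length cs) = int k4"
    "int k4 + 1 = int k5" "int k5 + 1 = int k6"
    "int oE + int (length es) + int (length es) = int k3" "int (length us) + int (length us) + 2 = int oV"
    by (simp_all add: k1_def k2_def k3_def k4_def k5_def k6_def oV_def oE_def oC_def)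
  have at': "input_at w k1 = int (length vs)" "input_at w k2 = int (length es)" "input_at w k3 = int (length cs)"
     "input_at w k4 = l" "input_at w k5 = p" "input_at w k6 = q"
    using at(4,6,9,11,12,13) by (simp_all only: k1_def k2_def k3_def k4_def k5_def k6_def)
  have "sem w PARSE s = setv x_q q (setv x_t (int k6) (setv x_p p (setv x_t (int k5) (setv x_l l (setv x_t (int k4)
     (setv x_oC (int oC) (setv x_nc (int (length cs)) (setv x_t (int k3) (setv x_oE (int oE) (setv x_ne (int (length es))
     (setv x_t (int k2) (setv x_nv (int (length vs)) (setv x_t (int k1) (setv x_oV (int oV) (setv x_nu (int (length us)) s)))))))))))))))"
    unfolding PARSE_def by (simp add: at(1) at' i)
  thus "layout oV oE oC (length us) (length es) (length vs) (length cs) (sem w PARSE s)"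
    "fst (sem w PARSE s) x_l = l" "fst (sem w PARSE s) x_p = p" "fst (sem w PARSE s) x_q = q"
    "snd (sem w PARSE s) = snd s" "fst (sem w PARSE s) 0 = fst s 0"
    by (simp_all add: layout_def)
qed

text \<open>Without colors the parameter is 0 while the number of right vertices is unbounded, so
  this case is decided directly. The left side is then empty and all sizes are 0, so it only remains
  to see whether there is a right vertex and whether 0 lies between \<open>x_p\<close> and
  \<open>x_q\<close>.\<close>

definition MAIN :: "aexp \<Rightarrow> com" where
  "MAIN te = PARSE ;; IfPos (Var x_nc) (BODY te)
     (IfPos (Var x_nv) (IfPos (Minus (Lit 1) (Var x_p)) (IfPos (Plus (Var x_q) (Lit 1)) (Assign 0 (Lit 1)) Skip) Skip) (Assign 0 (Lit 1)))"

lemma wfc_MAIN: "wfe 65 te \<Longrightarrow> wfe 66 te \<Longrightarrow> wfc 96 (MAIN te)"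
  by (simp add: MAIN_def PARSE_def BODY_def ROWS_def SEARCH_def FINAL_def LEVEL_def TRY_def COPY_def DEDUP_def
      SIG_def EMIT_def BITS_def GCOUNT_def VIOL_def NEQ_def EQ_def EQ2_def)

lemma length_le_input_size: "length w \<le> input_size w"
  unfolding input_size_def by (induction w) (auto simp: bits_def)

text \<open>Links the number that the program counts in the raw input to the supermodular function
  of Hall's condition.\<close>

lemma gval_slots:
  fixes I :: "(nat, nat) fm_instance" and us vs cs :: "nat list" and es :: "(nat \<times> nat) list" and l p q :: int
  assumes us: "distinct us" "set us = left I"
  defines "w \<equiv> encode us (col I) vs es cs l p q"
  defines "oV \<equiv> 2 * length us + 2"
  defines "oE \<equiv> oV + length vs + 1"
  defines "oC \<equiv> oE + 2 * length es + 1"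
  shows "gval w oV oE oC (length us) (length es) (length vs) (length cs) m =
     card {u\<in>left I. slots I (set es) vs cs u \<subseteq> bset (length vs * length cs) m}"
proof -
  let ?nv = "length vs" and ?nc = "length cs"
  note at = encode_at[where us=us and cl="col I" and vs=vs and es=es and cs=cs and l=l and p=p and q=q, folded w_def, folded oV_def, folded oE_def, folded oC_def]
  have fits: "fits w oV oE oC u e v c \<longleftrightarrow> us ! u = fst (es ! e) \<and> snd (es ! e) = vs ! v \<and> col I (us ! u) = cs ! c"
    if "u < length us" "e < length es" "v < ?nv" "c < ?nc" for u e v c
    unfolding fits_def at(2)[OF that(1)] at(3)[OF that(1)] at(7)[OF that(2)] at(8)[OF that(2)] at(5)[OF that(3)]
      at(10)[OF that(4)] of_nat_eq_iff ..
  have good: "(\<forall>e<length es. \<forall>v<?nv. \<forall>c<?nc. fits w oV oE oC u e v c \<longrightarrow> odd (m div 2 ^ (v * ?nc + c))) \<longleftrightarrow>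
      slots I (set es) vs cs (us ! u) \<subseteq> bset (?nv * ?nc) m" if u: "u < length us" for u
  proof
    assume a: "\<forall>e<length es. \<forall>v<?nv. \<forall>c<?nc. fits w oV oE oC u e v c \<longrightarrow> odd (m div 2 ^ (v * ?nc + c))"
    show "slots I (set es) vs cs (us ! u) \<subseteq> bset (?nv * ?nc) m"
    proof
      fix i assume "i \<in> slots I (set es) vs cs (us ! u)"
      hence i: "i < ?nv * ?nc" "(us ! u, vs ! (i div ?nc)) \<in> set es" "col I (us ! u) = cs ! (i mod ?nc)"
        by (auto simp: slots_def)
      have "\<exists>e<length es. es ! e = (us ! u, vs ! (i div ?nc))" using i(2) by (simp only: in_set_conv_nth)
      then obtain e where e: "e < length es" "es ! e = (us ! u, vs ! (i div ?nc))" by blast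
      note d = mult_add_less_index[OF i(1)]
      have d1: "i div ?nc < ?nv" and d2: "i mod ?nc < ?nc" using d by blast+
      have "fits w oV oE oC u e (i div ?nc) (i mod ?nc)"
        unfolding fits[OF u e(1) d1 d2] e(2) by (simp add: i(3))
      hence "odd (m div 2 ^ (i div ?nc * ?nc + i mod ?nc))" using a[rule_format, OF e(1) d1 d2] by blast
      thus "i \<in> bset (?nv * ?nc) m" using i(1) by (simp add: bset_def)
    qed
  next
    assume a: "slots I (set es) vs cs (us ! u) \<subseteq> bset (?nv * ?nc) m"
    show "\<forall>e<length es. \<forall>v<?nv. \<forall>c<?nc. fits w oV oE oC u e v c \<longrightarrow> odd (m div 2 ^ (v * ?nc + c))"
    proof (intro allI impI)
      fix e v c assume e: "e < length es" "v < ?nv" "c < ?nc" "fits w oV oE oC u e v c"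
      hence f: "us ! u = fst (es ! e)" "snd (es ! e) = vs ! v" "col I (us ! u) = cs ! c"
        using e(4) unfolding fits[OF u e(1-3)] by blast+
      have "es ! e \<in> set es" using e(1) by (rule nth_mem)
      moreover have "es ! e = (us ! u, vs ! v)" unfolding f(1) f(2)[symmetric] by simp
      ultimately have "(us ! u, vs ! v) \<in> set es" by (simp only:)
      moreover have "(v * k + c) div k = v" "(v * k + c) mod k = c" if "c < k" for k :: nat using that by auto
      from this[OF e(3)] have "(v * ?nc + c) div ?nc = v" "(v * ?nc + c) mod ?nc = c" .
      ultimately have "v * ?nc + c \<in> slots I (set es) vs cs (us ! u)"
        unfolding slots_def mem_Collect_eq by (simp only: f(3) mult_add_less[OF e(2,3)] simp_thms)
      from subsetD[OF a this] show "odd (m div 2 ^ (v * ?nc + c))" unfolding bset_def by (elim CollectE conjE)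
    qed
  qed
  have "card {u\<in>left I. slots I (set es) vs cs u \<subseteq> bset (?nv * ?nc) m} =
     card {u. u < length us \<and> slots I (set es) vs cs (us ! u) \<subseteq> bset (?nv * ?nc) m}"
    unfolding us(2)[symmetric] by (rule card_filter_nth[OF us(1)])
  moreover have "{u. u < length us \<and> slots I (set es) vs cs (us ! u) \<subseteq> bset (?nv * ?nc) m} =
     {u. u < length us \<and> (\<forall>e<length es. \<forall>v<?nv. \<forall>c<?nc. fits w oV oE oC u e v c \<longrightarrow> odd (m div 2 ^ (v * ?nc + c)))}"
    by (rule Collect_cong, rule conj_cong[OF refl], rule good[symmetric])
  ultimately show ?thesis unfolding gval_def by (simp only:)
qed

context listed_instance
begin

definition "G S = card {u\<in>U. N u \<subseteq> S}"

lemma G_super: "G A + G B \<le> G (A \<union> B) + G (A \<inter> B)"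
  unfolding G_def by (rule card_subset_supermodular[OF finite_U])

lemma G_full: "G {..<nv * nc} = card U"
  unfolding G_def using N_subset by simp

lemma levels_decide_Fair_Matching:
  defines "hs \<equiv> hard_rows (card U) nv nc (\<lambda>m. G (bset (nv * nc) m)) (int (fairness I)) (lower I) (upper I)"
  shows "(\<exists>y\<in>set (levels (nv * nc + nv) (card U + 1) hs (hs @ soft_rows nv nc) (card U + 1)). accepts nv nc thr y) \<longleftrightarrow>
    Fair_Matching \<Pi> I"
proof -
  let ?n = "nv * nc + nv"
  let ?rows = "hs @ soft_rows nv nc"
  let ?L = "card U + 1"
  have G: "(\<lambda>S. card {u\<in>U. N u \<subseteq> S}) = G" by (simp add: G_def fun_eq_iff)
  have unit: "unit_rows ?n ?rows" unfolding hs_def by (rule unit_rows_all_rows)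
  have coef: "\<bar>fst r i\<bar> \<le> 1" if "r \<in> set ?rows" "i < ?n" for r i
    using unit that unfolding unit_rows_def by fastforce
  have sub: "set hs \<subseteq> set ?rows" by simp
  have acc: "accepts nv nc thr x = accepts nv nc thr x'"
    if "\<And>r. r \<in> set ?rows \<Longrightarrow> (0 \<le> row_val ?n r x') = (0 \<le> row_val ?n r x)" for x x'
  proof -
    have soft: "\<forall>r\<in>set (soft_rows nv nc). (0 \<le> row_val ?n r x') = (0 \<le> row_val ?n r x)" using that by simp
    hence "{c. c < nc \<and> 0 \<le> row_val ?n (reach_row nv nc v c) x} = {c. c < nc \<and> 0 \<le> row_val ?n (reach_row nv nc v c) x'}"
      "(0 \<le> row_val ?n (zero_row nv nc v) x) = (0 \<le> row_val ?n (zero_row nv nc v) x')" if "v < nv" for v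
      using that unfolding ball_soft_rows by auto
    thus ?thesis unfolding accepts_def by simp
  qed
  show ?thesis
  proof
    assume "\<exists>y\<in>set (levels ?n ?L hs ?rows ?L). accepts nv nc thr y"
    then obtain y where y: "y \<in> set (levels ?n ?L hs ?rows ?L)" "accepts nv nc thr y" by blast
    have "(\<forall>i<?n. 0 \<le> y i) \<and> (\<forall>r\<in>set hs. 0 \<le> row_val ?n r y)"
      by (rule levels_decide(2)[where \<Phi>="accepts nv nc thr" and rows="?rows", OF coef sub _ acc y(1)]) simp_all
    hence "count_solution (card U) nv nc thr G (fairness I) (lower I) (upper I) y"
      using y(2) unfolding rows_iff_count_solution accepts_iff_acceptable hs_def by blast
    thus "Fair_Matching \<Pi> I" by (intro count_solution_sound) (simp only: G)
  next
    assume "Fair_Matching \<Pi> I"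
    from count_solution_exists[OF this] obtain X where
      X: "count_solution (card U) nv nc thr G (fairness I) (lower I) (upper I) X" "\<forall>i<?n. X i \<le> int (card U)"
      unfolding G by blast
    have X': "\<forall>i<?n. 0 \<le> X i" "\<forall>r\<in>set hs. 0 \<le> row_val ?n r X" "accepts nv nc thr X"
      using X(1) unfolding rows_iff_count_solution accepts_iff_acceptable hs_def by blast+
    \<comment> \<open>No entry of the solution exceeds \<open>card U\<close>, so
      \<open>card U + 1\<close> digits are enough.\<close>
    have "int (card U) < 2 ^ ?L"
    proof -
      have "card U < 2 ^ ?L" using less_exp[of ?L] by linarith
      hence "int (card U) < int (2 ^ ?L)" by (simp only: of_nat_less_iff)
      thus ?thesis by simp
    qed
    hence "\<forall>i<?n. 0 \<le> X i \<and> X i < 2 ^ ?L" using X'(1) X(2) by (meson order_le_less_trans)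
    from levels_decide(1)[where \<Phi>="accepts nv nc thr" and rows="?rows" and n="?n", OF coef sub _ acc this X'(2,3)]
    show "\<exists>y\<in>set (levels ?n ?L hs ?rows ?L). accepts nv nc thr y" by simp
  qed
qed

text \<open>Well-formedness leaves no left vertex, so every function is a slotting, and the witness
  \<open>m = 0\<close> proves fairness.\<close>

lemma no_colors:
  assumes "nc = 0"
  shows "Fair_Matching \<Pi> I \<longleftrightarrow> nv = 0 \<or> lower I \<le> 0 \<and> 0 \<le> upper I"
proof -
  have "colors I = {}" using assms cs(2) by (simp add: nc_def)
  hence "U = {}" using wf by (auto simp: fm_wf_def U_def)
  hence sl: "slotting f" for f by (simp add: slotting_def)
  have fa: "\<Pi> (col I) (colors I) {u\<in>U. f u div nc = v} \<le> fairness I" for f v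
    unfolding fair_slotting[OF sl order_refl]
    by (rule exI[of _ 0]) (simp add: fair_at_def assms)
  show ?thesis unfolding Fair_Matching_slotting using fa sl by (auto simp: assms)
qed

end

text \<open>The threshold is the number of colors for \<open>MaxMin\<close>, read from
  \<open>x_nc\<close>, and the constant 2 for \<open>MoV\<close>; the condition on \<open>te\<close>
  covers both.\<close>

lemma MAIN_correct:
  fixes I :: "(nat, nat) fm_instance"
  assumes wf: "fm_wf I" and rep: "represents w I" and te: "\<And>s. aval w te s = (if te = Var x_nc then fst s x_nc else 2)"
    and thr: "fair_threshold (card (colors I)) (if te = Var x_nc then card (colors I) else 2) \<Pi>"
  shows "fst (sem w (MAIN te) init) 0 = (if Fair_Matching \<Pi> I then 1 else 0) \<and>
     bdd w (input_size w + level_bound (card (colors I) * card (right I))) (MAIN te) init"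
proof -
  from rep obtain us vs es cs where us: "distinct us" "set us = left I" and vs: "distinct vs" "set vs = right I"
    and es: "set es \<subseteq> left I \<times> right I" "edges I = (\<lambda>(u, v). {u, v}) ` set es"
    and cs: "distinct cs" "set cs = colors I"
    and w: "w = encode us (col I) vs es cs (int (fairness I)) (lower I) (upper I)"
    unfolding represents_def encode_def by blast
  define nv where "nv = length vs"
  define nc where "nc = length cs"
  define t where "t = (if te = Var x_nc then nc else 2)"
  have card: "card (left I) = length us" "card (right I) = nv" "card (colors I) = nc"
    using distinct_card[OF us(1)] distinct_card[OF vs(1)] distinct_card[OF cs(1)] us vs cs
    by (simp_all add: nv_def nc_def)
  have thr': "fair_threshold (length cs) t \<Pi>" using thr unfolding card(3) t_def nc_def .
  interpret li: listed_instance I "set es" vs cs \<Pi> t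
    using wf es vs cs thr' by unfold_locales
  have li: "li.nv = nv" "li.nc = nc" "li.U = left I" "li.N = slots I (set es) vs cs"
    by (simp_all add: li.nv_def li.nc_def li.U_def li.N_def nv_def nc_def)
  define oV where "oV = 2 * length us + 2"
  define oE where "oE = oV + length vs + 1"
  define oC where "oC = oE + 2 * length es + 1"
  define s1 where "s1 = sem w PARSE init"
  note parse = PARSE_correct[where us=us and cl="col I" and vs=vs and es=es and cs=cs and l="int (fairness I)"
      and p="lower I" and q="upper I" and s=init, folded w,
      folded oV_def, folded oE_def, folded oC_def, folded s1_def, folded nv_def nc_def]
  have vals: "fst s1 x_nc = int nc" "fst s1 x_nv = int nv" using parse(1) by (simp_all add: layout_def)
  define B where "B = input_size w + level_bound (card (colors I) * card (right I))"
  have kap: "card (colors I) * card (right I) = nv * nc" by (simp add: card)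
  have lens: "length us \<le> input_size w" "length es \<le> input_size w" "nv \<le> input_size w" "nc \<le> input_size w"
    using encode_at(14-17)[where us=us and cl="col I" and vs=vs and es=es and cs=cs and l="int (fairness I)"
        and p="lower I" and q="upper I", folded w] length_le_input_size[of w]
    by (simp_all add: nv_def nc_def)
  have init0: "fst init 0 = 0" by (simp add: init_def)
  have bP: "bdd w B PARSE init" by (simp add: PARSE_def)
  show ?thesis
  proof (cases "nc = 0")
    case True
    have "fst (sem w (MAIN te) init) 0 = (if nv = 0 \<or> lower I \<le> 0 \<and> 0 \<le> upper I then 1 else 0)"
      using vals parse(3,4,6) True init0 by (auto simp: MAIN_def simp flip: s1_def)
    moreover have "bdd w B (MAIN te) init" using vals True bP by (simp add: MAIN_def flip: s1_def)
    ultimately show ?thesis using li.no_colors True unfolding li B_def by simp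
  next
    case False
    have e: "sem w (MAIN te) init = sem w (BODY te) s1" "bdd w B (MAIN te) init = bdd w B (BODY te) s1"
      using vals False bP by (simp_all add: MAIN_def flip: s1_def)
    have G: "gval w oV oE oC (length us) (length es) nv nc = (\<lambda>m. li.G (bset (nv * nc) m))"
    proof
      fix m
      show "gval w oV oE oC (length us) (length es) nv nc m = li.G (bset (nv * nc) m)"
        unfolding li.G_def li nv_def nc_def w oC_def oE_def oV_def by (rule gval_slots[OF us])
    qed
    have full: "li.G {..<nv * nc} = length us" using li.G_full unfolding li card .
    have Q0: "snd s1 a_Q = (\<lambda>_. 0)" unfolding parse(5) by (simp add: init_def)
    have tev: "aval w te s' = int t" if "fst s' x_nc = fst s1 x_nc" for s'
      using te[of s'] that vals(1) by (simp add: t_def)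
    have nc0: "0 < nc" using False by simp
    note body = BODY_correct[OF parse(1-4) Q0 tev G li.G_super full nc0 lens]
    note dec = li.levels_decide_Fair_Matching[unfolded li card]
    show ?thesis unfolding kap e(1) e(2)[unfolded B_def kap] using body[unfolded dec] by blast
  qed
qed

lemma self_power_rearrange:
  "(a * (c * k ^ (55 * k))) ^ d = a ^ d * c ^ d * k ^ (55 * d * k)" for a c d k :: nat
proof -
  have "55 * d * k = 55 * k * d" by simp
  hence "k ^ (55 * d * k) = (k ^ (55 * k)) ^ d" by (simp only: power_mult)
  thus ?thesis by (simp only: power_mult_distrib mult.assoc)
qed

theorem theorem3:
  fixes \<Pi> :: "(nat, nat) fairness_measure"
  assumes "\<Pi> = MaxMin \<or> \<Pi> = MoV"
  shows "solvable_in_Ostar_self_power (Fair_Matching \<Pi>) (\<lambda>I. card (colors I) * card (right I))"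
proof -
  define te where "te = (if \<Pi> = MaxMin then Var x_nc else Lit 2)"
  define P where "P = cc 0 96 (MAIN te)"
  define d where "d = dep (MAIN te)"
  define c where "c = (20 :: nat) ^ 11"
  \<comment> \<open>The factor \<open>[:2, 1:]\<close> is N + 2 for the input size N, because
    \<open>B + 1\<close> is at most N + 2 times \<open>level_bound k\<close>.\<close>
  define f where "f = [:csz (MAIN te) * c ^ d:] * [:2, 1:] ^ d"
  have "answers_within P w ((card (colors I) * card (right I)) ^ (55 * d * (card (colors I) * card (right I))) * poly f (input_size w))
      (Fair_Matching \<Pi> I)" if I: "fm_wf I" "represents w I" for I w
  proof -
    define k where "k = card (colors I) * card (right I)"
    define B where "B = input_size w + level_bound k"
    have te_val: "aval w te s = (if te = Var x_nc then fst s x_nc else 2)" for s by (simp add: te_def)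
    have "fair_threshold (card (colors I)) (if te = Var x_nc then card (colors I) else 2) \<Pi>"
      using assms fair_threshold_MaxMin fair_threshold_MoV by (auto simp: te_def)
    from MAIN_correct[OF I te_val this]
    have run: "fst (sem w (MAIN te) init) 0 = (if Fair_Matching \<Pi> I then 1 else 0)" "bdd w B (MAIN te) init"
      unfolding B_def k_def by blast+
    have "1 \<le> level_bound k" by (simp add: level_bound_def)
    hence "(input_size w + 1) * 1 \<le> (input_size w + 1) * level_bound k" by (rule mult_le_mono2)
    hence "B + 1 \<le> (input_size w + 2) * level_bound k" unfolding B_def by (simp add: algebra_simps)
    also have "\<dots> \<le> (input_size w + 2) * (c * k ^ (55 * k))"
      unfolding c_def by (rule mult_le_mono2[OF level_bound_self_power])
    finally have "(B + 1) ^ d \<le> ((input_size w + 2) * (c * k ^ (55 * k))) ^ d" by (rule power_mono) simp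
    hence "csz (MAIN te) * (B + 1) ^ d \<le> csz (MAIN te) * ((input_size w + 2) ^ d * c ^ d * k ^ (55 * d * k))"
      unfolding self_power_rearrange by (rule mult_le_mono2)
    also have "\<dots> = k ^ (55 * d * k) * poly f (input_size w)"
      by (simp add: f_def poly_power mult_ac)
    finally have "tm w (MAIN te) init \<le> k ^ (55 * d * k) * poly f (input_size w)"
      using tm_bound[OF run(2)] unfolding d_def by linarith
    moreover have "wfc 96 (MAIN te)" by (rule wfc_MAIN) (simp_all add: te_def)
    ultimately show ?thesis unfolding P_def k_def[symmetric] using run(1) by (intro compile_correct) simp_all
  qed
  hence "solves_within P (Fair_Matching \<Pi>) (\<lambda>I n. (card (colors I) * card (right I)) ^ (55 * d * (card (colors I) * card (right I))) * poly f n)"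
    unfolding solves_within_def by blast
  thus ?thesis unfolding solvable_in_Ostar_self_power_def by blast
qed

end
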